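(* Let $X$ be the exceptional Hopf surface given by the contraction $(x,y)\mapsto(b^rx+y^r,by)$. Set $\lambda\simeq(L_b)^\ell$ for some $\ell\in\mathbb{Z}$ with $\ell\le r$. Consider trace-free $\lambda$-twisted Higgs bundles $(E,\phi)$ with $\phi$ nowhere-vanishing and $E$ a normalized extension of line bundles. (1) When $1\le\ell\le r$, the $\lambda$-twisted Higgs bundles $(E,\phi)$, up to conjugation with an automorphism of $E$, are one of: (a) $E\simeq\mathcal{O}_X\oplus\lambda^{-1}$ with $\phi=\begin{pmatrix}0&ty^{2\ell}\\1&0\end{pmatrix}$ for some $t\in\mathbb{C}$. The $\phi$-invariant sub-line bundles are $\lambda^{-1}$ under the inclusions $(\pm y^\ell\sqrt t,1)$. (b) $E$ is the unique non-split extension of $(L_b)^{\ell-rk}$ by $\mathcal{O}_X$ for some integer $k\ge1$, and $\phi=\alpha(\phi_{11}-\phi_{22})$ for some $\alpha\in\mathbb{C}^*$. The $\phi$-invariant sub-line bundles are given by the inclusions $\iota_1:\mathcal{O}_X\hookrightarrow E$ and $\iota_2:(L_b)^{-rk}\hookrightarrow E$. (2) When $\ell=0$, the $\lambda$-twisted Higgs bundles $(E,\phi)$, up to conjugation with an automorphism of $E$, are one of: (a) $E\simeq\mathcal{O}_X\oplus\mathcal{O}_X$ and $\phi=\begin{pmatrix}0&1\\0&0\end{pmatrix}$. The first direct summand is the unique $\phi$-invariant sub-line bundle. (b) $E\simeq\mathcal{O}_X\oplus H$ for some $H\in\mathrm{Pic}(X)$ with $\phi=\begin{pmatrix}c&0\\0&-c\end{pmatrix}$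 for some $c\in\mathbb{C}^*$. Both direct summands are $\phi$-invariant. (c) $E$ is the unique non-split extension of $\mathcal{O}_X$ by itself, and $\phi=\beta\phi_{12}$ for some $\beta\in\mathbb{C}^*$. The unique $\phi$-invariant sub-line bundle is given by $\iota_1:\mathcal{O}_X\hookrightarrow E$. (3) For $\ell<0$, the $\lambda$-twisted Higgs bundles $(E,\phi)$, up to conjugation with an automorphism of $E$, are one of: (a) $E\simeq\mathcal{O}_X\oplus\lambda$ and $\phi=\begin{pmatrix}0&1\\0&0\end{pmatrix}$. Here the first direct summand is the only $\phi$-invariant sub-line bundle. (b) $E$ is the unique non-split extension of $\lambda$ by $\mathcal{O}_X$, and $\phi=\beta\phi_{12}$ for some $\beta\in\mathbb{C}^*$. The unique $\phi$-invariant sub-line bundle is given by $\iota_1:\mathcal{O}_X\hookrightarrow E$.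
   Context: The exceptional Hopf surface is $X=(\mathbb{C}^2\setminus\{0\})/\langle F\rangle$ with $F(x,y)=(b^rx+y^r,by)$, $0<|b|<1$, $r\ge1$ an integer. For $\tau\in\mathbb{C}^*$, $L_\tau$ is the line bundle obtained from $(\mathbb{C}^2\setminus\{0\})\times\mathbb{C}$ by identifying $(p,v)\sim(F(p),\tau v)$; every line bundle is isomorphic to a unique $L_\tau$. Sections of $L_\tau$ are holomorphic functions $s$ on $\mathbb{C}^2\setminus\{0\}$ with $s\circ F=\tau s$; $\deg(L_\tau)=\log|\tau|/\log|b|$. A trace-free $\lambda$-twisted Higgs bundle is $(E,\phi)$ with $E$ of rank 2 and $\phi\in H^0(X,\mathcal{E}nd_0(E)\otimes\lambda)$, where $\mathcal{E}nd_0(E)$ denotes trace-free endomorphisms. Normalized extensions of line bundles are those with $H^0(X,E)\ne0$ and $H^0(X,E\otimes M)=0$ for all line bundles $M$ with $\deg(M)<0$: either $E\simeq\mathcal{O}_X\oplus H$ with $\deg(H)\le0$, or $E$ is a non-split extension of $H=(L_b)^{-n}$ by $\mathcal{O}_X$ with $n\ge0$ (unique for each $n$). When $\deg(H)=0$, $\mathcal{O}_X\oplus H$ and its twist $\mathcal{O}_X\oplus H^{-1}$ by $H^{-1}$ are both normalized. For $E=\mathcal{O}_X\oplus H$, $\phi$ is written as a matrix $\begin{pmatrix}p&q\\ w&-p\end{pmatrix}$ acting on column vectors, with $p\in H^0(X,\lambda)$, $q\in H^0(X,\lambda\otimes H^{-1})$, $w\in H^0(X,\lambda\otimes H)$. An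 inclusion $(f,g)$ of $M$ means the map $M\to\mathcal{O}_X\oplus H$ with components $f\in H^0(X,M^{-1})$, $g\in H^0(X,M^{-1}\otimes H)$. A sub-line bundle $M$ (taken with torsion-free quotient) is $\phi$-invariant if $\phi(M)\subseteq M\otimes\lambda$. Definition of $\iota_i,\rho_i,\phi_{ij}$: let $E$ be the unique non-split extension of $(L_b)^{-rj-m}$ by $\mathcal{O}_X$, with integers $j\ge0$, $0\le m<r$. Then $E$ is also a non-split extension of $(L_b)^{r-m}$ by $(L_b)^{-r(j+1)}$, so there are exact sequences $$0\to\mathcal{O}_X\xrightarrow{\iota_1}E\xrightarrow{\rho_1}(L_b)^{-rj-m}\to0,\qquad 0\to(L_b)^{-r(j+1)}\xrightarrow{\iota_2}E\xrightarrow{\rho_2}(L_b)^{r-m}\to0.$$ Set $\phi_{11}=(\iota_1\otimes\mathrm{id})\circ\rho_2$ and $\phi_{22}=(\iota_2\otimes\mathrm{id})\circ\rho_1$ (both twisted by $(L_b)^{r-m}$), and $\phi_{12}=(\iota_1\otimes\mathrm{id})\circ\rho_1$ (twisted by $(L_b)^{-rj-m}$), with $\rho_1,\rho_2$ scaled so that $\mathrm{Tr}(\phi_{11})=\mathrm{Tr}(\phi_{22})=y^{r-m}$. Listed Higgs fields are determined by their parameters up to conjugation by automorphisms of $E$ unless otherwise indicated. *)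

theory Defs
  imports "HOL-Analysis.Analysis"
begin

type_synonym C2 = "complex \<times> complex"

definition C2_star :: "C2 set" where
  "C2_star = UNIV - {(0, 0)}"

definition contraction :: "complex \<Rightarrow> nat \<Rightarrow> C2 \<Rightarrow> C2" where
  "contraction b r = (\<lambda>(x, y). (b ^ r * x + y ^ r, b * y))"

text \<open>Only used for open \<open>U\<close>.\<close>

definition holo2_on :: "(C2 \<Rightarrow> complex) \<Rightarrow> C2 set \<Rightarrow> bool" where
  "holo2_on f U \<longleftrightarrow>
     (\<forall>p\<in>U. \<exists>u v. (f has_derivative (\<lambda>(h, k). u * h + v * k)) (at p))"

definition vec_holo_on :: "(C2 \<Rightarrow> complex ^ 'n) \<Rightarrow> C2 set \<Rightarrow> bool" where
  "vec_holo_on s U \<longleftrightarrow> (\<forall>i. holo2_on (\<lambda>p. s p $ i) U)"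

definition mat_holo_on :: "(C2 \<Rightarrow> complex ^ 'n ^ 'm) \<Rightarrow> C2 set \<Rightarrow> bool" where
  "mat_holo_on h U \<longleftrightarrow> (\<forall>i j. holo2_on (\<lambda>p. h p $ i $ j) U)"

text \<open>
  Holomorphic vector bundles on the Hopf surface \<open>X = C2_star / \<langle>F\<rangle>\<close>, \<open>F = contraction b r\<close>,
  are described on the universal cover. The total space is the set of pairs \<open>(p, v)\<close> with
  \<open>(p, v) \<sim> (F p, factor E p *v v)\<close>, and the holomorphic structure is given by an atlas of local
  frames: a pair \<open>(U, f)\<close> in \<open>frames E\<close> declares the columns of \<open>f\<close> to be a holomorphic frame
  over \<open>U\<close>.  Neither \<open>factor E\<close> nor the matrices \<open>f\<close> are required to be continuous; only the
  transition matrices are holomorphic.  So every holomorphic vector bundle of rank \<open>CARD('n)\<close>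
  on \<open>X\<close> occurs (identify the fibres of its pullback with \<open>\<complex>\<^sup>n\<close> arbitrarily), and not only those
  whose pullback to \<open>C2_star\<close> is holomorphically trivial.
\<close>

record ('n::finite) hopf_bundle =
  factor :: "C2 \<Rightarrow> complex ^ 'n ^ 'n"
  frames :: "(C2 set \<times> (C2 \<Rightarrow> complex ^ 'n ^ 'n)) set"

definition holo_bundle :: "complex \<Rightarrow> nat \<Rightarrow> ('n::finite) hopf_bundle \<Rightarrow> bool" where
  "holo_bundle b r E \<longleftrightarrow>
     (\<forall>p\<in>C2_star. invertible (factor E p)) \<and>
     (\<forall>(U, f)\<in>frames E. open U \<and> U \<subseteq> C2_star \<and> (\<forall>p\<in>U. invertible (f p))) \<and>
     (\<Union>(U, f)\<in>frames E. U) = C2_star \<and>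
     (\<forall>(U, f)\<in>frames E. \<forall>(V, g)\<in>frames E.
        mat_holo_on (\<lambda>p. matrix_inv (g p) ** f p) (U \<inter> V) \<and>
        mat_holo_on (\<lambda>p. matrix_inv (g (contraction b r p)) ** factor E p ** f p)
          (U \<inter> {p. contraction b r p \<in> V}))"

text \<open>Sections over an open subset of the universal cover, without equivariance.\<close>

definition local_section ::
  "('n::finite) hopf_bundle \<Rightarrow> C2 set \<Rightarrow> (C2 \<Rightarrow> complex ^ 'n) \<Rightarrow> bool" where
  "local_section E U s \<longleftrightarrow>
     (\<forall>(V, f)\<in>frames E. vec_holo_on (\<lambda>p. matrix_inv (f p) *v s p) (U \<inter> V))"

text \<open>The space \<open>H\<^sup>0(X, E)\<close>. Values at the origin are irrelevant here and below.\<close>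

definition global_section ::
  "complex \<Rightarrow> nat \<Rightarrow> ('n::finite) hopf_bundle \<Rightarrow> (C2 \<Rightarrow> complex ^ 'n) \<Rightarrow> bool" where
  "global_section b r E s \<longleftrightarrow>
     local_section E C2_star s \<and>
     (\<forall>p\<in>C2_star. s (contraction b r p) = factor E p *v s p)"

definition bundle_hom ::
  "complex \<Rightarrow> nat \<Rightarrow> ('n::finite) hopf_bundle \<Rightarrow> ('m::finite) hopf_bundle \<Rightarrow>
     (C2 \<Rightarrow> complex ^ 'n ^ 'm) \<Rightarrow> bool" where
  "bundle_hom b r E E' h \<longleftrightarrow>
     (\<forall>p\<in>C2_star. h (contraction b r p) ** factor E p = factor E' p ** h p) \<and>
     (\<forall>(U, f)\<in>frames E. \<forall>(V, g)\<in>frames E'.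
        mat_holo_on (\<lambda>p. matrix_inv (g p) ** h p ** f p) (U \<inter> V))"

definition bundle_iso ::
  "complex \<Rightarrow> nat \<Rightarrow> ('n::finite) hopf_bundle \<Rightarrow> 'n hopf_bundle \<Rightarrow>
     (C2 \<Rightarrow> complex ^ 'n ^ 'n) \<Rightarrow> bool" where
  "bundle_iso b r E E' g \<longleftrightarrow> bundle_hom b r E E' g \<and> (\<forall>p\<in>C2_star. invertible (g p))"

text \<open>
  Every line bundle on \<open>X\<close> is isomorphic to \<open>L \<tau>\<close> for a unique \<open>\<tau> \<noteq> 0\<close>, and
  \<open>L \<sigma> \<otimes> L \<tau> = L (\<sigma> * \<tau>)\<close>; quantification over line bundles is quantification over \<open>\<tau>\<close>.
\<close>

definition L :: "complex \<Rightarrow> 1 hopf_bundle" where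
  "L \<tau> = \<lparr>factor = (\<lambda>_. mat \<tau>), frames = {(C2_star, \<lambda>_. mat 1)}\<rparr>"

definition deg_L :: "complex \<Rightarrow> complex \<Rightarrow> real" where
  "deg_L b \<tau> = ln (cmod \<tau>) / ln (cmod b)"

definition L_sum :: "complex \<Rightarrow> complex \<Rightarrow> 2 hopf_bundle" where
  "L_sum \<sigma> \<tau> =
     \<lparr>factor = (\<lambda>_. vector [vector [\<sigma>, 0], vector [0, \<tau>]]), frames = {(C2_star, \<lambda>_. mat 1)}\<rparr>"

text \<open>The bundle \<open>E \<otimes> L \<tau>\<close>.\<close>

definition twist :: "complex \<Rightarrow> ('n::finite) hopf_bundle \<Rightarrow> 'n hopf_bundle" where
  "twist \<tau> E = \<lparr>factor = (\<lambda>p. mat \<tau> ** factor E p), frames = frames E\<rparr>"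

text \<open>The sequence \<open>0 \<rightarrow> L \<sigma> \<rightarrow> E \<rightarrow> L \<tau> \<rightarrow> 0\<close> with maps \<open>\<iota>\<close>, \<open>\<rho>\<close> is exact.\<close>

definition extension ::
  "complex \<Rightarrow> nat \<Rightarrow> complex \<Rightarrow> 2 hopf_bundle \<Rightarrow> complex \<Rightarrow>
     (C2 \<Rightarrow> complex ^ 1 ^ 2) \<Rightarrow> (C2 \<Rightarrow> complex ^ 2 ^ 1) \<Rightarrow> bool" where
  "extension b r \<sigma> E \<tau> \<iota> \<rho> \<longleftrightarrow>
     \<sigma> \<noteq> 0 \<and> \<tau> \<noteq> 0 \<and> bundle_hom b r (L \<sigma>) E \<iota> \<and> bundle_hom b r E (L \<tau>) \<rho> \<and>
     (\<forall>p\<in>C2_star. inj ((*v) (\<iota> p)) \<and> surj ((*v) (\<rho> p)) \<and>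
        range ((*v) (\<iota> p)) = {v. \<rho> p *v v = 0})"

definition nonsplit_extension ::
  "complex \<Rightarrow> nat \<Rightarrow> complex \<Rightarrow> 2 hopf_bundle \<Rightarrow> complex \<Rightarrow>
     (C2 \<Rightarrow> complex ^ 1 ^ 2) \<Rightarrow> (C2 \<Rightarrow> complex ^ 2 ^ 1) \<Rightarrow> bool" where
  "nonsplit_extension b r \<sigma> E \<tau> \<iota> \<rho> \<longleftrightarrow>
     extension b r \<sigma> E \<tau> \<iota> \<rho> \<and>
     \<not> (\<exists>s. bundle_hom b r (L \<tau>) E s \<and> (\<forall>p\<in>C2_star. \<rho> p ** s p = mat 1))"

definition normalized_extension :: "complex \<Rightarrow> nat \<Rightarrow> 2 hopf_bundle \<Rightarrow> bool" where
  "normalized_extension b r E \<longleftrightarrow>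
     holo_bundle b r E \<and>
     (\<exists>\<sigma> \<tau> \<iota> \<rho>. extension b r \<sigma> E \<tau> \<iota> \<rho>) \<and>
     (\<exists>s. global_section b r E s \<and> (\<exists>p\<in>C2_star. s p \<noteq> 0)) \<and>
     (\<forall>\<mu>. \<mu> \<noteq> 0 \<and> deg_L b \<mu> < 0 \<longrightarrow>
        (\<forall>s. global_section b r (twist \<mu> E) s \<longrightarrow> (\<forall>p\<in>C2_star. s p = 0)))"

text \<open>\<open>\<phi>\<close> is a trace-free Higgs field on \<open>E\<close> twisted by \<open>\<lambda> = L l\<close>.\<close>

definition higgs_field ::
  "complex \<Rightarrow> nat \<Rightarrow> complex \<Rightarrow> 2 hopf_bundle \<Rightarrow> (C2 \<Rightarrow> complex ^ 2 ^ 2) \<Rightarrow> bool" where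
  "higgs_field b r l E \<phi> \<longleftrightarrow>
     bundle_hom b r E (twist l E) \<phi> \<and> (\<forall>p\<in>C2_star. trace (\<phi> p) = 0)"

definition normalized_nv_higgs ::
  "complex \<Rightarrow> nat \<Rightarrow> complex \<Rightarrow> 2 hopf_bundle \<Rightarrow> (C2 \<Rightarrow> complex ^ 2 ^ 2) \<Rightarrow> bool" where
  "normalized_nv_higgs b r l E \<phi> \<longleftrightarrow>
     normalized_extension b r E \<and> higgs_field b r l E \<phi> \<and> (\<forall>p\<in>C2_star. \<phi> p \<noteq> 0)"

text \<open>Isomorphism of Higgs bundles; for \<open>E' = E\<close>, conjugation by an automorphism of \<open>E\<close>.\<close>

definition higgs_iso ::
  "complex \<Rightarrow> nat \<Rightarrow> 2 hopf_bundle \<Rightarrow> (C2 \<Rightarrow> complex ^ 2 ^ 2) \<Rightarrow>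
     2 hopf_bundle \<Rightarrow> (C2 \<Rightarrow> complex ^ 2 ^ 2) \<Rightarrow> bool" where
  "higgs_iso b r E \<phi> E' \<phi>' \<longleftrightarrow>
     (\<exists>g. bundle_iso b r E E' g \<and> (\<forall>p\<in>C2_star. g p ** \<phi> p = \<phi>' p ** g p))"

text \<open>
  A sub-line bundle is an injection \<open>h\<close> of the sheaf of sections of \<open>L \<mu>\<close> (for the connected
  surface \<open>X\<close> and a line bundle, injective means not identically zero) with torsion-free cokernel.
  Torsion-freeness is a condition on stalks and is expressed on the universal cover: if \<open>f\<close> is a
  nonzero function on a connected open set and \<open>f s\<close> lies in the image of \<open>h\<close>, so does \<open>s\<close>.
\<close>

definition sub_line_bundle ::
  "complex \<Rightarrow> nat \<Rightarrow> 2 hopf_bundle \<Rightarrow> complex \<Rightarrow> (C2 \<Rightarrow> complex ^ 1 ^ 2) \<Rightarrow> bool" where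
  "sub_line_bundle b r E \<mu> h \<longleftrightarrow>
     \<mu> \<noteq> 0 \<and> bundle_hom b r (L \<mu>) E h \<and> (\<exists>p\<in>C2_star. h p \<noteq> 0) \<and>
     (\<forall>U f s m. open U \<and> connected U \<and> U \<subseteq> C2_star \<and>
        holo2_on f U \<and> (\<exists>p\<in>U. f p \<noteq> 0) \<and>
        local_section E U s \<and> local_section (L \<mu>) U m \<and>
        (\<forall>p\<in>U. f p *s s p = h p *v m p) \<longrightarrow>
        (\<exists>m'. local_section (L \<mu>) U m' \<and> (\<forall>p\<in>U. s p = h p *v m' p)))"

text \<open>\<open>\<phi>(M) \<subseteq> M \<otimes> \<lambda>\<close>, where \<open>M\<close> is \<open>L \<mu>\<close> included by \<open>h\<close> and \<open>\<lambda> = L l\<close>.\<close>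

definition invariant_sub_line_bundle ::
  "complex \<Rightarrow> nat \<Rightarrow> complex \<Rightarrow> 2 hopf_bundle \<Rightarrow> (C2 \<Rightarrow> complex ^ 2 ^ 2) \<Rightarrow>
     complex \<Rightarrow> (C2 \<Rightarrow> complex ^ 1 ^ 2) \<Rightarrow> bool" where
  "invariant_sub_line_bundle b r l E \<phi> \<mu> h \<longleftrightarrow>
     sub_line_bundle b r E \<mu> h \<and>
     (\<exists>e. bundle_hom b r (L \<mu>) (twist l (L \<mu>)) e \<and> (\<forall>p\<in>C2_star. \<phi> p ** h p = h p ** e p))"

text \<open>The inclusions \<open>h\<close> of \<open>L \<mu>\<close> and \<open>h'\<close> of \<open>L \<mu>'\<close> define the same subobject.\<close>

definition same_sub ::
  "complex \<Rightarrow> nat \<Rightarrow> complex \<Rightarrow> (C2 \<Rightarrow> complex ^ 1 ^ 2) \<Rightarrow>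
     complex \<Rightarrow> (C2 \<Rightarrow> complex ^ 1 ^ 2) \<Rightarrow> bool" where
  "same_sub b r \<mu> h \<mu>' h' \<longleftrightarrow>
     (\<exists>u. bundle_iso b r (L \<mu>) (L \<mu>') u \<and> (\<forall>p\<in>C2_star. h p = h' p ** u p))"

definition mat2 :: "complex \<Rightarrow> complex \<Rightarrow> complex \<Rightarrow> complex \<Rightarrow> complex ^ 2 ^ 2" where
  "mat2 p q w z = vector [vector [p, q], vector [w, z]]"

definition incl :: "complex \<Rightarrow> complex \<Rightarrow> complex ^ 1 ^ 2" where
  "incl f g = vector [vector [f], vector [g]]"

text \<open>
  The two presentations of the non-split extension \<open>E\<close> of \<open>(L b)\<^bsup>-rj-m\<^esup>\<close> by the trivial bundle,
  with the trace normalization. Since \<open>L \<sigma>\<close> comes with a frame of its pullback, \<open>\<iota> \<otimes> id\<close> has the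
  same matrix as \<open>\<iota>\<close>, so \<open>\<phi>\<^sub>1\<^sub>1 = \<iota>1 ** \<rho>2\<close>, \<open>\<phi>\<^sub>2\<^sub>2 = \<iota>2 ** \<rho>1\<close> and \<open>\<phi>\<^sub>1\<^sub>2 = \<iota>1 ** \<rho>1\<close>.
\<close>

definition std_sequences ::
  "complex \<Rightarrow> nat \<Rightarrow> nat \<Rightarrow> nat \<Rightarrow> 2 hopf_bundle \<Rightarrow>
     (C2 \<Rightarrow> complex ^ 1 ^ 2) \<Rightarrow> (C2 \<Rightarrow> complex ^ 2 ^ 1) \<Rightarrow>
     (C2 \<Rightarrow> complex ^ 1 ^ 2) \<Rightarrow> (C2 \<Rightarrow> complex ^ 2 ^ 1) \<Rightarrow> bool" where
  "std_sequences b r j m E \<iota>1 \<rho>1 \<iota>2 \<rho>2 \<longleftrightarrow>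
     m < r \<and>
     nonsplit_extension b r 1 E (b powi (- int (r * j + m))) \<iota>1 \<rho>1 \<and>
     nonsplit_extension b r (b powi (- int (r * (j + 1)))) E (b powi int (r - m)) \<iota>2 \<rho>2 \<and>
     (\<forall>p\<in>C2_star. trace (\<iota>1 p ** \<rho>2 p) = snd p ^ (r - m) \<and>
                   trace (\<iota>2 p ** \<rho>1 p) = snd p ^ (r - m))"

definition phi_11_minus_22 ::
  "(C2 \<Rightarrow> complex ^ 1 ^ 2) \<Rightarrow> (C2 \<Rightarrow> complex ^ 2 ^ 1) \<Rightarrow>
   (C2 \<Rightarrow> complex ^ 1 ^ 2) \<Rightarrow> (C2 \<Rightarrow> complex ^ 2 ^ 1) \<Rightarrow> C2 \<Rightarrow> complex ^ 2 ^ 2" where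
  "phi_11_minus_22 \<iota>1 \<rho>1 \<iota>2 \<rho>2 p = \<iota>1 p ** \<rho>2 p - \<iota>2 p ** \<rho>1 p"

definition phi_12 ::
  "(C2 \<Rightarrow> complex ^ 1 ^ 2) \<Rightarrow> (C2 \<Rightarrow> complex ^ 2 ^ 1) \<Rightarrow> C2 \<Rightarrow> complex ^ 2 ^ 2" where
  "phi_12 \<iota>1 \<rho>1 p = \<iota>1 p ** \<rho>1 p"

end

(*
The classification rests on three facts about the universal cover.  A holomorphic function on the
punctured plane with f o F = tau f is a monomial in y, since its derivatives in x are sections of
line bundles of negative degree.  The contraction F splits a Cousin problem over a shell around
the origin up to a residue, and Laurent coefficients together with a cohomological equation on a
bidisc reduce that residue to an explicit cocycle; hence an extension of line bundles of slope at
most r either splits or is the model with factor (1, g; 0, b^(a-rk)), where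
g = ((x + y^r/b^r)^k - x^k)/y^a.  Finally, a trace-free Higgs field with phi^2 = (delta y^l)^2
has nowhere vanishing eigensections; comparing their jets along the curve y = 0 puts the
Higgs bundle into a diagonal, companion or model form, and normalization fixes the twist.
*)
theory Submission
  imports Defs "HOL-Complex_Analysis.Complex_Analysis"
begin

section \<open>Holomorphic functions of two variables\<close>

text \<open>Bundles are given by frames only, so the pullback to the punctured plane need not be
  trivial; this plane is not Stein and its first cohomology is infinite-dimensional. Patching local
  lifts of an extension cannot be done upstairs alone; equivariance under F is what kills the
  Laurent tails, through a pairing over a torus. F has Jacobian determinant b^(r+1), so for a
  quotient that is the sub-line twisted by L(b^l) the pairing is multiplied by b^(l-r-1), of modulus
  above 1 exactly when l <= r: here that hypothesis enters. What survives is resonance. F takes x^k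
  to b^(rk) (x + y^r/b^r)^k, so x^k is an eigenfunction only up to lower powers of x; this defect
  divided by y^a, with 1 <= a <= r and l = a - rk, is the cocycle. It makes (x^k, y^a) equivariant,
  and this vector is the second inclusion of the standard sequences. A Higgs field with nonzero
  determinant needs no cohomology: its eigensections build the frame, after division by powers of y.
  Only nilpotent fields use the splitting theorem.\<close>

definition holo2_at :: "(C2 => complex) => C2 => bool" where
 "holo2_at f p \<longleftrightarrow> (EX u v. (f has_derivative (%(h, k). u * h + v * k)) (at p))"

lemma holo2_on_iff: "holo2_on f U \<longleftrightarrow> (ALL p:U. holo2_at f p)"
 by (simp add: holo2_on_def holo2_at_def)

text \<open>A real-linear map commuting with complex scalars is determined by its values at (1, 0)
  and (0, 1). Without named coefficients the condition passes through sums, products and the chain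
  rule at once.\<close>

lemma holo2_at_iff_linear:
 "holo2_at f p \<longleftrightarrow> (EX D. (f has_derivative D) (at p) & (ALL c h k. D (c * h, c * k) = c * D (h, k)))"
proof
 assume "holo2_at f p"
 then obtain u v where "(f has_derivative (%(h, k). u * h + v * k)) (at p)"
  by (auto simp: holo2_at_def)
 thus "EX D. (f has_derivative D) (at p) & (ALL c h k. D (c * h, c * k) = c * D (h, k))"
  by (intro exI[of _ "%(h, k). u * h + v * k"]) (auto simp: algebra_simps)
next
 assume "EX D. (f has_derivative D) (at p) & (ALL c h k. D (c * h, c * k) = c * D (h, k))"
 then obtain D where D: "(f has_derivative D) (at p)" "!!c h k. D (c * h, c * k) = c * D (h, k)"
  by auto
 interpret bounded_linear D by (rule has_derivative_bounded_linear[OF D(1)])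
 have "D = (%(h, k). D (1, 0) * h + D (0, 1) * k)"
 proof (rule ext, clarify)
  fix h k
  have "D (h, k) = D (h * 1, h * 0) + D (k * 0, k * 1)"
   by (simp flip: add)
  thus "D (h, k) = D (1, 0) * h + D (0, 1) * k"
   using D(2)[of h 1 0] D(2)[of k 0 1] by (simp add: mult.commute)
 qed
 with D(1) show "holo2_at f p"
  unfolding holo2_at_def by metis
qed

lemma holo2_at_const [simp]: "holo2_at (%_. c) p"
 unfolding holo2_at_iff_linear by (intro exI[of _ "%_. 0"]) auto

lemma holo2_at_fst [simp]: "holo2_at fst p"
 unfolding holo2_at_iff_linear by (intro exI[of _ fst]) (auto intro: has_derivative_fst[OF has_derivative_ident])

lemma holo2_at_snd [simp]: "holo2_at snd p"
 unfolding holo2_at_iff_linear by (intro exI[of _ snd]) (auto intro: has_derivative_snd[OF has_derivative_ident])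

lemma holo2_at_add:
 assumes "holo2_at f p" "holo2_at g p"
 shows "holo2_at (%q. f q + g q) p"
proof -
 obtain D E where "(f has_derivative D) (at p)" "ALL c h k. D (c * h, c * k) = c * D (h, k)"
  "(g has_derivative E) (at p)" "ALL c h k. E (c * h, c * k) = c * E (h, k)"
  using assms unfolding holo2_at_iff_linear by blast
 thus ?thesis
  unfolding holo2_at_iff_linear
  by (intro exI[of _ "%h. D h + E h"]) (simp add: has_derivative_add algebra_simps)
qed

lemma holo2_at_mult:
 assumes "holo2_at f p" "holo2_at g p"
 shows "holo2_at (%q. f q * g q) p"
proof -
 obtain D E where "(f has_derivative D) (at p)" "ALL c h k. D (c * h, c * k) = c * D (h, k)"
  "(g has_derivative E) (at p)" "ALL c h k. E (c * h, c * k) = c * E (h, k)"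
  using assms unfolding holo2_at_iff_linear by blast
 thus ?thesis
  unfolding holo2_at_iff_linear
  by (intro exI[of _ "%h. f p * E h + D h * g p"] conjI has_derivative_mult)
   (simp_all add: algebra_simps)
qed

lemma holo2_at_minus: "holo2_at f p ==> holo2_at (%q. - f q) p"
 using holo2_at_mult[of "%_. -1" p f] by simp

lemma holo2_at_diff:
 "holo2_at f p ==> holo2_at g p ==> holo2_at (%q. f q - g q) p"
 using holo2_at_add[of f p "%q. - g q"] holo2_at_minus[of g p] by simp

lemma holo2_at_compose1:
 assumes "holo2_at f p" "(g has_field_derivative d) (at (f p))"
 shows "holo2_at (%q. g (f q)) p"
proof -
 obtain D where D: "(f has_derivative D) (at p)" "ALL c h k. D (c * h, c * k) = c * D (h, k)"
  using assms unfolding holo2_at_iff_linear by blast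
 have "((%q. g (f q)) has_derivative (%h. d * D h)) (at p)"
  using has_derivative_compose[OF D(1) assms(2)[unfolded has_field_derivative_def]] by simp
 thus ?thesis
  unfolding holo2_at_iff_linear using D(2)
  by (intro exI[of _ "%h. d * D h"]) (auto simp: algebra_simps)
qed

lemma holo2_at_power: "holo2_at f p ==> holo2_at (%q. f q ^ n) p"
 by (rule holo2_at_compose1[of f p "%z. z ^ n" "of_nat n * f p ^ (n - 1)"])
  (auto intro!: derivative_eq_intros)

lemma holo2_at_inverse: "holo2_at f p ==> f p ~= 0 ==> holo2_at (%q. inverse (f q)) p"
 by (rule holo2_at_compose1[of f p inverse]) (auto intro!: derivative_eq_intros)

lemma holo2_at_divide:
 "holo2_at f p ==> holo2_at g p ==> g p ~= 0 ==> holo2_at (%q. f q / g q) p"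
 unfolding divide_inverse by (intro holo2_at_mult holo2_at_inverse)

lemma holo2_at_sum:
 "(!!i. i : I ==> holo2_at (f i) p) ==> holo2_at (%q. \<Sum>i\<in>I. f i q) p"
 by (induction I rule: infinite_finite_induct) (simp_all add: holo2_at_add)

lemma holo2_at_compose2:
 assumes "holo2_at u p" "holo2_at v p" "holo2_at f (u p, v p)"
 shows "holo2_at (%q. f (u q, v q)) p"
proof -
 obtain D E G where D: "(u has_derivative D) (at p)" "ALL c h k. D (c * h, c * k) = c * D (h, k)"
  and E: "(v has_derivative E) (at p)" "ALL c h k. E (c * h, c * k) = c * E (h, k)"
  and G: "(f has_derivative G) (at (u p, v p))" "ALL c h k. G (c * h, c * k) = c * G (h, k)"
  using assms unfolding holo2_at_iff_linear by blast
 have "((%q. f (u q, v q)) has_derivative (%h. G (D h, E h))) (at p)"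
  using has_derivative_compose[OF has_derivative_Pair[OF D(1) E(1)] G(1)] .
 thus ?thesis
  unfolding holo2_at_iff_linear using D(2) E(2) G(2)
  by (intro exI[of _ "%h. G (D h, E h)"]) auto
qed

lemma holo2_at_transform:
 assumes "holo2_at f p" "open U" "p : U" "!!q. q : U ==> f q = g q"
 shows "holo2_at g p"
proof -
 obtain u v where "(f has_derivative (%(h, k). u * h + v * k)) (at p)"
  using assms(1) by (auto simp: holo2_at_def)
 hence "(g has_derivative (%(h, k). u * h + v * k)) (at p)"
  by (rule has_derivative_transform_within_open[OF _ assms(2-4)])
 thus ?thesis by (auto simp: holo2_at_def)
qed

lemma holo2_on_subset: "holo2_on f U ==> V <= U ==> holo2_on f V"
 by (auto simp: holo2_on_def)

lemma holo2_at_continuous: "holo2_at f p ==> isCont f p"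
 by (auto simp: holo2_at_def intro: has_derivative_continuous)

lemma holo2_on_continuous_on: "holo2_on f U ==> continuous_on U f"
 by (auto simp: holo2_on_iff intro!: continuous_at_imp_continuous_on holo2_at_continuous)

lemmas holo2_at_intros =
 holo2_at_const holo2_at_fst holo2_at_snd holo2_at_add holo2_at_mult holo2_at_minus holo2_at_diff
 holo2_at_power holo2_at_sum holo2_at_divide holo2_at_inverse

lemma holo2_at_slice_fst:
 assumes "holo2_at f (x, y)"
 shows "(%x. f (x, y)) field_differentiable (at x)"
proof -
 obtain u v where "(f has_derivative (%(h, k). u * h + v * k)) (at (x, y))"
  using assms by (auto simp: holo2_at_def)
 moreover have "((%x. (x, y)) has_derivative (%h. (h, 0))) (at x)"
  by (intro has_derivative_Pair has_derivative_ident has_derivative_const)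
 ultimately have "((%x. f (x, y)) has_derivative (%h. u * h)) (at x)"
  by (auto dest: has_derivative_compose)
 thus ?thesis
  unfolding field_differentiable_def has_field_derivative_def by blast
qed

lemma holo2_at_slice_snd:
 assumes "holo2_at f (x, y)"
 shows "(%y. f (x, y)) field_differentiable (at y)"
proof -
 obtain u v where "(f has_derivative (%(h, k). u * h + v * k)) (at (x, y))"
  using assms by (auto simp: holo2_at_def)
 moreover have "((%y. (x, y)) has_derivative (%k. (0, k))) (at y)"
  by (intro has_derivative_Pair has_derivative_ident has_derivative_const)
 ultimately have "((%y. f (x, y)) has_derivative (%k. v * k)) (at y)"
  by (auto dest: has_derivative_compose)
 thus ?thesis
  unfolding field_differentiable_def has_field_derivative_def by blast
qed

lemma holo2_on_slice_fst:
 "holo2_on f U ==> (!!x. x : A ==> (x, y) : U) ==> (%x. f (x, y)) holomorphic_on A"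
 unfolding holomorphic_on_def holo2_on_iff
 by (auto intro: field_differentiable_at_within holo2_at_slice_fst)

lemma holo2_on_slice_snd:
 "holo2_on f U ==> (!!y. y : A ==> (x, y) : U) ==> (%y. f (x, y)) holomorphic_on A"
 unfolding holomorphic_on_def holo2_on_iff
 by (auto intro: field_differentiable_at_within holo2_at_slice_snd)

lemma holo2_at_swap:
 assumes "holo2_at f (y, x)"
 shows "holo2_at (%p. f (prod.swap p)) (x, y)"
proof -
 have "holo2_at (%p. f (snd p, fst p)) (x, y)"
  using holo2_at_compose2[OF holo2_at_snd holo2_at_fst, of f "(x, y)"] assms by simp
 thus ?thesis by (simp add: prod.swap_def)
qed

section \<open>Cauchy integrals with parameters and Osgood's lemma\<close>

lemma open_contains_box2:
 fixes x :: "'a::metric_space" and y :: "'b::metric_space"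
 assumes "open U" "(x, y) : U"
 obtains e where "e > 0" "cball x e \<times> cball y e <= U"
proof -
 obtain A B where AB: "open A" "open B" "x : A" "y : B" "A \<times> B <= U"
  using open_prod_elim[OF assms] by (metis mem_Sigma_iff)
 obtain d1 d2 where "d1 > 0" "cball x d1 <= A" "d2 > 0" "cball y d2 <= B"
  using AB open_contains_cball by metis
 thus ?thesis
  using AB(5) by (intro that[of "min d1 d2"]) (auto simp: subset_iff)
qed

lemma open_slice_fst: "open U ==> open {x. (x, y) : U}"
 using open_vimage[of U "%x. (x, y)"] by (simp add: vimage_def continuous_on_Pair)

text \<open>By Cauchy's formula the derivative is an integral depending continuously on the parameter.\<close>

lemma continuous_deriv_param:
 fixes f :: "'a::topological_space => complex => complex"
 assumes cont: "continuous_on (A \<times> cball z r) (%(x, w). f x w)"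
  and holo: "!!x. x : A ==> f x holomorphic_on ball z r"
  and r: "r > 0"
 shows "continuous_on (A \<times> ball z r) (%(x, w). deriv (f x) w)"
proof -
 let ?c = "1 / (2 * of_real pi * \<i>)"
 let ?I = "%(x, w). integral (cbox 0 1) (%t. f x (circlepath z r t) / (circlepath z r t - w)\<^sup>2
           * (of_real r * (2 * of_real pi * \<i>) * exp (2 * of_real pi * \<i> * of_real t)))"
 have d: "deriv (f x) w = ?c * ?I (x, w)" if "x : A" "w : ball z r" for x w
 proof -
  have "continuous_on (cball z r) (%w. f x w)"
   using continuous_on_compose2[OF cont, of "cball z r" "%w. (x, w)"] that
   by (simp add: continuous_on_Pair image_subset_iff)
  from Cauchy_derivative_integral_circlepath(2)[OF this holo[OF that(1)] that(2)]
  have "deriv (f x) w = ?c * contour_integral (circlepath z r) (%u. f x u / (u - w)\<^sup>2)"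
   by (rule DERIV_imp_deriv)
  also have "contour_integral (circlepath z r) (%u. f x u / (u - w)\<^sup>2) = ?I (x, w)"
   unfolding contour_integral_integral
   by (auto simp: vector_derivative_circlepath algebra_simps intro!: integral_cong)
  finally show ?thesis .
 qed
 have circ: "circlepath z r t : sphere z r" for t
  using r by (auto simp: circlepath_def part_circlepath_def dist_norm norm_mult)
 have cc: "continuous_on UNIV (circlepath z r)"
  unfolding circlepath_def part_circlepath_def linepath_def by (intro continuous_intros)
 have "continuous_on (A \<times> ball z r) ?I"
 proof -
  have "continuous_on ((A \<times> ball z r) \<times> cbox 0 1) (%q. f (fst (fst q)) (circlepath z r (snd q)))"
  proof -
   have "continuous_on ((A \<times> ball z r) \<times> cbox 0 1) (%q. (fst (fst q), circlepath z r (snd q)))"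
    by (intro continuous_intros continuous_on_compose2[OF cc]) auto
   from continuous_on_compose2[OF cont this] show ?thesis
    using circ r by (fastforce simp: split_beta)
  qed
  moreover have "circlepath z r t - w ~= 0" if "w : ball z r" for w t
   using circ[of t] that by (auto simp: dist_norm)
  moreover have "continuous_on ((A \<times> ball z r) \<times> cbox 0 1) (%q. circlepath z r (snd q))"
   by (intro continuous_on_compose2[OF cc] continuous_intros) auto
  ultimately show ?thesis
   unfolding split_beta
   by (intro integral_continuous_on_param)
    (auto simp: split_beta intro!: continuous_intros)
 qed
 hence "continuous_on (A \<times> ball z r) (%p. ?c * ?I p)"
  by (intro continuous_intros)
 thus ?thesis
  by (rule continuous_on_eq) (use d in auto)
qed

text \<open>Continuity makes the Cauchy integral for the derivative in y depend continuously on both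
  variables. Existence of both partial derivatives, with one of them continuous, already gives the
  total derivative.\<close>

proposition osgood:
 assumes U: "open U" and cont: "continuous_on U f"
  and fst: "!!x y. (x, y) : U ==> (%x. f (x, y)) field_differentiable (at x)"
  and snd: "!!x y. (x, y) : U ==> (%y. f (x, y)) field_differentiable (at y)"
 shows "holo2_on f U"
 unfolding holo2_on_iff
proof clarify
 fix x y assume xy: "(x, y) : U"
 obtain e where e: "e > 0" "cball x e \<times> cball y e <= U"
  using open_contains_box2[OF U xy] .
 define fy where "fy = (%x y. deriv (%y. f (x, y)) y)"
 have inU: "(x', y') : U" if "x' : ball x e" "y' : ball y e" for x' y'
  using e that by (auto simp: subset_iff)
 have "continuous_on (ball x e \<times> ball y e) (%(x, w). deriv (%y. f (x, y)) w)"
 proof (rule continuous_deriv_param)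
  show "continuous_on (ball x e \<times> cball y e) (%(x, w). f (x, w))"
   using continuous_on_subset[OF cont] e by (auto simp: subset_iff)
  show "(%y. f (x', y)) holomorphic_on ball y e" if "x' : ball x e" for x'
   unfolding holomorphic_on_def using snd inU that by (blast intro: field_differentiable_at_within)
 qed fact
 hence cfy: "isCont (%(x, y). fy x y) (x, y)"
  using e by (subst (asm) continuous_on_eq_continuous_at) (auto simp: fy_def open_Times)
 have "((%(x, y). f (x, y)) has_derivative
     (%(h, k). deriv (%x. f (x, y)) x * h + blinfun_apply (blinfun_mult_right (fy x y)) k))
    (at (x, y) within ball x e \<times> ball y e)"
 proof (rule has_derivative_partialsI)
  show "((%x. f (x, y)) has_derivative (*) (deriv (%x. f (x, y)) x)) (at x within ball x e)"
   using fst[OF xy] by (auto simp: field_differentiable_derivI has_field_derivative_imp_has_derivative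
     intro: has_derivative_at_withinI)
  show "((%y. f (x', y)) has_derivative blinfun_apply (blinfun_mult_right (fy x' y'))) (at y' within ball y e)"
   if "x' : ball x e" "y' : ball y e" for x' y'
   using snd[OF inU[OF that]] by (auto simp: fy_def field_differentiable_derivI
     has_field_derivative_imp_has_derivative intro: has_derivative_at_withinI)
  have "isCont (%p. blinfun_mult_right (case p of (x, y) => fy x y)) (x, y)"
   using bounded_linear.isCont[OF bounded_linear_blinfun_mult_right cfy] .
  thus "continuous (at (x, y) within ball x e \<times> ball y e) (%(x, y). blinfun_mult_right (fy x y))"
   unfolding split_beta by (rule continuous_at_imp_continuous_within)
 qed (use e in auto)
 thus "holo2_at f (x, y)"
  using e by (subst (asm) at_within_open) (auto simp: holo2_at_def open_Times)
qed

text \<open>Differentiation under the integral is done in each variable separately; Osgood's lemma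
  then turns continuity plus separate holomorphy into joint holomorphy.\<close>

lemma holo2_on_integral:
 fixes H :: "C2 => real => complex"
 assumes U: "open U" and cont: "continuous_on (U \<times> {0..1}) (%(p, t). H p t)"
  and holo: "!!t. t : {0..1} ==> holo2_on (%p. H p t) U"
 shows "holo2_on (%p. integral {0..1} (H p)) U"
proof (rule osgood[OF U])
 show "continuous_on U (%p. integral {0..1} (H p))"
  using integral_continuous_on_param[of U 0 1 H] cont by simp
 have *: "(%x. integral {0..1} (K x)) field_differentiable (at x)"
  if "e > 0" and c: "continuous_on (cball x e \<times> {0..1}) (%(x, t). K x t)"
   and h: "!!t. t : {0..1} ==> (%x. K x t) holomorphic_on cball x e"
  for x e and K :: "complex => real => complex"
 proof -
  have hb: "(%x. K x t) holomorphic_on ball x e" if "t : {0..1}" for t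
   by (rule holomorphic_on_subset[OF h[OF that]]) auto
  have "continuous_on ({0..1} \<times> ball x e) (%(t, w). deriv (%x. K x t) w)"
   using continuous_on_swap_args[OF c] hb \<open>e > 0\<close>
   by (intro continuous_deriv_param) auto
  from continuous_on_swap_args[OF this]
  have "(%x. integral (cbox 0 1) (K x)) holomorphic_on ball x e"
  proof (intro leibniz_rule_holomorphic)
   fix x' and t :: real assume "x' : ball x e" "t : cbox 0 1"
   thus "((%x. K x t) has_field_derivative deriv (%x. K x t) x') (at x' within ball x e)"
    using has_field_derivative_at_within[OF holomorphic_derivI[OF hb[of t] open_ball]] by simp
  next
   fix x' assume x': "x' : ball x e"
   have "continuous_on {0..1} (K x')"
    using continuous_on_compose2[OF c, of "{0..1}" "%t. (x', t)"] x'
    by (simp add: continuous_on_Pair image_subset_iff)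
   thus "K x' integrable_on cbox 0 1"
    by (auto intro: integrable_continuous_real)
  qed auto
  thus ?thesis
   using \<open>e > 0\<close> by (auto intro: holomorphic_on_imp_differentiable_at)
 qed
 fix x y assume xy: "(x, y) : U"
 obtain e where e: "e > 0" "cball x e \<times> cball y e <= U"
  using open_contains_box2[OF U xy] .
 show "(%x. integral {0..1} (H (x, y))) field_differentiable (at x)"
 proof (rule *[OF e(1)])
  have "continuous_on (cball x e \<times> {0..1}) (%q. ((fst q, y), snd q :: real))"
   by (intro continuous_intros)
  from continuous_on_compose2[OF cont this]
  show "continuous_on (cball x e \<times> {0..1}) (%(x, t). H (x, y) t)"
   using e by (fastforce simp: split_beta)
  show "(%x. H (x, y) t) holomorphic_on cball x e" if "t : {0..1}" for t
   by (rule holo2_on_slice_fst[OF holo[OF that]]) (use e in auto)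
 qed
 show "(%y. integral {0..1} (H (x, y))) field_differentiable (at y)"
 proof (rule *[OF e(1)])
  have "continuous_on (cball y e \<times> {0..1}) (%q. ((x, fst q), snd q :: real))"
   by (intro continuous_intros)
  from continuous_on_compose2[OF cont this]
  show "continuous_on (cball y e \<times> {0..1}) (%(y, t). H (x, y) t)"
   using e by (fastforce simp: split_beta)
  show "(%y. H (x, y) t) holomorphic_on cball y e" if "t : {0..1}" for t
   by (rule holo2_on_slice_snd[OF holo[OF that]]) (use e in auto)
 qed
qed

text \<open>Strong enough that a contour integral becomes an integral over [0, 1] of a jointly
  continuous integrand. Line segments and full circles are the only instances.\<close>

definition C1_path :: "(real => complex) => bool" where
 "C1_path ga \<longleftrightarrow> path ga & continuous_on {0..1} (%t. vector_derivative ga (at t))"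

lemma C1_path_linepath: "C1_path (linepath a b)"
 by (simp add: C1_path_def vector_derivative_linepath_at)

lemma C1_path_circlepath: "C1_path (circlepath z r)"
 unfolding C1_path_def vector_derivative_circlepath by (auto intro!: continuous_intros)

text \<open>The exponent \<open>k\<close> serves three purposes: 1 for the Cauchy transform, 2 for
  the Cauchy formula of the derivative, 0 for a plain integral over the first variable.\<close>

lemma holo2_on_cauchy_kernel:
 assumes "C1_path ga" "open G" "holo2_on g G" "open B" "path_image ga \<times> B <= G"
 shows "holo2_on (%(x, y). contour_integral ga (%w. g (w, y) / (w - x) ^ k)) ((- path_image ga) \<times> B)"
proof -
 have cl: "open (- path_image ga)"
  using assms(1) by (intro open_Compl compact_imp_closed compact_path_image) (auto simp: C1_path_def)
 have "holo2_on (%p. integral {0..1} (%t. g (ga t, snd p) / (ga t - fst p) ^ k * vector_derivative ga (at t)))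
     ((- path_image ga) \<times> B)"
 proof (rule holo2_on_integral)
  show "open ((- path_image ga) \<times> B)" using assms cl by (auto intro: open_Times)
  have "continuous_on (((- path_image ga) \<times> B) \<times> {0..1}) (%q. (ga (snd q), snd (fst q)))"
   using assms(1) by (auto simp: C1_path_def path_def intro!: continuous_intros continuous_on_compose2[of "{0..1}" ga])
  hence "continuous_on (((- path_image ga) \<times> B) \<times> {0..1}) (%q. g (ga (snd q), snd (fst q)))"
   using assms(5)
   by (intro continuous_on_compose2[OF holo2_on_continuous_on[OF assms(3)]]) (auto simp: path_image_def)
  moreover have "continuous_on (((- path_image ga) \<times> B) \<times> {0..1}) (%q. ga (snd q))"
   using assms(1) by (auto simp: C1_path_def path_def intro!: continuous_intros continuous_on_compose2[of "{0..1}" ga])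
  moreover have "continuous_on (((- path_image ga) \<times> B) \<times> {0..1}) (%q. vector_derivative ga (at (snd q)))"
   using assms(1) unfolding C1_path_def
   by (auto intro!: continuous_intros continuous_on_compose2[of "{0..1}" "%t. vector_derivative ga (at t)" _ snd])
  ultimately show "continuous_on (((- path_image ga) \<times> B) \<times> {0..1})
    (%(p, t). g (ga t, snd p) / (ga t - fst p) ^ k * vector_derivative ga (at t))"
   unfolding split_beta by (intro continuous_intros) (auto simp: path_image_def)
  show "holo2_on (%p. g (ga t, snd p) / (ga t - fst p) ^ k * vector_derivative ga (at t)) ((- path_image ga) \<times> B)"
   if "t : {0..1}" for t
   unfolding holo2_on_iff
  proof
   fix p assume p: "p : (- path_image ga) \<times> B"
   have "(ga t, snd p) : path_image ga \<times> B"
    using p that by (auto simp: path_image_def)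
   hence "holo2_at g (ga t, snd p)"
    using assms(3,5) by (auto simp: holo2_on_iff)
   hence "holo2_at (%p. g (ga t, snd p)) p"
    by (rule holo2_at_compose2[OF holo2_at_const holo2_at_snd])
   moreover have "ga t - fst p ~= 0"
    using p that by (auto simp: path_image_def)
   ultimately show "holo2_at (%p. g (ga t, snd p) / (ga t - fst p) ^ k * vector_derivative ga (at t)) p"
    by (intro holo2_at_mult holo2_at_divide holo2_at_power holo2_at_diff holo2_at_const holo2_at_fst) simp_all
  qed
 qed
 thus ?thesis
  by (simp add: contour_integral_integral case_prod_unfold)
qed

text \<open>Integration is over the first variable; transforms in the second one are obtained by
  exchanging coordinates. The result is holomorphic on every side of the path, and this is what
  splits functions on an overlap or an annulus.\<close>

definition cauchy_transform :: "(real => complex) => (C2 => complex) => C2 => complex" where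
 "cauchy_transform ga g = (%(x, y). contour_integral ga (%w. g (w, y) / (w - x)) / (2 * of_real pi * \<i>))"

lemma holo2_on_cauchy_transform:
 assumes "C1_path ga" "open G" "holo2_on g G" "open B" "path_image ga \<times> B <= G"
 shows "holo2_on (cauchy_transform ga g) ((- path_image ga) \<times> B)"
proof -
 have "holo2_on (%p. (%(x, y). contour_integral ga (%w. g (w, y) / (w - x) ^ 1)) p / (2 * of_real pi * \<i>))
     ((- path_image ga) \<times> B)"
  using holo2_on_cauchy_kernel[OF assms, of 1] unfolding holo2_on_iff
  by (intro ballI holo2_at_divide holo2_at_const) auto
 thus ?thesis
  by (simp add: cauchy_transform_def case_prod_unfold)
qed

lemma holo2_on_deriv_fst:
 assumes U: "open U" and f: "holo2_on f U"
 shows "holo2_on (%(x, y). deriv (%x. f (x, y)) x) U"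
 unfolding holo2_on_iff
proof clarify
 fix x y assume xy: "(x, y) : U"
 obtain e where e: "e > 0" "cball x e \<times> cball y e <= U"
  using open_contains_box2[OF U xy] .
 let ?K = "%(x', y). contour_integral (circlepath x e) (%w. f (w, y) / (w - x') ^ 2)"
 have "holo2_on ?K ((- path_image (circlepath x e)) \<times> ball y e)"
  using e by (intro holo2_on_cauchy_kernel[OF C1_path_circlepath U f]) (auto simp: subset_iff)
 hence "holo2_at ?K (x, y)"
  using e by (auto simp: holo2_on_iff)
 hence "holo2_at (%p. 1 / (2 * of_real pi * \<i>) * ?K p) (x, y)"
  by (intro holo2_at_mult holo2_at_const)
 thus "holo2_at (%(x, y). deriv (%x. f (x, y)) x) (x, y)"
 proof (rule holo2_at_transform[of _ _ "ball x e \<times> ball y e"])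
  fix q assume "q : ball x e \<times> ball y e"
  then obtain x' y' where q: "q = (x', y')" "x' : ball x e" "y' : ball y e" by auto
  have "(%x. f (x, y')) holomorphic_on cball x e"
   using e q by (intro holo2_on_slice_fst[OF f]) (auto simp: subset_iff)
  hence "((%x. f (x, y')) has_field_derivative 1 / (2 * of_real pi * \<i>) *
    contour_integral (circlepath x e) (%u. f (u, y') / (u - x')\<^sup>2)) (at x')"
   using q by (intro Cauchy_derivative_integral_circlepath)
    (auto intro: holomorphic_on_imp_continuous_on holomorphic_on_subset[OF _ ball_subset_cball])
  thus "1 / (2 * of_real pi * \<i>) * ?K q = (case q of (x, y) => deriv (%x. f (x, y)) x)"
   using q by (simp add: DERIV_imp_deriv)
 qed (use e in \<open>auto simp: open_Times\<close>)
qed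

lemma cauchy_transform_circle:
 assumes "(%w. g (w, y)) holomorphic_on cball z r" "x : ball z r"
 shows "cauchy_transform (circlepath z r) g (x, y) = g (x, y)"
 using Cauchy_integral_circlepath_simple[OF assms(1), of x] assms(2)
 by (simp add: cauchy_transform_def contour_integral_unique dist_norm norm_minus_commute)

section \<open>Division by a coordinate function\<close>

lemma holo2_on_swap:
 assumes "holo2_on f U"
 shows "holo2_on (%p. f (prod.swap p)) (prod.swap ` U)"
 using assms holo2_at_swap by (auto simp: holo2_on_iff)

lemma open_swap: "open U ==> open (prod.swap ` U :: C2 set)"
proof -
 assume "open U"
 moreover have "prod.swap ` U = prod.swap -` U" by force
 ultimately show ?thesis
  by (simp add: open_vimage continuous_on_swap)
qed

text \<open>Near x = 0 the quotient is recovered as the Cauchy transform over a circle around 0,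
  where dividing by x is harmless; this gives joint holomorphy. Slice by slice the transform is the
  quotient with its removable singularity filled.\<close>

lemma holo2_divide_fst:
 assumes U: "open U" and f: "holo2_on f U" and zero: "!!y. (0, y) : U ==> f (0, y) = 0"
 obtains g where "holo2_on g U" "!!p. p : U ==> f p = fst p * g p"
proof
 define g where "g p = (if fst p = 0 then deriv (%w. f (w, snd p)) 0 else f p / fst p)" for p
 show "f p = fst p * g p" if "p : U" for p
  using zero[of "snd p"] that by (cases p) (auto simp: g_def)
 show "holo2_on g U"
  unfolding holo2_on_iff
 proof clarify
  fix x y assume xy: "(x, y) : U"
  show "holo2_at g (x, y)"
  proof (cases "x = 0")
   case False
   have "holo2_at (%p. f p / fst p) (x, y)"
    using False f xy by (intro holo2_at_intros) (auto simp: holo2_on_iff)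
   moreover have "open {p::C2. fst p ~= 0}"
    by (intro open_Collect_neq continuous_intros)
   ultimately show ?thesis
    by (rule holo2_at_transform) (use False in \<open>auto simp: g_def\<close>)
  next
   case True
   obtain e where e: "e > 0" "cball x e \<times> cball y e <= U"
    using open_contains_box2[OF U xy] .
   define G where "G = (%p. f p / fst p)"
   have G: "holo2_on G (U Int {p. fst p ~= 0})"
    using f unfolding G_def holo2_on_iff by (auto intro!: holo2_at_intros)
   have "open (U Int {p. fst p ~= 0})"
    using U by (intro open_Int open_Collect_neq continuous_intros)
   hence "holo2_on (cauchy_transform (circlepath 0 e) G) ((- path_image (circlepath 0 e)) \<times> ball y e)"
    using e True by (intro holo2_on_cauchy_transform[OF C1_path_circlepath _ G]) (auto simp: subset_iff)
   hence *: "holo2_at (cauchy_transform (circlepath 0 e) G) (x, y)"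
    using True e by (auto simp: holo2_on_iff)
   have "cauchy_transform (circlepath 0 e) G (x', y') = g (x', y')"
    if "x' : ball 0 e" "y' : ball y e" for x' y'
   proof -
    have "(%w. f (w, y')) holomorphic_on cball 0 e"
     using e True that by (intro holo2_on_slice_fst[OF f]) (auto simp: subset_iff)
    from pole_lemma[OF this, of 0]
    have "(%w. if w = 0 then deriv (%w. f (w, y')) 0 else (f (w, y') - f (0, y')) / (w - 0)) holomorphic_on cball 0 e"
     using e by simp
    moreover have "f (0, y') = 0"
     using e True that by (intro zero) (auto simp: subset_iff)
    ultimately have "(%w. g (w, y')) holomorphic_on cball 0 e"
     by (simp add: g_def cong: if_cong)
    from cauchy_transform_circle[OF this that(1)]
    have "cauchy_transform (circlepath 0 e) g (x', y') = g (x', y')" .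
    moreover have "cauchy_transform (circlepath 0 e) G (x', y') = cauchy_transform (circlepath 0 e) g (x', y')"
     using e by (auto simp: cauchy_transform_def g_def G_def intro!: contour_integral_eq)
    ultimately show ?thesis by simp
   qed
   thus ?thesis
    by (intro holo2_at_transform[OF *, of "ball 0 e \<times> ball y e"]) (use True e in \<open>auto simp: open_Times\<close>)
  qed
 qed
qed

lemma holo2_divide_snd:
 assumes U: "open U" and f: "holo2_on f U" and zero: "!!x. (x, 0) : U ==> f (x, 0) = 0"
 obtains g where "holo2_on g U" "!!p. p : U ==> f p = snd p * g p"
proof -
 have "!!y. (0, y) : prod.swap ` U ==> f (prod.swap (0, y)) = 0"
  using zero by force
 then obtain g where g: "holo2_on g (prod.swap ` U)" "!!p. p : prod.swap ` U ==> f (prod.swap p) = fst p * g p"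
  using holo2_divide_fst[OF open_swap[OF U] holo2_on_swap[OF f]] by metis
 show ?thesis
 proof
  show "holo2_on (%p. g (prod.swap p)) U"
   using holo2_on_swap[OF g(1)] by (simp add: image_image)
  show "f p = snd p * g (prod.swap p)" if "p : U" for p
   using g(2)[of "prod.swap p"] that by (cases p) force
 qed
qed

section \<open>Locally uniform limits and the identity theorem\<close>

lemma holo2_on_limit:
 assumes U: "open U" and f: "!!n. holo2_on (f n) U"
  and lim: "!!p. p : U ==> EX V. open V & p : V & V <= U & uniform_limit V f g sequentially"
 shows "holo2_on g U"
proof (rule osgood[OF U])
 show "continuous_on U g"
 proof (rule continuous_at_imp_continuous_on, rule ballI)
  fix p assume "p : U"
  then obtain V where V: "open V" "p : V" "V <= U" "uniform_limit V f g sequentially"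
   using lim by blast
  have "continuous_on V g"
   by (rule uniform_limit_theorem[OF _ V(4)])
    (use continuous_on_subset[OF holo2_on_continuous_on[OF f]] V in auto)
  thus "isCont g p"
   using V continuous_on_eq_continuous_at by blast
 qed
next
 fix x y assume xy: "(x, y) : U"
 then obtain V where V: "open V" "(x, y) : V" "V <= U" "uniform_limit V f g sequentially"
  using lim by blast
 obtain e where e: "e > 0" "cball x e \<times> cball y e <= V"
  using open_contains_box2[OF V(1,2)] .
 have "(%x. g (x, y)) holomorphic_on ball x e"
 proof (rule holomorphic_uniform_sequence)
  show "(%x. f n (x, y)) holomorphic_on ball x e" for n
   using e V by (intro holo2_on_slice_fst[OF f]) (auto simp: subset_iff)
  fix x' assume "x' : ball x e"
  then obtain d where "d > 0" "cball x' d <= ball x e"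
   using open_contains_cball by blast
  moreover have "uniform_limit (cball x' d) (%n x. f n (x, y)) (%x. g (x, y)) sequentially"
   if "cball x' d <= ball x e" for d
   using that e
   by (intro uniform_limit_compose'[OF uniform_limit_on_subset[OF V(4), of V]]) (auto simp: subset_iff)
  ultimately show "EX d>0. cball x' d <= ball x e &
    uniform_limit (cball x' d) (%n x. f n (x, y)) (%x. g (x, y)) sequentially"
   by blast
 qed auto
 thus "(%x. g (x, y)) field_differentiable (at x)"
  using e by (auto intro: holomorphic_on_imp_differentiable_at)
 have "(%y. g (x, y)) holomorphic_on ball y e"
 proof (rule holomorphic_uniform_sequence)
  show "(%y. f n (x, y)) holomorphic_on ball y e" for n
   using e V by (intro holo2_on_slice_snd[OF f]) (auto simp: subset_iff)
  fix y' assume "y' : ball y e"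
  then obtain d where "d > 0" "cball y' d <= ball y e"
   using open_contains_cball by blast
  moreover have "uniform_limit (cball y' d) (%n y. f n (x, y)) (%y. g (x, y)) sequentially"
   if "cball y' d <= ball y e" for d
   using that e
   by (intro uniform_limit_compose'[OF uniform_limit_on_subset[OF V(4), of V]]) (auto simp: subset_iff)
  ultimately show "EX d>0. cball y' d <= ball y e &
    uniform_limit (cball y' d) (%n y. f n (x, y)) (%y. g (x, y)) sequentially"
   by blast
 qed auto
 thus "(%y. g (x, y)) field_differentiable (at y)"
  using e by (auto intro: holomorphic_on_imp_differentiable_at)
qed

text \<open>One-variable continuation twice: in x over a small disc of values y, which makes f
  vanish on a full strip, then in y for each x.\<close>

lemma holo2_eq_0_box:
 assumes f: "holo2_on f (ball x e \<times> ball y e)" and V: "open V" "V <= ball x e \<times> ball y e" "V ~= {}"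
  and z: "!!p. p : V ==> f p = 0" and p: "x' : ball x e" "y' : ball y e"
 shows "f (x', y') = 0"
proof -
 obtain a c where ac: "(a, c) : V" using V by auto
 obtain d where d: "d > 0" "cball a d \<times> cball c d <= V"
  using open_contains_box2[OF V(1) ac] .
 have "ball a d \<times> ball c d <= ball x e \<times> ball y e"
  using d V by (meson ball_subset_cball Sigma_mono order_trans)
 hence V': "ball a d <= ball x e" "ball c d <= ball y e"
  using d by (auto simp: times_subset_iff)
 have 1: "f (x'', y'') = 0" if "x'' : ball x e" "y'' : ball c d" for x'' y''
  using analytic_continuation_open[of "ball a d" "ball x e" "%x. f (x, y'')" "%_. 0" x''] that V' d z
   holo2_on_slice_fst[OF f, of "ball x e" y'']
  by (auto simp: subset_iff)
 show ?thesis
  using analytic_continuation_open[of "ball c d" "ball y e" "%y. f (x', y)" "%_. 0" y'] p V' d 1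
   holo2_on_slice_snd[OF f, of "ball y e" x']
  by (auto simp: subset_iff)
qed

text \<open>The interior of the zero set is closed in U, because a box around a limit point meets it
  in a nonempty open set.\<close>

proposition holo2_identity:
 assumes U: "open U" "connected U" and f: "holo2_on f U"
  and V: "open V" "V <= U" "V ~= {}" and z: "!!p. p : V ==> f p = 0" and p: "p : U"
 shows "f p = 0"
proof -
 define Z where "Z = interior {p : U. f p = 0}"
 have "V <= Z" unfolding Z_def using V z by (intro interior_maximal) auto
 have "Z <= U" unfolding Z_def using interior_subset by blast
 have ext: "q : Z" if q: "q : U" "q : closure Z" for q
 proof -
  obtain x y where [simp]: "q = (x, y)" by (cases q)
  obtain e where e: "e > 0" "cball x e \<times> cball y e <= U"
   using open_contains_box2[OF U(1)] q by auto
  have ob: "open (ball x e \<times> ball y e)" by (simp add: open_Times)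
  hence ne: "ball x e \<times> ball y e Int Z ~= {}"
   using q e open_Int_closure_eq_empty[OF ob, of Z] by (metis IntI SigmaI \<open>q = (x, y)\<close> centre_in_ball empty_iff)
  have fb: "holo2_on f (ball x e \<times> ball y e)"
   by (rule holo2_on_subset[OF f]) (use e in \<open>auto simp: subset_iff\<close>)
  have "f (x', y') = 0" if "x' : ball x e" "y' : ball y e" for x' y'
  proof (rule holo2_eq_0_box[OF fb _ _ ne _ that])
   show "open (ball x e \<times> ball y e Int Z)" using ob by (auto simp: Z_def)
   show "f p = 0" if "p : ball x e \<times> ball y e Int Z" for p
    using that interior_subset unfolding Z_def by blast
  qed auto
  hence "ball x e \<times> ball y e <= Z"
   unfolding Z_def using e by (intro interior_maximal ob) (auto simp: subset_iff)
  thus ?thesis using e by auto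
 qed
 have "Z = {} \<or> Z = U"
 proof (rule connected_clopen[THEN iffD1, rule_format, OF U(2)], intro conjI)
  show "openin (top_of_set U) Z"
   using \<open>Z <= U\<close> U(1) by (simp add: openin_open_eq Z_def)
  have "Z = U Int closure Z"
   using ext \<open>Z <= U\<close> closure_subset by blast
  thus "closedin (top_of_set U) Z"
   using closedin_closed_Int by (metis closed_closure)
 qed
 hence "Z = U" using \<open>V <= Z\<close> V by auto
 thus ?thesis using p interior_subset unfolding Z_def by blast
qed

section \<open>Line bundles on the Hopf surface and their sections\<close>

lemma inj_on_power_complex:
 fixes q :: complex
 assumes "0 < cmod q" "cmod q < 1" "q ^ m = q ^ n"
 shows "m = n"
proof -
 have "cmod q ^ m = cmod q ^ n" using assms(3) by (metis norm_power)
 thus ?thesis using assms(1,2) by (metis power_inject_exp' less_irrefl linorder_neqE_nat power_strict_decreasing_iff)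
qed

lemma entire_isCont: "h holomorphic_on UNIV ==> isCont h z"
 using holomorphic_on_imp_continuous_on[of h UNIV] continuous_on_eq_continuous_at[of UNIV h] by simp

text \<open>Comparing Taylor coefficients at 0 gives (q^n - \<nu>) a_n = 0, and the powers of q are
  distinct, so at most one coefficient survives.\<close>

lemma entire_eigenfunction:
 assumes q: "0 < cmod q" "cmod q < 1" and h: "h holomorphic_on UNIV"
  and eq: "!!x. x ~= 0 ==> h (q * x) = \<nu> * h x"
 shows "(ALL x. h x = 0) \<or> (EX n c. \<nu> = q ^ n & (ALL x. h x = c * x ^ n))"
proof -
 define a where "a n = (deriv ^^ n) h 0" for n
 have "isCont h 0" using h by (rule entire_isCont)
 \<comment> \<open>The equation is only assumed for nonzero x; its instance at 0 is obtained as a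
   limit.\<close>
 hence 0: "h 0 = \<nu> * h 0"
 proof -
  assume c: "isCont h 0"
  have A: "((%x. h (q * x)) \<longlongrightarrow> h (q * 0)) (at 0)"
   by (rule isCont_tendsto_compose[of _ h]) (use c in \<open>auto intro!: tendsto_eq_intros\<close>)
  have B: "((%x. h (q * x)) \<longlongrightarrow> \<nu> * h 0) (at 0)"
  proof (rule Lim_transform_eventually)
   show "((%x. \<nu> * h x) \<longlongrightarrow> \<nu> * h 0) (at 0)"
    using c by (auto simp: isCont_def intro!: tendsto_intros)
   show "\<forall>\<^sub>F x in at 0. \<nu> * h x = h (q * x)"
    using eq by (auto simp: eventually_at_filter)
  qed
  show ?thesis using tendsto_unique[OF _ A B] by simp
 qed
 have eq': "(%x. h (q * x)) = (%x. \<nu> * h x)"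
  using eq 0 by (metis mult_zero_right)
 have *: "(q ^ n - \<nu>) * a n = 0" for n
 proof -
  have "(deriv ^^ n) (%x. h (q * x)) 0 = q ^ n * a n"
   using higher_deriv_compose_linear[OF h open_UNIV open_UNIV, of 0 q n] by (simp add: a_def)
  moreover have "(deriv ^^ n) (%x. \<nu> * h x) 0 = \<nu> * a n"
   using higher_deriv_cmult[OF h, of 0] by (simp add: a_def)
  ultimately show ?thesis unfolding eq' by (metis cancel_comm_monoid_add_class.diff_cancel left_diff_distrib)
 qed
 have ser: "(%n. a n / fact n * x ^ n) sums h x" for x
  using holomorphic_power_series[of h 0 "cmod x + 1" x] holomorphic_on_subset[OF h]
  by (simp add: a_def)
 show ?thesis
 proof (cases "ALL n. a n = 0")
  case True
  have "h x = 0" for x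
   using ser[of x] True by (simp add: sums_iff)
  thus ?thesis by blast
 next
  case False
  then obtain n where n: "a n ~= 0" by auto
  have \<nu>: "\<nu> = q ^ n" using *[of n] n by simp
  have z: "a m = 0" if "m ~= n" for m
   using *[of m] that inj_on_power_complex[OF q, of m n] \<nu> by auto
  have "h x = a n / fact n * x ^ n" for x
  proof (rule sums_unique2[OF ser])
   show "(%m. a m / fact m * x ^ m) sums (a n / fact n * x ^ n)"
   proof -
    have "(%m. a m / fact m * x ^ m) = (%m. if m = n then a m / fact m * x ^ m else 0)"
     using z by auto
    with sums_single[of n "%m. a m / fact m * x ^ m"] show ?thesis by simp
   qed
  qed
  thus ?thesis using \<nu> by blast
 qed
qed

text \<open>The closed annulus between \<open>cmod q\<close> and 1 meets every orbit of
  multiplication by q in the punctured unit disc.\<close>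

lemma annulus_scaling:
 fixes q :: complex
 assumes q: "0 < cmod q" "cmod q < 1" and x: "x ~= 0" "cmod x <= 1"
 obtains n z where "x = q ^ n * z" "cmod q <= cmod z" "cmod z <= 1"
proof -
 have ex: "EX n. cmod q ^ Suc n <= cmod x"
 proof -
  obtain n where "cmod q ^ n < cmod x"
   using real_arch_pow_inv[of "cmod x" "cmod q"] q x by auto
  moreover have "cmod q ^ Suc n <= cmod q ^ n" using q by (intro power_decreasing) auto
  ultimately show ?thesis by (intro exI[of _ n]) auto
 qed
 define n where "n = (LEAST n. cmod q ^ Suc n <= cmod x)"
 have n: "cmod q ^ Suc n <= cmod x" unfolding n_def using ex by (rule LeastI_ex)
 have n': "cmod x <= cmod q ^ n"
 proof (cases n)
  case 0 thus ?thesis using x by simp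
 next
  case (Suc m)
  hence "~ cmod q ^ Suc m <= cmod x"
   using not_less_Least[of m "%n. cmod q ^ Suc n <= cmod x"] n_def by simp
  thus ?thesis using Suc by simp
 qed
 show ?thesis
 proof
  show "x = q ^ n * (x / q ^ n)" using q by auto
  show "cmod q <= cmod (x / q ^ n)" "cmod (x / q ^ n) <= 1"
   using n n' q by (simp_all add: norm_divide norm_power field_simps)
 qed
qed

text \<open>The growth at 0 is polynomial: f is bounded on a fundamental annulus, and each scaling
  multiplies it by \<mu>. After multiplication by a power of x the singularity is removable and the
  entire case applies; hence the exponent may be negative.\<close>

lemma punctured_eigenfunction:
 assumes q: "0 < cmod q" "cmod q < 1" and f: "f holomorphic_on - {0}"
  and eq: "!!x. x ~= 0 ==> f (q * x) = \<mu> * f x"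
 shows "(ALL x. x ~= 0 --> f x = 0) \<or> (EX m::int. EX c. \<mu> = q powi m & (ALL x. x ~= 0 --> f x = c * x powi m))"
proof -
 have q0: "q ~= 0" using q by auto
 \<comment> \<open>With this \<open>N\<close> the multiplier of x^N f has modulus at most 1, so the
   bound on the annulus spreads to the punctured disc.\<close>
 obtain N where N: "cmod \<mu> * cmod q ^ N <= 1"
 proof -
  have "EX N. cmod q ^ N < 1 / (cmod \<mu> + 1)"
   using q by (intro real_arch_pow_inv) (auto intro: add_nonneg_pos)
  then obtain N where "cmod q ^ N < 1 / (cmod \<mu> + 1)" by auto
  hence "cmod q ^ N * (cmod \<mu> + 1) < 1"
   by (simp add: pos_less_divide_eq add_nonneg_pos)
  hence "cmod \<mu> * cmod q ^ N <= 1" by (simp add: algebra_simps) (smt (verit) q(1) zero_le_power)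
  thus ?thesis by (rule that)
 qed
 define g where "g x = x ^ N * f x" for x
 have geq: "g (q ^ n * x) = (q ^ N * \<mu>) ^ n * g x" if "x ~= 0" for n x
 proof (induction n)
  case (Suc n)
  have "g (q ^ Suc n * x) = (q * (q ^ n * x)) ^ N * f (q * (q ^ n * x))"
   by (simp add: g_def mult.assoc)
  also have "\<dots> = q ^ N * \<mu> * g (q ^ n * x)"
   using q0 that by (subst eq) (auto simp: g_def power_mult_distrib)
  finally show ?case using Suc by simp
 qed simp
 have "compact {z. cmod q <= cmod z & cmod z <= 1}"
 proof -
  have "{z. cmod q <= cmod z & cmod z <= 1} = cball 0 1 - ball 0 (cmod q)" by auto
  thus ?thesis by (simp add: compact_diff)
 qed
 moreover have "continuous_on {z. cmod q <= cmod z & cmod z <= 1} g"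
  unfolding g_def using q
  by (intro continuous_intros continuous_on_subset[OF holomorphic_on_imp_continuous_on[OF f]]) auto
 ultimately have "bounded (g ` {z. cmod q <= cmod z & cmod z <= 1})"
  by (intro compact_imp_bounded compact_continuous_image)
 then obtain C where C: "!!z. cmod q <= cmod z ==> cmod z <= 1 ==> cmod (g z) <= C"
  unfolding bounded_iff by auto
 have bd: "cmod (g x) <= C" if x: "x ~= 0" "cmod x <= 1" for x
 proof -
  obtain n z where z: "x = q ^ n * z" "cmod q <= cmod z" "cmod z <= 1"
   using annulus_scaling[OF q x] .
  have "cmod (g x) = cmod (q ^ N * \<mu>) ^ n * cmod (g z)"
   using geq[of z n] z x by (auto simp: norm_mult norm_power)
  also have "\<dots> <= 1 * C"
   using N C[OF z(2,3)] by (intro mult_mono power_le_one) (auto simp: norm_mult norm_power mult.commute)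
  finally show ?thesis by simp
 qed
 \<comment> \<open>One more factor x forces the limit 0 at the origin, so boundedness of
   \<open>g\<close> is enough to remove the singularity.\<close>
 define h where "h x = (if x = 0 then 0 else x * g x)" for x
 have "h holomorphic_on UNIV"
 proof (rule no_isolated_singularity'[of "{0}"])
  have "h holomorphic_on - {0} \<longleftrightarrow> (%x. x * (x ^ N * f x)) holomorphic_on - {0}"
   by (rule holomorphic_cong) (auto simp: h_def g_def)
  moreover have "(%x. x * (x ^ N * f x)) holomorphic_on - {0}"
   by (intro holomorphic_on_mult holomorphic_on_power holomorphic_on_ident f)
  ultimately show "h holomorphic_on UNIV - {0}"
   by (simp add: Compl_eq_Diff_UNIV)
  fix z :: complex assume "z : {0}"
  have "(h \<longlongrightarrow> 0) (at 0)"
  proof (rule Lim_null_comparison)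
   show "\<forall>\<^sub>F x in at 0. norm (h x) <= norm x * \<bar>C\<bar>"
   proof -
    have "\<forall>\<^sub>F x in at (0::complex). x : ball 0 1 - {0}"
     by (intro eventually_at_in_open) auto
    thus ?thesis
    proof (rule eventually_mono)
     fix x :: complex assume x: "x : ball 0 1 - {0}"
     hence "cmod (g x) <= \<bar>C\<bar>" using bd[of x] by auto
     thus "norm (h x) <= norm x * \<bar>C\<bar>" using x by (simp add: h_def norm_mult mult_left_mono)
    qed
   qed
   have "((%x::complex. norm x * \<bar>C\<bar>) \<longlongrightarrow> norm (0::complex) * \<bar>C\<bar>) (at 0)"
    by (intro tendsto_intros)
   thus "((%x::complex. norm x * \<bar>C\<bar>) \<longlongrightarrow> 0) (at 0)" by simp
  qed
  thus "(h \<longlongrightarrow> h z) (at z)" using \<open>z : {0}\<close> h_def by simp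
 qed auto
 moreover have "h (q * x) = (q ^ Suc N * \<mu>) * h x" if "x ~= 0" for x
  using geq[OF that, of 1] that q0 by (simp add: h_def)
 ultimately consider "ALL x. h x = 0" | n c where "q ^ Suc N * \<mu> = q ^ n" "ALL x. h x = c * x ^ n"
  using entire_eigenfunction[OF q] by meson
 thus ?thesis
 proof cases
  case 1
  hence "f x = 0" if "x ~= 0" for x
   using that by (metis h_def g_def mult_eq_0_iff power_eq_0_iff)
  thus ?thesis by blast
 next
  case (2 n c)
  let ?m = "int n - int (Suc N)"
  have "q powi ?m = q ^ n / q ^ Suc N"
   using q0 by (subst power_int_diff) (simp_all del: of_nat_Suc power_Suc)
  hence "\<mu> = q powi ?m"
   using 2(1) q0 by (metis nonzero_mult_div_cancel_left power_not_zero)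
  moreover have "f x = c * x powi ?m" if "x ~= 0" for x
  proof -
   have "x ^ Suc N * f x = c * x ^ n" using 2(2) that by (metis h_def g_def mult.assoc power_Suc)
   hence "f x = c * (x ^ n / x ^ Suc N)" using that by (simp add: divide_simps mult.commute del: power_Suc)
   moreover have "x powi ?m = x ^ n / x ^ Suc N"
    using that by (subst power_int_diff) (simp_all del: of_nat_Suc power_Suc)
   ultimately show ?thesis by simp
  qed
  ultimately show ?thesis by blast
 qed
qed

section \<open>The punctured plane and the contraction\<close>

lemma open_C2_star [simp]: "open C2_star"
 unfolding C2_star_def by (intro open_Diff) auto

text \<open>Used whenever an identity has been divided by a power of y and is therefore known only
  off the curve y = 0.\<close>

lemma eq_on_axis:
 fixes f g :: "C2 => 'a::t2_space"
 assumes "isCont f (x, 0)" "isCont g (x, 0)" "open U" "(x, 0) : U"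
  "!!q. q : U ==> snd q ~= 0 ==> f q = g q"
 shows "f (x, 0) = g (x, 0)"
proof -
 have t: "((%y::complex. (x, y)) \<longlongrightarrow> (x, 0)) (at 0)"
  by (intro tendsto_intros)
 have "\<forall>\<^sub>F y in at (0::complex). (x, y) : U"
  using topological_tendstoD[OF t assms(3,4)] .
 moreover have "\<forall>\<^sub>F y in at (0::complex). y ~= 0"
  by (simp add: eventually_at_filter)
 ultimately have "\<forall>\<^sub>F y in at (0::complex). f (x, y) = g (x, y)"
  by eventually_elim (use assms(5) in auto)
 hence "((%y. g (x, y)) \<longlongrightarrow> f (x, 0)) (at 0)"
  by (rule Lim_transform_eventually[OF isCont_tendsto_compose[OF assms(1) t]])
 from tendsto_unique[OF _ this isCont_tendsto_compose[OF assms(2) t]] show ?thesis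
  by simp
qed

text \<open>By the maximum principle on the coordinate discs there is no blow-up at the puncture.\<close>

lemma holo2_bounded_near_0:
 assumes f: "holo2_on f C2_star"
 obtains C where "!!x y. (x, y) : C2_star ==> cmod x <= 1 ==> cmod y <= 1 ==> cmod (f (x, y)) <= C"
proof -
 let ?S = "sphere 0 1 \<times> cball 0 1 Un cball 0 1 \<times> sphere (0::complex) 1 :: C2 set"
 have "compact ?S" by (intro compact_Un compact_Times) auto
 moreover have "continuous_on ?S f"
  by (rule continuous_on_subset[OF holo2_on_continuous_on[OF f]]) (auto simp: C2_star_def)
 ultimately have "bounded (f ` ?S)" by (intro compact_imp_bounded compact_continuous_image)
 then obtain C where C: "!!p. p : ?S ==> cmod (f p) <= C"
  unfolding bounded_iff by auto
 have max: "cmod (h z) <= C"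
  if h: "h holomorphic_on cball 0 1" and "!!z. z : sphere 0 1 ==> cmod (h z) <= C" "cmod z <= 1"
  for h :: "complex => complex" and z
 proof (rule maximum_modulus_frontier[of h "cball 0 1"])
  show "h holomorphic_on interior (cball 0 1)"
   using h by (rule holomorphic_on_subset) auto
  show "continuous_on (closure (cball 0 1)) h"
   using h by (auto intro: holomorphic_on_imp_continuous_on)
 qed (use that in auto)
 show ?thesis
 proof
  fix x y :: complex assume xy: "(x, y) : C2_star" "cmod x <= 1" "cmod y <= 1"
  show "cmod (f (x, y)) <= C"
  proof (cases "y = 0")
   case False
   hence "(%x. f (x, y)) holomorphic_on cball 0 1"
    by (intro holo2_on_slice_fst[OF f]) (auto simp: C2_star_def)
   from max[OF this, of x] show ?thesis using xy C by auto
  next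
   case True
   hence "x ~= 0" using xy by (auto simp: C2_star_def)
   hence "(%y. f (x, y)) holomorphic_on cball 0 1"
    by (intro holo2_on_slice_snd[OF f]) (auto simp: C2_star_def)
   from max[OF this, of y] show ?thesis using xy C by auto
  qed
 qed
qed

locale hopf =
 fixes b :: complex and r :: nat
 assumes b: "0 < cmod b" "cmod b < 1" and r: "1 <= r"
begin

abbreviation F :: "C2 => C2" where "F \<equiv> contraction b r"

lemma b0 [simp]: "b ~= 0" using b by auto

lemma br: "0 < cmod (b ^ r)" "cmod (b ^ r) < 1"
 using b r by (auto simp: norm_power power_less_one_iff)

lemma F_eq: "F (x, y) = (b ^ r * x + y ^ r, b * y)"
 by (simp add: contraction_def)

lemma snd_F [simp]: "snd (F p) = b * snd p"
 by (cases p) (simp add: F_eq)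

lemma F_C2_star [simp]: "F p : C2_star \<longleftrightarrow> p : C2_star"
 using r by (cases p) (auto simp: F_eq C2_star_def power_0_left)

lemma holo2_at_F: "holo2_at f (F p) ==> holo2_at (%q. f (F q)) p"
proof -
 assume f: "holo2_at f (F p)"
 have 1: "holo2_at (%p. b ^ r * fst p + snd p ^ r) p" "holo2_at (%p. b * snd p) p"
  by (intro holo2_at_intros)+
 have "holo2_at (%p. f (b ^ r * fst p + snd p ^ r, b * snd p)) p"
  by (rule holo2_at_compose2[OF 1]) (use f in \<open>simp add: contraction_def case_prod_unfold\<close>)
 thus ?thesis by (simp add: contraction_def case_prod_unfold)
qed

lemma isCont_F: "isCont F p"
 unfolding contraction_def case_prod_unfold by (intro continuous_intros)

lemma F_power: "(F ^^ n) (x, y) = (b ^ (r * n) * (x + of_nat n * y ^ r / b ^ r), b ^ n * y)"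
proof (induction n)
 case (Suc n)
 have "(b ^ n) ^ r = b ^ (r * n)" by (metis mult.commute power_mult)
 thus ?case using Suc
  by (simp add: F_eq power_add power_mult_distrib field_simps)
qed simp

lemma F_power_C2_star: "(F ^^ n) p : C2_star \<longleftrightarrow> p : C2_star"
 by (induction n) auto

lemma F_power_tendsto_0: "(%n. (F ^^ n) p) \<longlonglongrightarrow> (0, 0)"
proof (cases p)
 case (Pair x y)
 have b1: "(%n. b ^ n) \<longlonglongrightarrow> 0" using b by (intro LIMSEQ_power_zero) auto
 have q1: "(%n. (b ^ r) ^ n) \<longlonglongrightarrow> 0" using br by (intro LIMSEQ_power_zero) auto
 have q2: "(%n. of_nat n * (b ^ r) ^ n) \<longlonglongrightarrow> 0"
  using br by (intro powser_times_n_limit_0) auto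
 have "(%n. (b ^ r) ^ n * x + of_nat n * (b ^ r) ^ n * (y ^ r / b ^ r)) \<longlonglongrightarrow> 0 * x + 0 * (y ^ r / b ^ r)"
  by (intro tendsto_intros q1 q2)
 hence "(%n. (b ^ r) ^ n * (x + of_nat n * y ^ r / b ^ r)) \<longlonglongrightarrow> 0"
  by (simp add: algebra_simps del: power_mult)
 hence "(%n. b ^ (r * n) * (x + of_nat n * y ^ r / b ^ r)) \<longlonglongrightarrow> 0"
  by (simp add: power_mult)
 moreover have "(%n. b ^ n * y) \<longlonglongrightarrow> 0 * y"
  by (intro tendsto_intros b1)
 ultimately have "(%n. (b ^ (r * n) * (x + of_nat n * y ^ r / b ^ r), b ^ n * y)) \<longlonglongrightarrow> (0, 0)"
  by (intro tendsto_Pair) auto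
 thus ?thesis unfolding Pair F_power .
qed

text \<open>The forward orbit tends to the puncture, near which f is bounded, while the values along
  it grow like \<tau>^n.\<close>

lemma section_negative_eq_0:
 assumes f: "holo2_on f C2_star" and eq: "!!p. p : C2_star ==> f (F p) = \<tau> * f p"
  and \<tau>: "cmod \<tau> > 1" and p: "p : C2_star"
 shows "f p = 0"
proof (rule ccontr)
 assume nz: "f p ~= 0"
 obtain C where C: "!!x y. (x, y) : C2_star ==> cmod x <= 1 ==> cmod y <= 1 ==> cmod (f (x, y)) <= C"
  using holo2_bounded_near_0[OF f] by blast
 have it: "f ((F ^^ n) p) = \<tau> ^ n * f p" for n
  by (induction n) (use eq F_power_C2_star p in auto)
 have "\<forall>\<^sub>F n in sequentially. (F ^^ n) p : ball 0 1 \<times> ball 0 1"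
  by (rule topological_tendstoD[OF F_power_tendsto_0]) (auto simp: open_Times)
 hence "\<forall>\<^sub>F n in sequentially. cmod (f ((F ^^ n) p)) <= C"
 proof eventually_elim
  case (elim n)
  thus ?case
   using C[of "fst ((F ^^ n) p)" "snd ((F ^^ n) p)"] p F_power_C2_star[of n p]
   by (auto simp: mem_Times_iff)
 qed
 hence "EX N. ALL n>=N. cmod \<tau> ^ n * cmod (f p) <= C"
  unfolding eventually_sequentially it norm_mult norm_power .
 then obtain N where N: "!!n. n >= N ==> cmod \<tau> ^ n * cmod (f p) <= C"
  by blast
 obtain m where "C / cmod (f p) < cmod \<tau> ^ m"
  using real_arch_pow[OF \<tau>] by blast
 moreover have "cmod \<tau> ^ m <= cmod \<tau> ^ (max m N)"
  using \<tau> by (intro power_increasing) auto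
 ultimately have "C < cmod \<tau> ^ (max m N) * cmod (f p)"
  using nz by (simp add: pos_divide_less_eq order.strict_trans2 mult_right_mono)
 thus False using N[of "max m N"] by simp
qed

text \<open>Differentiation in x turns a solution for \<tau> into one for \<tau>/b^r, of larger
  modulus, so induction ends at multipliers of modulus above 1, where only 0 is left. A derivative c
  y^m integrates to c y^m x + h(y), and c has to vanish.\<close>

proposition section_eq_monomial:
 assumes f: "holo2_on f C2_star" and eq: "!!p. p : C2_star ==> f (F p) = \<tau> * f p"
 shows "(ALL p:C2_star. f p = 0) \<or> (EX n c. \<tau> = b ^ n & (ALL p:C2_star. f p = c * snd p ^ n))"
proof (cases "\<tau> = 0")
 case True
 have "f p = 0" if "p : C2_star" for p
 proof -
  obtain x y where p: "p = (x, y)" by (cases p)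
  \<comment> \<open>The preimage of \<open>p\<close>: F is surjective, so \<tau> = 0 leaves only f =
    0.\<close>
  define q where "q = ((x - (y / b) ^ r) / b ^ r, y / b)"
  have "F q = p" by (simp add: q_def F_eq p)
  thus ?thesis using eq[of q] that True F_C2_star[of q] by simp
 qed
 thus ?thesis by blast
next
 case False
 have ind: "(ALL p:C2_star. f p = 0) \<or> (EX n c. \<tau> = b ^ n & (ALL p:C2_star. f p = c * snd p ^ n))"
  if "cmod b ^ N < cmod \<tau>" "holo2_on f C2_star" "!!p. p : C2_star ==> f (F p) = \<tau> * f p" for N f \<tau>
  using that
 proof (induction N arbitrary: f \<tau>)
  case 0
  have "1 < cmod \<tau>" using 0(1) by simp
  from section_negative_eq_0[OF 0(2,3) this] show ?case by blast
 next
  case (Suc N)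
  note f = Suc.prems(2) and eq = Suc.prems(3)
  define fx where "fx = (%(x, y). deriv (%x. f (x, y)) x)"
  have fxd: "((%x. f (x, y)) has_field_derivative fx (x, y)) (at x)" if "(x, y) : C2_star" for x y
   using holo2_at_slice_fst[of f x y] f that
   by (simp add: fx_def holo2_on_iff field_differentiable_derivI)
  have "holo2_on fx C2_star" unfolding fx_def by (rule holo2_on_deriv_fst[OF _ f]) simp
  moreover have "fx (F p) = \<tau> / b ^ r * fx p" if "p : C2_star" for p
  proof -
   obtain x y where p: "p = (x, y)" by (cases p)
   have 1: "((%x. f (b ^ r * x + y ^ r, b * y)) has_field_derivative fx (F p) * b ^ r) (at x)"
   proof (rule DERIV_chain2[of "%x. f (x, b * y)"])
    show "((%x. f (x, b * y)) has_field_derivative fx (F p)) (at (b ^ r * x + y ^ r))"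
     using fxd[of "b ^ r * x + y ^ r" "b * y"] F_C2_star[of p] that by (simp add: p F_eq)
    show "((%x. b ^ r * x + y ^ r) has_field_derivative b ^ r) (at x)"
     by (auto intro!: derivative_eq_intros)
   qed
   have 2: "((%x. \<tau> * f (x, y)) has_field_derivative \<tau> * fx p) (at x)"
    using fxd[of x y] that p by (auto intro!: derivative_eq_intros)
   have "((%x. f (b ^ r * x + y ^ r, b * y)) has_field_derivative \<tau> * fx p) (at x)"
   proof (rule has_field_derivative_transform_within_open[OF 2 open_slice_fst[OF open_C2_star, of y]])
    show "x : {x. (x, y) : C2_star}" using that p by simp
    show "\<tau> * f (x, y) = f (b ^ r * x + y ^ r, b * y)" if "x : {x. (x, y) : C2_star}" for x
     using eq[of "(x, y)"] that by (simp add: F_eq)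
   qed
   from DERIV_unique[OF 1 this] show ?thesis by (simp add: field_simps)
  qed
  moreover have "cmod b ^ N < cmod (\<tau> / b ^ r)"
  proof -
   have "cmod b ^ N * cmod b ^ r <= cmod b ^ N * cmod b ^ 1"
    using b r by (intro mult_left_mono power_decreasing) auto
   also have "\<dots> < cmod \<tau>" using Suc.prems(1) by (simp add: mult.commute)
   finally show ?thesis using b by (simp add: norm_divide norm_power pos_less_divide_eq)
  qed
  ultimately have "(ALL p:C2_star. fx p = 0) \<or> (EX n c. \<tau> / b ^ r = b ^ n & (ALL p:C2_star. fx p = c * snd p ^ n))"
   by (intro Suc.IH)
  then obtain m c where mc: "c = 0 \<or> \<tau> = b ^ (m + r)" "!!p. p : C2_star ==> fx p = c * snd p ^ m"
  proof
   assume "ALL p:C2_star. fx p = 0"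
   thus ?thesis by (intro that[of 0]) auto
  next
   assume "EX n c. \<tau> / b ^ r = b ^ n & (ALL p:C2_star. fx p = c * snd p ^ n)"
   thus ?thesis using that by (auto simp: field_simps power_add)
  qed
  define h where "h y = f (1, y) - c * y ^ m" for y
  have h: "h holomorphic_on UNIV"
   unfolding h_def by (intro holomorphic_intros holo2_on_slice_snd[OF f]) (simp add: C2_star_def)
  have fh1: "f (x, y) = c * y ^ m * x + h y" if "y ~= 0" for x y
  proof -
   have d: "((%x. f (x, y) - c * y ^ m * x) has_field_derivative 0) (at x)" for x
   proof -
    have "((%x. f (x, y) - c * y ^ m * x) has_field_derivative fx (x, y) - c * y ^ m * 1) (at x)"
    proof (rule DERIV_diff[OF fxd])
     show "(x, y) : C2_star" using that by (simp add: C2_star_def)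
     show "((%x. c * y ^ m * x) has_field_derivative c * y ^ m * 1) (at x)"
      by (rule DERIV_cmult[OF DERIV_ident])
    qed
    thus ?thesis using mc(2)[of "(x, y)"] that by (simp add: C2_star_def)
   qed
   obtain k where "ALL x. f (x, y) - c * y ^ m * x = k"
    using has_field_derivative_zero_constant[of UNIV "%x. f (x, y) - c * y ^ m * x"] d by auto
   hence "f (x, y) - c * y ^ m * x = f (1, y) - c * y ^ m * 1" by metis
   thus ?thesis by (simp add: h_def algebra_simps)
  qed
  have heq: "h (b * y) = \<tau> * h y - c * b ^ m * y ^ (m + r)" if "y ~= 0" for y
  proof -
   have "f (F (0, y)) = \<tau> * f (0, y)" using that by (intro eq) (simp add: C2_star_def)
   thus ?thesis
    using that by (simp add: F_eq fh1 power_mult_distrib power_add algebra_simps)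
  qed
  \<comment> \<open>On y = 0 the line is punctured and was left out of the integration in x; the
    formula extends to it by continuity.\<close>
  have fh: "f p = c * snd p ^ m * fst p + h (snd p)" if p: "p : C2_star" for p
  proof (cases "snd p = 0")
   case False thus ?thesis using fh1[of "snd p" "fst p"] by simp
  next
   case True
   then obtain x where [simp]: "p = (x, 0)" by (cases p) auto
   have "isCont h 0" using h by (rule entire_isCont)
   hence A: "isCont (%p. c * snd p ^ m * fst p + h (snd p)) (x, 0)"
    by (intro continuous_intros isCont_o2[of _ snd h]) auto
   have B: "isCont f (x, 0)" using f p by (auto simp: holo2_on_iff intro: holo2_at_continuous)
   have "f q = c * snd q ^ m * fst q + h (snd q)" if "snd q ~= 0" for q
    using fh1[OF that, of "fst q"] by simp
   with eq_on_axis[OF B A open_UNIV] show ?thesis by simp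
  qed
  \<comment> \<open>The term c y^m x contributes c b^m y^(m+r) to the equation for h. If c were
    nonzero, \<tau> would equal b^(m+r), the coefficients of h in that degree would cancel, and
    nothing would balance this term.\<close>
  have "c = 0"
  proof (rule ccontr)
   assume c: "c ~= 0"
   define M where "M = m + r"
   have \<tau>: "\<tau> = b ^ M" using mc(1) c by (simp add: M_def)
   have M: "M >= 1" using r by (simp add: M_def)
   have h0: "h (b * 0) = \<tau> * h 0 - c * b ^ m * 0 ^ M"
   proof -
    have cont: "isCont h 0" using h by (rule entire_isCont)
    have "isCont (%p. h (b * snd p)) ((1::complex), 0)" "isCont (%p. \<tau> * h (snd p) - c * b ^ m * snd p ^ M) ((1::complex), 0)"
     using cont by (auto intro!: continuous_intros isCont_o2[of _ snd h] isCont_o2[of _ "%p. b * snd p" h])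
    from eq_on_axis[OF this open_UNIV] show ?thesis using heq by (simp add: M_def)
   qed
   have "h (b * y) = \<tau> * h y - c * b ^ m * y ^ M" for y
    using h0 heq[of y] by (cases "y = 0") (auto simp: M_def)
   hence "(%y. h (b * y)) = (%y. \<tau> * h y - (c * b ^ m) * y ^ M)" by auto
   moreover have "(deriv ^^ M) (%y. h (b * y)) 0 = b ^ M * (deriv ^^ M) h 0"
    using higher_deriv_compose_linear[OF h open_UNIV open_UNIV, of 0 b M] by simp
   moreover have "(deriv ^^ M) (%y. \<tau> * h y - (c * b ^ m) * y ^ M) 0
     = \<tau> * (deriv ^^ M) h 0 - (c * b ^ m) * (deriv ^^ M) (%y. y ^ M) 0"
    using h by (subst higher_deriv_diff[of _ UNIV]) (auto intro!: holomorphic_intros simp: higher_deriv_cmult[of _ UNIV] holomorphic_intros)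
   moreover have "(deriv ^^ M) (%y::complex. y ^ M) 0 = fact M"
    using higher_deriv_power[of M 0 M "0::complex"] by (simp add: pochhammer_fact)
   ultimately show False using \<tau> c by simp
  qed
  hence "h (b * y) = \<tau> * h y" if "y ~= 0" for y using heq[OF that] by simp
  from entire_eigenfunction[OF b h this] show ?case
   using fh \<open>c = 0\<close> by auto
 qed
 obtain N where "cmod b ^ N < cmod \<tau>"
  using real_arch_pow_inv[of "cmod \<tau>" "cmod b"] False b by auto
 thus ?thesis by (rule ind[OF _ f eq])
qed

end

section \<open>The additive Cousin problem on products of rectangles and square annuli\<close>

lemma compact_open_box:
 fixes C :: "('a::heine_borel \<times> 'b::heine_borel) set"
 assumes "compact C" "open G" "C <= G"
 obtains e where "e > 0"
  "!!x y x' y'. (x, y) : C ==> dist x x' < e ==> dist y y' < e ==> (x', y') : G"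
proof -
 have "EX d>0. ALL p:C. ALL q:- G. d <= dist p q"
  using assms by (intro separate_compact_closed) auto
 then obtain d where d: "d > 0" "!!p q. p : C ==> q : - G ==> d <= dist p q"
  by blast
 show ?thesis
 proof (rule that[of "d / 2"])
  fix x y x' y' assume xy: "(x, y) : C" "dist x x' < d / 2" "dist y y' < d / 2"
  have "dist (x, y) (x', y') <= dist x x' + dist y y'"
   by (simp add: dist_Pair_Pair sqrt_sum_squares_le_sum)
  thus "(x', y') : G" using d(2)[OF xy(1), of "(x', y')"] xy by force
 qed (use d in auto)
qed

section \<open>Cauchy transforms along the sides of a rectangle\<close>

text \<open>The sides are ordered and oriented as in \<open>rectpath a c\<close>. They are kept
  apart because each transform is singular only along its own side.\<close>

definition edge :: "complex => complex => nat => complex \<times> complex" where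
 "edge a c k = (let a2 = Complex (Re c) (Im a); a4 = Complex (Re a) (Im c) in
  if k = 0 then (a, a2) else if k = 1 then (a2, c) else if k = 2 then (c, a4) else (a4, a))"

definition edge_set :: "complex => complex => nat => complex set" where
 "edge_set a c k = closed_segment (fst (edge a c k)) (snd (edge a c k))"

lemma in_edge_set:
 assumes "Re a <= Re c" "Im a <= Im c"
 shows "z : edge_set a c k \<longleftrightarrow>
  (if k = 0 then Re a <= Re z & Re z <= Re c & Im z = Im a
  else if k = 1 then Re z = Re c & Im a <= Im z & Im z <= Im c
  else if k = 2 then Re a <= Re z & Re z <= Re c & Im z = Im c
  else Re z = Re a & Im a <= Im z & Im z <= Im c)"
 using assms by (auto simp: edge_set_def edge_def Let_def closed_segment_same_Re closed_segment_same_Im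
   closed_segment_eq_real_ivl split: if_splits)

abbreviation edge_transform :: "(C2 => complex) => complex \<times> complex => nat => C2 => complex" where
 "edge_transform g rh k \<equiv> cauchy_transform (linepath (fst (edge (fst rh) (snd rh) k)) (snd (edge (fst rh) (snd rh) k))) g"

lemma sum_edge_transform:
 assumes "Re a < Re c" "Im a < Im c" and holo: "(%w. g (w, y)) holomorphic_on cbox a c"
 shows "x : box a c ==> (\<Sum>k<4. edge_transform g (a, c) k (x, y)) = g (x, y)"
  and "x \<notin> cbox a c ==> (\<Sum>k<4. edge_transform g (a, c) k (x, y)) = 0"
proof -
 let ?h = "%w. g (w, y) / (w - x)"
 define a2 where "a2 = Complex (Re c) (Im a)"
 define a4 where "a4 = Complex (Re a) (Im c)"
 have sub: "path_image (rectpath a c) <= cbox a c"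
  using assms by (intro path_image_rectpath_subset_cbox) auto
 have sum: "(\<Sum>k<4. edge_transform g (a, c) k (x, y)) = contour_integral (rectpath a c) ?h / (2 * of_real pi * \<i>)"
  if x: "x \<notin> path_image (rectpath a c)"
 proof -
  have "continuous_on (path_image (rectpath a c)) ?h"
   using x holomorphic_on_imp_continuous_on[OF holo] sub
   by (intro continuous_intros) (auto intro: continuous_on_subset)
  moreover have pi: "path_image (rectpath a c) = closed_segment a a2 Un closed_segment a2 c Un closed_segment c a4 Un closed_segment a4 a"
   by (simp add: rectpath_def Let_def path_image_join Un_assoc a2_def a4_def)
  ultimately have i: "?h contour_integrable_on linepath a a2" "?h contour_integrable_on linepath a2 c"
   "?h contour_integrable_on linepath c a4" "?h contour_integrable_on linepath a4 a"
   by (auto intro!: contour_integrable_continuous_linepath elim: continuous_on_subset)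
  have "contour_integral (rectpath a c) ?h = contour_integral (linepath a a2) ?h + (contour_integral (linepath a2 c) ?h
    + (contour_integral (linepath c a4) ?h + contour_integral (linepath a4 a) ?h))"
   using i by (simp add: rectpath_def Let_def flip: a2_def a4_def)
  moreover have "{..<4::nat} = {0, 1, 2, 3}" by auto
  ultimately show ?thesis
   by (simp add: cauchy_transform_def edge_def Let_def add_divide_distrib flip: a2_def a4_def)
 qed
 show "(\<Sum>k<4. edge_transform g (a, c) k (x, y)) = g (x, y)" if x: "x : box a c"
 proof -
  have nx: "x \<notin> path_image (rectpath a c)"
   using x assms by (simp add: path_image_rectpath_cbox_minus_box)
  have "(?h has_contour_integral (2 * pi * \<i> * winding_number (rectpath a c) x * g (x, y))) (rectpath a c)"
   by (rule Cauchy_integral_formula_convex_simple[OF convex_box(1) holo])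
    (use x sub nx in \<open>auto simp: interior_cbox\<close>)
  hence "contour_integral (rectpath a c) ?h = 2 * pi * \<i> * g (x, y)"
   using winding_number_rectpath[OF x] by (simp add: contour_integral_unique)
  thus ?thesis using sum[OF nx] by simp
 qed
 show "(\<Sum>k<4. edge_transform g (a, c) k (x, y)) = 0" if x: "x \<notin> cbox a c"
 proof -
  have "?h holomorphic_on cbox a c"
   using x by (intro holomorphic_intros holo) auto
  hence "(?h has_contour_integral 0) (rectpath a c)"
   using sub by (intro Cauchy_theorem_convex_simple[OF _ convex_box(1)]) auto
  thus ?thesis using sum x sub by (auto simp: contour_integral_unique)
 qed
qed

section \<open>Additive Cousin data and the merging of two solutions\<close>

text \<open>Neither \<open>u\<close> nor the local functions \<open>v\<close> need any regularity;
  only their differences are holomorphic. Later they measure holomorphic lifts against an arbitrary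
  set-theoretic one.\<close>

definition fits :: "(C2 set \<times> (C2 => complex)) set => C2 set => (C2 => complex) => bool" where
 "fits D U u \<longleftrightarrow> (ALL (V, v):D. holo2_on (%p. u p - v p) (U Int V))"

definition cousin_data :: "(C2 set \<times> (C2 => complex)) set => bool" where
 "cousin_data D \<longleftrightarrow> (ALL (V, v):D. open V & fits D V v)"

text \<open>The solution lives on a neighbourhood of K, so that compactness of K leaves room for
  merging.\<close>

definition cousin_solvable :: "(C2 set \<times> (C2 => complex)) set => C2 set => bool" where
 "cousin_solvable D K \<longleftrightarrow> (EX U u. open U & K <= U & U <= \<Union>(fst ` D) & fits D U u)"

lemma fits_at:
 "fits D U u \<longleftrightarrow> (ALL p:U. ALL (V, v):D. p : V --> holo2_at (%p. u p - v p) p)"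
 by (auto simp: fits_def holo2_on_iff)

lemma fits_atD:
 assumes "fits D U u" "p : U" "(V, v) : D" "p : V"
 shows "holo2_at (%p. u p - v p) p"
 using bspec[OF bspec[OF assms(1)[unfolded fits_at] assms(2)] assms(3)] assms(4) by simp

lemma fits_atI:
 assumes "!!p V v. p : U ==> (V, v) : D ==> p : V ==> holo2_at (%p. u p - v p) p"
 shows "fits D U u"
 unfolding fits_at by (intro ballI, clarify) (rule assms)

lemma fits_subset: "fits D U u ==> V <= U ==> fits D V u"
 unfolding fits_at by blast

lemma fits_diff:
 assumes "fits D U u" "fits D U' u'" "U Int U' <= \<Union>(fst ` D)"
 shows "holo2_on (%p. u p - u' p) (U Int U')"
 unfolding holo2_on_iff
proof
 fix p assume p: "p : U Int U'"
 with assms(3) have "p : \<Union>(fst ` D)" by blast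
 then obtain V v where V: "(V, v) : D" "p : V" by auto
 have "holo2_at (%p. (u p - v p) - (u' p - v p)) p"
  by (rule holo2_at_diff[OF fits_atD[OF assms(1) _ V] fits_atD[OF assms(2) _ V]]) (use p in simp_all)
 thus "holo2_at (%p. u p - u' p) p" by simp
qed

lemma fits_add:
 assumes "fits D U u" "holo2_on h U"
 shows "fits D U (%p. u p + h p)"
proof (rule fits_atI)
 fix p V v assume p: "p : U" "(V, v) : D" "p : V"
 have "holo2_at h p" using assms(2) p(1) by (simp add: holo2_on_iff)
 with fits_atD[OF assms(1) p] have "holo2_at (%p. (u p - v p) + h p) p"
  by (rule holo2_at_add)
 thus "holo2_at (%p. u p + h p - v p) p" by (simp add: algebra_simps)
qed

lemma fits_cong:
 assumes "fits D U u" "open U" "!!p. p : U ==> u p = u' p"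
 shows "fits D U u'"
proof (rule fits_atI)
 fix p V v assume p: "p : U" "(V, v) : D" "p : V"
 show "holo2_at (%p. u' p - v p) p"
  by (rule holo2_at_transform[OF fits_atD[OF assms(1) p] assms(2) p(1)]) (simp add: assms(3))
qed

lemma fits_Un: "fits D U u ==> fits D V u ==> fits D (U Un V) u"
 unfolding fits_at by blast

lemma fits_glue:
 assumes "fits D U u" "fits D U' u'" "open U" "open U'" "!!p. p : U Int U' ==> u p = u' p"
 shows "fits D (U Un U') (%p. if p : U then u p else u' p)"
proof (rule fits_Un)
 show "fits D U (%p. if p : U then u p else u' p)"
  by (rule fits_cong[OF assms(1,3)]) auto
 show "fits D U' (%p. if p : U then u p else u' p)"
  by (rule fits_cong[OF assms(2,4)]) (use assms(5) in auto)
qed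

lemma cousin_solvable_point:
 assumes "cousin_data D" "p : \<Union>(fst ` D)"
 shows "cousin_solvable D {p}"
proof -
 obtain V v where V: "(V, v) : D" "p : V" using assms(2) by auto
 hence "open V" "fits D V v" using assms(1) by (auto simp: cousin_data_def)
 moreover have "V <= \<Union>(fst ` D)" using V by force
 ultimately show ?thesis unfolding cousin_solvable_def using V by blast
qed

text \<open>The corrected functions \<open>u1 + h1\<close> and \<open>u2 - h2\<close> agree on
  \<open>O'\<close>. Outside \<open>O'\<close> the two compact sets are disjoint and can be
  separated, so the shrunken neighbourhoods meet only inside \<open>O'\<close>.\<close>

lemma cousin_merge:
 assumes K: "compact K1" "compact K2"
  and 1: "open U1" "K1 <= U1" "U1 <= \<Union>(fst ` D)" "fits D U1 u1"
  and 2: "open U2" "K2 <= U2" "U2 <= \<Union>(fst ` D)" "fits D U2 u2"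
  and O: "open O'" "K1 Int K2 <= O'" "O' <= U1 Int U2"
  and W1: "open W1" "K1 Un O' <= W1" "holo2_on h1 W1"
  and W2: "open W2" "K2 Un O' <= W2" "holo2_on h2 W2"
  and eq: "!!p. p : O' ==> u2 p - u1 p = h1 p + h2 p"
 shows "cousin_solvable D (K1 Un K2)"
proof -
 have "compact (K1 - O')" "compact (K2 - O')" "(K1 - O') Int (K2 - O') = {}"
  using K O by (auto simp: compact_diff)
 then obtain N1 N2 where N: "open N1" "open N2" "K1 - O' <= N1" "K2 - O' <= N2" "N1 Int N2 = {}"
  using separation_normal[of "K1 - O'" "K2 - O'"] compact_imp_closed by metis
 define V1 where "V1 = (O' Un N1) Int U1 Int W1"
 define V2 where "V2 = (O' Un N2) Int U2 Int W2"
 have V: "open V1" "open V2" "K1 <= V1" "K2 <= V2" "V1 Int V2 <= O'"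
  using N 1 2 W1 W2 O unfolding V1_def V2_def by auto
 have f1: "fits D V1 (%p. u1 p + h1 p)"
  by (rule fits_add[OF fits_subset[OF 1(4)] holo2_on_subset[OF W1(3)]]) (auto simp: V1_def)
 have "holo2_on (%p. - h2 p) V2"
  using W2(3) unfolding holo2_on_iff V2_def by (auto intro: holo2_at_minus)
 hence f2: "fits D V2 (%p. u2 p + - h2 p)"
  by (intro fits_add[OF fits_subset[OF 2(4)]]) (auto simp: V2_def)
 have "u1 p + h1 p = u2 p + - h2 p" if "p : V1 Int V2" for p
  using eq[of p] that V(5) by (auto simp: algebra_simps)
 from fits_glue[OF f1 f2 V(1,2) this]
 have "fits D (V1 Un V2) (%p. if p : V1 then u1 p + h1 p else u2 p + - h2 p)" .
 moreover have "V1 Un V2 <= \<Union>(fst ` D)" using 1 2 by (auto simp: V1_def V2_def)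
 ultimately show ?thesis
  unfolding cousin_solvable_def using V by (intro exI[of _ "V1 Un V2"]) blast
qed

text \<open>
  The Cauchy integral over the boundary of thin rectangles around the overlap of \<open>A1\<close> and \<open>A2\<close> is
  distributed over the edges: an edge missing \<open>A1\<close> contributes to the correction near \<open>A1\<close>.
\<close>

lemma cousin_merge_rectangles:
 assumes comp: "compact A1" "compact A2" "compact B"
  and 1: "open U1" "A1 \<times> B <= U1" "U1 <= \<Union>(fst ` D)" "fits D U1 u1"
  and 2: "open U2" "A2 \<times> B <= U2" "U2 <= \<Union>(fst ` D)" "fits D U2 u2"
  and R: "finite R" "!!a c. (a, c) : R ==> Re a < Re c & Im a < Im c"
  and disj: "!!rh rh'. rh : R ==> rh' : R ==> rh ~= rh' ==> cbox (fst rh) (snd rh) Int cbox (fst rh') (snd rh') = {}"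
  and cover: "A1 Int A2 <= (\<Union>(a, c)\<in>R. box a c)"
  and edges: "!!a c k. (a, c) : R ==> k < 4 ==> edge_set a c k Int A1 = {} \<or> edge_set a c k Int A2 = {}"
  and sub: "!!a c. (a, c) : R ==> cbox a c \<times> B <= U1 Int U2"
 shows "cousin_solvable D ((A1 Un A2) \<times> B)"
proof -
 define G where "G = U1 Int U2"
 define g where "g p = u2 p - u1 p" for p
 have "holo2_on (%p. u2 p - u1 p) (U2 Int U1)"
  by (rule fits_diff[OF 2(4) 1(4)]) (use 1(3) in auto)
 hence G: "open G" "holo2_on g G"
  using 1(1) 2(1) by (simp_all add: G_def g_def[abs_def] Int_commute open_Int)
 have "compact ((\<Union>(a, c)\<in>R. cbox a c) \<times> B)"
  using R comp by (intro compact_Times compact_UN) auto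
 moreover have "(\<Union>(a, c)\<in>R. cbox a c) \<times> B <= G" using sub by (fastforce simp: G_def)
 ultimately obtain e where e: "e > 0"
  "!!x y x' y'. (x, y) : (\<Union>(a, c)\<in>R. cbox a c) \<times> B ==> dist x x' < e ==> dist y y' < e ==> (x', y') : G"
  using compact_open_box[OF _ G(1)] by metis
 \<comment> \<open>B is thickened so that the transforms are holomorphic over an open set of y,
   while the closed rectangles stay inside the common domain.\<close>
 define B' where "B' = (\<Union>y\<in>B. ball y e)"
 have B': "open B'" "B <= B'" using e by (auto simp: B'_def)
 have GB: "cbox a c \<times> B' <= G" if "(a, c) : R" for a c
 proof clarify
  fix x y assume "x : cbox a c" "y : B'"
  then obtain y0 where "y0 : B" "dist y0 y < e" by (auto simp: B'_def)
  thus "(x, y) : G" using e(2)[of x y0 x y] \<open>x : cbox a c\<close> that e(1) by auto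
 qed
 define I where "I = R \<times> {..<4::nat}"
 define ES where "ES i = edge_set (fst (fst i)) (snd (fst i)) (snd i)" for i :: "(complex \<times> complex) \<times> nat"
 define T where "T i = edge_transform g (fst i) (snd i)" for i :: "(complex \<times> complex) \<times> nat"
 define I1 where "I1 = {i : I. ES i Int A1 = {}}"
 define I2 where "I2 = I - I1"
 have fin: "finite I" "finite I1" "finite I2" using R by (auto simp: I_def I1_def I2_def)
 have ES_cbox: "ES (rh, k) <= cbox (fst rh) (snd rh) - box (fst rh) (snd rh)" if "rh : R" for rh k
  using R(2)[of "fst rh" "snd rh"] that
  by (auto simp: ES_def in_edge_set in_cbox_complex_iff in_box_complex_iff split: if_splits)
 have holoT: "holo2_on (T i) ((- ES i) \<times> B')" if "i : I" for i
 proof -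
  have "ES i \<times> B' <= G"
   using ES_cbox[of "fst i" "snd i"] GB[of "fst (fst i)" "snd (fst i)"] that by (auto simp: I_def) blast
  hence "path_image (linepath (fst (edge (fst (fst i)) (snd (fst i)) (snd i))) (snd (edge (fst (fst i)) (snd (fst i)) (snd i)))) \<times> B' <= G"
   by (simp add: ES_def edge_set_def)
  from holo2_on_cauchy_transform[OF C1_path_linepath G B'(1) this] show ?thesis
   by (simp add: T_def ES_def edge_set_def)
 qed
 have clES: "closed (ES i)" for i by (simp add: ES_def edge_set_def)
 define O' where "O' = (\<Union>(a, c)\<in>R. box a c) \<times> B'"
 define h1 where "h1 p = (\<Sum>i\<in>I1. T i p)" for p
 define h2 where "h2 p = (\<Sum>i\<in>I2. T i p)" for p
 have boxES: "x \<notin> ES i" if "x : box a c" "(a, c) : R" "i : I" for x a c i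
 proof (cases "fst i = (a, c)")
  case True thus ?thesis using ES_cbox[of "(a, c)" "snd i"] that by (cases i) auto
 next
  case False
  hence "cbox a c Int cbox (fst (fst i)) (snd (fst i)) = {}"
   using disj[of "(a, c)" "fst i"] that by (auto simp: I_def)
  moreover have "x : cbox a c" using that(1) box_subset_cbox by blast
  moreover have "ES i <= cbox (fst (fst i)) (snd (fst i))"
   using ES_cbox[of "fst i" "snd i"] that(3) by (auto simp: I_def)
  ultimately show ?thesis by blast
 qed
 have "cousin_solvable D (A1 \<times> B Un A2 \<times> B)"
 proof (rule cousin_merge[OF _ _ 1 2])
  show "compact (A1 \<times> B)" "compact (A2 \<times> B)" using comp by (auto intro: compact_Times)
  show "open O'" unfolding O'_def using B' by (intro open_Times open_UN) (auto split: prod.splits)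
  show "A1 \<times> B Int A2 \<times> B <= O'" using cover B' by (auto simp: O'_def)
  show "O' <= U1 Int U2" using GB box_subset_cbox unfolding O'_def G_def by blast
  show "open ((- (\<Union>i\<in>I1. ES i)) \<times> B')" "open ((- (\<Union>i\<in>I2. ES i)) \<times> B')"
   using fin clES B' by (intro open_Times open_Compl closed_UN; auto)+
  show "A1 \<times> B Un O' <= (- (\<Union>i\<in>I1. ES i)) \<times> B'"
   using B' boxES by (auto simp: I1_def O'_def)
  have "ES i Int A2 = {}" if "i : I2" for i
   using that edges[of "fst (fst i)" "snd (fst i)" "snd i"] by (auto simp: I2_def I1_def I_def ES_def)
  thus "A2 \<times> B Un O' <= (- (\<Union>i\<in>I2. ES i)) \<times> B'"
   using B' boxES by (auto simp: I2_def O'_def)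
  show "holo2_on h1 ((- (\<Union>i\<in>I1. ES i)) \<times> B')"
   unfolding holo2_on_iff h1_def
   by (intro ballI holo2_at_sum) (use holoT in \<open>auto simp: I1_def holo2_on_iff\<close>)
  show "holo2_on h2 ((- (\<Union>i\<in>I2. ES i)) \<times> B')"
   unfolding holo2_on_iff h2_def
   by (intro ballI holo2_at_sum) (use holoT in \<open>auto simp: I2_def holo2_on_iff\<close>)
  fix p assume "p : O'"
  then obtain a c x y where p: "p = (x, y)" "(a, c) : R" "x : box a c" "y : B'"
   by (auto simp: O'_def)
  have hol: "(%w. g (w, y)) holomorphic_on cbox a' c'" if "(a', c') : R" for a' c'
   using GB[OF that] p by (intro holo2_on_slice_fst[OF G(2)]) auto
  have "h1 p + h2 p = (\<Sum>i\<in>I. T i p)"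
  proof -
   have "I = I1 Un I2" "I1 Int I2 = {}" by (auto simp: I1_def I2_def)
   thus ?thesis using fin by (simp add: h1_def h2_def sum.union_disjoint)
  qed
  also have "\<dots> = (\<Sum>rh\<in>R. \<Sum>k<4. edge_transform g rh k p)"
   by (simp add: I_def T_def sum.cartesian_product case_prod_unfold)
  also have "\<dots> = (\<Sum>rh\<in>R. if rh = (a, c) then g p else 0)"
  proof (rule sum.cong)
   fix rh assume rh: "rh : R"
   obtain a' c' where ac: "rh = (a', c')" by (cases rh)
   show "(\<Sum>k<4. edge_transform g rh k p) = (if rh = (a, c) then g p else 0)"
   proof (cases "rh = (a, c)")
    case True
    thus ?thesis using sum_edge_transform(1)[OF _ _ hol[of a c] p(3)] R(2)[of a c] p by simp
   next
    case False
    \<comment> \<open>The closed rectangles are disjoint, so every other one contributes 0 by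
      Cauchy's theorem.\<close>
    hence "x \<notin> cbox a' c'"
     using disj[OF rh p(2)] p(3) box_subset_cbox[of a c] ac by auto
    thus ?thesis using False sum_edge_transform(2)[OF _ _ hol[of a' c'], of x] R(2)[of a' c'] p rh ac
      by (simp only: if_False) auto
   qed
  qed auto
  also have "\<dots> = g p" using R p by simp
  finally show "u2 p - u1 p = h1 p + h2 p" by (simp add: g_def)
 qed
 thus ?thesis by (simp add: Sigma_Un_distrib1)
qed

section \<open>Rectangles and square annuli\<close>

text \<open>The parameters are left, right, bottom and top. Degenerate rectangles occur: overlaps
  are points or segments.\<close>

definition Rect :: "real \<times> real \<times> real \<times> real => complex set" where
 "Rect = (%(al, bea, ga, de). {z. al <= Re z & Re z <= bea & ga <= Im z & Im z <= de})"

lemma Rect_eq_cbox: "Rect (al, bea, ga, de) = cbox (Complex al ga) (Complex bea de)"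
 by (auto simp: Rect_def in_cbox_complex_iff)

lemma compact_Rect: "compact (Rect q)"
 by (cases q) (simp add: Rect_eq_cbox compact_cbox)

abbreviation enlarge_corners :: "real => real \<times> real \<times> real \<times> real => complex \<times> complex" where
 "enlarge_corners \<eta> \<equiv> (%(al, bea, ga, de). (Complex (al - \<eta>) (ga - \<eta>), Complex (bea + \<eta>) (de + \<eta>)))"

text \<open>The overlap may consist of several degenerate rectangles. Each is fattened by a small
  \<eta>; \<open>\<eta>0\<close> bounds the range in which the fattened ones stay disjoint and each
  of their sides misses one of the two sets.\<close>

lemma cousin_merge_Rects:
 assumes comp: "compact A1" "compact A2" "compact B"
  and S: "cousin_solvable D (A1 \<times> B)" "cousin_solvable D (A2 \<times> B)"
  and Q: "finite Q" "A1 Int A2 = \<Union>(Rect ` Q)" "!!al bea ga de. (al, bea, ga, de) : Q ==> al <= bea & ga <= de"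
  and \<eta>0: "\<eta>0 > 0"
  and disj: "!!\<eta> q q'. 0 < \<eta> ==> \<eta> < \<eta>0 ==> q : Q ==> q' : Q ==> q ~= q' ==>
   cbox (fst (enlarge_corners \<eta> q)) (snd (enlarge_corners \<eta> q)) \<inter>
   cbox (fst (enlarge_corners \<eta> q')) (snd (enlarge_corners \<eta> q')) = {}"
  and edges: "!!\<eta> q k. 0 < \<eta> ==> \<eta> < \<eta>0 ==> q : Q ==> k < 4 ==>
   edge_set (fst (enlarge_corners \<eta> q)) (snd (enlarge_corners \<eta> q)) k Int A1 = {} \<or>
   edge_set (fst (enlarge_corners \<eta> q)) (snd (enlarge_corners \<eta> q)) k Int A2 = {}"
 shows "cousin_solvable D ((A1 Un A2) \<times> B)"
proof -
 obtain U1 u1 where 1: "open U1" "A1 \<times> B <= U1" "U1 <= \<Union>(fst ` D)" "fits D U1 u1"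
  using S(1) unfolding cousin_solvable_def by blast
 obtain U2 u2 where 2: "open U2" "A2 \<times> B <= U2" "U2 <= \<Union>(fst ` D)" "fits D U2 u2"
  using S(2) unfolding cousin_solvable_def by blast
 have "compact ((A1 Int A2) \<times> B)" using comp by (intro compact_Times compact_Int)
 moreover have "(A1 Int A2) \<times> B <= U1 Int U2" using 1 2 by auto
 ultimately obtain e where e: "e > 0"
  "!!x y x' y'. (x, y) : (A1 Int A2) \<times> B ==> dist x x' < e ==> dist y y' < e ==> (x', y') : U1 Int U2"
  using compact_open_box[OF _ open_Int[OF 1(1) 2(1)]] by metis
 define \<eta> where "\<eta> = min (\<eta>0 / 2) (e / 4)"
 have \<eta>: "\<eta> > 0" "\<eta> < \<eta>0" "2 * \<eta> < e" using \<eta>0 e by (auto simp: \<eta>_def)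
 define R where "R = enlarge_corners \<eta> ` Q"
 show ?thesis
 proof (rule cousin_merge_rectangles[OF comp 1 2, of R])
  show "finite R" using Q by (simp add: R_def)
  show "Re a < Re c & Im a < Im c" if "(a, c) : R" for a c
   using that Q(3) \<eta> by (force simp: R_def)
  show "cbox (fst rh) (snd rh) Int cbox (fst rh') (snd rh') = {}" if "rh : R" "rh' : R" "rh ~= rh'" for rh rh'
  proof -
   obtain q q' where q: "q : Q" "rh = enlarge_corners \<eta> q" "q' : Q" "rh' = enlarge_corners \<eta> q'"
    using \<open>rh : R\<close> \<open>rh' : R\<close> unfolding R_def by (elim imageE)
   hence "q ~= q'" using \<open>rh ~= rh'\<close> by blast
   from disj[OF \<eta>(1,2) q(1,3) this] show ?thesis by (simp only: q(2,4))
  qed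
  show "A1 Int A2 <= (\<Union>(a, c)\<in>R. box a c)"
   using \<eta> unfolding Q(2) R_def by (fastforce simp: Rect_def in_box_complex_iff)
  show "edge_set a c k Int A1 = {} \<or> edge_set a c k Int A2 = {}" if "(a, c) : R" "k < 4" for a c k
  proof -
   from that(1) have "EX q:Q. (a, c) = enlarge_corners \<eta> q" unfolding R_def image_iff .
   then obtain q where q: "q : Q" "(a, c) = enlarge_corners \<eta> q" ..
   thus ?thesis using edges[OF \<eta>(1,2) q(1) that(2)] by (metis fst_conv snd_conv)
  qed
  show "cbox a c \<times> B <= U1 Int U2" if "(a, c) : R" for a c
  proof clarify
   fix x y assume xy: "x : cbox a c" "y : B"
   obtain al bea ga de where q: "(al, bea, ga, de) : Q" "a = Complex (al - \<eta>) (ga - \<eta>)" "c = Complex (bea + \<eta>) (de + \<eta>)"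
    using \<open>(a, c) : R\<close> by (auto simp: R_def)
   \<comment> \<open>The nearest point of the original rectangle, obtained by clamping both
     coordinates.\<close>
   define x0 where "x0 = Complex (max al (min bea (Re x))) (max ga (min de (Im x)))"
   have "x0 : Rect (al, bea, ga, de)" using Q(3)[OF q(1)] by (auto simp: x0_def Rect_def)
   hence "x0 : A1 Int A2" using Q(2) q(1) by blast
   moreover have "dist x0 x < e"
   proof -
    have "\<bar>Re (x0 - x)\<bar> <= \<eta>" "\<bar>Im (x0 - x)\<bar> <= \<eta>"
     using xy(1) \<eta> Q(3)[OF q(1)] by (auto simp: x0_def q in_cbox_complex_iff)
    thus ?thesis using cmod_le[of "x0 - x"] \<eta> by (simp add: dist_norm)
   qed
   ultimately show "(x, y) : U1 Int U2" using e(2)[of x0 y x y] xy(2) e(1) by simp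
  qed
 qed
qed

lemma cousin_solvable_nbhd:
 assumes "cousin_solvable D (K \<times> B)" "compact K" "compact B"
 obtains e where "e > 0" "!!K'. (!!x. x : K' ==> EX x0:K. dist x0 x < e) ==> cousin_solvable D (K' \<times> B)"
proof -
 obtain U u where U: "open U" "K \<times> B <= U" "U <= \<Union>(fst ` D)" "fits D U u"
  using assms(1) unfolding cousin_solvable_def by blast
 obtain e where e: "e > 0"
  "!!x y x' y'. (x, y) : K \<times> B ==> dist x x' < e ==> dist y y' < e ==> (x', y') : U"
  using compact_open_box[OF _ U(1,2)] assms by (metis compact_Times)
 show ?thesis
 proof
  fix K' assume K': "!!x. x : K' ==> EX x0:K. dist x0 x < e"
  have "K' \<times> B <= U"
  proof clarify
   fix x y assume "x : K'" "y : B"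
   thus "(x, y) : U" using K'[of x] e(2)[of _ y x y] e(1) by auto
  qed
  thus "cousin_solvable D (K' \<times> B)" unfolding cousin_solvable_def using U by blast
 qed fact
qed

text \<open>Bisection: solvability near points passes to vertical segments and from these to the
  rectangle they sweep out. Neighbouring pieces share a point or a segment, and each side of the
  fattened overlap misses one of the two pieces.\<close>

lemma cousin_solvable_Rect:
 assumes B: "compact B" and pt: "!!a. a : Rect (al, bea, ga, de) ==> cousin_solvable D ({a} \<times> B)"
  and le: "al <= bea" "ga <= de"
 shows "cousin_solvable D (Rect (al, bea, ga, de) \<times> B)"
proof -
 have line: "cousin_solvable D (Rect (s, s, ga, de) \<times> B)" if s: "al <= s" "s <= bea" for s
 proof -
  define P where "P c d \<longleftrightarrow> (ga <= c --> d <= de --> cousin_solvable D (Rect (s, s, c, d) \<times> B))" for c d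
  have "P ga de"
   using le(2)
  proof (induct rule: Bolzano)
   case (trans c t d)
   show ?case
    unfolding P_def
   proof (intro impI)
    assume cd: "ga <= c" "d <= de"
    have edges: "edge_set (fst (enlarge_corners \<eta> q)) (snd (enlarge_corners \<eta> q)) k Int Rect (s, s, c, t) = {} \<or>
      edge_set (fst (enlarge_corners \<eta> q)) (snd (enlarge_corners \<eta> q)) k Int Rect (s, s, t, d) = {}"
     if "0 < \<eta>" "\<eta> < 1" "q : {(s, s, t, t)}" "k < 4" for \<eta> :: real and q and k :: nat
    proof -
     have "k = 0 \<or> k = 1 \<or> k = 2 \<or> k = 3" using that(4) by linarith
     thus ?thesis using that(1,3) by (elim disjE)
      ((rule disjI2, (auto simp: in_edge_set Rect_def)[1]; fail) | (rule disjI1, (auto simp: in_edge_set Rect_def)[1]; fail))+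
    qed
    have S: "cousin_solvable D (Rect (s, s, c, t) \<times> B)" "cousin_solvable D (Rect (s, s, t, d) \<times> B)"
     using trans cd by (auto simp: P_def)
    have "cousin_solvable D ((Rect (s, s, c, t) Un Rect (s, s, t, d)) \<times> B)"
     by (rule cousin_merge_Rects[where Q = "{(s, s, t, t)}", OF compact_Rect compact_Rect B S _ _ _ zero_less_one _ edges])
      (use trans in \<open>auto simp: Rect_def\<close>)
    moreover have "Rect (s, s, c, t) Un Rect (s, s, t, d) = Rect (s, s, c, d)"
     using trans by (auto simp: Rect_def)
    ultimately show "cousin_solvable D (Rect (s, s, c, d) \<times> B)" by simp
   qed
  next
   case (local t)
   have "cousin_solvable D ({Complex s t} \<times> B)"
    using local s by (intro pt) (auto simp: Rect_def)
   then obtain e where e: "e > 0"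
    "!!K'. (!!x. x : K' ==> EX x0:{Complex s t}. dist x0 x < e) ==> cousin_solvable D (K' \<times> B)"
    by (rule cousin_solvable_nbhd[OF _ compact_sing B]) blast
   show ?case
    unfolding P_def
   proof (intro exI[of _ e] conjI allI impI e)
    fix c d x assume "c <= t & t <= d & d - c < e" "x : Rect (s, s, c, d)"
    hence "Re x = s" "\<bar>t - Im x\<bar> < e" by (auto simp: Rect_def)
    hence "cmod (Complex s t - x) < e"
     using cmod_eq_Im[of "Complex s t - x"] by simp
    thus "EX x0:{Complex s t}. dist x0 x < e" by (simp add: dist_norm)
   qed
  qed
  thus ?thesis by (simp add: P_def)
 qed
 define P where "P c d \<longleftrightarrow> (al <= c --> d <= bea --> cousin_solvable D (Rect (c, d, ga, de) \<times> B))" for c d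
 have "P al bea"
  using le(1)
 proof (induct rule: Bolzano)
  case (trans c t d)
  show ?case
   unfolding P_def
  proof (intro impI)
   assume cd: "al <= c" "d <= bea"
   have edges: "edge_set (fst (enlarge_corners \<eta> q)) (snd (enlarge_corners \<eta> q)) k Int Rect (c, t, ga, de) = {} \<or>
     edge_set (fst (enlarge_corners \<eta> q)) (snd (enlarge_corners \<eta> q)) k Int Rect (t, d, ga, de) = {}"
    if "0 < \<eta>" "\<eta> < 1" "q : {(t, t, ga, de)}" "k < 4" for \<eta> :: real and q and k :: nat
   proof -
    have "k = 0 \<or> k = 1 \<or> k = 2 \<or> k = 3" using that(4) by linarith
    thus ?thesis using that(1,3) le(2) by (elim disjE)
     ((rule disjI2, (auto simp: in_edge_set Rect_def)[1]; fail) | (rule disjI1, (auto simp: in_edge_set Rect_def)[1]; fail))+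
   qed
   have S: "cousin_solvable D (Rect (c, t, ga, de) \<times> B)" "cousin_solvable D (Rect (t, d, ga, de) \<times> B)"
    using trans cd by (auto simp: P_def)
   have "cousin_solvable D ((Rect (c, t, ga, de) Un Rect (t, d, ga, de)) \<times> B)"
    by (rule cousin_merge_Rects[where Q = "{(t, t, ga, de)}", OF compact_Rect compact_Rect B S _ _ _ zero_less_one _ edges])
     (use trans le in \<open>auto simp: Rect_def\<close>)
   moreover have "Rect (c, t, ga, de) Un Rect (t, d, ga, de) = Rect (c, d, ga, de)"
    using trans by (auto simp: Rect_def)
   ultimately show "cousin_solvable D (Rect (c, d, ga, de) \<times> B)" by simp
  qed
 next
  case (local t)
  hence "cousin_solvable D (Rect (t, t, ga, de) \<times> B)" by (intro line)
  then obtain e where e: "e > 0"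
   "!!K'. (!!x. x : K' ==> EX x0:Rect (t, t, ga, de). dist x0 x < e) ==> cousin_solvable D (K' \<times> B)"
   by (rule cousin_solvable_nbhd[OF _ compact_Rect B]) blast
  show ?case
   unfolding P_def
  proof (intro exI[of _ e] conjI allI impI e)
   fix c d x assume x: "c <= t & t <= d & d - c < e" "x : Rect (c, d, ga, de)"
   hence "\<bar>t - Re x\<bar> < e" by (auto simp: Rect_def)
   hence "cmod (Complex t (Im x) - x) < e"
    using cmod_eq_Re[of "Complex t (Im x) - x"] by simp
   thus "EX x0:Rect (t, t, ga, de). dist x0 x < e"
    using x by (intro bexI[of _ "Complex t (Im x)"]) (auto simp: dist_norm Rect_def)
  qed
 qed
 thus ?thesis by (simp add: P_def)
qed

text \<open>Squares replace discs so that the region is a union of rectangles parallel to the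
  axes.\<close>

definition Square_annulus :: "real => real => complex set" where
 "Square_annulus ep R = {z. \<bar>Re z\<bar> <= R & \<bar>Im z\<bar> <= R & (ep <= \<bar>Re z\<bar> \<or> ep <= \<bar>Im z\<bar>)}"

text \<open>\<open>A1\<close> consists of the full-height slabs left and right of the hole,
  \<open>A2\<close> of the blocks above and below it. The overlap has four components, all merged in
  a single step, so the hole causes no monodromy.\<close>

lemma cousin_solvable_Square_annulus:
 assumes B: "compact B" and pt: "!!a. a : Square_annulus ep R ==> cousin_solvable D ({a} \<times> B)"
  and le: "0 < ep" "ep <= R"
 shows "cousin_solvable D (Square_annulus ep R \<times> B)"
proof -
 have rect: "cousin_solvable D (Rect (al, bea, ga, de) \<times> B)"
  if "Rect (al, bea, ga, de) <= Square_annulus ep R" "al <= bea" "ga <= de" for al bea ga de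
  using that by (intro cousin_solvable_Rect[OF B] pt) auto
 define A1 where "A1 = Rect (-R, -ep, -R, R) Un Rect (ep, R, -R, R)"
 define A2 where "A2 = Rect (-ep, ep, -R, -ep) Un Rect (-ep, ep, ep, R)"
 have A1: "cousin_solvable D (A1 \<times> B)" unfolding A1_def
 proof (rule cousin_merge_Rects[where Q = "{}" and ?\<eta>0.0 = 1])
  show "cousin_solvable D (Rect (-R, -ep, -R, R) \<times> B)" "cousin_solvable D (Rect (ep, R, -R, R) \<times> B)"
   using le by (intro rect; auto simp: Square_annulus_def Rect_def)+
  show "Rect (-R, -ep, -R, R) Int Rect (ep, R, -R, R) = \<Union> (Rect ` {})" using le by (auto simp: Rect_def)
 qed (use B compact_Rect in auto)
 have A2: "cousin_solvable D (A2 \<times> B)" unfolding A2_def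
 proof (rule cousin_merge_Rects[where Q = "{}" and ?\<eta>0.0 = 1])
  show "cousin_solvable D (Rect (-ep, ep, -R, -ep) \<times> B)" "cousin_solvable D (Rect (-ep, ep, ep, R) \<times> B)"
   using le by (intro rect; auto simp: Square_annulus_def Rect_def)+
  show "Rect (-ep, ep, -R, -ep) Int Rect (-ep, ep, ep, R) = \<Union> (Rect ` {})" using le by (auto simp: Rect_def)
 qed (use B compact_Rect in auto)
 have in1: "z : A1 \<longleftrightarrow> ep <= \<bar>Re z\<bar> & \<bar>Re z\<bar> <= R & \<bar>Im z\<bar> <= R" for z
  using le by (auto simp: A1_def Rect_def)
 have in2: "z : A2 \<longleftrightarrow> ep <= \<bar>Im z\<bar> & \<bar>Im z\<bar> <= R & \<bar>Re z\<bar> <= ep" for z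
  using le by (auto simp: A2_def Rect_def)
 \<comment> \<open>The four vertical segments over Re z = ep and Re z = -ep; any \<eta> < ep keeps
   their fattenings apart.\<close>
 let ?Q = "{(ep, ep, ep, R), (-ep, -ep, ep, R), (ep, ep, -R, -ep), (-ep, -ep, -R, -ep)}"
 have "cousin_solvable D ((A1 Un A2) \<times> B)"
 proof (rule cousin_merge_Rects[where Q = ?Q and ?\<eta>0.0 = ep, OF _ _ B A1 A2])
  show "compact A1" "compact A2" by (auto simp: A1_def A2_def intro: compact_Un compact_Rect)
  show "A1 Int A2 = \<Union>(Rect ` ?Q)"
  proof (rule set_eqI)
   fix z
   show "z : A1 Int A2 \<longleftrightarrow> z : \<Union>(Rect ` ?Q)"
    using le by (simp only: Int_iff in1 in2, simp add: Rect_def) (smt (verit))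
  qed
  fix \<eta> :: real assume \<eta>: "0 < \<eta>" "\<eta> < ep"
  show "cbox (fst (enlarge_corners \<eta> q)) (snd (enlarge_corners \<eta> q)) \<inter>
   cbox (fst (enlarge_corners \<eta> q')) (snd (enlarge_corners \<eta> q')) = {}"
   if "q : ?Q" "q' : ?Q" "q ~= q'" for q q'
   using that \<eta> le by (auto simp: in_cbox_complex_iff)
  show "edge_set (fst (enlarge_corners \<eta> q)) (snd (enlarge_corners \<eta> q)) k Int A1 = {} \<or>
   edge_set (fst (enlarge_corners \<eta> q)) (snd (enlarge_corners \<eta> q)) k Int A2 = {}"
   if "q : ?Q" "k < 4" for q k
  proof -
   have "k = 0 \<or> k = 1 \<or> k = 2 \<or> k = 3" using that(2) by linarith
   moreover have "q = (ep, ep, ep, R) \<or> q = (-ep, -ep, ep, R) \<or> q = (ep, ep, -R, -ep) \<or> q = (-ep, -ep, -R, -ep)"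
    using that(1) by blast
   ultimately show ?thesis
    using \<eta> le by (elim disjE)
     ((rule disjI2, (auto simp: in_edge_set in2)[1]; fail) | (rule disjI1, (auto simp: in_edge_set in1)[1]; fail))+
  qed
 qed (use le in auto)
 moreover have "A1 Un A2 = Square_annulus ep R"
  by (rule set_eqI) (use le in \<open>auto simp: in1 in2 Square_annulus_def\<close>)
 ultimately show ?thesis by simp
qed

definition admissible :: "complex set => bool" where
 "admissible A \<longleftrightarrow> (EX R>0. A = Rect (-R, R, -R, R)) \<or> (EX ep R. 0 < ep & ep <= R & A = Square_annulus ep R)"

lemma admissible_compact: "admissible A ==> compact A"
proof -
 have "Square_annulus ep R = cbox (Complex (-R) (-R)) (Complex R R) Int {z. ep <= \<bar>Re z\<bar> \<or> ep <= \<bar>Im z\<bar>}" for ep R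
  by (auto simp: Square_annulus_def in_cbox_complex_iff)
 moreover have "closed {z. ep <= \<bar>Re z\<bar> \<or> ep <= \<bar>Im z\<bar>}" for ep
  by (intro closed_Collect_disj closed_Collect_le continuous_intros)
 ultimately show "admissible A ==> compact A"
  by (auto simp: admissible_def compact_Rect intro!: compact_Int_closed)
qed

lemma cousin_solvable_admissible:
 assumes "admissible A" "compact B" "!!a. a : A ==> cousin_solvable D ({a} \<times> B)"
 shows "cousin_solvable D (A \<times> B)"
 using assms cousin_solvable_Rect[of B] cousin_solvable_Square_annulus[of B]
 unfolding admissible_def by force

text \<open>Merging works in the first variable; exchanging the coordinates makes it available in
  the second.\<close>

definition swap_data :: "(C2 set \<times> (C2 => complex)) set => (C2 set \<times> (C2 => complex)) set" where
 "swap_data D = (%(V, v). (prod.swap ` V, %p. v (prod.swap p))) ` D"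

lemma fits_swap:
 assumes "fits D U u"
 shows "fits (swap_data D) (prod.swap ` U) (%p. u (prod.swap p))"
proof (rule fits_atI)
 fix p V v assume p: "p : prod.swap ` U" "(V, v) : swap_data D" "p : V"
 obtain W w where W: "(W, w) : D" "V = prod.swap ` W" "v = (%p. w (prod.swap p))"
  using p(2) by (auto simp: swap_data_def)
 obtain x y where xy: "p = (x, y)" "(y, x) : U" "(y, x) : W"
  using p W(2) by (cases p) force
 show "holo2_at (%p. u (prod.swap p) - v p) p"
  using holo2_at_swap[OF fits_atD[OF assms xy(2) W(1) xy(3)]] by (simp add: xy(1) W(3))
qed

lemma swap_swap_data: "swap_data (swap_data D) = D"
 by (force simp: swap_data_def image_image case_prod_unfold)

lemma cousin_solvable_swap:
 assumes "cousin_solvable D (A \<times> B)"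
 shows "cousin_solvable (swap_data D) (B \<times> A)"
proof -
 obtain U u where U: "open U" "A \<times> B <= U" "U <= \<Union>(fst ` D)" "fits D U u"
  using assms unfolding cousin_solvable_def by blast
 have "B \<times> A <= prod.swap ` U" using image_mono[OF U(2), of prod.swap] by (simp add: product_swap)
 moreover have "prod.swap ` U <= \<Union>(fst ` swap_data D)"
 proof -
  have "\<Union>(fst ` swap_data D) = prod.swap ` (\<Union>(fst ` D))"
   by (simp add: swap_data_def image_image case_prod_unfold image_UN)
  thus ?thesis using image_mono[OF U(3), of prod.swap] by simp
 qed
 ultimately show ?thesis
  unfolding cousin_solvable_def using open_swap[OF U(1)] fits_swap[OF U(4)] by blast
qed

text \<open>For a fixed y the points are merged over \<open>A\<close>; after the exchange of
  coordinates the slices over \<open>A\<close> are merged along \<open>B\<close>.\<close>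

theorem cousin:
 assumes D: "cousin_data D" and AB: "admissible A" "admissible B" "A \<times> B <= \<Union>(fst ` D)"
 shows "cousin_solvable D (A \<times> B)"
proof -
 have "cousin_solvable (swap_data D) ({y} \<times> A)" if "y : B" for y
 proof (rule cousin_solvable_swap, rule cousin_solvable_admissible[OF AB(1)])
  fix a assume "a : A"
  thus "cousin_solvable D ({a} \<times> {y})"
   using cousin_solvable_point[OF D, of "(a, y)"] AB(3) that by auto
 qed auto
 hence "cousin_solvable (swap_data D) (B \<times> A)"
  by (rule cousin_solvable_admissible[OF AB(2) admissible_compact[OF AB(1)]])
 from cousin_solvable_swap[OF this] show ?thesis by (simp add: swap_swap_data)
qed

section \<open>Splitting over a shell around the origin\<close>

definition torus_integral :: "real => real => (C2 => complex) => complex" where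
 "torus_integral rh1 rh2 f =
  contour_integral (circlepath 0 rh2) (%y. contour_integral (circlepath 0 rh1) (%x. f (x, y)))"

lemma continuous_circlepath: "continuous_on A (circlepath z r)"
 unfolding circlepath_def part_circlepath_def linepath_def by (intro continuous_intros)

lemma contour_integral_circlepath_eq:
 "contour_integral (circlepath z r) f =
  integral {0..1} (%t. f (circlepath z r t) * (2 * of_real pi * \<i> * of_real r * exp (2 * of_real pi * \<i> * of_real t)))"
 unfolding contour_integral_integral vector_derivative_circlepath by (simp add: algebra_simps)

lemma circlepath_in_sphere: "r > 0 ==> circlepath z r t : sphere z r"
 by (auto simp: circlepath_def part_circlepath_def dist_norm norm_mult)

lemma slice_continuous_on:
 assumes "continuous_on (A \<times> B) f" "y : B"
 shows "continuous_on A (%x. f (x, y))"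
 by (rule continuous_on_compose2[OF assms(1), of A "%x. (x, y)"]) (use assms(2) in \<open>auto intro: continuous_intros\<close>)

context
 fixes rh1 rh2 :: real
 assumes pos: "rh1 > 0" "rh2 > 0"
begin

abbreviation torus :: "C2 set" where "torus \<equiv> sphere 0 rh1 \<times> sphere 0 rh2"

lemma inner_integrable:
 assumes "continuous_on torus f" "y : sphere 0 rh2"
 shows "(%x. f (x, y)) contour_integrable_on circlepath 0 rh1"
 using slice_continuous_on[OF assms] pos by (intro contour_integrable_continuous_circlepath) simp

lemma outer_integrable:
 assumes "continuous_on torus f"
 shows "(%y. contour_integral (circlepath 0 rh1) (%x. f (x, y))) contour_integrable_on circlepath 0 rh2"
proof (rule contour_integrable_continuous_circlepath)
 let ?H = "%y t. f (circlepath 0 rh1 t, y) * (2 * of_real pi * \<i> * of_real rh1 * exp (2 * of_real pi * \<i> * of_real t))"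
 have "continuous_on (sphere 0 rh2 \<times> cbox 0 1) (%q. (circlepath 0 rh1 (snd q), fst q))"
  by (intro continuous_intros continuous_on_compose2[OF continuous_circlepath[of UNIV]]) auto
 hence "continuous_on (sphere 0 rh2 \<times> cbox 0 1) (%q. f (circlepath 0 rh1 (snd q), fst q))"
  using circlepath_in_sphere[OF pos(1)] by (intro continuous_on_compose2[OF assms]) auto
 hence "continuous_on (sphere 0 rh2 \<times> cbox 0 1) (%(y, t). ?H y t)"
  unfolding case_prod_unfold by (intro continuous_intros)
 from integral_continuous_on_param[OF this]
 show "continuous_on (path_image (circlepath 0 rh2)) (%y. contour_integral (circlepath 0 rh1) (%x. f (x, y)))"
  unfolding contour_integral_circlepath_eq using pos by simp
qed

lemma contour_integral_circlepath_cong: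
 assumes "!!y. y : sphere 0 rh2 ==> f y = g y"
 shows "contour_integral (circlepath 0 rh2) f = contour_integral (circlepath 0 rh2) g"
 by (rule contour_integral_eq) (use assms pos in auto)

lemma torus_integral_add:
 assumes "continuous_on torus f" "continuous_on torus g"
 shows "torus_integral rh1 rh2 (%p. f p + g p) = torus_integral rh1 rh2 f + torus_integral rh1 rh2 g"
proof -
 have "torus_integral rh1 rh2 (%p. f p + g p) = contour_integral (circlepath 0 rh2)
  (%y. contour_integral (circlepath 0 rh1) (%x. f (x, y)) + contour_integral (circlepath 0 rh1) (%x. g (x, y)))"
  unfolding torus_integral_def
  by (rule contour_integral_circlepath_cong, rule contour_integral_add; rule inner_integrable) (use assms in auto)
 thus ?thesis
  by (simp add: torus_integral_def contour_integral_add outer_integrable assms)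
qed

lemma torus_integral_cmult:
 assumes "continuous_on torus f"
 shows "torus_integral rh1 rh2 (%p. c * f p) = c * torus_integral rh1 rh2 f"
proof -
 have "torus_integral rh1 rh2 (%p. c * f p) = contour_integral (circlepath 0 rh2)
  (%y. c * contour_integral (circlepath 0 rh1) (%x. f (x, y)))"
  unfolding torus_integral_def
  by (rule contour_integral_circlepath_cong, rule contour_integral_lmul, rule inner_integrable) (use assms in auto)
 thus ?thesis
  by (simp add: torus_integral_def contour_integral_lmul outer_integrable assms)
qed

lemma torus_integral_cong:
 assumes "!!p. p : torus ==> f p = g p"
 shows "torus_integral rh1 rh2 f = torus_integral rh1 rh2 g"
 unfolding torus_integral_def
 by (rule contour_integral_circlepath_cong, rule contour_integral_eq) (use assms pos in auto)

lemma torus_integral_bound: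
 assumes "continuous_on torus f" "!!p. p : torus ==> cmod (f p) <= C" "C >= 0"
 shows "cmod (torus_integral rh1 rh2 f) <= C * (2 * pi * rh1) * (2 * pi * rh2)"
proof -
 have "cmod (contour_integral (circlepath 0 rh1) (%x. f (x, y))) <= C * (2 * pi * rh1)" if "y : sphere 0 rh2" for y
  using has_contour_integral_bound_circlepath[OF has_contour_integral_integral[OF inner_integrable[OF assms(1) that]], of C]
   assms that pos by auto
 thus ?thesis
  unfolding torus_integral_def
  using has_contour_integral_bound_circlepath[OF has_contour_integral_integral[OF outer_integrable[OF assms(1)]], of "C * (2 * pi * rh1)"]
   assms(3) pos by auto
qed

lemma torus_integral_swap:
 assumes "continuous_on torus f"
 shows "torus_integral rh1 rh2 f =
  contour_integral (circlepath 0 rh1) (%x. contour_integral (circlepath 0 rh2) (%y. f (x, y)))"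
 unfolding torus_integral_def
proof (rule contour_integral_swap)
 have "continuous_on (sphere 0 rh2 \<times> sphere 0 rh1) (%q. f (snd q, fst q))"
  by (rule continuous_on_compose2[OF assms]) (auto intro!: continuous_on_Pair continuous_on_fst continuous_on_snd)
 thus "continuous_on (path_image (circlepath 0 rh2) \<times> path_image (circlepath 0 rh1)) (%(y, x). f (x, y))"
  using pos by (simp add: case_prod_unfold)
qed (auto simp: vector_derivative_circlepath intro!: continuous_intros)

end

lemma contour_integral_circle_0:
 assumes "f holomorphic_on cball 0 rh" "rh > 0"
 shows "contour_integral (circlepath 0 rh) f = 0"
 using Cauchy_theorem_convex_simple[OF assms(1), of "circlepath 0 rh"] assms(2)
 by (simp add: contour_integral_unique)

text \<open>A homotopy inside the annulus moves the centre to 0, undoes the rotation by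
  \<open>Arg c\<close> and adjusts the radius. For fixed y the map F is affine in x, so this
  computes how a torus integral changes under F.\<close>

lemma contour_integral_affine_circle:
 fixes k :: "complex => complex"
 assumes k: "k holomorphic_on {x. al < cmod x & cmod x < bea}"
  and rh: "rh > 0" "al < rh'" "rh' < bea" "rh' > 0"
  and c: "c ~= 0" "al < cmod c * rh - cmod d" "cmod c * rh + cmod d < bea"
 shows "contour_integral (circlepath 0 rh) (%x. k (c * x + d)) = contour_integral (circlepath 0 rh') k / c"
proof -
 let ?S = "{x. al < cmod x & cmod x < bea}"
 let ?ga = "%t. c * circlepath 0 rh t + d"
 let ?e = "%t::real. exp (2 * of_real pi * \<i> * of_real t)"
 have circ: "circlepath 0 s t = of_real s * ?e t" for s t
  by (simp add: circlepath_def part_circlepath_def linepath_def algebra_simps)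
 have opS: "open ?S"
  by (intro open_Collect_conj open_Collect_less continuous_intros)
 have vd: "(?ga has_vector_derivative c * vector_derivative (circlepath 0 rh) (at t)) (at t)" for t
  unfolding vector_derivative_circlepath
  using has_vector_derivative_add_const has_vector_derivative_mult_right[OF has_vector_derivative_circlepath[of 0 rh t UNIV], of c]
  by (auto simp: has_vector_derivative_add_const)
 have vp: "valid_path ?ga"
  unfolding valid_path_def
 proof (rule C1_differentiable_imp_piecewise)
  show "?ga C1_differentiable_on {0..1}"
   unfolding C1_differentiable_on_def
   by (intro exI[of _ "%t. c * vector_derivative (circlepath 0 rh) (at t)"] conjI ballI vd)
    (auto simp: vector_derivative_circlepath intro!: continuous_intros)
 qed
 have 1: "contour_integral ?ga k = c * contour_integral (circlepath 0 rh) (%x. k (c * x + d))"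
  unfolding contour_integral_integral vector_derivative_at[OF vd]
  by (subst integral_mult_right[symmetric]) (simp add: algebra_simps)
 have "homotopic_loops ?S ?ga (circlepath 0 rh')"
 proof -
  define C where "C s = (1 - s) * (cmod c * rh) + s * rh'" for s
  define h where "h = (%(s, t). of_real (C s) * exp (\<i> * of_real ((1 - s) * Arg c)) * ?e t + of_real (1 - s) * d)"
  have "continuous_on ({0..1::real} \<times> {0..1}) h"
   unfolding h_def case_prod_unfold C_def by (intro continuous_intros)
  moreover have "h (s, t) : ?S" if "s : {0..1}" for s t
  proof -
   have C0: "C s >= 0" using that rh by (auto simp: C_def intro!: add_nonneg_nonneg mult_nonneg_nonneg)
   have n1: "cmod (of_real (C s) * exp (\<i> * of_real ((1 - s) * Arg c)) * ?e t) = C s"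
    using C0 by (simp add: norm_mult)
   have n2: "cmod (of_real (1 - s) * d) = (1 - s) * cmod d"
    using that by (simp only: norm_mult norm_of_real) simp
   have lo: "al < C s - (1 - s) * cmod d"
   proof -
    have "C s - (1 - s) * cmod d - al = (1 - s) * (cmod c * rh - cmod d - al) + s * (rh' - al)"
     by (simp add: C_def algebra_simps)
    also have "\<dots> > 0"
     using that rh c by (cases "s = 0") (auto intro!: add_nonneg_pos mult_pos_pos mult_nonneg_nonneg)
    finally show ?thesis by simp
   qed
   have hi: "C s + (1 - s) * cmod d < bea"
   proof -
    have "bea - (C s + (1 - s) * cmod d) = (1 - s) * (bea - (cmod c * rh + cmod d)) + s * (bea - rh')"
     by (simp add: C_def algebra_simps)
    also have "\<dots> > 0"
     using that rh c by (cases "s = 0") (auto intro!: add_nonneg_pos mult_pos_pos mult_nonneg_nonneg)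
    finally show ?thesis by simp
   qed
   show ?thesis
    using norm_triangle_ineq[of "of_real (C s) * exp (\<i> * of_real ((1 - s) * Arg c)) * ?e t" "of_real (1 - s) * d"]
     norm_diff_ineq[of "of_real (C s) * exp (\<i> * of_real ((1 - s) * Arg c)) * ?e t" "of_real (1 - s) * d"]
     n1 n2 lo hi by (simp add: h_def)
  qed
  moreover have "h (0, t) = ?ga t" for t
  proof -
   have "c = of_real (cmod c) * exp (\<i> * of_real (Arg c))" using c(1) by (simp add: Arg_eq)
   thus ?thesis by (simp add: h_def C_def circ algebra_simps)
  qed
  moreover have "h (1, t) = circlepath 0 rh' t" for t by (simp add: h_def C_def circ)
  moreover have "pathfinish (h \<circ> Pair s) = pathstart (h \<circ> Pair s)" for s
   by (simp add: pathfinish_def pathstart_def h_def exp_two_pi_i)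
  ultimately show ?thesis unfolding homotopic_loops by (intro exI[of _ h]) auto
 qed
 from Cauchy_theorem_homotopic_loops[OF this opS k vp]
 have "contour_integral ?ga k = contour_integral (circlepath 0 rh') k" by simp
 with 1 c(1) show ?thesis by (simp add: field_simps)
qed

lemma contour_integral_concentric:
 fixes k :: "complex => complex"
 assumes "k holomorphic_on {x. al < cmod x & cmod x < bea}" "al < rh" "rh < bea" "al < rh'" "rh' < bea" "rh > 0" "rh' > 0"
 shows "contour_integral (circlepath 0 rh) k = contour_integral (circlepath 0 rh') k"
 using contour_integral_affine_circle[of k al bea rh rh' 1 0] assms by simp

text \<open>The difference quotient of f at z is holomorphic on the annulus, so its two circle
  integrals agree, while z lies inside the larger circle and outside the smaller one.\<close>

lemma Cauchy_integral_annulus: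
 fixes f :: "complex => complex"
 assumes f: "f holomorphic_on {x. al < cmod x & cmod x < bea}"
  and rh: "0 < rh1" "al < rh1" "rh2 < bea" and z: "rh1 < cmod z" "cmod z < rh2"
 shows "contour_integral (circlepath 0 rh2) (%w. f w / (w - z)) - contour_integral (circlepath 0 rh1) (%w. f w / (w - z))
     = 2 * of_real pi * \<i> * f z"
proof -
 let ?S = "{x. al < cmod x & cmod x < bea}"
 have opS: "open ?S"
  by (intro open_Collect_conj open_Collect_less continuous_intros)
 define \<phi> where "\<phi> w = (if w = z then deriv f z else (f w - f z) / (w - z))" for w
 have "\<phi> holomorphic_on ?S"
  using pole_lemma_open[OF f opS, of z] by (simp add: \<phi>_def[abs_def])
 hence eq: "contour_integral (circlepath 0 rh1) \<phi> = contour_integral (circlepath 0 rh2) \<phi>"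
  by (rule contour_integral_concentric[of \<phi> al bea]) (use rh z in auto)
 have sub: "sphere 0 rh <= ?S" if "rh : {rh1, rh2}" for rh using that rh z by auto
 have *: "contour_integral (circlepath 0 rh) \<phi> = contour_integral (circlepath 0 rh) (%w. f w / (w - z))
   - f z * contour_integral (circlepath 0 rh) (%w. 1 / (w - z))" if "rh : {rh1, rh2}" for rh
 proof -
  have p: "rh > 0" "!!w. w : sphere 0 rh ==> w ~= z" using that rh z by auto
  have c: "continuous_on (sphere 0 rh) f"
   using holomorphic_on_imp_continuous_on[OF f] continuous_on_subset sub[OF that] by blast
  have i1: "(%w. f w / (w - z)) contour_integrable_on circlepath 0 rh"
   using p c by (intro contour_integrable_continuous_circlepath) (auto intro!: continuous_intros)
  have i2: "(%w. 1 / (w - z)) contour_integrable_on circlepath 0 rh"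
   using p by (intro contour_integrable_continuous_circlepath) (auto intro!: continuous_intros)
  have "contour_integral (circlepath 0 rh) \<phi> = contour_integral (circlepath 0 rh) (%w. f w / (w - z) - f z * (1 / (w - z)))"
   using p by (intro contour_integral_eq) (auto simp: \<phi>_def diff_divide_distrib)
  also have "\<dots> = contour_integral (circlepath 0 rh) (%w. f w / (w - z)) - contour_integral (circlepath 0 rh) (%w. f z * (1 / (w - z)))"
   by (rule contour_integral_diff[OF i1 contour_integrable_lmul[OF i2]])
  finally show ?thesis unfolding contour_integral_lmul[OF i2] .
 qed
 have "contour_integral (circlepath 0 rh1) (%w. 1 / (w - z)) = 0"
  by (rule contour_integral_circle_0[OF holomorphic_on_divide[OF holomorphic_on_const holomorphic_on_diff[OF holomorphic_on_ident holomorphic_on_const]]])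
   (use z rh in auto)
 moreover have "contour_integral (circlepath 0 rh2) (%w. 1 / (w - z)) = 2 * of_real pi * \<i>"
  using Cauchy_integral_circlepath_simple[of "%_. 1" 0 rh2 z] z by (simp add: contour_integral_unique)
 ultimately show ?thesis using eq *[of rh1] *[of rh2] by (simp add: algebra_simps)
qed

section \<open>Cousin data equivariant under the contraction\<close>

text \<open>The affine operation taking u to \<kappa> + \<nu> u(F) preserves solutions of the Cousin
  problem, and a solution fixed by it is one on the Hopf surface. The function \<kappa> may be as
  irregular as the data themselves.\<close>

locale equivariant_cousin = hopf +
 fixes D :: "(C2 set \<times> (C2 => complex)) set" and \<kappa> :: "C2 => complex" and \<nu> :: complex
 assumes D: "cousin_data D" and covers: "\<Union>(fst ` D) = C2_star"
  and equivariant: "!!V v. (V, v) : D ==> fits D {p. F p : V} (%p. \<kappa> p + \<nu> * v (F p))"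
  and \<nu>0: "\<nu> ~= 0"
begin

lemma in_cover: "p : C2_star ==> EX V v. (V, v) : D & p : V"
 unfolding covers[symmetric] by auto

lemma holo2_on_F: "holo2_on h B ==> (!!p. p : A ==> F p : B) ==> holo2_on (%p. h (F p)) A"
 unfolding holo2_on_iff using holo2_at_F by blast

lemma fits_pullback:
 assumes u: "fits D U u" and U: "U <= C2_star"
 shows "fits D {p. F p : U} (%p. \<kappa> p + \<nu> * u (F p))"
proof (rule fits_atI)
 fix p V v assume p: "p : {p. F p : U}" "(V, v) : D" "p : V"
 then obtain W w where W: "(W, w) : D" "F p : W" using in_cover[of "F p"] U by blast
 have "holo2_at (%q. u q - w q) (F p)"
  using fits_atD[OF u _ W] p(1) by simp
 from holo2_at_mult[OF holo2_at_const holo2_at_F[OF this]]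
 have "holo2_at (%q. \<nu> * (u (F q) - w (F q))) p" .
 moreover have "holo2_at (%q. \<kappa> q + \<nu> * w (F q) - v q) p"
  using fits_atD[OF equivariant[OF W(1)] _ p(2,3)] W(2) by simp
 ultimately have "holo2_at (%q. \<nu> * (u (F q) - w (F q)) + (\<kappa> q + \<nu> * w (F q) - v q)) p"
  by (rule holo2_at_add)
 thus "holo2_at (%p. \<kappa> p + \<nu> * u (F p) - v p) p" by (simp add: algebra_simps)
qed

lemma fits_diff': "fits D U u ==> fits D U' u' ==> U Int U' <= C2_star ==> holo2_on (%p. u p - u' p) (U Int U')"
 using fits_diff[of D U u U' u'] covers by simp

text \<open>
  \<open>g\<close> measures the failure of a splitting \<open>u1\<close> near \<open>disc \<times> annulus\<close> and a splitting \<open>u2\<close> near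
  \<open>annulus \<times> disc\<close> to match. Pairing with holomorphic functions turns \<open>F\<close>-equivariance into an
  eigenvalue equation with eigenvalue of modulus greater than one, which forces the pairing to vanish.
\<close>

lemma pairing_eq_0:
 assumes nu: "cmod \<nu> > cmod b ^ (r + 1)"
  and u1: "fits D (ball 0 R1 \<times> {y. al2 < cmod y & cmod y < R2}) u1"
  and u2: "fits D ({x. al1 < cmod x & cmod x < R1} \<times> ball 0 R2) u2"
  and pos: "0 < rh1" "0 < rh2" "0 < al1" "0 < al2"
  and inv: "cmod b ^ r * rh1 + rh2 ^ r <= rh1" "al1 < cmod b ^ r * rh1 - rh2 ^ r" "al2 < cmod b * rh2"
  and lt: "rh1 < \<sigma>1" "\<sigma>1 <= R1" "rh2 < \<sigma>2" "\<sigma>2 <= R2"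
  and inv': "cmod b ^ r * \<sigma>1 + \<sigma>2 ^ r <= \<sigma>1"
  and h: "holo2_on h (ball 0 \<sigma>1 \<times> ball 0 \<sigma>2)"
 shows "torus_integral rh1 rh2 (%p. (u1 p - u2 p) * h p) = 0"
proof -
 let ?q = "cmod b"
 let ?T = "sphere 0 rh1 \<times> sphere 0 rh2 :: C2 set"
 let ?X1 = "ball 0 R1 \<times> {y. al2 < cmod y & cmod y < R2} :: C2 set"
 let ?X2 = "{x. al1 < cmod x & cmod x < R1} \<times> ball 0 R2 :: C2 set"
 let ?B = "ball 0 \<sigma>1 \<times> ball 0 \<sigma>2 :: C2 set"
 have q: "0 < ?q" "?q < 1" using b by auto
 have X: "?X1 <= C2_star" "?X2 <= C2_star" using pos by (auto simp: C2_star_def)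
 have al: "al1 < rh1" "al2 < rh2"
 proof -
  show "al1 < rh1" using inv(1,2) pos q by (smt (verit) zero_le_power)
  have "?q * rh2 <= 1 * rh2" using q pos by (intro mult_right_mono) auto
  thus "al2 < rh2" using inv(3) by simp
 qed
 have qrh2: "?q * rh2 < rh2" using q pos by simp
 have q\<sigma>2: "?q * rh2 < \<sigma>2" using qrh2 lt by linarith
 define g where "g p = u1 p - u2 p" for p
 have "holo2_on g (?X1 Int ?X2)"
  unfolding g_def by (rule fits_diff'[OF u1 u2]) (use X in auto)
 moreover have Xint: "?X1 Int ?X2 = {x. al1 < cmod x & cmod x < R1} \<times> {y. al2 < cmod y & cmod y < R2}"
  by auto
 ultimately have g: "holo2_on g ({x. al1 < cmod x & cmod x < R1} \<times> {y. al2 < cmod y & cmod y < R2})"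
  by simp
 define G where "G = ({x. al1 < cmod x & cmod x < R1} \<times> {y. al2 < cmod y & cmod y < R2} :: C2 set)"
 have TG: "?T <= G" using al lt by (auto simp: G_def)
 have Fbounds: "cmod (b ^ r * x + y ^ r) <= ?q ^ r * cmod x + cmod y ^ r"
   "?q ^ r * cmod x - cmod y ^ r <= cmod (b ^ r * x + y ^ r)" for x y
  using norm_triangle_ineq[of "b ^ r * x" "y ^ r"] norm_diff_ineq[of "b ^ r * x" "y ^ r"]
  by (simp_all add: norm_mult norm_power)
 have FT: "F p : G" if "p : ?T" for p
 proof -
  obtain x y where [simp]: "p = (x, y)" by (cases p)
  show ?thesis using that Fbounds[of x y] inv lt qrh2 by (auto simp: G_def F_eq norm_mult)
 qed
 have FB: "F p : ?B" if "p : ?B" for p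
 proof -
  obtain x y where [simp]: "p = (x, y)" by (cases p)
  have xy: "cmod x < \<sigma>1" "cmod y < \<sigma>2" using that by auto
  have "?q ^ r * cmod x + cmod y ^ r < ?q ^ r * \<sigma>1 + \<sigma>2 ^ r"
   using xy q by (intro add_less_le_mono mult_strict_left_mono power_mono) auto
  hence 1: "cmod (b ^ r * x + y ^ r) < \<sigma>1" using Fbounds(1)[of x y] inv' by simp
  have "?q * cmod y <= 1 * cmod y" using q by (intro mult_right_mono) auto
  thus ?thesis using 1 xy by (simp add: F_eq norm_mult)
 qed
 \<comment> \<open>Up to \<open>w1\<close> and \<open>w2\<close> the mismatch g equals \<nu> g(F),
   because \<kappa> cancels in the difference. Of these, \<open>w1\<close> is holomorphic over the
   full disc in x and \<open>w2\<close> over the full disc in y, so Cauchy's theorem removes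
   both.\<close>
 have step: "torus_integral rh1 rh2 (%p. g p * h (F p)) = \<nu> / b ^ (r + 1) * torus_integral rh1 rh2 (%p. g p * h p)"
  if h: "holo2_on h ?B" for h
 proof -
  have hF: "holo2_on (%p. h (F p)) ?B"
   by (rule holo2_on_F[OF h FB])
  define u1' where "u1' p = \<kappa> p + \<nu> * u1 (F p)" for p
  define u2' where "u2' p = \<kappa> p + \<nu> * u2 (F p)" for p
  define w1 where "w1 p = u1' p - u1 p" for p
  define w2 where "w2 p = u2' p - u2 p" for p
  have w1: "holo2_on w1 ({p. F p : ?X1} Int ?X1)"
   unfolding w1_def u1'_def by (rule fits_diff'[OF fits_pullback[OF u1 X(1)] u1]) (use X in auto)
  have w2: "holo2_on w2 ({p. F p : ?X2} Int ?X2)"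
   unfolding w2_def u2'_def by (rule fits_diff'[OF fits_pullback[OF u2 X(2)] u2]) (use X in auto)
  have D1: "cball 0 rh1 \<times> sphere 0 rh2 <= {p. F p : ?X1} Int ?X1"
  proof clarify
   fix x y :: complex assume xy: "x : cball 0 rh1" "y : sphere 0 rh2"
   have "?q ^ r * cmod x <= ?q ^ r * rh1" using xy q by (intro mult_left_mono) auto
   moreover have "cmod y ^ r = rh2 ^ r" using xy by simp
   ultimately have "cmod (b ^ r * x + y ^ r) < R1" using Fbounds(1)[of x y] inv(1) lt by linarith
   thus "(x, y) : {p. F p : ?X1} Int ?X1"
    using xy Fbounds[of x y] inv lt al qrh2 by (auto simp: F_eq norm_mult)
  qed
  have D2: "sphere 0 rh1 \<times> cball 0 rh2 <= {p. F p : ?X2} Int ?X2"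
  proof clarify
   fix x y :: complex assume xy: "x : sphere 0 rh1" "y : cball 0 rh2"
   have "cmod y ^ r <= rh2 ^ r" using xy by (intro power_mono) auto
   moreover have "?q * cmod y <= ?q * rh2" using xy q by (intro mult_left_mono) auto
   moreover have "?q ^ r * cmod x = ?q ^ r * rh1" using xy by simp
   ultimately have "al1 < cmod (b ^ r * x + y ^ r)" "cmod (b ^ r * x + y ^ r) < R1" "?q * cmod y < R2"
    using Fbounds[of x y] inv lt qrh2 by linarith+
   thus "(x, y) : {p. F p : ?X2} Int ?X2"
    using xy Fbounds[of x y] inv lt al qrh2 by (auto simp: F_eq norm_mult)
  qed
  have B1: "cball 0 rh1 \<times> cball 0 rh2 <= ?B" using lt by auto
  have c_hF: "continuous_on ?T (%p. h (F p))"
   by (rule continuous_on_subset[OF holo2_on_continuous_on[OF hF]]) (rule order_trans[OF _ B1], auto)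
  have c_w1: "continuous_on ?T w1"
   by (rule continuous_on_subset[OF holo2_on_continuous_on[OF w1]]) (rule order_trans[OF _ D1], auto)
  have c_w2: "continuous_on ?T w2"
   by (rule continuous_on_subset[OF holo2_on_continuous_on[OF w2]]) (rule order_trans[OF _ D2], auto)
  have gF: "continuous_on ?T (%p. g (F p))"
  proof -
   have "holo2_on (%p. g (F p)) ?T"
    by (rule holo2_on_F[OF g]) (use FT in \<open>simp add: G_def\<close>)
   thus ?thesis by (rule holo2_on_continuous_on)
  qed
  have "torus_integral rh1 rh2 (%p. g p * h (F p)) =
    torus_integral rh1 rh2 (%p. (\<nu> * (g (F p) * h (F p)) + (-1) * (w1 p * h (F p))) + w2 p * h (F p))"
   by (rule torus_integral_cong[OF pos(1,2)]) (simp add: g_def w1_def w2_def u1'_def u2'_def algebra_simps)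
  also have "\<dots> = \<nu> * torus_integral rh1 rh2 (%p. g (F p) * h (F p))
    + (-1) * torus_integral rh1 rh2 (%p. w1 p * h (F p)) + torus_integral rh1 rh2 (%p. w2 p * h (F p))"
   by (simp only: torus_integral_add[OF pos(1,2)] torus_integral_cmult[OF pos(1,2)]
     continuous_on_add continuous_on_mult continuous_on_const c_hF c_w1 c_w2 gF)
  also have "torus_integral rh1 rh2 (%p. w1 p * h (F p)) = 0"
  proof -
   have "contour_integral (circlepath 0 rh1) (%x. w1 (x, y) * h (F (x, y))) = 0" if y: "y : sphere 0 rh2" for y
   proof (rule contour_integral_circle_0[OF holomorphic_on_mult pos(1)])
    show "(%x. w1 (x, y)) holomorphic_on cball 0 rh1"
     by (rule holo2_on_slice_fst[OF w1]) (rule subsetD[OF D1], use y in auto)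
    show "(%x. h (F (x, y))) holomorphic_on cball 0 rh1"
     by (rule holo2_on_slice_fst[OF hF]) (rule subsetD[OF B1], use y in auto)
   qed
   thus ?thesis
    unfolding torus_integral_def
    using contour_integral_circlepath_cong[OF pos(1,2), of "%y. contour_integral (circlepath 0 rh1) (%x. w1 (x, y) * h (F (x, y)))" "%_. 0"]
    by simp
  qed
  also have "torus_integral rh1 rh2 (%p. w2 p * h (F p)) = 0"
  proof -
   have "contour_integral (circlepath 0 rh2) (%y. w2 (x, y) * h (F (x, y))) = 0" if x: "x : sphere 0 rh1" for x
   proof (rule contour_integral_circle_0[OF holomorphic_on_mult pos(2)])
    show "(%y. w2 (x, y)) holomorphic_on cball 0 rh2"
     by (rule holo2_on_slice_snd[OF w2]) (rule subsetD[OF D2], use x in auto)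
    show "(%y. h (F (x, y))) holomorphic_on cball 0 rh2"
     by (rule holo2_on_slice_snd[OF hF]) (rule subsetD[OF B1], use x in auto)
   qed
   hence "contour_integral (circlepath 0 rh1) (%x. contour_integral (circlepath 0 rh2) (%y. w2 (x, y) * h (F (x, y)))) = 0"
    using contour_integral_circlepath_cong[OF pos(2,1), of "%x. contour_integral (circlepath 0 rh2) (%y. w2 (x, y) * h (F (x, y)))" "%_. 0"]
    by simp
   thus ?thesis
    by (subst torus_integral_swap[OF pos(1,2)]) (simp_all add: continuous_on_mult c_w2 c_hF)
  qed
  \<comment> \<open>Two contour deformations, one per variable; b^(r+1) is the Jacobian determinant
    of F.\<close>
  also have "torus_integral rh1 rh2 (%p. g (F p) * h (F p)) = 1 / b ^ (r + 1) * torus_integral rh1 rh2 (%p. g p * h p)"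
  proof -
   define k where "k p = g p * h p" for p
   define bea1 where "bea1 = min \<sigma>1 R1"
   define bea2 where "bea2 = min \<sigma>2 R2"
   have kh: "holo2_on k ({x. al1 < cmod x & cmod x < \<sigma>1} \<times> {y. al2 < cmod y & cmod y < \<sigma>2})"
    using g h lt unfolding k_def holo2_on_iff by (intro ballI holo2_at_mult) auto
   define \<Phi> where "\<Phi> y = contour_integral (circlepath 0 rh1) (%x. k (x, y))" for y
   have \<Phi>: "\<Phi> holomorphic_on {y. al2 < cmod y & cmod y < \<sigma>2}"
   proof -
    let ?S = "{y. al2 < cmod y & cmod y < \<sigma>2} :: complex set"
    have op1: "open {x. al1 < cmod x & cmod x < \<sigma>1}" for al1 \<sigma>1
     by (intro open_Collect_conj open_Collect_less continuous_intros)
    have "holo2_on (%(x', y). contour_integral (circlepath 0 rh1) (%w. k (w, y) / (w - x') ^ 0))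
      ((- path_image (circlepath 0 rh1)) \<times> ?S)"
     using pos al lt by (intro holo2_on_cauchy_kernel[OF C1_path_circlepath _ kh op1] open_Times op1) auto
    from holo2_on_slice_snd[OF this, of ?S 0] show ?thesis
     using pos by (simp add: \<Phi>_def[abs_def])
   qed
   have in1: "contour_integral (circlepath 0 rh1) (%x. k (F (x, y))) = \<Phi> (b * y) / b ^ r" if y: "y : sphere 0 rh2" for y
   proof -
    have "(%x. k (x, b * y)) holomorphic_on {x. al1 < cmod x & cmod x < \<sigma>1}"
     using y inv qrh2 lt by (intro holo2_on_slice_fst[OF kh]) (auto simp: norm_mult)
    from contour_integral_affine_circle[OF this, of rh1 rh1 "b ^ r" "y ^ r"] show ?thesis
     using y inv al lt pos by (simp add: F_eq \<Phi>_def norm_power)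
   qed
   have "torus_integral rh1 rh2 (%p. k (F p)) = contour_integral (circlepath 0 rh2) (%y. \<Phi> (b * y) / b ^ r)"
    unfolding torus_integral_def by (rule contour_integral_circlepath_cong[OF pos(1,2) in1])
   also have "\<dots> = contour_integral (circlepath 0 rh2) (%y. (%z. \<Phi> z / b ^ r) (b * y + 0))" by simp
   also have "\<dots> = contour_integral (circlepath 0 rh2) (%z. \<Phi> z / b ^ r) / b"
    using inv q\<sigma>2 lt al pos by (intro contour_integral_affine_circle[OF holomorphic_on_divide[OF \<Phi> holomorphic_on_const]]) auto
   also have "contour_integral (circlepath 0 rh2) (%z. \<Phi> z / b ^ r) = contour_integral (circlepath 0 rh2) \<Phi> / b ^ r"
   proof -
    have "\<Phi> contour_integrable_on circlepath 0 rh2"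
     using lt al pos by (intro contour_integrable_continuous_circlepath
       continuous_on_subset[OF holomorphic_on_imp_continuous_on[OF \<Phi>]]) auto
    from contour_integral_lmul[OF this, of "1 / b ^ r"] show ?thesis by simp
   qed
   finally have "torus_integral rh1 rh2 (%p. k (F p)) = contour_integral (circlepath 0 rh2) \<Phi> / b ^ r / b" .
   moreover have "torus_integral rh1 rh2 k = contour_integral (circlepath 0 rh2) \<Phi>"
    by (simp add: torus_integral_def \<Phi>_def[abs_def])
   ultimately have "torus_integral rh1 rh2 (%p. k (F p)) = 1 / b ^ (r + 1) * torus_integral rh1 rh2 k"
    by (simp add: mult.commute)
   thus ?thesis by (simp add: k_def[abs_def])
  qed
  finally show ?thesis by simp
 qed
 define N where "N = \<nu> / b ^ (r + 1)"
 have N: "cmod N > 1"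
  using nu q by (simp add: N_def norm_divide norm_power norm_mult pos_less_divide_eq)
 \<comment> \<open>The pairings with h(F^n) stay bounded, since F maps the closed bidisc into
   itself, yet they equal N^n times the original pairing, with N of modulus above 1.\<close>
 define hn where "hn n p = h ((F ^^ n) p)" for n p
 have hn: "holo2_on (hn n) ?B" for n
 proof (induction n)
  case 0 thus ?case using h by (simp add: hn_def[abs_def])
 next
  case (Suc n)
  have "holo2_on (%p. hn n (F p)) ?B" by (rule holo2_on_F[OF Suc FB])
  thus ?case by (simp add: hn_def[abs_def] funpow_swap1)
 qed
 have iter: "torus_integral rh1 rh2 (%p. g p * hn n p) = N ^ n * torus_integral rh1 rh2 (%p. g p * h p)" for n
 proof (induction n)
  case (Suc n)
  have "hn (Suc n) = (%p. hn n (F p))" by (simp add: hn_def[abs_def] funpow_swap1)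
  thus ?case using step[OF hn[of n]] Suc by (simp add: N_def)
 qed (simp add: hn_def)
 let ?P = "cball 0 rh1 \<times> cball 0 rh2 :: C2 set"
 have FP: "F p : ?P" if "p : ?P" for p
 proof -
  obtain x y where [simp]: "p = (x, y)" by (cases p)
  have xy: "cmod x <= rh1" "cmod y <= rh2" using that by auto
  have "?q ^ r * cmod x + cmod y ^ r <= ?q ^ r * rh1 + rh2 ^ r"
   using xy q by (intro add_mono mult_left_mono power_mono) auto
  hence 1: "cmod (b ^ r * x + y ^ r) <= rh1" using Fbounds(1)[of x y] inv by simp
  have "?q * cmod y <= 1 * cmod y" using q by (intro mult_right_mono) auto
  thus ?thesis using 1 xy by (simp add: F_eq norm_mult)
 qed
 have FPn: "(F ^^ n) p : ?P" if "p : ?P" for n p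
  by (induction n) (use that FP in auto)
 have "compact ?P" by (intro compact_Times) auto
 moreover have "continuous_on ?P h"
  by (rule continuous_on_subset[OF holo2_on_continuous_on[OF h]]) (use lt in auto)
 ultimately have "bounded (h ` ?P)" by (intro compact_imp_bounded compact_continuous_image)
 then obtain Ch where Ch: "!!p. p : ?P ==> cmod (h p) <= Ch" unfolding bounded_iff by auto
 have cg: "continuous_on ?T g"
  by (rule continuous_on_subset[OF holo2_on_continuous_on[OF g]]) (use TG in \<open>auto simp: G_def\<close>)
 have "bounded (g ` ?T)"
  by (intro compact_imp_bounded compact_continuous_image cg compact_Times) auto
 then obtain Cg where Cg: "!!p. p : ?T ==> cmod (g p) <= Cg" unfolding bounded_iff by auto
 define C where "C = \<bar>Cg\<bar> * \<bar>Ch\<bar> * (2 * pi * rh1) * (2 * pi * rh2)"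
 have bd: "cmod (torus_integral rh1 rh2 (%p. g p * hn n p)) <= C" for n
  unfolding C_def
 proof (rule torus_integral_bound[OF pos(1,2)])
  show "continuous_on ?T (%p. g p * hn n p)"
   by (intro continuous_intros cg continuous_on_subset[OF holo2_on_continuous_on[OF hn]]) (use lt in auto)
  fix p assume p: "p : ?T"
  have "cmod (hn n p) <= \<bar>Ch\<bar>"
   using Ch[OF FPn[of p n]] p by (force simp: hn_def)
  moreover have "cmod (g p) <= \<bar>Cg\<bar>" using Cg[OF p] by simp
  ultimately show "cmod (g p * hn n p) <= \<bar>Cg\<bar> * \<bar>Ch\<bar>"
   unfolding norm_mult by (intro mult_mono) auto
 qed simp
 have "torus_integral rh1 rh2 (%p. g p * h p) = 0"
 proof (rule ccontr)
  let ?I = "torus_integral rh1 rh2 (%p. g p * h p)"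
  assume nz: "?I ~= 0"
  obtain n where "C / cmod ?I < cmod N ^ n" using real_arch_pow[OF N] by blast
  hence "C < cmod N ^ n * cmod ?I" using nz by (simp add: pos_divide_less_eq)
  thus False using bd[of n] iter[of n] by (simp add: norm_mult norm_power)
 qed
 thus ?thesis by (simp add: g_def)
qed

end

lemma open_annulus: "open {x. al < cmod x & cmod x < bea}"
 by (intro open_Collect_conj open_Collect_less continuous_intros)

lemma Square_annulus_superset:
 "{x. 2 * ep <= cmod x & cmod x <= R} <= Square_annulus ep R"
proof clarify
 fix x assume x: "2 * ep <= cmod x" "cmod x <= R"
 have "cmod x <= \<bar>Re x\<bar> + \<bar>Im x\<bar>" by (rule cmod_le)
 hence "ep <= \<bar>Re x\<bar> \<or> ep <= \<bar>Im x\<bar>" using x by linarith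
 thus "x : Square_annulus ep R"
  using x abs_Re_le_cmod[of x] abs_Im_le_cmod[of x] by (simp add: Square_annulus_def)
qed

lemma Rect_superset: "{x. cmod x <= R} <= Rect (-R, R, -R, R)"
proof clarify
 fix x assume "cmod x <= R"
 thus "x : Rect (-R, R, -R, R)"
  using abs_Re_le_cmod[of x] abs_Im_le_cmod[of x] by (auto simp: Rect_def)
qed

lemma zero_notin_Square_annulus: "ep > 0 ==> 0 \<notin> Square_annulus ep R"
 by (simp add: Square_annulus_def)

text \<open>Scaling x by s^r and y by s respects the weights of F, so an invariant bidisc enlarged
  in this way is again invariant.\<close>

lemma weighted_enlargement:
 fixes rh1 rh2 a1 a2 :: real
 assumes "rh1 > 0" "rh2 > 0" "rh1 < a1" "rh2 < a2"
 obtains s where "s > 1" "s ^ r * rh1 < a1" "s * rh2 < a2"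
proof -
 have "((%s. s ^ r * rh1) \<longlongrightarrow> 1 ^ r * rh1) (at_right (1::real))" "((%s. s * rh2) \<longlongrightarrow> 1 * rh2) (at_right (1::real))"
  by (intro tendsto_intros)+
 hence "\<forall>\<^sub>F s in at_right 1. s ^ r * rh1 < a1" "\<forall>\<^sub>F s in at_right 1. s * rh2 < a2"
  using assms by (auto intro: order_tendstoD)
 moreover have "\<forall>\<^sub>F s in at_right (1::real). s > 1" by (simp add: eventually_at_right_less)
 ultimately have "\<forall>\<^sub>F s in at_right (1::real). s > 1 & s ^ r * rh1 < a1 & s * rh2 < a2"
  by eventually_elim auto
 thus ?thesis using that eventually_happens by force
qed

context equivariant_cousin
begin

text \<open>Let u1 and u2 be solutions near disc times annulus and annulus times disc. Their
  difference splits in x as \<open>Gp - Gm\<close>, where \<open>Gp\<close> continues into the disc.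
  The principal part of \<open>Gm\<close> in y is a pairing with a Cauchy kernel and vanishes, so
  \<open>Gm\<close> continues across y = 0. Hence u1 - Gp and u2 - Gm glue.\<close>

lemma shell_solution:
 assumes nu: "cmod \<nu> > cmod b ^ (r + 1)"
  and pos: "0 < rh1" "0 < rh2"
  and inv: "cmod b ^ r * rh1 + rh2 ^ r <= rh1" "rh2 ^ r < cmod b ^ r * rh1"
  and lt: "rh1 < R" "rh2 < 1"
 obtains u where "fits D (ball 0 R \<times> ball 0 1 - cball 0 rh1 \<times> cball 0 rh2) u"
proof -
 let ?q = "cmod b"
 have q: "0 < ?q" "?q < 1" using b by auto
 \<comment> \<open>The inner radii are half of the bounds that the vanishing of the pairing
   allows.\<close>
 define al1 where "al1 = (?q ^ r * rh1 - rh2 ^ r) / 2"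
 define al2 where "al2 = ?q * rh2 / 2"
 have qr: "?q ^ r < 1" "?q ^ r > 0" using br by (auto simp: norm_power)
 have al: "0 < al1" "al1 < ?q ^ r * rh1 - rh2 ^ r" "al1 < rh1" "0 < al2" "al2 < ?q * rh2" "al2 < rh2"
 proof -
  show a: "0 < al1" "al1 < ?q ^ r * rh1 - rh2 ^ r" using inv unfolding al1_def by (simp_all only: field_simps)
  have "?q ^ r * rh1 <= 1 * rh1" using qr pos by (intro mult_right_mono) auto
  thus "al1 < rh1" using a(2) pos by (smt (verit) zero_le_power)
  show a2: "0 < al2" "al2 < ?q * rh2" using q pos by (auto simp: al2_def)
  have "?q * rh2 <= 1 * rh2" using q pos by (intro mult_right_mono) auto
  thus "al2 < rh2" using a2 by simp
 qed
 define R1 where "R1 = 2 * R"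
 have R: "R > 0" "R1 > 0" "R < R1" using pos lt by (auto simp: R1_def)
 let ?X1 = "ball 0 R1 \<times> {y. al2 < cmod y & cmod y < 2} :: C2 set"
 let ?X2 = "{x. al1 < cmod x & cmod x < R1} \<times> ball 0 2 :: C2 set"
 obtain u1 where u1: "fits D ?X1 u1"
 proof -
  have "cousin_solvable D (Rect (-R1, R1, -R1, R1) \<times> Square_annulus (al2 / 2) 2)"
  proof (rule cousin[OF D])
   show "admissible (Rect (-R1, R1, -R1, R1))" unfolding admissible_def using R by blast
   show "admissible (Square_annulus (al2 / 2) 2)"
    unfolding admissible_def using al lt by (intro disjI2 exI[of _ "al2 / 2"] exI[of _ 2]) auto
   show "Rect (-R1, R1, -R1, R1) \<times> Square_annulus (al2 / 2) 2 <= \<Union>(fst ` D)"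
    unfolding covers using zero_notin_Square_annulus[of "al2 / 2" 2] al by (auto simp: C2_star_def)
  qed
  then obtain U u where "Rect (-R1, R1, -R1, R1) \<times> Square_annulus (al2 / 2) 2 <= U" "fits D U u"
   unfolding cousin_solvable_def by blast
  moreover have "?X1 <= Rect (-R1, R1, -R1, R1) \<times> Square_annulus (al2 / 2) 2"
  proof (rule Sigma_mono)
   show "ball 0 R1 <= Rect (-R1, R1, -R1, R1)" by (rule order_trans[OF _ Rect_superset]) auto
   show "{y. al2 < cmod y & cmod y < 2} <= Square_annulus (al2 / 2) 2"
    by (rule order_trans[OF _ Square_annulus_superset]) auto
  qed
  ultimately show ?thesis using that fits_subset by (meson order_trans)
 qed
 obtain u2 where u2: "fits D ?X2 u2"
 proof -
  have "cousin_solvable D (Square_annulus (al1 / 2) R1 \<times> Rect (-2, 2, -2, 2))"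
  proof (rule cousin[OF D])
   show "admissible (Rect (-2, 2, -2, 2))" unfolding admissible_def by (intro disjI1 exI[of _ 2]) auto
   show "admissible (Square_annulus (al1 / 2) R1)"
    unfolding admissible_def using al R lt by (intro disjI2 exI[of _ "al1 / 2"] exI[of _ R1]) auto
   show "Square_annulus (al1 / 2) R1 \<times> Rect (-2, 2, -2, 2) <= \<Union>(fst ` D)"
    unfolding covers using zero_notin_Square_annulus[of "al1 / 2" R1] al by (auto simp: C2_star_def)
  qed
  then obtain U u where "Square_annulus (al1 / 2) R1 \<times> Rect (-2, 2, -2, 2) <= U" "fits D U u"
   unfolding cousin_solvable_def by blast
  moreover have "?X2 <= Square_annulus (al1 / 2) R1 \<times> Rect (-2, 2, -2, 2)"
  proof (rule Sigma_mono)
   show "ball 0 2 <= Rect (-2, 2, -2, 2)" by (rule order_trans[OF _ Rect_superset]) auto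
   show "{x. al1 < cmod x & cmod x < R1} <= Square_annulus (al1 / 2) R1"
    by (rule order_trans[OF _ Square_annulus_superset]) auto
  qed
  ultimately show ?thesis using that fits_subset by (meson order_trans)
 qed
 define g where "g p = u1 p - u2 p" for p
 let ?G = "{x. al1 < cmod x & cmod x < R1} \<times> {y. al2 < cmod y & cmod y < 2} :: C2 set"
 have "holo2_on g (?X1 Int ?X2)"
  unfolding g_def by (rule fits_diff'[OF u1 u2]) (use al in \<open>auto simp: C2_star_def\<close>)
 moreover have "?X1 Int ?X2 = ?G" by auto
 ultimately have g: "holo2_on g ?G" by simp
 have opG: "open ?G" by (intro open_Times open_annulus)
 define Gp where "Gp = cauchy_transform (circlepath 0 R) g"
 define Gm where "Gm = cauchy_transform (circlepath 0 rh1) g"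
 have Gp: "holo2_on Gp (ball 0 R \<times> {y. al2 < cmod y & cmod y < 2})"
  unfolding Gp_def
  by (rule holo2_on_subset[OF holo2_on_cauchy_transform[OF C1_path_circlepath opG g open_annulus[of al2 2]]])
   (use R al lt in auto)
 have Gm: "holo2_on Gm ({x. rh1 < cmod x} \<times> {y. al2 < cmod y & cmod y < 2})"
  unfolding Gm_def
  by (rule holo2_on_subset[OF holo2_on_cauchy_transform[OF C1_path_circlepath opG g open_annulus[of al2 2]]])
   (use R al lt pos in auto)
 have opx: "open {x. rh1 < cmod x}" by (intro open_Collect_less continuous_intros)
 \<comment> \<open>The Cauchy transform of \<open>Gm\<close> in the second variable over the unit
   circle, hence holomorphic across y = 0.\<close>
 define H where "H p = cauchy_transform (circlepath 0 1) (%p. Gm (prod.swap p)) (prod.swap p)" for p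
 have H: "holo2_on H ({x. rh1 < cmod x} \<times> ball 0 1)"
 proof -
  have "holo2_on (%p. Gm (prod.swap p)) ({y. al2 < cmod y & cmod y < 2} \<times> {x. rh1 < cmod x})"
   using holo2_on_swap[OF Gm] by (simp add: product_swap)
  from holo2_on_cauchy_transform[OF C1_path_circlepath _ this opx, of 0 1]
  have "holo2_on (cauchy_transform (circlepath 0 1) (%p. Gm (prod.swap p))) ((- sphere 0 1) \<times> {x. rh1 < cmod x})"
   using al lt opx by (simp add: open_Times open_annulus) (auto simp: subset_iff)
  from holo2_on_swap[OF this]
  have "holo2_on H ({x. rh1 < cmod x} \<times> (- sphere 0 1))"
   by (simp add: H_def[abs_def] product_swap)
  thus ?thesis by (rule holo2_on_subset) auto
 qed
 have Lx: "g (x, y) = Gp (x, y) - Gm (x, y)" if "rh1 < cmod x" "cmod x < R" "al2 < cmod y" "cmod y < 2" for x y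
 proof -
  have "(%w. g (w, y)) holomorphic_on {x. al1 < cmod x & cmod x < R1}"
   by (rule holo2_on_slice_fst[OF g]) (use that in auto)
  from Cauchy_integral_annulus[OF this pos(1) _ _ that(1,2)]
  show ?thesis using al R by (simp add: Gp_def Gm_def cauchy_transform_def field_simps)
 qed
 have HG: "H (x, y) = Gm (x, y)" if x: "rh1 < cmod x" and y: "rh2 < cmod y" "cmod y < 1" for x y
 proof -
  have "(%z. Gm (x, z)) holomorphic_on {y. al2 < cmod y & cmod y < 2}"
   by (rule holo2_on_slice_snd[OF Gm]) (use x in auto)
  from Cauchy_integral_annulus[OF this pos(2) _ _ y]
  have 1: "contour_integral (circlepath 0 1) (%w. Gm (x, w) / (w - y)) -
   contour_integral (circlepath 0 rh2) (%w. Gm (x, w) / (w - y)) = 2 * of_real pi * \<i> * Gm (x, y)"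
   using al by simp
  have "contour_integral (circlepath 0 rh2) (%w. Gm (x, w) / (w - y)) = 0"
  proof -
   obtain s where s: "s > 1" "s ^ r * rh1 < min (cmod x) R1" "s * rh2 < min (cmod y) 2"
    using weighted_enlargement[of rh1 rh2 "min (cmod x) R1" "min (cmod y) 2"] pos x y lt R by auto
   \<comment> \<open>The Cauchy kernel of the torus at a point outside the bidisc; the factor
     \<open>s\<close> leaves room between the torus and the poles.\<close>
   define h where "h p = 1 / (2 * of_real pi * \<i>) * (1 / ((fst p - x) * (snd p - y)))" for p :: C2
   have h: "holo2_on h (ball 0 (s ^ r * rh1) \<times> ball 0 (s * rh2))"
    unfolding h_def holo2_on_iff
    by (intro ballI holo2_at_mult holo2_at_divide holo2_at_diff holo2_at_const holo2_at_fst holo2_at_snd)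
     (use s in auto)
   have sr: "1 < s ^ r" using s(1) r by (simp add: one_less_power)
   have s1: "rh1 < s ^ r * rh1" "rh2 < s * rh2"
    using s(1) sr pos by simp_all
   have s2: "?q ^ r * (s ^ r * rh1) + (s * rh2) ^ r <= s ^ r * rh1"
   proof -
    have "?q ^ r * (s ^ r * rh1) + (s * rh2) ^ r = s ^ r * (?q ^ r * rh1 + rh2 ^ r)"
     by (simp add: algebra_simps)
    also have "\<dots> <= s ^ r * rh1" using inv s(1) by (intro mult_left_mono) auto
    finally show ?thesis .
   qed
   have "torus_integral rh1 rh2 (%p. (u1 p - u2 p) * h p) = 0"
    by (rule pairing_eq_0[OF nu u1 u2 pos al(1) al(4) inv(1) al(2) al(5) s1(1) _ s1(2) _ s2 h]) (use s in auto)
   moreover have "torus_integral rh1 rh2 (%p. (u1 p - u2 p) * h p) =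
     contour_integral (circlepath 0 rh2) (%w. Gm (x, w) / (w - y))"
    unfolding torus_integral_def
   proof (rule contour_integral_circlepath_cong[OF pos])
    fix w :: complex assume w: "w : sphere 0 rh2"
    have "(%z. g (z, w) / (z - x)) contour_integrable_on circlepath 0 rh1"
    proof (rule contour_integrable_continuous_circlepath)
     have "(%z. g (z, w)) holomorphic_on {x. al1 < cmod x & cmod x < R1}"
      by (rule holo2_on_slice_fst[OF g]) (use w al lt in auto)
     from holomorphic_on_imp_continuous_on[OF this]
     have "continuous_on (sphere 0 rh1) (%z. g (z, w))"
      by (rule continuous_on_subset) (use al R lt in auto)
     thus "continuous_on (path_image (circlepath 0 rh1)) (%z. g (z, w) / (z - x))"
      using pos x by (auto intro!: continuous_intros)
    qed
    from contour_integral_lmul[OF this, of "1 / (2 * of_real pi * \<i>) / (w - y)"]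
    show "contour_integral (circlepath 0 rh1) (%x. (u1 (x, w) - u2 (x, w)) * h (x, w)) = Gm (x, w) / (w - y)"
     by (simp add: Gm_def cauchy_transform_def h_def g_def field_simps)
   qed
   ultimately show ?thesis by simp
  qed
  thus ?thesis using 1 by (simp add: H_def cauchy_transform_def)
 qed
 let ?O1 = "ball 0 R \<times> {y. rh2 < cmod y & cmod y < 1} :: C2 set"
 let ?O2 = "{x. rh1 < cmod x & cmod x < R} \<times> ball 0 1 :: C2 set"
 have "holo2_on (%p. - Gp p) ?O1" "holo2_on (%p. H p + 0) ?O2"
  using Gp H al by (auto simp: holo2_on_iff intro!: holo2_at_minus)
 hence f1: "fits D ?O1 (%p. u1 p + - Gp p)" and f2: "fits D ?O2 (%p. u2 p + - H p)"
 proof -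
  assume "holo2_on (%p. - Gp p) ?O1"
  thus "fits D ?O1 (%p. u1 p + - Gp p)"
   by (intro fits_add[OF fits_subset[OF u1]]) (use al R in auto)
  have "holo2_on (%p. - H p) ?O2"
   using H unfolding holo2_on_iff by (auto intro: holo2_at_minus)
  thus "fits D ?O2 (%p. u2 p + - H p)"
   by (intro fits_add[OF fits_subset[OF u2]]) (use al R in auto)
 qed
 have "u1 p + - Gp p = u2 p + - H p" if "p : ?O1 Int ?O2" for p
 proof -
  obtain x y where p: "p = (x, y)" by (cases p)
  show ?thesis using Lx[of x y] HG[of x y] that al by (auto simp: p g_def algebra_simps)
 qed
 from fits_glue[OF f1 f2 _ _ this]
 have "fits D (?O1 Un ?O2) (%p. if p : ?O1 then u1 p + - Gp p else u2 p + - H p)"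
  by (simp add: open_Times open_annulus)
 moreover have "ball 0 R \<times> ball 0 1 - cball 0 rh1 \<times> cball 0 rh2 <= ?O1 Un ?O2" by auto
 ultimately show ?thesis using that fits_subset by blast
qed

section \<open>Propagation along orbits, and Hartogs extension\<close>

text \<open>An orbit meets S in an interval of times, and on S the solution is already fixed by
  \<open>Op\<close>; so applying \<open>Op\<close> until T^n p lies in S gives a value independent
  of n. The lemma serves for F and then for its inverse.\<close>

lemma orbit_extension:
 fixes T :: "C2 => C2" and Op :: "(C2 => complex) => C2 => complex"
 assumes T: "continuous_on C2_star T" "!!p. p : C2_star ==> T p : C2_star"
  and Op: "!!u p. Op u p = al p + bea p * u (T p)"
  and Op_fits: "!!U u. open U ==> U <= C2_star ==> fits D U u ==> fits D {p : C2_star. T p : U} (Op u)"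
  and S: "open S" "S <= C2_star" "fits D S u"
  and fix_eq: "!!p. p : S ==> T p : S ==> Op u p = u p"
  and orbit: "!!p n i. p : S ==> (T ^^ n) p : S ==> i <= n ==> (T ^^ i) p : S"
  and reach: "!!p. p : V ==> EX n. (T ^^ n) p : S"
  and V: "open V" "V <= C2_star"
 obtains u' where "fits D V u'" "!!p. p : V ==> T p : V ==> Op u' p = u' p"
proof -
 \<comment> \<open>The value \<open>(Op ^^ n) u p\<close> sees u only at the single point T^n
   p.\<close>
 have loc: "(Op ^^ n) u p = (Op ^^ n) u' p" if "u ((T ^^ n) p) = u' ((T ^^ n) p)" for n u u' p
  using that
 proof (induction n arbitrary: p)
  case (Suc n)
  hence "(Op ^^ n) u (T p) = (Op ^^ n) u' (T p)" by (intro Suc.IH) (simp add: funpow_swap1)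
  thus ?case by (simp add: Op[of "(Op ^^ n) u"] Op[of "(Op ^^ n) u'"])
 qed simp
 have step: "(Op ^^ Suc n) u p = (Op ^^ n) u p" if "(T ^^ n) p : S" "(T ^^ Suc n) p : S" for n p
 proof -
  have "(Op ^^ n) (Op u) p = (Op ^^ n) u p"
   by (rule loc, rule fix_eq) (use that in auto)
  thus ?thesis by (simp add: funpow_swap1)
 qed
 have indep0: "(Op ^^ (n + k)) u p = (Op ^^ n) u p" if "(T ^^ n) p : S" "(T ^^ (n + k)) p : S" for n k p
  using that
 proof (induction k)
  case (Suc k)
  have "(T ^^ k) ((T ^^ n) p) : S"
  proof (rule orbit[OF Suc.prems(1)])
   show "(T ^^ Suc k) ((T ^^ n) p) : S"
    using Suc.prems(2) by (metis add.commute comp_apply funpow_add)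
  qed simp
  hence nk: "(T ^^ (n + k)) p : S" by (metis add.commute comp_apply funpow_add)
  thus ?case using Suc step[of "n + k" p] by simp
 qed simp
 have indep: "(Op ^^ n) u p = (Op ^^ m) u p" if "(T ^^ n) p : S" "(T ^^ m) p : S" for n m p
  using indep0[of n p "m - n"] indep0[of m p "n - m"] that by (cases "n <= m") auto
 define u' where "u' p = (Op ^^ (SOME n. (T ^^ n) p : S)) u p" for p
 have u': "u' p = (Op ^^ n) u p" if "(T ^^ n) p : S" for p n
  unfolding u'_def by (rule indep[OF someI[of "%n. (T ^^ n) p : S", OF that] that])
 have preim: "open {p : C2_star. (T ^^ n) p : S} & fits D {p : C2_star. (T ^^ n) p : S} ((Op ^^ n) u)" for n
 proof (induction n)
  case 0
  have "{p : C2_star. p : S} = S" using S(2) by auto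
  thus ?case using S by simp
 next
  case (Suc n)
  have eq: "{p : C2_star. (T ^^ Suc n) p : S} = {p : C2_star. T p : {p : C2_star. (T ^^ n) p : S}}"
   using T(2) by (auto simp: funpow_swap1)
  have "{p : C2_star. T p : {p : C2_star. (T ^^ n) p : S}} = C2_star Int T -` {p : C2_star. (T ^^ n) p : S}"
   by auto
  hence "open {p : C2_star. T p : {p : C2_star. (T ^^ n) p : S}}"
   using continuous_open_preimage[OF T(1) open_C2_star conjunct1[OF Suc]] by (simp only:)
  thus ?case unfolding eq using Op_fits[of "{p : C2_star. (T ^^ n) p : S}"] Suc by simp
 qed
 show ?thesis
 proof
  show "fits D V u'"
  proof (rule fits_atI)
   fix p W w assume p: "p : V" "(W, w) : D" "p : W"
   then obtain n where n: "(T ^^ n) p : S" using reach by blast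
   let ?Q = "{p : C2_star. (T ^^ n) p : S}"
   have pQ: "p : ?Q" using n p V by auto
   have "holo2_at (%q. (Op ^^ n) u q - w q) p"
    by (rule fits_atD[OF conjunct2[OF preim[of n]] pQ p(2,3)])
   thus "holo2_at (%q. u' q - w q) p"
    by (rule holo2_at_transform[OF _ conjunct1[OF preim[of n]] pQ]) (simp add: u'[of n])
  qed
  fix p assume p: "p : V" "T p : V"
  then obtain n where n: "(T ^^ n) (T p) : S" using reach by blast
  hence "(T ^^ Suc n) p : S" by (simp add: funpow_swap1)
  from u'[OF this] u'[OF n] show "Op u' p = u' p"
   by (simp add: Op[of u'] Op[of "(Op ^^ n) u"])
 qed
qed

end

text \<open>The Cauchy transform in x over a circle outside the removed disc is holomorphic for all
  y in the unit disc. It equals w where y lies beyond the removed disc, and by continuation in y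
  also where only x does.\<close>

lemma hartogs_bidisc:
 assumes w: "holo2_on w (ball 0 R \<times> ball 0 1 - cball 0 R' \<times> cball 0 rh')"
  and lt: "0 < R'" "R' < R" "0 < rh'" "rh' < 1"
 obtains W where "holo2_on W (ball 0 R \<times> ball 0 1)"
  "!!p. p : ball 0 R \<times> ball 0 1 - cball 0 R' \<times> cball 0 rh' ==> W p = w p"
proof -
 let ?S = "ball 0 R \<times> ball 0 1 - cball 0 R' \<times> cball 0 rh' :: C2 set"
 define R'' where "R'' = (R' + R) / 2"
 have R'': "R' < R''" "R'' < R" "R'' > 0" using lt by (auto simp: R''_def)
 have opS: "open ?S" by (intro open_Diff open_Times closed_Times) auto
 define C where "C = cauchy_transform (circlepath 0 R'') w"
 have C: "holo2_on C (ball 0 R'' \<times> ball 0 1)"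
  unfolding C_def
  by (rule holo2_on_subset[OF holo2_on_cauchy_transform[OF C1_path_circlepath opS w, of "ball 0 1"]])
   (use R'' in auto)
 have 1: "C (x, y) = w (x, y)" if "cmod x < R''" "rh' < cmod y" "cmod y < 1" for x y
  unfolding C_def using that R''
  by (intro cauchy_transform_circle holo2_on_slice_fst[OF w]) auto
 have 2: "C (x, y) = w (x, y)" if x: "R' < cmod x" "cmod x < R''" and y: "cmod y < 1" for x y
 proof (rule analytic_continuation_open[of "{y. rh' < cmod y & cmod y < 1}" "ball 0 1" "%y. C (x, y)" "%y. w (x, y)"])
  show "{y. rh' < cmod y & cmod y < 1} ~= {}"
  proof -
   have "cmod (of_real ((rh' + 1) / 2)) = (rh' + 1) / 2" using lt by (simp only: norm_of_real) simp
   hence "of_real ((rh' + 1) / 2) : {y. rh' < cmod y & cmod y < 1}" using lt by simp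
   thus ?thesis by blast
  qed
  show "(%y. C (x, y)) holomorphic_on ball 0 1" by (rule holo2_on_slice_snd[OF C]) (use x in auto)
  show "(%y. w (x, y)) holomorphic_on ball 0 1" by (rule holo2_on_slice_snd[OF w]) (use x R'' in auto)
  show "C (x, y) = w (x, y)" if "y : {y. rh' < cmod y & cmod y < 1}" for y
   using 1[of x y] x that by auto
 qed (use y in \<open>auto simp: open_annulus\<close>)
 define W where "W p = (if cmod (fst p) < R'' then C p else w p)" for p
 have eq: "W p = w p" if "p : ?S" for p
 proof -
  obtain x y where p: "p = (x, y)" by (cases p)
  show ?thesis
  proof (cases "cmod x < R''")
   case True
   thus ?thesis using that 1[of x y] 2[of x y] by (auto simp: p W_def not_le)
  qed (simp add: p W_def)
 qed
 show ?thesis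
 proof (rule that[OF _ eq])
  show "holo2_on W (ball 0 R \<times> ball 0 1)"
   unfolding holo2_on_iff
  proof
   fix p :: C2 assume p: "p : ball 0 R \<times> ball 0 1"
   show "holo2_at W p"
   proof (cases "cmod (fst p) < R''")
    case True
    have "holo2_at C p" using C p True by (auto simp: holo2_on_iff)
    thus ?thesis
     by (rule holo2_at_transform[of _ _ "ball 0 R'' \<times> ball 0 1"]) (use p True in \<open>auto simp: W_def open_Times\<close>)
   next
    case False
    hence "p : ?S" using p R'' by auto
    hence "holo2_at w p" using w by (simp add: holo2_on_iff)
    thus ?thesis
     by (rule holo2_at_transform[OF _ opS \<open>p : ?S\<close>]) (simp add: eq)
   qed
  qed
 qed
qed

section \<open>The cohomological equation and global splittings\<close>

text \<open>
  The polynomial \<open>((x + y\<^sup>r / b\<^sup>r)\<^sup>k - x\<^sup>k) / y\<^sup>a\<close>: the cocycle of the non-split extension of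
  \<open>(L b)\<^bsup>a-rk\<^esup>\<close> by the trivial bundle.
\<close>

context hopf
begin

definition cocycle :: "nat => nat => C2 => complex" where
 "cocycle k a p = (\<Sum>i<k. of_nat (k choose i) * fst p ^ i * (1 / b ^ r) ^ (k - i) * snd p ^ (r * (k - i) - a))"

lemma binomial_lower:
 "(x + c * z) ^ n = x ^ n + (\<Sum>i<n. of_nat (n choose i) * x ^ i * c ^ (n - i) * z ^ (n - i))" for x c z :: complex
proof -
 have "(x + c * z) ^ n = (\<Sum>i\<le>n. of_nat (n choose i) * x ^ i * (c * z) ^ (n - i))"
  by (rule binomial_ring)
 also have "\<dots> = (\<Sum>i<n. of_nat (n choose i) * x ^ i * (c * z) ^ (n - i)) + x ^ n"
  by (simp flip: lessThan_Suc_atMost)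
 finally show ?thesis by (simp add: power_mult_distrib mult.assoc)
qed

text \<open>The natural-number exponents r(k-i) - a are genuine differences, since i < k and a <= r
  give a <= r(k-i).\<close>

lemma cocycle_eq:
 assumes "a <= r"
 shows "snd p ^ a * cocycle k a p = (fst p + snd p ^ r / b ^ r) ^ k - fst p ^ k"
proof -
 have "snd p ^ a * cocycle k a p =
   (\<Sum>i<k. of_nat (k choose i) * fst p ^ i * (1 / b ^ r) ^ (k - i) * (snd p ^ a * snd p ^ (r * (k - i) - a)))"
  by (simp add: cocycle_def sum_distrib_left algebra_simps)
 also have "\<dots> = (\<Sum>i<k. of_nat (k choose i) * fst p ^ i * (1 / b ^ r) ^ (k - i) * (snd p ^ r) ^ (k - i))"
 proof (rule sum.cong)
  fix i assume "i : {..<k}"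
  hence "1 <= k - i" by auto
  hence "r <= r * (k - i)" by (cases "k - i") auto
  hence "a + (r * (k - i) - a) = r * (k - i)" by (intro le_add_diff_inverse order_trans[OF assms])
  hence "snd p ^ a * snd p ^ (r * (k - i) - a) = (snd p ^ r) ^ (k - i)"
   by (metis power_add power_mult)
  thus "of_nat (k choose i) * fst p ^ i * (1 / b ^ r) ^ (k - i) * (snd p ^ a * snd p ^ (r * (k - i) - a)) =
   of_nat (k choose i) * fst p ^ i * (1 / b ^ r) ^ (k - i) * (snd p ^ r) ^ (k - i)" by simp
 qed simp
 also have "\<dots> = (fst p + snd p ^ r / b ^ r) ^ k - fst p ^ k"
  using binomial_lower[of "fst p" "1 / b ^ r" "snd p ^ r" k] by simp
 finally show ?thesis .
qed

lemma holo2_at_cocycle: "holo2_at (cocycle k a) p"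
 unfolding cocycle_def[abs_def]
 by (rule holo2_at_sum, rule holo2_at_mult, rule holo2_at_mult, rule holo2_at_mult)
  (auto intro: holo2_at_power holo2_at_fst holo2_at_snd)

end

lemma holo2_at_monomial: "holo2_at (%p. fst p ^ i * snd p ^ j) p"
 by (rule holo2_at_mult[OF holo2_at_power[OF holo2_at_fst] holo2_at_power[OF holo2_at_snd]])

section \<open>The cohomological equation on a bidisc\<close>

text \<open>The bound on R makes F map the bidisc of radii R and 1 into itself. Equations are solved
  modulo multiples of \<open>cc\<close>, which will be the cocycle, or 0 when no obstruction is
  expected.\<close>

locale cohomological_eq = hopf +
 fixes R :: real and \<nu> :: complex and cc :: "C2 => complex"
 assumes R: "R > 0" "cmod b ^ r * R + 1 < R"
begin

abbreviation \<Delta> :: "C2 set" where "\<Delta> \<equiv> ball 0 R \<times> ball 0 1"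

definition solvable :: "(C2 => complex) => bool" where
 "solvable f \<longleftrightarrow> (EX h c. holo2_on h \<Delta> & (ALL p:\<Delta>. f p + \<nu> * h (F p) - h p = c * cc p))"

lemma solvable_linear:
 assumes "solvable f" "solvable g"
 shows "solvable (%p. s * f p + g p)"
proof -
 obtain h c h' c' where h: "holo2_on h \<Delta>" "!!p. p : \<Delta> ==> f p + \<nu> * h (F p) - h p = c * cc p"
  and h': "holo2_on h' \<Delta>" "!!p. p : \<Delta> ==> g p + \<nu> * h' (F p) - h' p = c' * cc p"
  using assms unfolding solvable_def by blast
 have "holo2_on (%p. s * h p + h' p) \<Delta>"
  using h(1) h'(1) unfolding holo2_on_iff
  by (blast intro: holo2_at_add[OF holo2_at_mult[OF holo2_at_const]])
 moreover have "s * f p + g p + \<nu> * (s * h (F p) + h' (F p)) - (s * h p + h' p) = (s * c + c') * cc p"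
  if "p : \<Delta>" for p
 proof -
  have "s * (f p + \<nu> * h (F p) - h p) + (g p + \<nu> * h' (F p) - h' p) = (s * c + c') * cc p"
   unfolding h(2)[OF that] h'(2)[OF that] by (simp add: algebra_simps)
  thus ?thesis by (simp add: algebra_simps)
 qed
 ultimately show ?thesis
  unfolding solvable_def by (intro exI[of _ "%p. s * h p + h' p"] exI[of _ "s * c + c'"]) blast
qed

lemma solvable_0: "solvable (%_. 0)"
 unfolding solvable_def by (intro exI[of _ "%_. 0"] exI[of _ 0]) (simp add: holo2_on_iff)

lemma solvable_cmult: "solvable f ==> solvable (%p. s * f p)"
 using solvable_linear[of f "%_. 0" s] solvable_0 by simp

lemma solvable_add: "solvable f ==> solvable g ==> solvable (%p. f p + g p)"
 using solvable_linear[of f g 1] by simp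

lemma solvable_sum: "(!!i. i : I ==> solvable (f i)) ==> solvable (%p. \<Sum>i\<in>I. f i p)"
 by (induction I rule: infinite_finite_induct) (simp_all add: solvable_0 solvable_add)

lemma solvable_cong: "solvable f ==> (!!p. p : \<Delta> ==> f p = g p) ==> solvable g"
 unfolding solvable_def by metis

lemma solvable_reduce:
 assumes "holo2_on h \<Delta>" "solvable g" "!!p. p : \<Delta> ==> g p = f p + \<nu> * h (F p) - h p"
 shows "solvable f"
proof -
 obtain h' c' where h': "holo2_on h' \<Delta>" "!!p. p : \<Delta> ==> g p + \<nu> * h' (F p) - h' p = c' * cc p"
  using assms unfolding solvable_def by blast
 have "holo2_on (%p. h p + h' p) \<Delta>"
  using assms(1) h'(1) unfolding holo2_on_iff by (blast intro: holo2_at_add)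
 moreover have "f p + \<nu> * (h (F p) + h' (F p)) - (h p + h' p) = c' * cc p" if "p : \<Delta>" for p
  using h'(2)[OF that] assms(3)[OF that] by (simp add: algebra_simps)
 ultimately show ?thesis
  unfolding solvable_def by (intro exI[of _ "%p. h p + h' p"] exI[of _ c']) blast
qed

lemma solvable_cc: "solvable cc"
 unfolding solvable_def by (intro exI[of _ "%_. 0"] exI[of _ 1]) (simp add: holo2_on_iff)

text \<open>
  In the weighted norm \<open>|x| + M |y|\<close> the map \<open>F\<close> contracts by a factor arbitrarily close to \<open>|b|\<close>,
  so the Neumann series converges on functions vanishing to sufficiently high order.
\<close>

lemma solvable_high_order:
 assumes th: "cmod b < th" "th < 1" "cmod \<nu> * th ^ (i + j) < 1" and G: "holo2_on G \<Delta>"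
 obtains h where "holo2_on h \<Delta>" "!!p. p : \<Delta> ==> fst p ^ i * snd p ^ j * G p + \<nu> * h (F p) - h p = 0"
proof -
 let ?q = "cmod b"
 have q: "0 < ?q" "?q < 1" using b by auto
 have qr: "0 < ?q ^ r" "?q ^ r <= ?q" "?q ^ r < 1"
  using q r power_decreasing[of 1 r ?q] br by (auto simp: norm_power)
 \<comment> \<open>Chosen to give 1 + M |b| <= M th: the weight on y absorbs the shear y^r, of
   modulus at most |y|, into the contraction rate \<open>th\<close>.\<close>
 define M where "M = max 1 (1 / (th - ?q))"
 have M: "M >= 1" "1 + M * ?q <= M * th"
 proof -
  show "M >= 1" by (simp add: M_def)
  have "1 / (th - ?q) <= M" by (simp add: M_def)
  thus "1 + M * ?q <= M * th" using th by (simp add: divide_le_eq algebra_simps)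
 qed
 define N where "N p = cmod (fst p) + M * cmod (snd p)" for p :: C2
 have N0: "N p >= 0" for p using M by (simp add: N_def)
 have NF: "N (F p) <= th * N p" if "cmod (snd p) <= 1" for p
 proof -
  obtain x y where p: "p = (x, y)" by (cases p)
  have "cmod y ^ r <= cmod y" using that power_decreasing[of 1 r "cmod y"] r by (simp add: p)
  moreover have "cmod (b ^ r * x + y ^ r) <= ?q ^ r * cmod x + cmod y ^ r"
   using norm_triangle_ineq[of "b ^ r * x" "y ^ r"] by (simp add: norm_mult norm_power)
  moreover have "?q ^ r * cmod x <= th * cmod x" using qr th by (intro mult_right_mono) auto
  ultimately have "N (F p) <= th * cmod x + cmod y + M * (?q * cmod y)"
   by (simp add: N_def p F_eq norm_mult)
  also have "\<dots> = th * cmod x + (1 + M * ?q) * cmod y" by (simp add: algebra_simps)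
  also have "\<dots> <= th * cmod x + (M * th) * cmod y" using M by (intro add_left_mono mult_right_mono) auto
  finally show ?thesis by (simp add: N_def p algebra_simps)
 qed
 have F\<Delta>: "F p : ball 0 R1 \<times> ball 0 s1" if "p : ball 0 R1 \<times> ball 0 s1" "?q ^ r * R1 + 1 <= R1" "s1 <= 1" for p R1 s1
 proof -
  obtain x y where p: "p = (x, y)" by (cases p)
  have "cmod (b ^ r * x + y ^ r) <= ?q ^ r * cmod x + cmod y ^ r"
   using norm_triangle_ineq[of "b ^ r * x" "y ^ r"] by (simp add: norm_mult norm_power)
  also have "\<dots> < ?q ^ r * R1 + 1"
   using that p qr power_le_one[of "cmod y" r] by (intro add_less_le_mono mult_strict_left_mono) auto
  finally have 1: "cmod (b ^ r * x + y ^ r) < R1" using that by simp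
  have "?q * cmod y <= 1 * cmod y" using q by (intro mult_right_mono) auto
  thus ?thesis using 1 that p by (simp add: F_eq norm_mult)
 qed
 define f where "f p = fst p ^ i * snd p ^ j * G p" for p
 have f: "holo2_on f \<Delta>"
  using G unfolding f_def holo2_on_iff by (blast intro: holo2_at_mult[OF holo2_at_monomial])
 define t where "t n p = \<nu> ^ n * f ((F ^^ n) p)" for n p
 have Fn\<Delta>: "(F ^^ n) p : ball 0 R1 \<times> ball 0 s1" if "p : ball 0 R1 \<times> ball 0 s1" "?q ^ r * R1 + 1 <= R1" "s1 <= 1" for n p R1 s1
  by (induction n) (use that F\<Delta> in auto)
 have t: "holo2_on (t n) \<Delta>" for n
 proof (induction n)
  case 0 thus ?case using f by (simp add: t_def[abs_def])
 next
  case (Suc n)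
  have "t (Suc n) = (%p. \<nu> * t n (F p))" by (auto simp: t_def funpow_swap1)
  moreover have "holo2_at (%p. \<nu> * t n (F p)) p" if "p : \<Delta>" for p
  proof -
   have "F p : \<Delta>" using F\<Delta>[OF that] R by simp
   hence "holo2_at (t n) (F p)" using Suc unfolding holo2_on_iff by (rule bspec[rotated])
   from holo2_at_mult[OF holo2_at_const holo2_at_F[OF this]] show ?thesis .
  qed
  ultimately show ?case by (simp add: holo2_on_iff)
 qed
 define \<eta> where "\<eta> = cmod \<nu> * th ^ (i + j)"
 have th0: "th > 0" using th q by linarith
 have \<eta>: "0 <= \<eta>" "\<eta> < 1" using th th0 by (auto simp: \<eta>_def)
 define h where "h p = (\<Sum>n. t n p)" for p
 have loc: "EX V. open V & p : V & V <= \<Delta> & (ALL q:V. summable (%n. t n q)) & uniform_limit V (%n q. \<Sum>i<n. t i q) h sequentially"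
  if "p : \<Delta>" for p
 proof -
  \<comment> \<open>A slightly smaller bidisc that contains p and is still mapped into itself; on
    its closure G is bounded.\<close>
  define R1 where "R1 = max ((cmod (fst p) + R) / 2) (?q ^ r * R + 1)"
  define s1 where "s1 = (cmod (snd p) + 1) / 2"
  have R1: "cmod (fst p) < R1" "R1 < R" using that R by (auto simp: R1_def less_max_iff_disj)
  have "?q ^ r * R1 <= ?q ^ r * R" using R1 qr by (intro mult_left_mono) auto
  moreover have "?q ^ r * R + 1 <= R1" by (simp add: R1_def)
  ultimately have R1': "?q ^ r * R1 + 1 <= R1" by linarith
  have s1: "cmod (snd p) < s1" "s1 < 1" using that by (auto simp: s1_def)
  let ?V = "ball 0 R1 \<times> ball 0 s1 :: C2 set"
  have "compact (cball 0 R1 \<times> cball 0 s1 :: C2 set)" by (intro compact_Times) auto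
  moreover have "continuous_on (cball 0 R1 \<times> cball 0 s1) G"
   by (rule continuous_on_subset[OF holo2_on_continuous_on[OF G]]) (use R1 s1 in auto)
  ultimately have "bounded (G ` (cball 0 R1 \<times> cball 0 s1))"
   by (intro compact_imp_bounded compact_continuous_image)
  then obtain C where C: "!!q. q : cball 0 R1 \<times> cball 0 s1 ==> cmod (G q) <= C" unfolding bounded_iff by auto
  define K where "K = (R1 + M) ^ (i + j) * \<bar>C\<bar>"
  have bd: "cmod (t n q) <= K * \<eta> ^ n" if q: "q : ?V" for n q
  proof -
   have NFn: "N ((F ^^ n) q) <= th ^ n * N q"
   proof (induction n)
    case (Suc n)
    have "(F ^^ n) q : ?V" using Fn\<Delta>[OF q R1'] s1 by simp
    hence "N (F ((F ^^ n) q)) <= th * N ((F ^^ n) q)" using s1 by (intro NF) auto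
    also have "\<dots> <= th * (th ^ n * N q)" using Suc th0 by (intro mult_left_mono) auto
    finally show ?case by simp
   qed simp
   have Nq: "N q <= R1 + M"
   proof -
    have "cmod (fst q) < R1" "cmod (snd q) < 1" using q s1 by (auto simp: mem_Times_iff)
    moreover from this have "M * cmod (snd q) <= M * 1" using M by (intro mult_left_mono) auto
    ultimately show ?thesis unfolding N_def by linarith
   qed
   let ?p = "(F ^^ n) q"
   have "1 * cmod (snd ?p) <= M * cmod (snd ?p)" using M by (intro mult_right_mono) auto
   hence "cmod (fst ?p) <= N ?p" "cmod (snd ?p) <= N ?p"
    unfolding N_def using norm_ge_zero[of "snd ?p"] norm_ge_zero[of "fst ?p"] by linarith+
   hence "cmod (fst ?p) ^ i * cmod (snd ?p) ^ j <= N ?p ^ i * N ?p ^ j"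
    using N0 by (intro mult_mono power_mono) auto
   also have "\<dots> = N ?p ^ (i + j)" by (simp add: power_add)
   also have "\<dots> <= (th ^ n * (R1 + M)) ^ (i + j)"
    using NFn N0 Nq th0 by (intro power_mono order_trans[OF NFn] mult_left_mono) auto
   finally have 1: "cmod (fst ?p) ^ i * cmod (snd ?p) ^ j <= (th ^ n * (R1 + M)) ^ (i + j)" .
   have "?p : cball 0 R1 \<times> cball 0 s1" using Fn\<Delta>[OF q R1', of n] s1 by (auto simp: mem_Times_iff less_imp_le)
   hence 2: "cmod (G ?p) <= \<bar>C\<bar>" using C by fastforce
   have "0 <= R1 + M" using Nq N0[of q] by linarith
   have "cmod (t n q) = cmod \<nu> ^ n * ((cmod (fst ?p) ^ i * cmod (snd ?p) ^ j) * cmod (G ?p))"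
    by (simp add: t_def f_def norm_mult norm_power)
   also have "\<dots> <= cmod \<nu> ^ n * ((th ^ n * (R1 + M)) ^ (i + j) * \<bar>C\<bar>)"
    using 1 2 th0 \<open>0 <= R1 + M\<close> by (intro mult_left_mono mult_mono) auto
   also have "\<dots> = K * \<eta> ^ n"
    by (simp add: K_def \<eta>_def power_mult_distrib mult.commute mult.left_commute flip: power_mult)
   finally show ?thesis .
  qed
  have sm: "summable (%n. K * \<eta> ^ n)" using \<eta> by (intro summable_mult summable_geometric) auto
  have "uniform_limit ?V (%n q. \<Sum>i<n. t i q) h sequentially"
   unfolding h_def by (rule Weierstrass_m_test[OF bd sm])
  moreover have "summable (%n. t n q)" if "q : ?V" for q
   by (rule summable_comparison_test'[OF sm bd[OF that]])
  moreover have "open ?V" "p : ?V" "?V <= \<Delta>" using R1 s1 by (auto simp: open_Times mem_Times_iff)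
  ultimately show ?thesis by blast
 qed
 have h: "holo2_on h \<Delta>"
 proof (rule holo2_on_limit)
  show "open \<Delta>" by (simp add: open_Times)
  show "holo2_on (%q. \<Sum>i<n. t i q) \<Delta>" for n
   using t unfolding holo2_on_iff by (auto intro: holo2_at_sum)
  show "EX V. open V & p : V & V <= \<Delta> & uniform_limit V (%n q. \<Sum>i<n. t i q) h sequentially" if "p : \<Delta>" for p
   using loc[OF that] by blast
 qed
 show ?thesis
 proof (rule that[OF h])
  fix p assume p: "p : \<Delta>"
  have sm: "summable (%n. t n p)" if p': "p : \<Delta>" for p
  proof -
   obtain V where "p : V" "ALL q:V. summable (%n. t n q)" using loc[OF p'] by (elim exE conjE)
   thus ?thesis by (rule bspec[rotated])
  qed
  from sm[OF p] have "h p = t 0 p + (\<Sum>n. t (Suc n) p)" unfolding h_def using suminf_split_head[of "%n. t n p"] by simp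
  moreover have "F p : \<Delta>" using F\<Delta>[OF p] R by simp
  from sm[OF this] have "(\<Sum>n. \<nu> * t n (F p)) = \<nu> * h (F p)" unfolding h_def by (rule suminf_mult)
  moreover have "t (Suc n) p = \<nu> * t n (F p)" for n by (simp add: t_def funpow_swap1)
  ultimately have "h p = t 0 p + \<nu> * h (F p)" by simp
  thus "fst p ^ i * snd p ^ j * G p + \<nu> * h (F p) - h p = 0"
   by (simp add: t_def f_def)
 qed
qed

text \<open>Repeated division by x and y expands f into monomials of degree below d and remainders
  x^i y^j G with i + j = d. The remainders have convergent Neumann series, so only finitely many
  monomials can obstruct.\<close>

lemma solvable_holo2:
 assumes mono: "!!i j. i + j < d ==> solvable (%p. fst p ^ i * snd p ^ j)"
  and th: "cmod b < th" "th < 1" "cmod \<nu> * th ^ d < 1" and f: "holo2_on f \<Delta>"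
 shows "solvable f"
proof -
 have op: "open \<Delta>" by (simp add: open_Times)
 have "solvable (%p. fst p ^ i * snd p ^ j * G p)" if "i + j + e = d" "holo2_on G \<Delta>" for i j e G
  using that
 proof (induction e arbitrary: i j G)
  case 0
  then obtain h where "holo2_on h \<Delta>" "!!p. p : \<Delta> ==> fst p ^ i * snd p ^ j * G p + \<nu> * h (F p) - h p = 0"
   using solvable_high_order[OF th(1,2), of i j G] th(3) by auto
  thus ?case by (intro solvable_reduce[OF _ solvable_0]) auto
 next
  case (Suc e)
  note G = Suc.prems(2)
  define G0 where "G0 p = G (fst p, 0)" for p :: C2
  have G0: "holo2_on G0 \<Delta>"
   unfolding holo2_on_iff
  proof
   fix p assume p: "p : \<Delta>"
   hence "holo2_at G (fst p, 0)" using G by (auto simp: holo2_on_iff)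
   from holo2_at_compose2[OF holo2_at_fst holo2_at_const this] show "holo2_at G0 p"
    by (simp add: G0_def[abs_def])
  qed
  have "holo2_on (%p. G p - G0 p) \<Delta>" using G G0 unfolding holo2_on_iff by (blast intro: holo2_at_diff)
  then obtain G2 where G2: "holo2_on G2 \<Delta>" "!!p. p : \<Delta> ==> G p - G0 p = snd p * G2 p"
   using holo2_divide_snd[OF op, of "%p. G p - G0 p"] by (auto simp: G0_def)
  have "holo2_on (%p. G0 p - G (0, 0)) \<Delta>" using G0 unfolding holo2_on_iff by (intro ballI holo2_at_diff[OF _ holo2_at_const]) (rule bspec)
  then obtain G1 where G1: "holo2_on G1 \<Delta>" "!!p. p : \<Delta> ==> G0 p - G (0, 0) = fst p * G1 p"
   using holo2_divide_fst[OF op, of "%p. G0 p - G (0, 0)"] by (auto simp: G0_def)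
  have s0: "solvable (%p. G (0, 0) * (fst p ^ i * snd p ^ j))"
   using Suc.prems(1) by (intro solvable_cmult mono) simp
  have s1: "solvable (%p. fst p ^ Suc i * snd p ^ j * G1 p)"
   by (rule Suc.IH[OF _ G1(1)]) (use Suc.prems(1) in simp)
  have s2: "solvable (%p. fst p ^ i * snd p ^ Suc j * G2 p)"
   by (rule Suc.IH[OF _ G2(1)]) (use Suc.prems(1) in simp)
  show ?case
  proof (rule solvable_cong[OF solvable_add[OF s0 solvable_add[OF s1 s2]]])
   fix p assume p: "p : \<Delta>"
   have "G p = G (0, 0) + fst p * G1 p + snd p * G2 p"
    using G1(2)[OF p] G2(2)[OF p] by (simp add: algebra_simps)
   thus "G (0, 0) * (fst p ^ i * snd p ^ j) + (fst p ^ Suc i * snd p ^ j * G1 p + fst p ^ i * snd p ^ Suc j * G2 p)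
     = fst p ^ i * snd p ^ j * G p"
    by (simp add: algebra_simps)
  qed
 qed
 from this[of 0 0 d f] f show ?thesis by simp
qed

end

text \<open>Resonant monomials are handled by descending induction on the exponent of \<open>x\<close>.\<close>

lemma (in hopf) solvable_monomial:
 assumes R: "R > 0" "cmod b ^ r * R + 1 < R" and k: "1 <= k" and a: "1 <= a" "a <= r"
 shows "cohomological_eq.solvable b r R (b powi (int a - int (r * k))) (cocycle k a) (%p. fst p ^ i * snd p ^ m)"
proof -
 let ?\<nu> = "b powi (int a - int (r * k))"
 interpret cohomological_eq b r R ?\<nu> "cocycle k a"
  by unfold_locales (use R in auto)
 define bea where "bea = 1 / b ^ r"
 have bea0: "bea ~= 0" by (simp add: bea_def)
 \<comment> \<open>The terms of lower degree in x which the shear adds to the pullback of x^n y^m',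
   up to the factor b^(rn+m').\<close>
 define low where "low n m' p = (\<Sum>j<n. of_nat (n choose j) * fst p ^ j * bea ^ (n - j) * (snd p ^ r) ^ (n - j)) * snd p ^ m'"
  for n m' and p :: C2
 have hmon: "holo2_on (%p. s * (fst p ^ i * snd p ^ j)) \<Delta>" for s i j
  unfolding holo2_on_iff by (blast intro: holo2_at_mult[OF holo2_at_const holo2_at_monomial])
 have mF: "fst (F p) ^ n * snd (F p) ^ m' = b ^ (r * n + m') * (fst p ^ n * snd p ^ m' + low n m' p)" for n m' p
 proof -
  obtain x y where p: "p = (x, y)" by (cases p)
  have "b ^ r * x + y ^ r = b ^ r * (x + bea * y ^ r)" by (simp add: bea_def field_simps)
  hence "fst (F p) ^ n * snd (F p) ^ m' = b ^ (r * n + m') * ((x + bea * y ^ r) ^ n * y ^ m')"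
   by (simp add: p F_eq power_mult_distrib power_add power_mult)
  thus ?thesis unfolding binomial_lower by (simp add: p low_def algebra_simps)
 qed
 show ?thesis
 proof (induction i arbitrary: m rule: less_induct)
  case (less i)
  have low: "solvable (low n m')" if "n <= i" for n m'
  proof -
   have "solvable (%p. \<Sum>j<n. of_nat (n choose j) * bea ^ (n - j) * (fst p ^ j * snd p ^ (r * (n - j) + m')))"
    using that by (intro solvable_sum solvable_cmult less.IH) auto
   thus ?thesis
    by (rule solvable_cong) (unfold low_def sum_distrib_right, rule sum.cong, simp_all only: power_add power_mult mult_ac)
  qed
  \<comment> \<open>b^e is the factor by which \<nu> times the pullback acts on the leading
    monomial; e = 0 is resonance.\<close>
  define e where "e = int (r * i + m) + int a - int (r * k)"
  have be: "?\<nu> * b ^ (r * i + m) = b powi e"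
  proof -
   have "?\<nu> * b ^ (r * i + m) = b powi (int a - int (r * k)) * b powi int (r * i + m)" by (simp only: power_int_of_nat)
   also have "\<dots> = b powi e" by (subst power_int_add[symmetric]) (auto simp: e_def algebra_simps)
   finally show ?thesis .
  qed
  show ?case
  proof (cases "e = 0")
   case False
   have "b powi e ~= 1"
   proof
    assume *: "b powi e = 1"
    have "b ^ nat \<bar>e\<bar> = b ^ 0"
     using * by (cases "e >= 0") (auto simp: power_int_def power_inverse)
    from inj_on_power_complex[OF b this] show False using False by simp
   qed
   \<comment> \<open>Off resonance this coefficient cancels the leading monomial and leaves only
     lower powers of x.\<close>
   define s where "s = 1 / (1 - b powi e)"
   have s: "1 + s * b powi e - s = 0" using \<open>b powi e ~= 1\<close> by (simp add: s_def field_simps)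
   show ?thesis
   proof (rule solvable_reduce[OF hmon[of s i m] solvable_cmult[OF low[OF order_refl, of m], of "s * b powi e"]])
    fix p
    have "fst p ^ i * snd p ^ m + ?\<nu> * (s * (fst (F p) ^ i * snd (F p) ^ m)) - s * (fst p ^ i * snd p ^ m)
     = fst p ^ i * snd p ^ m + s * (?\<nu> * b ^ (r * i + m)) * (fst p ^ i * snd p ^ m + low i m p) - s * (fst p ^ i * snd p ^ m)"
     unfolding mF by (simp add: algebra_simps)
    also have "\<dots> = (1 + s * b powi e - s) * (fst p ^ i * snd p ^ m) + s * b powi e * low i m p"
     unfolding be by (simp add: algebra_simps)
    finally show "s * b powi e * low i m p = fst p ^ i * snd p ^ m + ?\<nu> * (s * (fst (F p) ^ i * snd (F p) ^ m)) - s * (fst p ^ i * snd p ^ m)"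
     using s by simp
   qed
  next
   case True
   hence "int (r * i + m + a) = int (r * k)" by (simp add: e_def)
   hence wt: "r * i + m + a = r * k" by (simp only: of_nat_eq_iff)
   hence "r * i < r * k" using a by linarith
   hence ik: "i < k" by simp
   show ?thesis
   proof (cases "i = k - 1")
    case True
    hence k': "k = Suc i" using k by simp
    hence m: "m + a = r" using wt by simp
    \<comment> \<open>The leading term of the cocycle in x is k b^(-r) x^(k-1) y^(r-a), so here the
      monomial is a multiple of the cocycle up to lower powers of x.\<close>
    define c where "c = of_nat k * bea"
    have c0: "c ~= 0" using k bea0 by (simp add: c_def)
    have "solvable (%p. \<Sum>j<i. of_nat (k choose j) * bea ^ (k - j) * (fst p ^ j * snd p ^ (r * (k - j) - a)))"
     by (intro solvable_sum solvable_cmult less.IH) auto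
    from solvable_linear[OF this solvable_cc, of "-1"]
    have "solvable (%p. - 1 * (\<Sum>j<i. of_nat (k choose j) * bea ^ (k - j) * (fst p ^ j * snd p ^ (r * (k - j) - a))) + cocycle k a p)" .
    hence "solvable (%p. c * (fst p ^ i * snd p ^ m))"
    proof (rule solvable_cong)
     fix p
     have "cocycle k a p = (\<Sum>j<Suc i. of_nat (k choose j) * fst p ^ j * bea ^ (k - j) * snd p ^ (r * (k - j) - a))"
      by (simp add: cocycle_def bea_def k')
     also have "\<dots> = (\<Sum>j<i. of_nat (k choose j) * bea ^ (k - j) * (fst p ^ j * snd p ^ (r * (k - j) - a)))
       + of_nat (k choose i) * fst p ^ i * bea ^ (k - i) * snd p ^ (r * (k - i) - a)"
      by (simp add: algebra_simps)
     also have "of_nat (k choose i) * fst p ^ i * bea ^ (k - i) * snd p ^ (r * (k - i) - a) = c * (fst p ^ i * snd p ^ m)"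
      using m by (simp add: k' c_def) (metis add_diff_cancel_right')
     finally show "- 1 * (\<Sum>j<i. of_nat (k choose j) * bea ^ (k - j) * (fst p ^ j * snd p ^ (r * (k - j) - a))) + cocycle k a p = c * (fst p ^ i * snd p ^ m)"
      by simp
    qed
    from solvable_cmult[OF this, of "1 / c"] show ?thesis using c0 by simp
   next
    case False
    hence "Suc (Suc i) <= k" using ik by simp
    hence "r * Suc (Suc i) <= r * k" by (rule mult_le_mono2)
    hence mr: "r <= m" using wt a by simp
    \<comment> \<open>The monomial x^(i+1) y^(m-r) is resonant as well, so its leading term cancels
      in the coboundary and the next one, (i+1) b^(-r) x^i y^m, takes its place.\<close>
    define c where "c = - 1 / (of_nat (Suc i) * bea)"
    have c: "c * of_nat (Suc i) * bea = - 1" using bea0 by (simp add: c_def field_simps del: of_nat_Suc)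
    have nu1: "?\<nu> * b ^ (r * Suc i + (m - r)) = 1"
    proof -
     have "r * Suc i + (m - r) = r * i + m" using mr by simp
     thus ?thesis using be \<open>e = 0\<close> by simp
    qed
    define rest where "rest p = (\<Sum>j<i. of_nat (Suc i choose j) * bea ^ (Suc i - j) * (fst p ^ j * snd p ^ (r * (Suc i - j) + (m - r))))" for p :: C2
    have "solvable rest"
     unfolding rest_def by (intro solvable_sum solvable_cmult less.IH) auto
    show ?thesis
    proof (rule solvable_reduce[OF hmon[of c "Suc i" "m - r"] solvable_cmult[OF \<open>solvable rest\<close>, of c]])
     fix p
     have lowS: "low (Suc i) (m - r) p = of_nat (Suc i) * bea * (fst p ^ i * snd p ^ m) + rest p"
     proof -
      have "low (Suc i) (m - r) p = (\<Sum>j<Suc i. of_nat (Suc i choose j) * bea ^ (Suc i - j) * (fst p ^ j * snd p ^ (r * (Suc i - j) + (m - r))))"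
       by (unfold low_def sum_distrib_right, rule sum.cong, simp_all only: power_add power_mult mult_ac)
      also have "\<dots> = rest p + of_nat (Suc i choose i) * bea ^ (Suc i - i) * (fst p ^ i * snd p ^ (r * (Suc i - i) + (m - r)))"
       unfolding rest_def by (rule sum.lessThan_Suc)
      also have "r * (Suc i - i) + (m - r) = m" using mr by simp
      finally show ?thesis by simp
     qed
     have "fst p ^ i * snd p ^ m + ?\<nu> * (c * (fst (F p) ^ Suc i * snd (F p) ^ (m - r))) - c * (fst p ^ Suc i * snd p ^ (m - r))
      = fst p ^ i * snd p ^ m + c * (?\<nu> * b ^ (r * Suc i + (m - r))) * (fst p ^ Suc i * snd p ^ (m - r) + low (Suc i) (m - r) p) - c * (fst p ^ Suc i * snd p ^ (m - r))"
      unfolding mF by (simp only: mult_ac)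
     also have "\<dots> = fst p ^ i * snd p ^ m + c * low (Suc i) (m - r) p"
      unfolding nu1 by (simp add: algebra_simps)
     also have "\<dots> = (1 + c * of_nat (Suc i) * bea) * (fst p ^ i * snd p ^ m) + c * rest p"
      unfolding lowS by (simp add: algebra_simps)
     finally show "c * rest p = fst p ^ i * snd p ^ m + ?\<nu> * (c * (fst (F p) ^ Suc i * snd (F p) ^ (m - r))) - c * (fst p ^ Suc i * snd p ^ (m - r))"
      unfolding c by simp
    qed
   qed
  qed
 qed
qed

section \<open>Splitting on the whole punctured plane\<close>

context hopf
begin

definition F_inv :: "C2 => C2" where
 "F_inv = (%(x, y). ((x - (y / b) ^ r) / b ^ r, y / b))"

lemma F_F_inv [simp]: "F (F_inv p) = p" and F_inv_F [simp]: "F_inv (F p) = p"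
 by (cases p; simp add: F_inv_def F_eq)+

lemma F_inv_C2_star [simp]: "F_inv p : C2_star \<longleftrightarrow> p : C2_star"
 using F_C2_star[of "F_inv p"] by simp

lemma holo2_at_F_inv: "holo2_at f (F_inv p) ==> holo2_at (%q. f (F_inv q)) p"
proof -
 assume f: "holo2_at f (F_inv p)"
 have "holo2_at (%p. (fst p - (snd p / b) ^ r) / b ^ r) p" "holo2_at (%p. snd p / b) p"
  by (rule holo2_at_divide holo2_at_diff holo2_at_power holo2_at_fst holo2_at_snd holo2_at_const | simp)+
 hence "holo2_at (%p. f ((fst p - (snd p / b) ^ r) / b ^ r, snd p / b)) p"
  by (rule holo2_at_compose2) (use f in \<open>simp add: F_inv_def case_prod_unfold\<close>)
 thus ?thesis by (simp add: F_inv_def case_prod_unfold)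
qed

lemma F_power_F_inv: "(F ^^ n) ((F_inv ^^ n) p) = p"
 by (induction n arbitrary: p) (simp_all add: funpow_swap1)

end

text \<open>The bound l <= r gives |\<nu>| > |b|^(r+1), hence a shell solution. Its defect under F
  extends over the bidisc by Hartogs; solving the cohomological equation there makes the shell
  solution equivariant up to the cocycle, and orbits carry it everywhere. For l >= 1 one has |\<nu>|
  < 1, and the Neumann series meets no obstruction.\<close>

theorem (in equivariant_cousin) global_splitting:
 assumes \<nu>: "\<nu> = b powi l" and l: "l <= int r"
  and res: "l >= 1 \<or> 1 <= k & 1 <= a & a <= r & l = int a - int (r * k)"
 obtains u c where "fits D C2_star u" "l >= 1 ==> c = 0"
  "!!p. p : C2_star ==> \<kappa> p + \<nu> * u (F p) - u p = c * cocycle k a p"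
proof -
 let ?q = "cmod b"
 have q: "0 < ?q" "?q < 1" using b by auto
 define Q where "Q = ?q ^ r"
 have Q: "0 < Q" "Q < 1" using br by (auto simp: Q_def norm_power)
 \<comment> \<open>Q R + 1 < R makes the weighted bidiscs invariant under F; Q R > 1 keeps the image
   of the torus away from x = 0.\<close>
 define R where "R = 2 / (Q * (1 - Q))"
 have R: "R > 0" and QR: "1 < Q * R" "Q * R + 1 < R"
 proof -
  show R0: "R > 0" using Q by (simp add: R_def)
  have QR': "Q * R = 2 / (1 - Q)" using Q by (simp add: R_def)
  show "1 < Q * R" unfolding QR' using Q by (simp add: less_divide_eq)
  have "Q * (1 - Q) ~= 0" using Q by auto
  hence "R * (Q * (1 - Q)) = 2" unfolding R_def by (rule nonzero_eq_divide_eq[THEN iffD1, OF _ refl])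
  hence "(R * (1 - Q)) * Q = 2" by (simp only: mult_ac)
  hence "R * (1 - Q) = 2 / Q" using Q by (intro nonzero_eq_divide_eq[THEN iffD2]) auto
  moreover have "2 / Q > 1" using Q by (simp add: less_divide_eq)
  ultimately show "Q * R + 1 < R" by (simp add: algebra_simps)
 qed
 have cmod\<nu>: "cmod \<nu> = ?q powi l" by (simp add: \<nu> norm_power_int)
 have nu: "cmod \<nu> > ?q ^ (r + 1)"
 proof -
  have "?q powi int (r + 1) < ?q powi l" using q l by (intro power_int_strict_decreasing) auto
  thus ?thesis unfolding cmod\<nu> power_int_of_nat .
 qed
 \<comment> \<open>Large enough that the preimage under F of the weighted bidisc of size t lies in
   the one of size c t.\<close>
 define c where "c = max (1 / ?q) ((R + 1 / Q) / (Q * R))"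
 have c: "c >= 1" "1 / ?q <= c" "(R + 1 / Q) / (Q * R) <= c ^ r"
 proof -
  have "1 / ?q >= 1" using q by simp
  thus c1: "c >= 1" by (simp add: c_def le_max_iff_disj)
  show "1 / ?q <= c" by (simp add: c_def)
  have "c ^ 1 <= c ^ r" using c1 r by (intro power_increasing) auto
  moreover have "(R + 1 / Q) / (Q * R) <= c" by (simp add: c_def)
  ultimately show "(R + 1 / Q) / (Q * R) <= c ^ r" by simp
 qed
 \<comment> \<open>The radii t^r R and t carry the weights of F, so a single parameter governs both
   coordinates.\<close>
 define bd where "bd t = (cball 0 (t ^ r * R) \<times> cball 0 t :: C2 set)" for t
 let ?\<Delta> = "ball 0 R \<times> ball 0 1 :: C2 set"
 have F1: "F p : bd t" if "p : bd t" for p t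
 proof -
  obtain x y where p: "p = (x, y)" by (cases p)
  have xy: "cmod x <= t ^ r * R" "cmod y <= t" using that by (auto simp: bd_def p)
  have t: "t >= 0" using xy(2) norm_ge_zero[of y] by linarith
  have "cmod (b ^ r * x + y ^ r) <= Q * cmod x + cmod y ^ r"
   using norm_triangle_ineq[of "b ^ r * x" "y ^ r"] by (simp add: Q_def norm_mult norm_power)
  also have "\<dots> <= Q * (t ^ r * R) + t ^ r"
   using xy Q by (intro add_mono mult_left_mono power_mono) auto
  also have "\<dots> = t ^ r * (Q * R + 1)" by (simp add: algebra_simps)
  also have "\<dots> <= t ^ r * R" using R QR t by (intro mult_left_mono) auto
  finally have 1: "cmod (b ^ r * x + y ^ r) <= t ^ r * R" .
  have "?q * cmod y <= 1 * cmod y" using q by (intro mult_right_mono) auto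
  thus ?thesis using 1 xy by (simp add: bd_def p F_eq norm_mult)
 qed
 have F2: "p : bd (c * t)" if "F p : bd t" for p t
 proof -
  obtain x y where p: "p = (x, y)" by (cases p)
  have xy: "cmod (b ^ r * x + y ^ r) <= t ^ r * R" "?q * cmod y <= t"
   using that by (auto simp: bd_def p F_eq norm_mult)
  have t: "t >= 0" using xy(1) xy(2) q by (smt (verit) mult_nonneg_nonneg norm_ge_zero)
  have y1: "cmod y <= (1 / ?q) * t" using xy(2) q by (simp add: field_simps)
  also have "\<dots> <= c * t" using c t by (intro mult_right_mono) auto
  finally have y: "cmod y <= c * t" .
  have yr: "cmod y ^ r <= t ^ r / Q"
   using power_mono[OF y1, of r] by (simp add: Q_def power_divide)
  have "Q * cmod x <= cmod (b ^ r * x + y ^ r) + cmod y ^ r"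
   using norm_diff_ineq[of "b ^ r * x" "y ^ r"] by (simp add: Q_def norm_mult norm_power)
  also have "\<dots> <= t ^ r * R + t ^ r / Q" using xy yr by simp
  also have "\<dots> = t ^ r * ((R + 1 / Q) / (Q * R)) * (Q * R)" using Q R QR by (simp add: field_simps)
  also have "\<dots> <= t ^ r * c ^ r * (Q * R)" using c t Q R QR by (intro mult_right_mono mult_left_mono) auto
  finally have "Q * cmod x <= Q * ((c * t) ^ r * R)" by (simp add: power_mult_distrib algebra_simps)
  hence "cmod x <= (c * t) ^ r * R" using Q by simp
  thus ?thesis using y by (simp add: bd_def p)
 qed
 have bd\<Delta>: "bd t <= ?\<Delta>" if "0 < t" "t < 1" for t
 proof -
  have "t ^ r * R < 1 * R" using that R QR r by (intro mult_strict_right_mono) (auto simp: power_less_one_iff)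
  thus ?thesis using that unfolding bd_def by (intro Sigma_mono) auto
 qed
 have bd_mono: "bd t <= bd t'" if "0 <= t" "t <= t'" for t t'
  using that R QR unfolding bd_def by (intro Sigma_mono subset_cball mult_right_mono power_mono) auto
 have F\<Delta>: "F p : ?\<Delta>" if "p : ?\<Delta>" for p
 proof -
  obtain x y where p: "p = (x, y)" by (cases p)
  have xy: "cmod x < R" "cmod y < 1" using that by (auto simp: p)
  have "cmod (b ^ r * x + y ^ r) <= Q * cmod x + cmod y ^ r"
   using norm_triangle_ineq[of "b ^ r * x" "y ^ r"] by (simp add: Q_def norm_mult norm_power)
  also have "\<dots> <= Q * R + 1"
   using xy Q by (intro add_mono mult_left_mono power_le_one) auto
  finally have 1: "cmod (b ^ r * x + y ^ r) < R" using R QR by simp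
  have "?q * cmod y <= 1 * cmod y" using q by (intro mult_right_mono) auto
  thus ?thesis using 1 xy by (simp add: p F_eq norm_mult)
 qed
 have clbd: "closed (bd t)" for t unfolding bd_def by (intro closed_Times) auto
 have zbd: "(0, 0) : bd t" if "0 <= t" for t using that R QR by (simp add: bd_def)
 \<comment> \<open>Room for two backward steps: enlarging \<open>bd t\<close> twice by c gives size
   1/2, still inside the unit bidisc.\<close>
 define t where "t = 1 / (2 * c ^ 2)"
 define s where "s = c * t"
 have ts: "0 < t" "t <= s" "0 < s" "s < 1" "0 < c * s" "c * s < 1" "t < 1"
 proof -
  have c0: "c > 0" using c by linarith
  show "0 < t" "0 < s" "0 < c * s" "c * s < 1" using c0 by (auto simp: t_def s_def power2_eq_square)
  show "t <= s" using c c0 by (simp add: s_def t_def divide_right_mono)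
  have "s = 1 / (2 * c)" using c0 by (simp add: s_def t_def power2_eq_square)
  thus "s < 1" using c by (simp add: divide_less_eq)
  with \<open>t <= s\<close> show "t < 1" by simp
 qed
 obtain u0 where "fits D (ball 0 R \<times> ball 0 1 - cball 0 (t ^ r * R) \<times> cball 0 t) u0"
 proof (rule shell_solution[OF nu])
  show "0 < t ^ r * R" "0 < t" "t < 1" using ts R QR by auto
  have "Q * (t ^ r * R) + t ^ r = t ^ r * (Q * R + 1)" by (simp add: algebra_simps)
  also have "\<dots> <= t ^ r * R" using R QR ts by (intro mult_left_mono) auto
  finally show "?q ^ r * (t ^ r * R) + t ^ r <= t ^ r * R" by (simp add: Q_def)
  have "t ^ r * 1 < t ^ r * (Q * R)" using R QR ts by (intro mult_strict_left_mono) auto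
  thus "t ^ r < ?q ^ r * (t ^ r * R)" by (simp add: Q_def algebra_simps)
  have "t ^ r * R < 1 * R" using ts R QR r by (intro mult_strict_right_mono) (auto simp: power_less_one_iff)
  thus "t ^ r * R < R" by simp
 qed
 hence u0: "fits D (?\<Delta> - bd t) u0" by (simp add: bd_def)
 define S where "S = ?\<Delta> - bd s"
 have S0: "p : ?\<Delta> - bd t" "F p : ?\<Delta> - bd t" if "p : S" for p
  using that F2[of p t] F\<Delta>[of p] bd_mono[of t s] ts by (auto simp: S_def s_def)
 have star: "?\<Delta> - bd t <= C2_star" "S <= C2_star"
  using zbd[of t] zbd[of s] ts by (auto simp: C2_star_def S_def)
 have opS: "open S" unfolding S_def by (intro open_Diff open_Times clbd) auto
 \<comment> \<open>The defect of \<open>u0\<close> under F is holomorphic although neither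
   \<open>u0\<close> nor \<kappa> is assumed to be.\<close>
 define w where "w p = (\<kappa> p + \<nu> * u0 (F p)) - u0 p" for p
 have "holo2_on w ({p. F p : ?\<Delta> - bd t} Int (?\<Delta> - bd t))"
  unfolding w_def by (rule fits_diff'[OF fits_pullback[OF u0 star(1)] u0]) (use star in auto)
 hence "holo2_on w S" by (rule holo2_on_subset) (use S0 in blast)
 hence "holo2_on w (?\<Delta> - cball 0 (s ^ r * R) \<times> cball 0 s)" by (simp add: S_def bd_def)
 moreover have "s ^ r * R < R"
 proof -
  have "s ^ r * R < 1 * R" using ts R QR r by (intro mult_strict_right_mono) (auto simp: power_less_one_iff)
  thus ?thesis by simp
 qed
 ultimately obtain W where W: "holo2_on W ?\<Delta>" "!!p. p : ?\<Delta> - cball 0 (s ^ r * R) \<times> cball 0 s ==> W p = w p"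
  using hartogs_bidisc[of w R "s ^ r * R" s] ts R by auto
 have W': "W p = w p" if "p : S" for p using W(2)[of p] that by (simp add: S_def bd_def)
 obtain h d where h: "holo2_on h ?\<Delta>" and d: "l >= 1 ==> d = 0"
  and hd: "!!p. p : ?\<Delta> ==> W p + \<nu> * h (F p) - h p = d * cocycle k a p"
 proof (cases "l >= 1")
  case True
  interpret cohomological_eq b r R \<nu> "%_. 0"
   by unfold_locales (use R QR in \<open>auto simp: Q_def\<close>)
  have "solvable W"
  proof (rule solvable_holo2[of 0 "(?q + 1) / 2", OF _ _ _ _ W(1)])
   have "?q powi l < 1"
    using power_int_strict_decreasing[of 0 l ?q] q True by simp
   thus "cmod \<nu> * ((?q + 1) / 2) ^ 0 < 1" by (simp add: cmod\<nu>)
  qed (use q in auto)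
  then obtain h c where "holo2_on h ?\<Delta>" "ALL p:?\<Delta>. W p + \<nu> * h (F p) - h p = c * 0"
   unfolding solvable_def by blast
  thus ?thesis by (intro that[of h 0]) auto
 next
  case False
  hence ka: "1 <= k" "1 <= a" "a <= r" "l = int a - int (r * k)" using res by auto
  interpret cohomological_eq b r R \<nu> "cocycle k a"
   by unfold_locales (use R QR in \<open>auto simp: Q_def\<close>)
  \<comment> \<open>Here |\<nu>| |b|^n = 1, so |\<nu>| th^(n+1) < 1 for every \<open>th\<close>
    slightly above |b|, and degree n + 1 suffices for the Neumann series.\<close>
  define n where "n = nat (- l)"
  have n: "?q powi l * ?q ^ n = 1"
  proof -
   have "?q powi l * ?q powi int n = ?q powi (l + int n)" using q by (intro power_int_add[symmetric]) auto
   also have "l + int n = 0" using False by (simp add: n_def)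
   finally show ?thesis by simp
  qed
  have "((%th. ?q powi l * th ^ Suc n) \<longlongrightarrow> ?q powi l * ?q ^ Suc n) (at_right ?q)"
   by (intro tendsto_intros)
  moreover have "?q powi l * ?q ^ Suc n < 1" using n q by (simp add: mult.left_commute)
  ultimately have "\<forall>\<^sub>F th in at_right ?q. ?q powi l * th ^ Suc n < 1" by (rule order_tendstoD)
  moreover have "\<forall>\<^sub>F th in at_right ?q. th < 1" "\<forall>\<^sub>F th in at_right ?q. ?q < th"
   using q by (auto intro: eventually_at_right_less order_tendstoD(2)[OF tendsto_ident_at])
  ultimately have "\<forall>\<^sub>F th in at_right ?q. ?q < th & th < 1 & ?q powi l * th ^ Suc n < 1"
   by eventually_elim auto
  then obtain th where th: "?q < th" "th < 1" "?q powi l * th ^ Suc n < 1"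
   using eventually_happens by force
  have "solvable W"
  proof (rule solvable_holo2[OF _ th(1,2) _ W(1)])
   show "cmod \<nu> * th ^ Suc n < 1" using th(3) by (simp add: cmod\<nu>)
   show "solvable (%p. fst p ^ i * snd p ^ j)" for i j
    using solvable_monomial[OF R ka(1) ka(2) ka(3), of i j] by (simp add: \<nu> ka(4))
  qed
  then obtain h c where "holo2_on h ?\<Delta>" "ALL p:?\<Delta>. W p + \<nu> * h (F p) - h p = c * cocycle k a p"
   unfolding solvable_def by blast
  thus ?thesis using False by (intro that[of h c]) auto
 qed
 define u where "u p = u0 p + h p" for p
 have u: "fits D S u"
  unfolding u_def
  by (rule fits_add[OF fits_subset[OF u0] holo2_on_subset[OF h]]) (use S0 in \<open>auto simp: S_def\<close>)
 have u_eq: "\<kappa> p + \<nu> * u (F p) - u p = d * cocycle k a p" if "p : S" for p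
 proof -
  have "w p + \<nu> * h (F p) - h p = d * cocycle k a p"
   using hd[of p] W'[OF that] that by (auto simp: S_def)
  thus ?thesis by (simp add: w_def u_def algebra_simps)
 qed
 let ?cc = "%p. d * cocycle k a p"
 have holo_cc: "holo2_at ?cc p" for p by (rule holo2_at_mult[OF holo2_at_const holo2_at_cocycle])
 have bdn: "(F ^^ n) p : bd s" if "p : bd s" for n p by (induction n) (use that F1 in auto)
 have \<Delta>n: "(F ^^ n) p : ?\<Delta>" if "p : ?\<Delta>" for n p by (induction n) (use that F\<Delta> in auto)
 define V where "V = C2_star - bd s"
 have V: "open V" "V <= C2_star" unfolding V_def by (auto intro: open_Diff clbd)
 \<comment> \<open>Forward orbits enter the bidisc, so the shell solution pulls back to the whole
   complement of \<open>bd s\<close>.\<close>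
 obtain u' where u': "fits D V u'" "!!p. p : V ==> F p : V ==> (\<kappa> p - ?cc p) + \<nu> * u' (F p) = u' p"
 proof (rule orbit_extension[of F "%u p. (\<kappa> p - ?cc p) + \<nu> * u (F p)" "%p. \<kappa> p - ?cc p" "%_. \<nu>" S u V])
  show "continuous_on C2_star F" using isCont_F by (intro continuous_at_imp_continuous_on) auto
  show "fits D {p : C2_star. F p : U} (%p. (\<kappa> p - ?cc p) + \<nu> * u (F p))"
   if "open U" "U <= C2_star" "fits D U u" for U u
  proof -
   have "fits D {p : C2_star. F p : U} (%p. \<kappa> p + \<nu> * u (F p))"
    by (rule fits_subset[OF fits_pullback[OF that(3,2)]]) auto
   moreover have "holo2_on (%p. - ?cc p) {p : C2_star. F p : U}"
    unfolding holo2_on_iff by (intro ballI holo2_at_minus[OF holo_cc])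
   ultimately have "fits D {p : C2_star. F p : U} (%p. (\<kappa> p + \<nu> * u (F p)) + - ?cc p)"
    by (rule fits_add)
   thus ?thesis by (simp add: algebra_simps)
  qed
  show "(\<kappa> p - ?cc p) + \<nu> * u (F p) = u p" if "p : S" for p
   using u_eq[OF that] by (simp add: algebra_simps)
  show "(F ^^ i) p : S" if "p : S" "(F ^^ n) p : S" "i <= n" for p n i
  proof -
   have "(F ^^ n) p = (F ^^ (n - i)) ((F ^^ i) p)" using that(3) by (metis comp_apply funpow_add le_add_diff_inverse2)
   hence "(F ^^ i) p \<notin> bd s" using that(2) bdn[of "(F ^^ i) p" "n - i"] by (auto simp: S_def)
   thus ?thesis using \<Delta>n[of p i] that(1) by (auto simp: S_def)
  qed
  show "EX n. (F ^^ n) p : S" if p: "p : V" for p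
  proof -
   have "\<forall>\<^sub>F n in sequentially. (F ^^ n) p : ?\<Delta>"
    by (rule topological_tendstoD[OF F_power_tendsto_0]) (use R QR in \<open>auto simp: open_Times\<close>)
   hence ex: "EX n. (F ^^ n) p : ?\<Delta>" by (auto simp: eventually_sequentially)
   \<comment> \<open>At its first entry into the bidisc an orbit cannot have jumped over the shell:
     the preimage of \<open>bd s\<close> lies in \<open>bd (c * s)\<close>, which is already inside
     the bidisc.\<close>
   define n where "n = (LEAST n. (F ^^ n) p : ?\<Delta>)"
   have n: "(F ^^ n) p : ?\<Delta>" unfolding n_def by (rule LeastI_ex[OF ex])
   have "(F ^^ n) p \<notin> bd s"
   proof (cases n)
    case 0 thus ?thesis using p by (simp add: V_def)
   next
    case (Suc m)
    hence "(F ^^ m) p \<notin> ?\<Delta>" using not_less_Least[of m "%n. (F ^^ n) p : ?\<Delta>"] Suc unfolding n_def[symmetric] by simp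
    hence "(F ^^ m) p \<notin> bd (c * s)" using bd\<Delta>[of "c * s"] ts by auto
    thus ?thesis using F2[of "(F ^^ m) p" s] Suc by auto
   qed
   thus ?thesis using n unfolding S_def by (intro exI[of _ n] DiffI)
  qed
 qed (use opS star u V in auto)
 \<comment> \<open>Backward orbits leave \<open>bd s\<close>, so the inverse of F carries the
   solution inwards to the whole punctured plane.\<close>
 obtain u'' where u'': "fits D C2_star u''"
  "!!p. p : C2_star ==> F_inv p : C2_star ==> (?cc (F_inv p) - \<kappa> (F_inv p)) / \<nu> + 1 / \<nu> * u'' (F_inv p) = u'' p"
 proof (rule orbit_extension[of F_inv "%u p. (?cc (F_inv p) - \<kappa> (F_inv p)) / \<nu> + 1 / \<nu> * u (F_inv p)"
    "%p. (?cc (F_inv p) - \<kappa> (F_inv p)) / \<nu>" "%_. 1 / \<nu>" V u' C2_star])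
  show contF: "continuous_on C2_star F_inv"
   unfolding F_inv_def case_prod_unfold by (intro continuous_intros) auto
  show "fits D {p : C2_star. F_inv p : U} (%p. (?cc (F_inv p) - \<kappa> (F_inv p)) / \<nu> + 1 / \<nu> * u (F_inv p))"
   if U: "open U" "U <= C2_star" "fits D U u" for U u
  proof (rule fits_atI)
   fix p W w assume p: "p : {p : C2_star. F_inv p : U}" "(W, w) : D" "p : W"
   have 1: "F_inv p : {q. F q : W} Int U" using p by simp
   have "holo2_on (%q. \<kappa> q + \<nu> * w (F q) - u q) ({q. F q : W} Int U)"
    by (rule fits_diff'[OF equivariant[OF p(2)] U(3)]) (use U(2) in auto)
   hence "holo2_at (%q. \<kappa> q + \<nu> * w (F q) - u q) (F_inv p)" using 1 unfolding holo2_on_iff by (rule bspec)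
   from holo2_at_diff[OF holo_cc this]
   have "holo2_at (%q. ?cc q - (\<kappa> q + \<nu> * w (F q) - u q)) (F_inv p)" .
   from holo2_at_mult[OF holo2_at_const holo2_at_F_inv[OF this], of "1 / \<nu>"]
   have "holo2_at (%q. 1 / \<nu> * (?cc (F_inv q) - (\<kappa> (F_inv q) + \<nu> * w q - u (F_inv q)))) p" by simp
   moreover have "1 / \<nu> * (?cc (F_inv q) - (\<kappa> (F_inv q) + \<nu> * w q - u (F_inv q))) =
     (?cc (F_inv q) - \<kappa> (F_inv q)) / \<nu> + 1 / \<nu> * u (F_inv q) - w q" for q
    using \<nu>0 by (simp add: field_simps)
   ultimately show "holo2_at (%p. (?cc (F_inv p) - \<kappa> (F_inv p)) / \<nu> + 1 / \<nu> * u (F_inv p) - w p) p" by simp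
  qed
  show "(?cc (F_inv p) - \<kappa> (F_inv p)) / \<nu> + 1 / \<nu> * u' (F_inv p) = u' p" if "p : V" "F_inv p : V" for p
  proof -
   have "(\<kappa> (F_inv p) - ?cc (F_inv p)) + \<nu> * u' p = u' (F_inv p)" using u'(2)[OF that(2)] that(1) by simp
   thus ?thesis using \<nu>0 by (simp add: field_simps)
  qed
  have Vinv: "F_inv p : V" if "p : V" for p
   using that F1[of "F_inv p" s] by (auto simp: V_def)
  show "(F_inv ^^ i) p : V" if "p : V" for p i by (induction i) (use that Vinv in auto)
  show "EX n. (F_inv ^^ n) p : V" if p: "p : C2_star" for p
  proof (rule ccontr)
   assume "\<nexists>n. (F_inv ^^ n) p : V"
   moreover have "(F_inv ^^ n) p : C2_star" for n by (induction n) (use p in auto)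
   ultimately have in_bd: "(F_inv ^^ n) p : bd s" for n by (auto simp: V_def)
   obtain x y where xy: "p = (x, y)" by (cases p)
   \<comment> \<open>For every n the point p is the image under F^n of a point of
     \<open>bd s\<close>; this forces y = 0 and then x = 0.\<close>
   have form: "EX x' y'. x = b ^ (r * n) * (x' + of_nat n * y' ^ r / b ^ r) & y = b ^ n * y' & cmod x' <= s ^ r * R & cmod y' <= s" for n
    using F_power_F_inv[of n p] in_bd[of n] by (cases "(F_inv ^^ n) p") (auto simp: F_power xy bd_def)
   have small: "z = 0" if "!!n. cmod z <= th ^ n * C" "0 <= th" "th < 1" for z :: complex and th C
   proof -
    have "(%n. th ^ n * C) \<longlonglongrightarrow> 0 * C" using that by (intro tendsto_intros LIMSEQ_power_zero) auto
    hence "cmod z <= 0 * C" by (rule LIMSEQ_le_const) (use that in auto)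
    thus ?thesis by simp
   qed
   have "y = 0"
   proof (rule small[of y ?q s])
    show "cmod y <= ?q ^ n * s" for n using form[of n] by (auto simp: norm_mult norm_power intro: mult_left_mono)
   qed (use q in auto)
   moreover have "x = 0"
   proof (rule small[of x Q "s ^ r * R"])
    show "cmod x <= Q ^ n * (s ^ r * R)" for n
    proof -
     obtain x' y' where "x = b ^ (r * n) * (x' + of_nat n * y' ^ r / b ^ r)" "y = b ^ n * y'" "cmod x' <= s ^ r * R"
      using form[of n] by blast
     moreover from this \<open>y = 0\<close> have "y' = 0" by simp
     ultimately have "x = b ^ (r * n) * x'" "cmod x' <= s ^ r * R" using r by auto
     thus ?thesis using q by (auto simp: norm_mult norm_power Q_def power_mult intro!: mult_left_mono)
    qed
   qed (use Q in auto)
   ultimately show False using p xy by (simp add: C2_star_def)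
  qed
 qed (use V u' in auto)
 show ?thesis
 proof (rule that[of u'' d])
  show "fits D C2_star u''" by fact
  show "\<kappa> p + \<nu> * u'' (F p) - u'' p = d * cocycle k a p" if "p : C2_star" for p
   using u''(2)[of "F p"] that \<nu>0 by (simp add: field_simps)
 qed (use d in auto)
qed

no_notation fps_nth (infixl "$" 75)

section \<open>Bundles in local frames\<close>

definition mat_at :: "(C2 => complex ^ 'n ^ 'm) => C2 => bool" where
 "mat_at h p \<longleftrightarrow> (ALL i j. holo2_at (%q. h q $ i $ j) p)"

definition vec_at :: "(C2 => complex ^ 'n) => C2 => bool" where
 "vec_at s p \<longleftrightarrow> (ALL i. holo2_at (%q. s q $ i) p)"

lemma mat_holo_on_iff: "mat_holo_on h U \<longleftrightarrow> (ALL p:U. mat_at h p)"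
 by (auto simp: mat_holo_on_def mat_at_def holo2_on_iff)

lemma vec_holo_on_iff: "vec_holo_on s U \<longleftrightarrow> (ALL p:U. vec_at s p)"
 by (auto simp: vec_holo_on_def vec_at_def holo2_on_iff)

lemma mat_at_mult:
 fixes f :: "C2 => complex ^ 'k ^ 'm" and g :: "C2 => complex ^ 'n ^ 'k"
 assumes "mat_at f p" "mat_at g p"
 shows "mat_at (%q. f q ** g q) p"
 unfolding mat_at_def matrix_matrix_mult_def
proof (intro allI)
 fix i j
 have "holo2_at (%q. \<Sum>k\<in>UNIV. f q $ i $ k * g q $ k $ j) p"
  by (rule holo2_at_sum, rule holo2_at_mult) (use assms in \<open>simp_all add: mat_at_def\<close>)
 thus "holo2_at (%q. (\<chi> i j. \<Sum>k\<in>UNIV. f q $ i $ k * g q $ k $ j) $ i $ j) p" by simp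
qed

lemma vec_at_mult:
 fixes f :: "C2 => complex ^ 'k ^ 'm"
 assumes "mat_at f p" "vec_at s p"
 shows "vec_at (%q. f q *v s q) p"
 unfolding vec_at_def matrix_vector_mult_def
proof (intro allI)
 fix i
 have "holo2_at (%q. \<Sum>k\<in>UNIV. f q $ i $ k * s q $ k) p"
  by (rule holo2_at_sum, rule holo2_at_mult) (use assms in \<open>simp_all add: mat_at_def vec_at_def\<close>)
 thus "holo2_at (%q. (\<chi> i. \<Sum>k\<in>UNIV. f q $ i $ k * s q $ k) $ i) p" by simp
qed

lemma mat_at_const [simp]: "mat_at (%_. c) p"
 by (simp add: mat_at_def)

lemma mat_at_transform:
 assumes "mat_at f p" "open U" "p : U" "!!q. q : U ==> f q = g q"
 shows "mat_at g p"
 unfolding mat_at_def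
proof (intro allI)
 fix i j
 show "holo2_at (%q. g q $ i $ j) p"
  by (rule holo2_at_transform[OF _ assms(2,3), of "%q. f q $ i $ j"]) (use assms in \<open>simp_all add: mat_at_def\<close>)
qed

lemma vec_at_transform:
 assumes "vec_at f p" "open U" "p : U" "!!q. q : U ==> f q = g q"
 shows "vec_at g p"
 unfolding vec_at_def
proof (intro allI)
 fix i
 show "holo2_at (%q. g q $ i) p"
  by (rule holo2_at_transform[OF _ assms(2,3), of "%q. f q $ i"]) (use assms in \<open>simp_all add: vec_at_def\<close>)
qed

lemma vec_at_add: "vec_at s p ==> vec_at t p ==> vec_at (%q. s q + t q) p"
 by (simp add: vec_at_def holo2_at_add)

lemma vec_at_scale: "holo2_at f p ==> vec_at s p ==> vec_at (%q. f q *s s q) p"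
 by (simp add: vec_at_def holo2_at_mult)

lemma vec_at_isCont: "vec_at s p ==> isCont s p"
proof -
 assume "vec_at s p"
 hence "isCont (%q. s q $ i) p" for i by (auto simp: vec_at_def intro: holo2_at_continuous)
 hence "isCont (%q. \<chi> i. s q $ i) p"
  unfolding isCont_def by (intro tendsto_vec_lambda)
 thus ?thesis by simp
qed

lemma matrix_inv_left: "invertible A ==> matrix_inv A ** A = mat 1"
 and matrix_inv_right: "invertible A ==> A ** matrix_inv A = mat 1"
 for A :: "complex ^ 'n ^ 'n"
 unfolding invertible_def matrix_inv_def by (metis (mono_tags, lifting) someI_ex)+

lemma matrix_inv_cancel:
 fixes A :: "complex ^ 'n ^ 'n"
 assumes "invertible A"
 shows "matrix_inv A ** (A ** X) = X" "A ** (matrix_inv A ** X) = X"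
  "Y ** A ** matrix_inv A = Y" "Y ** matrix_inv A ** A = Y"
  "matrix_inv A *v (A *v v) = v" "A *v (matrix_inv A *v v) = v"
 using matrix_inv_left[OF assms] matrix_inv_right[OF assms]
 by (simp_all add: matrix_mul_assoc matrix_vector_mul_assoc matrix_mul_assoc[symmetric, of Y])

lemma matrix_inv_eq:
 fixes A :: "complex ^ 'n ^ 'n"
 assumes "A ** B = mat 1"
 shows "matrix_inv A = B"
proof -
 have "invertible A" using assms matrix_left_right_inverse unfolding invertible_def by blast
 hence "matrix_inv A ** (A ** B) = B" by (rule matrix_inv_cancel)
 thus ?thesis using assms by simp
qed

lemma matrix_inv_mat_1 [simp]: "matrix_inv (mat 1 :: complex ^ 'n ^ 'n) = mat 1"
 by (rule matrix_inv_eq) simp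

lemma invertible_matrix_inv: "invertible (A :: complex ^ 'n ^ 'n) ==> invertible (matrix_inv A)"
 using matrix_inv_left matrix_inv_right unfolding invertible_def by blast

lemma invertible_mult_vec_eq_0:
 fixes A :: "complex ^ 'n ^ 'n"
 assumes "invertible A" shows "A *v v = 0 \<longleftrightarrow> v = 0"
 using matrix_inv_cancel(5)[OF assms, of v] by auto

lemma mat_2_eqI:
 fixes A B :: "complex ^ 2 ^ 2"
 assumes "A$1$1 = B$1$1" "A$1$2 = B$1$2" "A$2$1 = B$2$1" "A$2$2 = B$2$2"
 shows "A = B"
 using assms by (simp add: vec_eq_iff forall_2)

lemma mult_22:
 fixes A B :: "complex ^ 2 ^ 2"
 shows "(A ** B) $ i $ j = A$i$1 * B$1$j + A$i$2 * B$2$j"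
 by (simp add: matrix_matrix_mult_def sum_2)

lemma mult_vec_2: "((A :: complex ^ 2 ^ 'm) *v v) $ i = A$i$1 * v$1 + A$i$2 * v$2"
 by (simp add: matrix_vector_mult_def sum_2)

lemma mat2_nth [simp]:
 "mat2 p q w z $ 1 $ 1 = p" "mat2 p q w z $ 1 $ 2 = q" "mat2 p q w z $ 2 $ 1 = w" "mat2 p q w z $ 2 $ 2 = z"
 by (simp_all add: mat2_def)

lemma mat_nth_2 [simp]:
 "(mat c :: complex ^ 2 ^ 2) $ 1 $ 1 = c" "(mat c :: complex ^ 2 ^ 2) $ 1 $ 2 = 0"
 "(mat c :: complex ^ 2 ^ 2) $ 2 $ 1 = 0" "(mat c :: complex ^ 2 ^ 2) $ 2 $ 2 = c"
 by (simp_all add: mat_def)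

lemma matrix_inv_2:
 fixes A :: "complex ^ 2 ^ 2"
 assumes d: "d = A $ 1 $ 1 * A $ 2 $ 2 - A $ 1 $ 2 * A $ 2 $ 1" "d ~= 0"
 shows "matrix_inv A = mat2 (A $ 2 $ 2 / d) (- (A $ 1 $ 2) / d) (- (A $ 2 $ 1) / d) (A $ 1 $ 1 / d)"
proof (rule matrix_inv_eq[OF mat_2_eqI])
qed (use d(2) in \<open>simp_all add: mult_22 field_simps\<close>, simp_all add: d(1) field_simps)

lemma invertible_2_iff: "invertible (A :: complex ^ 2 ^ 2) \<longleftrightarrow> A$1$1 * A$2$2 - A$1$2 * A$2$1 ~= 0"
 by (simp add: invertible_det_nz det_2)

lemma mat_at_inverse_2:
 fixes f :: "C2 => complex ^ 2 ^ 2"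
 assumes f: "mat_at f p" and U: "open U" "p : U" "!!q. q : U ==> invertible (f q)"
 shows "mat_at (%q. matrix_inv (f q)) p"
proof -
 define d where "d q = f q $ 1 $ 1 * f q $ 2 $ 2 - f q $ 1 $ 2 * f q $ 2 $ 1" for q
 have e: "holo2_at (%q. f q $ i $ j) p" for i j using f by (simp add: mat_at_def)
 have d: "holo2_at d p" unfolding d_def by (rule holo2_at_diff; rule holo2_at_mult; rule e)
 have d0: "d q ~= 0" if "q : U" for q using U(3)[OF that] by (simp add: invertible_2_iff d_def)
 have "mat_at (%q. mat2 (f q $ 2 $ 2 / d q) (- (f q $ 1 $ 2) / d q) (- (f q $ 2 $ 1) / d q) (f q $ 1 $ 1 / d q)) p"
  unfolding mat_at_def forall_2 mat2_nth
  by (intro conjI; rule holo2_at_divide[OF _ d d0[OF U(2)]]; (rule holo2_at_minus)?; rule e)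
 thus ?thesis
  by (rule mat_at_transform[OF _ U(1,2)]) (rule matrix_inv_2[symmetric, OF d_def d0])
qed

lemma mat_mult_nth [simp]: "(mat c ** A) $ i $ j = c * (A :: complex ^ 'n ^ 'm) $ i $ j"
proof -
 have "(\<Sum>k\<in>UNIV. (mat c :: complex ^ 'm ^ 'm) $ i $ k * A $ k $ j) = (\<Sum>k\<in>UNIV. if k = i then c * A $ i $ j else 0)"
  by (rule sum.cong) (auto simp: mat_def)
 thus ?thesis by (simp add: matrix_matrix_mult_def)
qed

lemma mult_mat_nth [simp]: "(A ** mat c) $ i $ j = c * (A :: complex ^ 'n ^ 'm) $ i $ j"
proof -
 have "(\<Sum>k\<in>UNIV. A $ i $ k * (mat c :: complex ^ 'n ^ 'n) $ k $ j) = (\<Sum>k\<in>UNIV. if k = j then c * A $ i $ j else 0)"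
  by (rule sum.cong) (auto simp: mat_def)
 thus ?thesis by (simp add: matrix_matrix_mult_def)
qed

lemma mat_mult_commute:
 fixes A :: "complex ^ 'n ^ 'm"
 shows "mat c ** A = A ** mat c"
 by (simp add: vec_eq_iff)

lemma mat_mult_vec:
 fixes v :: "complex ^ 'n"
 shows "mat c *v v = c *s v"
proof -
 have "(\<Sum>k\<in>UNIV. (mat c :: complex ^ 'n ^ 'n) $ i $ k * v $ k) = (\<Sum>k\<in>UNIV. if k = i then c * v $ i else 0)" for i
  by (rule sum.cong) (auto simp: mat_def)
 thus ?thesis by (simp add: vec_eq_iff matrix_vector_mult_def)
qed

lemma mat_mult_mult_vec: "(mat c ** A) *v v = c *s (A *v (v :: complex ^ 'n))" for A :: "complex ^ 'n ^ 'm"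
 by (simp add: mat_mult_vec flip: matrix_vector_mul_assoc)

lemma invertible_mat_mult:
 fixes A :: "complex ^ 'n ^ 'n"
 assumes "c ~= 0" "invertible A" shows "invertible (mat c ** A)"
proof -
 have "(mat c ** A) ** (mat (1 / c) ** matrix_inv A) = ((mat c ** A) ** mat (1 / c)) ** matrix_inv A"
  by (simp add: matrix_mul_assoc)
 also have "(mat c ** A) ** mat (1 / c) = A"
  using assms(1) by (simp add: vec_eq_iff)
 finally have "(mat c ** A) ** (mat (1 / c) ** matrix_inv A) = mat 1" using matrix_inv_right[OF assms(2)] by simp
 thus ?thesis using matrix_left_right_inverse unfolding invertible_def by blast
qed

lemma matrix_scale_vec: "A *v (c *s v) = c *s (A *v v)" for A :: "complex ^ 'n ^ 'm"
 by (simp add: vec_eq_iff matrix_vector_mult_def sum_distrib_left mult.left_commute)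

section \<open>Sections and homomorphisms read in frames\<close>

context hopf
begin

no_notation fps_nth (infixl "$" 75)

lemma local_section_iff:
 "local_section E U s \<longleftrightarrow> (ALL p:U. ALL (V, f):frames E. p : V --> vec_at (%q. matrix_inv (f q) *v s q) p)"
 unfolding local_section_def vec_holo_on_iff by blast

lemma local_sectionD:
 "local_section E U s ==> p : U ==> (V, f) : frames E ==> p : V ==> vec_at (%q. matrix_inv (f q) *v s q) p"
 unfolding local_section_iff by fast

lemma local_sectionI:
 assumes "!!p V f. p : U ==> (V, f) : frames E ==> p : V ==> vec_at (%q. matrix_inv (f q) *v s q) p"
 shows "local_section E U s"
 unfolding local_section_iff by (intro ballI, clarify) (rule assms)

lemma frame_at:
 assumes "holo_bundle b r E" "p : C2_star"
 obtains V f where "(V, f) : frames E" "p : V" "open V" "V <= C2_star" "!!q. q : V ==> invertible (f q)"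
proof -
 have "p : (\<Union>(V, f)\<in>frames E. V)" using assms unfolding holo_bundle_def by simp
 then obtain V f where "(V, f) : frames E" "p : V" by auto
 thus ?thesis using assms that[of V f] unfolding holo_bundle_def by blast
qed

lemma frameD:
 assumes "holo_bundle b r E" "(V, f) : frames E"
 shows "open V" "V <= C2_star" "q : V ==> invertible (f q)"
 using assms unfolding holo_bundle_def by blast+

lemma transition_at:
 assumes "holo_bundle b r E" "(U, f) : frames E" "(V, g) : frames E"
 shows "p : U ==> p : V ==> mat_at (%p. matrix_inv (g p) ** f p) p"
  "p : U ==> F p : V ==> mat_at (%p. matrix_inv (g (F p)) ** factor E p ** f p) p"
proof -
 have *: "mat_holo_on (%p. matrix_inv (g p) ** f p) (U Int V) &
     mat_holo_on (%p. matrix_inv (g (F p)) ** factor E p ** f p) (U Int {p. F p : V})"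
  using assms unfolding holo_bundle_def by fast
 show "p : U ==> p : V ==> mat_at (%p. matrix_inv (g p) ** f p) p"
  "p : U ==> F p : V ==> mat_at (%p. matrix_inv (g (F p)) ** factor E p ** f p) p"
  using * unfolding mat_holo_on_iff by auto
qed

lemma factor_invertible: "holo_bundle b r E ==> p : C2_star ==> invertible (factor E p)"
 unfolding holo_bundle_def by blast

lemma bundle_homD:
 assumes "bundle_hom b r E E' h"
 shows "p : C2_star ==> h (F p) ** factor E p = factor E' p ** h p"
  "(U, f) : frames E ==> (V, g) : frames E' ==> p : U ==> p : V ==> mat_at (%p. matrix_inv (g p) ** h p ** f p) p"
 using assms unfolding bundle_hom_def mat_holo_on_iff by fast+

lemma bundle_homI:
 assumes "!!p. p : C2_star ==> h (F p) ** factor E p = factor E' p ** h p"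
  "!!U f V g p. (U, f) : frames E ==> (V, g) : frames E' ==> p : U ==> p : V ==> mat_at (%p. matrix_inv (g p) ** h p ** f p) p"
 shows "bundle_hom b r E E' h"
 unfolding bundle_hom_def mat_holo_on_iff using assms by blast

lemma bundle_hom_cong:
 assumes "bundle_hom b r E E' h" "holo_bundle b r E" "!!p. p : C2_star ==> h p = h' p"
 shows "bundle_hom b r E E' h'"
proof (rule bundle_homI)
 show "h' (F p) ** factor E p = factor E' p ** h' p" if "p : C2_star" for p
  using bundle_homD(1)[OF assms(1) that] assms(3) that by simp
 fix U f V g p assume *: "(U, f) : frames E" "(V, g) : frames E'" "p : U" "p : V"
 show "mat_at (%p. matrix_inv (g p) ** h' p ** f p) p"
  by (rule mat_at_transform[OF bundle_homD(2)[OF assms(1) *] frameD(1)[OF assms(2) *(1)] *(3)])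
   (use assms(3) frameD(2)[OF assms(2) *(1)] in auto)
qed

lemma bundle_hom_comp:
 assumes h: "bundle_hom b r E E' h" and h': "bundle_hom b r E' E'' h'" and E: "holo_bundle b r E" and E': "holo_bundle b r E'"
 shows "bundle_hom b r E E'' (%p. h' p ** h p)"
proof (rule bundle_homI)
 fix p assume p: "p : C2_star"
 have "h' (F p) ** h (F p) ** factor E p = h' (F p) ** (factor E' p ** h p)"
  using bundle_homD(1)[OF h p] by (simp add: matrix_mul_assoc[symmetric])
 also have "\<dots> = factor E'' p ** h' p ** h p"
  using bundle_homD(1)[OF h' p] by (simp add: matrix_mul_assoc)
 finally show "h' (F p) ** h (F p) ** factor E p = factor E'' p ** (h' p ** h p)"
  by (simp add: matrix_mul_assoc)
next
 fix U f V g p assume *: "(U, f) : frames E" "(V, g) : frames E''" "p : U" "p : V"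
 have "p : C2_star" using frameD(2)[OF E *(1)] *(3) by auto
 then obtain W k where W: "(W, k) : frames E'" "p : W" "open W" "!!q. q : W ==> invertible (k q)"
  using frame_at[OF E'] by metis
 have "mat_at (%p. (matrix_inv (g p) ** h' p ** k p) ** (matrix_inv (k p) ** h p ** f p)) p"
  by (rule mat_at_mult[OF bundle_homD(2)[OF h' W(1) *(2) W(2) *(4)] bundle_homD(2)[OF h *(1) W(1) *(3) W(2)]])
 thus "mat_at (%p. matrix_inv (g p) ** (h' p ** h p) ** f p) p"
 proof (rule mat_at_transform[OF _ W(3,2)])
  fix q assume "q : W"
  hence "k q ** (matrix_inv (k q) ** (h q ** f q)) = h q ** f q" using matrix_inv_cancel(2)[OF W(4)] by blast
  thus "(matrix_inv (g q) ** h' q ** k q) ** (matrix_inv (k q) ** h q ** f q) = matrix_inv (g q) ** (h' q ** h q) ** f q"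
   by (simp add: matrix_mul_assoc[symmetric])
 qed
qed

lemma bundle_iso_inverse:
 fixes E E' :: "2 hopf_bundle"
 assumes g: "bundle_iso b r E E' g" and E: "holo_bundle b r E" and E': "holo_bundle b r E'"
 shows "bundle_iso b r E' E (%p. matrix_inv (g p))"
 unfolding bundle_iso_def
proof (intro conjI ballI)
 have gh: "bundle_hom b r E E' g" and gi: "!!p. p : C2_star ==> invertible (g p)"
  using g by (auto simp: bundle_iso_def)
 show "invertible (matrix_inv (g p))" if "p : C2_star" for p using gi[OF that] by (rule invertible_matrix_inv)
 show "bundle_hom b r E' E (%p. matrix_inv (g p))"
 proof (rule bundle_homI)
  fix p assume p: "p : C2_star"
  have Fp: "F p : C2_star" using p by simp
  have "matrix_inv (g (F p)) ** factor E' p = matrix_inv (g (F p)) ** (factor E' p ** g p) ** matrix_inv (g p)"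
   using matrix_inv_cancel(3)[OF gi[OF p], of "matrix_inv (g (F p)) ** factor E' p"] by (simp add: matrix_mul_assoc)
  also have "\<dots> = matrix_inv (g (F p)) ** (g (F p) ** (factor E p ** matrix_inv (g p)))"
   using bundle_homD(1)[OF gh p] by (simp add: matrix_mul_assoc)
  also have "\<dots> = factor E p ** matrix_inv (g p)" by (rule matrix_inv_cancel(1)[OF gi[OF Fp]])
  finally show "matrix_inv (g (F p)) ** factor E' p = factor E p ** matrix_inv (g p)" .
 next
  fix U f V k p assume *: "(U, f) : frames E'" "(V, k) : frames E" "p : U" "p : V"
  have UV: "open (U Int V)" "p : U Int V"
   using frameD(1)[OF E' *(1)] frameD(1)[OF E *(2)] * by auto
  have inv: "invertible (f q)" "invertible (k q)" "invertible (g q)" if "q : U Int V" for q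
   using that frameD(3)[OF E' *(1), of q] frameD(3)[OF E *(2), of q] gi[of q] subsetD[OF frameD(2)[OF E' *(1)], of q] by blast+
  have inv3: "matrix_inv (matrix_inv (f q) ** g q ** k q) = matrix_inv (k q) ** matrix_inv (g q) ** f q"
   if "q : U Int V" for q
  proof (rule matrix_inv_eq)
   have "matrix_inv (f q) ** g q ** k q ** (matrix_inv (k q) ** matrix_inv (g q) ** f q)
     = matrix_inv (f q) ** (g q ** (k q ** (matrix_inv (k q) ** (matrix_inv (g q) ** f q))))"
    by (simp add: matrix_mul_assoc)
   thus "matrix_inv (f q) ** g q ** k q ** (matrix_inv (k q) ** matrix_inv (g q) ** f q) = mat 1"
    using inv[OF that] by (simp add: matrix_inv_cancel matrix_inv_left)
  qed
  have "mat_at (%q. matrix_inv (matrix_inv (f q) ** g q ** k q)) p"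
  proof (rule mat_at_inverse_2[OF bundle_homD(2)[OF gh *(2,1,4,3)] UV])
   show "invertible (matrix_inv (f q) ** g q ** k q)" if "q : U Int V" for q
    using inv[OF that] by (intro invertible_mult invertible_matrix_inv)
  qed
  thus "mat_at (%p. matrix_inv (k p) ** matrix_inv (g p) ** f p) p"
   by (rule mat_at_transform[OF _ UV]) (rule inv3)
 qed
qed

lemma local_section_hom:
 assumes h: "bundle_hom b r E E' h" and E: "holo_bundle b r E" and s: "local_section E U s" and U: "U <= C2_star"
 shows "local_section E' U (%p. h p *v s p)"
proof (rule local_sectionI)
 fix p V g assume *: "p : U" "(V, g) : frames E'" "p : V"
 obtain W k where W: "(W, k) : frames E" "p : W" "open W" "!!q. q : W ==> invertible (k q)"
  using frame_at[OF E, of p] * U by (metis subsetD)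
 have "vec_at (%p. (matrix_inv (g p) ** h p ** k p) *v (matrix_inv (k p) *v s p)) p"
  by (rule vec_at_mult[OF bundle_homD(2)[OF h W(1) *(2) W(2) *(3)] local_sectionD[OF s *(1) W(1,2)]])
 thus "vec_at (%p. matrix_inv (g p) *v (h p *v s p)) p"
 proof (rule vec_at_transform[OF _ W(3,2)])
  fix q assume "q : W"
  thus "(matrix_inv (g q) ** h q ** k q) *v (matrix_inv (k q) *v s q) = matrix_inv (g q) *v (h q *v s q)"
   using matrix_inv_cancel(6)[OF W(4)] by (simp add: matrix_vector_mul_assoc[symmetric])
 qed
qed

lemma local_section_add:
 assumes "local_section E U s" "local_section E U t"
 shows "local_section E U (%p. s p + t p)"
 by (rule local_sectionI) (use vec_at_add[OF local_sectionD[OF assms(1)] local_sectionD[OF assms(2)]] in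
   \<open>simp add: matrix_vector_right_distrib\<close>)

lemma local_section_scale:
 assumes "local_section E U s" "!!p. p : U ==> holo2_at f p"
 shows "local_section E U (%p. f p *s s p)"
 by (rule local_sectionI) (use vec_at_scale[OF assms(2) local_sectionD[OF assms(1)]] in \<open>simp add: matrix_scale_vec\<close>)

lemma local_section_cong:
 assumes "local_section E U s" "open U" "!!p. p : U ==> s p = t p"
 shows "local_section E U t"
proof (rule local_sectionI)
 fix p V f assume *: "p : U" "(V, f) : frames E" "p : V"
 show "vec_at (%q. matrix_inv (f q) *v t q) p"
  by (rule vec_at_transform[OF local_sectionD[OF assms(1) *] assms(2) *(1)]) (simp add: assms(3))
qed

text \<open>The entries of a section need not be continuous, only its coordinates in a frame are;
  continuity has to be used after multiplication by the inverse frame.\<close>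

lemma local_section_eq_on_axis:
 assumes E: "holo_bundle b r E" and s: "local_section E U s" "local_section E U t" and U: "open U" "U <= C2_star"
  and eq: "!!p. p : U ==> snd p ~= 0 ==> s p = t p" and p: "p : U"
 shows "s p = t p"
proof (cases "snd p = 0")
 case True
 then obtain x where [simp]: "p = (x, 0)" by (cases p) auto
 obtain W k where W: "(W, k) : frames E" "p : W" "open W" "!!q. q : W ==> invertible (k q)"
  using frame_at[OF E, of p] p U by (metis subsetD)
 have "matrix_inv (k (x, 0)) *v s (x, 0) = matrix_inv (k (x, 0)) *v t (x, 0)"
 proof (rule eq_on_axis[where U = U and f = "%q. matrix_inv (k q) *v s q" and g = "%q. matrix_inv (k q) *v t q"])
  show "isCont (%q. matrix_inv (k q) *v s q) (x, 0)" "isCont (%q. matrix_inv (k q) *v t q) (x, 0)"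
   using vec_at_isCont[OF local_sectionD[OF s(1) p W(1,2)]] vec_at_isCont[OF local_sectionD[OF s(2) p W(1,2)]] by simp_all
 qed (use U p eq in auto)
 thus ?thesis using matrix_inv_cancel(6)[OF W(4)[OF W(2)]] by (metis \<open>p = (x, 0)\<close>)
qed (use eq p in auto)

text \<open>The coordinates are divided by y in every frame. Two frames give the same quotient off y
  = 0 by cancellation and on y = 0 by continuity, so choosing one frame per point defines a
  section.\<close>

lemma local_section_divide:
 assumes E: "holo_bundle b r E" and s: "local_section E C2_star s" and zero: "!!x. x ~= 0 ==> s (x, 0) = 0"
 obtains s' where "local_section E C2_star s'" "!!p. p : C2_star ==> s p = snd p *s s' p"
proof -
 have ex: "EX t. (ALL p:V. vec_at t p) & (ALL p:V. matrix_inv (f p) *v s p = snd p *s t p)" if Vf: "(V, f) : frames E" for V f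
 proof -
  have V: "open V" "V <= C2_star" using frameD[OF E Vf] by auto
  have "EX g. holo2_on g V & (ALL p:V. (matrix_inv (f p) *v s p) $ i = snd p * g p)" for i
  proof -
   have "holo2_on (%p. (matrix_inv (f p) *v s p) $ i) V"
    unfolding holo2_on_iff using local_sectionD[OF s _ Vf] V by (auto simp: vec_at_def)
   moreover have "(matrix_inv (f (x, 0)) *v s (x, 0)) $ i = 0" if "(x, 0) : V" for x
    using zero[of x] that V by (cases "x = 0") (auto simp: C2_star_def)
   ultimately obtain g where "holo2_on g V" "!!p. p : V ==> (matrix_inv (f p) *v s p) $ i = snd p * g p"
    using holo2_divide_snd[OF V(1), of "%p. (matrix_inv (f p) *v s p) $ i"] by blast
   thus ?thesis by blast
  qed
  then obtain g where g: "!!i. holo2_on (g i) V" "!!i p. p : V ==> (matrix_inv (f p) *v s p) $ i = snd p * g i p"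
   by metis
  show ?thesis
   by (rule exI[of _ "%p. \<chi> i. g i p"]) (use g in \<open>auto simp: vec_at_def holo2_on_iff vec_eq_iff\<close>)
 qed
 define T where "T V f = (SOME t. (ALL p:V. vec_at t p) & (ALL p:V. matrix_inv (f p) *v s p = snd p *s t p))" for V and f :: "C2 => complex ^ 'a ^ 'a"
 have T: "vec_at (T V f) p" "matrix_inv (f p) *v s p = snd p *s T V f p" if "(V, f) : frames E" "p : V" for V f p
  using someI_ex[OF ex[OF that(1)]] that(2) unfolding T_def by auto
 define fr where "fr p = (SOME Vf. Vf : frames E & p : fst Vf)" for p
 have fr: "fr p : frames E & p : fst (fr p)" if p: "p : C2_star" for p
 proof -
  obtain V f where "(V, f) : frames E" "p : V" using frame_at[OF E p] by metis
  thus ?thesis unfolding fr_def by (intro someI_ex[of "%Vf. Vf : frames E & p : fst Vf"]) auto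
 qed
 define s' where "s' p = snd (fr p) p *v T (fst (fr p)) (snd (fr p)) p" for p
 have key: "matrix_inv (g p) *v s' p = T W g p" if W: "(W, g) : frames E" and p: "p : W" for W g p
 proof -
  have pC: "p : C2_star" using frameD(2)[OF E W] p by auto
  obtain V f where Vf: "fr p = (V, f)" by (cases "fr p")
  have V: "(V, f) : frames E" "p : V" using fr[OF pC] Vf by auto
  have op: "open (V Int W)" using frameD(1)[OF E W] frameD(1)[OF E V(1)] by auto
  have tr: "snd q *s T W g q = snd q *s ((matrix_inv (g q) ** f q) *v T V f q)" if q: "q : V Int W" for q
  proof -
   have "snd q *s ((matrix_inv (g q) ** f q) *v T V f q) = matrix_inv (g q) *v (f q *v (matrix_inv (f q) *v s q))"
    using T(2)[OF V(1), of q] q by (simp add: matrix_vector_mul_assoc[symmetric] matrix_scale_vec)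
   also have "\<dots> = matrix_inv (g q) *v s q"
    using matrix_inv_cancel(6)[OF frameD(3)[OF E V(1), of q]] q by simp
   finally have e: "snd q *s ((matrix_inv (g q) ** f q) *v T V f q) = matrix_inv (g q) *v s q" .
   show ?thesis unfolding e using T(2)[OF W, of q] q by simp
  qed
  have tr': "T W g q = (matrix_inv (g q) ** f q) *v T V f q" if "q : V Int W" "snd q ~= 0" for q
   using tr[OF that(1)] that(2) unfolding vector_mul_lcancel by blast
  have "T W g p = (matrix_inv (g p) ** f p) *v T V f p"
  proof (cases "snd p = 0")
   case True
   then obtain x where [simp]: "p = (x, 0)" by (cases p) auto
   have "T W g (x, 0) = (matrix_inv (g (x, 0)) ** f (x, 0)) *v T V f (x, 0)"
   proof (rule eq_on_axis[where U = "V Int W" and f = "T W g" and g = "%q. (matrix_inv (g q) ** f q) *v T V f q"])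
    show "isCont (T W g) (x, 0)" using vec_at_isCont[OF T(1)[OF W p]] by simp
    show "isCont (%q. (matrix_inv (g q) ** f q) *v T V f q) (x, 0)"
     using vec_at_isCont[OF vec_at_mult[OF transition_at(1)[OF E V(1) W V(2) p] T(1)[OF V]]] by simp
   qed (use op V p tr' in auto)
   thus ?thesis by simp
  qed (use tr' V p in auto)
  thus ?thesis by (simp add: s'_def Vf matrix_vector_mul_assoc)
 qed
 show ?thesis
 proof
  show "local_section E C2_star s'"
  proof (rule local_sectionI)
   fix p W g assume W: "(W, g) : frames E" "p : W"
   show "vec_at (%q. matrix_inv (g q) *v s' q) p"
    by (rule vec_at_transform[OF T(1)[OF W] frameD(1)[OF E W(1)] W(2)]) (rule key[OF W(1), symmetric])
  qed
  show "s p = snd p *s s' p" if p: "p : C2_star" for p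
  proof -
   obtain W g where W: "(W, g) : frames E" "p : W" using frame_at[OF E p] by metis
   have inv: "invertible (g p)" using frameD(3)[OF E W] .
   have "matrix_inv (g p) *v s p = matrix_inv (g p) *v (snd p *s s' p)"
    using T(2)[OF W] key[OF W] by (simp add: matrix_scale_vec)
   thus ?thesis using matrix_inv_cancel(6)[OF inv] by metis
  qed
 qed
qed

section \<open>Equivariant sections\<close>

text \<open>These are the homomorphisms from L \<sigma> to E, equivalently the global sections of E
  twisted by the inverse of L \<sigma>.\<close>

definition esec :: "('n::finite) hopf_bundle => complex => (C2 => complex ^ 'n) => bool" where
 "esec E \<sigma> s \<longleftrightarrow> local_section E C2_star s & (ALL p:C2_star. factor E p *v s p = \<sigma> *s s (F p))"

lemma open_F_vimage: "open U ==> open {p. F p : U}"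
 using open_vimage[of U F] isCont_F by (simp add: vimage_def continuous_at_imp_continuous_on)

text \<open>\<open>factor E\<close> by itself need not be continuous; the pullback is holomorphic
  because the transition from a frame at p to a frame at F p is.\<close>

lemma pullback_section:
 fixes E :: "2 hopf_bundle"
 assumes E: "holo_bundle b r E" and t: "local_section E U t" and U: "U <= C2_star"
 shows "local_section E {p. F p : U} (%p. matrix_inv (factor E p) *v t (F p))"
proof (rule local_sectionI)
 fix p V f assume *: "p : {p. F p : U}" "(V, f) : frames E" "p : V"
 have Fp: "F p : C2_star" using * U by auto
 obtain W g where W: "(W, g) : frames E" "F p : W" "open W" "W <= C2_star" "!!q. q : W ==> invertible (g q)"
  using frame_at[OF E Fp] by metis
 note V = frameD[OF E *(2)]
 define M where "M q = matrix_inv (g (F q)) ** factor E q ** f q" for q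
 have O: "open (V Int {q. F q : W})" using V(1) open_F_vimage[OF W(3)] by auto
 have pO: "p : V Int {q. F q : W}" using * W by auto
 have inv: "invertible (factor E q)" "invertible (f q)" "invertible (g (F q))" if "q : V Int {q. F q : W}" for q
  using that factor_invertible[OF E, of q] V(2,3) W(5) by auto
 have M: "invertible (M q)" if "q : V Int {q. F q : W}" for q
  unfolding M_def using inv[OF that] by (intro invertible_mult invertible_matrix_inv)
 have "vec_at (%q. matrix_inv (g q) *v t q) (F p)"
  by (rule local_sectionD[OF t _ W(1,2)]) (use * in simp)
 hence 1: "vec_at (%q. matrix_inv (g (F q)) *v t (F q)) p"
  unfolding vec_at_def by (intro allI holo2_at_F) simp
 have 2: "mat_at (%q. matrix_inv (M q)) p"
 proof (rule mat_at_inverse_2[OF _ O pO])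
  show "mat_at M p" unfolding M_def by (rule transition_at(2)[OF E *(2) W(1) *(3) W(2)])
 qed (rule M)
 have "vec_at (%q. matrix_inv (M q) *v (matrix_inv (g (F q)) *v t (F q))) p"
  by (rule vec_at_mult[OF 2 1])
 thus "vec_at (%q. matrix_inv (f q) *v (matrix_inv (factor E q) *v t (F q))) p"
 proof (rule vec_at_transform[OF _ O pO])
  fix q assume q: "q : V Int {q. F q : W}"
  let ?v = "matrix_inv (f q) *v (matrix_inv (factor E q) *v t (F q))"
  have "M q *v ?v = matrix_inv (g (F q)) *v (factor E q *v (f q *v ?v))"
   by (simp only: M_def matrix_vector_mul_assoc[symmetric])
  also have "\<dots> = matrix_inv (g (F q)) *v t (F q)"
   by (simp add: matrix_inv_cancel(6)[OF inv(1)[OF q]] matrix_inv_cancel(6)[OF inv(2)[OF q]])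
  finally show "matrix_inv (M q) *v (matrix_inv (g (F q)) *v t (F q)) = ?v"
   using matrix_inv_cancel(5)[OF M[OF q]] by metis
 qed
qed

lemma equivariant_on_axis:
 fixes E :: "2 hopf_bundle"
 assumes E: "holo_bundle b r E" and s: "local_section E C2_star s" and t: "local_section E C2_star t"
  and eq: "!!p. p : C2_star ==> snd p ~= 0 ==> factor E p *v s p = t (F p)" and p: "p : C2_star"
 shows "factor E p *v s p = t (F p)"
proof -
 have "s p = matrix_inv (factor E p) *v t (F p)"
 proof (rule local_section_eq_on_axis[OF E s _ open_C2_star order_refl _ p])
  show "local_section E C2_star (%p. matrix_inv (factor E p) *v t (F p))"
   using pullback_section[OF E t order_refl] by simp
  show "s q = matrix_inv (factor E q) *v t (F q)" if "q : C2_star" "snd q ~= 0" for q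
   using eq[OF that] matrix_inv_cancel(5)[OF factor_invertible[OF E that(1)]] by metis
 qed
 thus ?thesis using matrix_inv_cancel(6)[OF factor_invertible[OF E p]] by simp
qed

text \<open>Dividing by y multiplies the multiplier by b, as y itself is multiplied by b under
  F.\<close>

lemma esec_divide:
 fixes E :: "2 hopf_bundle"
 assumes E: "holo_bundle b r E" and s: "esec E \<sigma> s" and zero: "!!x. x ~= 0 ==> s (x, 0) = 0"
 obtains s' where "esec E (\<sigma> * b) s'" "!!p. p : C2_star ==> s p = snd p *s s' p"
proof -
 obtain s' where s': "local_section E C2_star s'" "!!p. p : C2_star ==> s p = snd p *s s' p"
  using local_section_divide[where E = E and s = s] E zero s unfolding esec_def by metis
 have ls: "local_section E C2_star (%p. (\<sigma> * b) *s s' p)" by (rule local_section_scale[OF s'(1)]) simp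
 have eq: "factor E p *v s' p = (\<sigma> * b) *s s' (F p)" if p: "p : C2_star" "snd p ~= 0" for p
 proof -
  have "snd p *s (factor E p *v s' p) = factor E p *v s p"
   unfolding s'(2)[OF p(1)] matrix_scale_vec ..
  also have "\<dots> = \<sigma> *s s (F p)" using s p(1) unfolding esec_def by blast
  also have "\<dots> = snd p *s ((\<sigma> * b) *s s' (F p))"
   using s'(2)[of "F p"] p(1) by (simp add: vector_smult_assoc mult_ac)
  finally show ?thesis using p(2) unfolding vector_mul_lcancel by blast
 qed
 have "esec E (\<sigma> * b) s'"
  unfolding esec_def using s'(1) equivariant_on_axis[OF E s'(1) ls eq] by blast
 thus ?thesis using that s'(2) by blast
qed

end

section \<open>Extensions of line bundles\<close>

lemma column_mult: "column j (A ** B) = A *v column j B"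
 by (simp add: vec_eq_iff column_def matrix_matrix_mult_def matrix_vector_mult_def)

lemma mult_vec_1: "(h :: complex ^ 1 ^ 'm) *v w = w $ 1 *s column 1 h"
 by (simp add: vec_eq_iff column_def matrix_vector_mult_def mult.commute)

lemma column_mult_1: "column 1 ((h :: complex ^ 1 ^ 'm) ** u) = u $ 1 $ 1 *s column 1 h"
 by (simp add: column_mult mult_vec_1) (simp add: column_def)

lemma column_1_eq_iff: "column 1 h = column 1 h' \<longleftrightarrow> h = (h' :: complex ^ 1 ^ 'm)"
 by (auto simp: vec_eq_iff column_def forall_1)

lemma column_1_zero [simp]: "column 1 (0 :: complex ^ 1 ^ 'm) = 0"
 by (simp add: vec_eq_iff column_def)

lemma mat_at_columns: "mat_at M p \<longleftrightarrow> (ALL j. vec_at (%q. column j (M q)) p)"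
 by (auto simp: mat_at_def vec_at_def column_def)

lemma proportional_2:
 fixes u v :: "complex ^ 2"
 assumes "u ~= 0" "u $ 1 * v $ 2 = u $ 2 * v $ 1"
 obtains c where "v = c *s u"
proof (cases "u $ 1 = 0")
 case True
 hence "u $ 2 ~= 0" using assms(1) by (simp add: vec_eq_iff forall_2)
 thus ?thesis using True assms(2) by (intro that[of "v $ 2 / u $ 2"]) (simp add: vec_eq_iff forall_2)
next
 case False
 thus ?thesis using assms(2) by (intro that[of "v $ 1 / u $ 1"]) (simp add: vec_eq_iff forall_2 field_simps)
qed

lemma kernel_2:
 fixes M :: "complex ^ 2 ^ 'm"
 assumes "M ~= 0" "u ~= 0" "M *v u = 0" "M *v v = 0"
 obtains c where "v = c *s u"
proof -
 obtain i j where ij: "M $ i $ j ~= 0" using assms(1) by (auto simp: vec_eq_iff)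
 have e: "M $ i $ 1 * u $ 1 + M $ i $ 2 * u $ 2 = 0" "M $ i $ 1 * v $ 1 + M $ i $ 2 * v $ 2 = 0"
  using assms(3,4) by (simp_all add: vec_eq_iff mult_vec_2)
 have "M $ i $ 1 * (u $ 1 * v $ 2 - u $ 2 * v $ 1) = (M $ i $ 1 * u $ 1 + M $ i $ 2 * u $ 2) * v $ 2 - (M $ i $ 1 * v $ 1 + M $ i $ 2 * v $ 2) * u $ 2"
  "M $ i $ 2 * (u $ 1 * v $ 2 - u $ 2 * v $ 1) = (M $ i $ 1 * v $ 1 + M $ i $ 2 * v $ 2) * u $ 1 - (M $ i $ 1 * u $ 1 + M $ i $ 2 * u $ 2) * v $ 1"
  by (simp_all add: algebra_simps)
 hence "M $ i $ 1 * (u $ 1 * v $ 2 - u $ 2 * v $ 1) = 0" "M $ i $ 2 * (u $ 1 * v $ 2 - u $ 2 * v $ 1) = 0"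
  unfolding e by simp_all
 moreover have "M $ i $ 1 ~= 0 \<or> M $ i $ 2 ~= 0" using ij exhaust_2[of j] by auto
 ultimately have "u $ 1 * v $ 2 = u $ 2 * v $ 1" by auto
 thus ?thesis by (rule proportional_2[OF assms(2)]) (rule that)
qed

text \<open>A matrix with image in one line is a column times a row; the row will become the
  quotient map of an extension.\<close>

lemma rank_one_2:
 fixes M :: "complex ^ 2 ^ 2"
 assumes "!!v. EX c. M *v v = c *s z"
 obtains \<kappa> :: "complex ^ 2 ^ 1" where "!!v. M *v v = (\<kappa> *v v) $ 1 *s z"
proof -
 obtain c where c: "!!v. M *v v = c v *s z" using assms by metis
 let ?\<kappa> = "\<chi> i j. c (axis j 1)"
 have "M $ i $ j = c (axis j 1) * z $ i" for i j
 proof -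
  have "M $ i $ j = (M *v axis j 1) $ i"
   using exhaust_2[of j] by (auto simp: mult_vec_2 axis_def)
  thus ?thesis by (simp add: c)
 qed
 hence "M *v v = (?\<kappa> *v v) $ 1 *s z" for v
  by (simp add: vec_eq_iff mult_vec_2 algebra_simps)
 thus ?thesis by (rule that)
qed

definition cols :: "complex ^ 2 => complex ^ 2 => complex ^ 2 ^ 2" where
 "cols u v = (\<chi> i j. if j = 1 then u $ i else v $ i)"

lemma column_cols [simp]: "column 1 (cols u v) = u" "column 2 (cols u v) = v"
 by (simp_all add: cols_def column_def vec_eq_iff)

lemma cols_mult_vec: "cols u v *v w = w $ 1 *s u + w $ 2 *s v"
 by (simp add: vec_eq_iff mult_vec_2 cols_def mult.commute)

lemma invertible_kernel: "invertible (A :: complex ^ 'n ^ 'n) \<longleftrightarrow> (ALL x. A *v x = 0 --> x = 0)"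
 using matrix_left_invertible_ker[of A] matrix_left_right_inverse unfolding invertible_def by metis

text \<open>A bundle with trivial pullback, given by its factor of automorphy. All normal forms are
  of this kind.\<close>

definition TB :: "(C2 => complex ^ 2 ^ 2) => 2 hopf_bundle" where
 "TB B = \<lparr>factor = B, frames = {(C2_star, %_. mat 1)}\<rparr>"

lemma TB_simps [simp]: "factor (TB B) = B" "frames (TB B) = {(C2_star, %_. mat 1)}"
 by (simp_all add: TB_def)

lemma twist_simps [simp]: "factor (twist l E) p = mat l ** factor E p" "frames (twist l E) = frames E"
 by (simp_all add: twist_def)

lemma L_simps [simp]: "factor (L \<tau>) p = mat \<tau>" "frames (L \<tau>) = {(C2_star, %_. mat 1)}"
 by (simp_all add: L_def)

lemma L_sum_eq_TB: "L_sum \<sigma> \<tau> = TB (%_. mat2 \<sigma> 0 0 \<tau>)"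
 by (simp add: L_sum_def TB_def mat2_def)

section \<open>Global frames and ratios of sections\<close>

context hopf
begin

lemma local_section_trivial:
 assumes "frames E = {(C2_star, %_. mat 1)}" "U <= C2_star"
 shows "local_section E U s \<longleftrightarrow> (ALL p:U. vec_at s p)"
 using assms(2) by (auto simp: local_section_iff assms(1))

lemma local_section_twist [simp]: "local_section (twist l E) U s = local_section E U s"
 by (simp add: local_section_def)

lemma holo_bundle_twist:
 fixes E :: "2 hopf_bundle"
 assumes l: "l ~= 0" and E: "holo_bundle b r E"
 shows "holo_bundle b r (twist l E)"
proof -
 have *: "mat_holo_on (%p. matrix_inv (g (F p)) ** (mat l ** factor E p) ** f p) (U Int {p. F p : V})"
  if "(U, f) : frames E" "(V, g) : frames E" for U f V g
  unfolding mat_holo_on_iff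
 proof
  fix p assume "p : U Int {p. F p : V}"
  hence "mat_at (%p. mat l ** (matrix_inv (g (F p)) ** factor E p ** f p)) p"
   using transition_at(2)[OF E that] by (intro mat_at_mult[OF mat_at_const]) auto
  moreover have "mat l ** (X ** Y ** Z) = X ** (mat l ** Y) ** Z" for X Y Z :: "complex ^ 2 ^ 2"
   by (simp add: matrix_mul_assoc mat_mult_commute[of l X])
  ultimately show "mat_at (%p. matrix_inv (g (F p)) ** (mat l ** factor E p) ** f p) p" by simp
 qed
 have *: "ALL (U, f):frames E. ALL (V, g):frames E.
    mat_holo_on (%p. matrix_inv (g p) ** f p) (U Int V) &
    mat_holo_on (%p. matrix_inv (g (F p)) ** (mat l ** factor E p) ** f p) (U Int {p. F p : V})"
 proof clarify
  fix U f V g assume h: "(U, f) : frames E" "(V, g) : frames E"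
  show "mat_holo_on (%p. matrix_inv (g p) ** f p) (U Int V) &
    mat_holo_on (%p. matrix_inv (g (F p)) ** (mat l ** factor E p) ** f p) (U Int {p. F p : V})"
   using transition_at(1)[OF E h] *[OF h] unfolding mat_holo_on_iff by simp
 qed
 have **: "ALL p:C2_star. invertible (mat l ** factor E p)"
  using factor_invertible[OF E] invertible_mat_mult[OF l] by blast
 have "(ALL (U, f):frames E. open U & U <= C2_star & (ALL p:U. invertible (f p))) & (\<Union>(U, f)\<in>frames E. U) = C2_star"
  using E unfolding holo_bundle_def by simp
 thus ?thesis
  using * ** unfolding holo_bundle_def twist_simps by simp
qed

lemma bundle_hom_L_iff:
 fixes h :: "C2 => complex ^ 1 ^ 2"
 shows "bundle_hom b r (L \<sigma>) E h \<longleftrightarrow> esec E \<sigma> (%p. column 1 (h p))"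
proof -
 have 1: "h (F p) ** mat \<sigma> = factor E p ** h p \<longleftrightarrow> factor E p *v column 1 (h p) = \<sigma> *s column 1 (h (F p))" for p
  unfolding column_1_eq_iff[symmetric] column_mult_1 column_mult[of 1 "factor E p"] by (auto simp: mat_def)
 have 2: "mat_at (%p. matrix_inv (g p) ** h p) p \<longleftrightarrow> vec_at (%p. matrix_inv (g p) *v column 1 (h p)) p"
  for g p unfolding mat_at_columns forall_1 column_mult ..
 show ?thesis
  unfolding bundle_hom_def esec_def local_section_def
  by (simp add: 1 mat_holo_on_iff vec_holo_on_iff 2) blast
qed

text \<open>It suffices to test on the columns of a frame, which are local sections
  themselves.\<close>

lemma bundle_hom_local:
 fixes E :: "'n::finite hopf_bundle"
 assumes E: "holo_bundle b r E" and eq: "!!p. p : C2_star ==> h (F p) ** factor E p = factor E' p ** h p"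
  and loc: "!!U s. open U ==> U <= C2_star ==> local_section E U s ==> local_section E' U (%p. h p *v s p)"
 shows "bundle_hom b r E E' h"
proof (rule bundle_homI[OF eq])
 fix U f V g p assume *: "(U, f) : frames E" "(V, g) : frames E'" "p : U" "p : V"
 have "vec_at (%q. matrix_inv (g q) *v (h q *v column j (f q))) p" for j
 proof (rule local_sectionD[OF loc *(3,2,4)])
  show "open U" "U <= C2_star" using frameD[OF E *(1)] by auto
  show "local_section E U (%q. column j (f q))"
  proof (rule local_sectionI)
   fix q W k assume "q : U" "(W, k) : frames E" "q : W"
   from transition_at(1)[OF E *(1) this(2,1,3)]
   show "vec_at (%q. matrix_inv (k q) *v column j (f q)) q"
    unfolding mat_at_columns column_mult by blast
  qed
 qed
 thus "mat_at (%p. matrix_inv (g p) ** h p ** f p) p"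
  unfolding mat_at_columns by (simp add: column_mult matrix_vector_mul_assoc matrix_mul_assoc)
qed

text \<open>A global frame of the pullback trivializes it, and B is the matrix of
  \<open>factor E\<close> with respect to this frame.\<close>

lemma frame_iso:
 assumes E: "holo_bundle b r E" and e: "local_section E C2_star e0" "local_section E C2_star e1"
  and indep: "!!p x y. p : C2_star ==> x *s e0 p + y *s e1 p = 0 ==> x = 0 & y = 0"
  and F0: "!!p. p : C2_star ==> factor E p *v e0 p = B p $ 1 $ 1 *s e0 (F p) + B p $ 2 $ 1 *s e1 (F p)"
  and F1: "!!p. p : C2_star ==> factor E p *v e1 p = B p $ 1 $ 2 *s e0 (F p) + B p $ 2 $ 2 *s e1 (F p)"
 shows "bundle_iso b r (TB B) E (%p. cols (e0 p) (e1 p))"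
 unfolding bundle_iso_def
proof (intro conjI ballI)
 show "invertible (cols (e0 p) (e1 p))" if p: "p : C2_star" for p
  unfolding invertible_kernel cols_mult_vec
 proof (intro allI impI)
  fix x :: "complex ^ 2" assume "x $ 1 *s e0 p + x $ 2 *s e1 p = 0"
  from indep[OF p this] show "x = 0" by (simp add: vec_eq_iff forall_2)
 qed
 show "bundle_hom b r (TB B) E (%p. cols (e0 p) (e1 p))"
 proof (rule bundle_homI)
  fix p assume p: "p : C2_star"
  have "column j (cols (e0 (F p)) (e1 (F p)) ** factor (TB B) p) = column j (factor E p ** cols (e0 p) (e1 p))" for j
   using exhaust_2[of j] F0[OF p] F1[OF p] by (auto simp: column_mult cols_mult_vec) (simp_all add: column_def)
  thus "cols (e0 (F p)) (e1 (F p)) ** factor (TB B) p = factor E p ** cols (e0 p) (e1 p)"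
   by (simp add: column_def vec_eq_iff)
 next
  fix U f V g p assume *: "(U, f) : frames (TB B)" "(V, g) : frames E" "p : U" "p : V"
  hence [simp]: "f = (%_. mat 1)" "p : C2_star" by auto
  show "mat_at (%p. matrix_inv (g p) ** cols (e0 p) (e1 p) ** f p) p"
   using local_sectionD[OF e(1) _ *(2,4)] local_sectionD[OF e(2) _ *(2,4)]
   by (simp add: mat_at_columns column_mult forall_2)
 qed
qed

lemma section_ratio:
 assumes f: "!!p. p : C2_star ==> holo2_at f p" and \<mu>: "\<mu> ~= 0" and eq: "!!p. p : C2_star ==> \<mu> * f (F p) = \<tau> * f p"
 shows "(ALL p:C2_star. f p = 0) \<or> (EX n c. c ~= 0 & \<tau> = \<mu> * b ^ n & (ALL p:C2_star. f p = c * snd p ^ n))"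
proof -
 have "f (F p) = \<tau> / \<mu> * f p" if "p : C2_star" for p
  using eq[OF that] \<mu> by (simp add: field_simps)
 from section_eq_monomial[of f "\<tau> / \<mu>", OF _ this] f consider "ALL p:C2_star. f p = 0"
  | n c where "\<tau> / \<mu> = b ^ n" "ALL p:C2_star. f p = c * snd p ^ n"
  unfolding holo2_on_iff by blast
 thus ?thesis
 proof cases
  case 2
  thus ?thesis using \<mu> by (cases "c = 0") (auto simp: field_simps)
 qed auto
qed

text \<open>Where i does not vanish, some coordinate of i in a frame is invertible, and the factor
  of proportionality is a quotient of coordinates.\<close>

lemma ratio_local:
 fixes i s :: "C2 => complex ^ 2"
 assumes E: "holo_bundle b r E" and s: "local_section E U s" and i: "local_section E U i"
  and U: "open U" "U <= C2_star" and p: "p : U" "i p ~= 0"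
 obtains W \<alpha> \<beta> where "open W" "p : W" "W <= U" "holo2_on \<alpha> W" "holo2_on \<beta> W" "ALL q:W. \<beta> q ~= 0"
  "ALL q:W. ALL c. s q = c *s i q --> c = \<alpha> q / \<beta> q"
proof -
 have pC: "p : C2_star" using p U by auto
 obtain V k where V: "(V, k) : frames E" "p : V" "open V" "!!q. q : V ==> invertible (k q)"
  using frame_at[OF E pC] by metis
 have "matrix_inv (k p) *v i p ~= 0"
  using invertible_mult_vec_eq_0[OF invertible_matrix_inv[OF V(4)[OF V(2)]]] p(2) by simp
 then obtain j where j: "(matrix_inv (k p) *v i p) $ j ~= 0" by (auto simp: vec_eq_iff)
 define \<alpha> where "\<alpha> q = (matrix_inv (k q) *v s q) $ j" for q
 define \<beta> where "\<beta> q = (matrix_inv (k q) *v i q) $ j" for q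
 have h: "holo2_on \<alpha> (U Int V)" "holo2_on \<beta> (U Int V)"
  unfolding holo2_on_iff \<alpha>_def \<beta>_def
  using local_sectionD[OF s _ V(1)] local_sectionD[OF i _ V(1)] by (auto simp: vec_at_def)
 have "open ((U Int V) Int \<beta> -` (- {0}))"
  by (rule continuous_open_preimage[OF holo2_on_continuous_on[OF h(2)]]) (use U V(3) in auto)
 moreover have "(U Int V) Int \<beta> -` (- {0}) = {q : U Int V. \<beta> q : - {0}}" by auto
 ultimately have "open {q : U Int V. \<beta> q : - {0}}" by simp
 thus ?thesis
 proof (rule that[of "{q : U Int V. \<beta> q : - {0}}" \<alpha> \<beta>])
  show "p : {q : U Int V. \<beta> q : - {0}}" using p V j by (simp add: \<beta>_def)
  show "holo2_on \<alpha> {q : U Int V. \<beta> q : - {0}}" "holo2_on \<beta> {q : U Int V. \<beta> q : - {0}}"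
   by (rule holo2_on_subset[OF h(1)] holo2_on_subset[OF h(2)], force)+
  show "ALL q:{q : U Int V. \<beta> q : - {0}}. ALL c. s q = c *s i q --> c = \<alpha> q / \<beta> q"
   by (auto simp add: \<alpha>_def matrix_scale_vec simp flip: \<beta>_def)
 qed auto
qed

lemma holo2_at_ratio:
 fixes i s :: "C2 => complex ^ 2"
 assumes E: "holo_bundle b r E" and s: "local_section E U s" and i: "local_section E U i"
  and U: "open U" "U <= C2_star" and p: "p : U" and eq: "!!q. q : U ==> i q ~= 0 & s q = f q *s i q"
 shows "holo2_at f p"
proof -
 have ip: "i p ~= 0" using eq p by blast
 obtain W \<alpha> \<beta> where W: "open W" "p : W" "W <= U" "holo2_on \<alpha> W" "holo2_on \<beta> W" "ALL q:W. \<beta> q ~= 0"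
  "ALL q:W. ALL c. s q = c *s i q --> c = \<alpha> q / \<beta> q"
  by (rule ratio_local[OF E s i U p ip])
 show ?thesis
 proof (rule holo2_at_transform[OF holo2_at_divide W(1,2)])
  show "holo2_at \<alpha> p" "holo2_at \<beta> p" using W(2,4,5) unfolding holo2_on_iff by blast+
  show "\<alpha> q / \<beta> q = f q" if "q : W" for q using W(7) eq[of q] W(3) that by (metis subsetD)
 qed (use W in auto)
qed

lemma holomorphic_on_axis_ratio:
 fixes i s :: "C2 => complex ^ 2"
 assumes E: "holo_bundle b r E" and s: "local_section E C2_star s" and i: "local_section E C2_star i"
  and eq: "!!x. x ~= 0 ==> i (x, 0) ~= 0 & s (x, 0) = v x *s i (x, 0)"
 shows "v holomorphic_on - {0}"
proof -
 have "v field_differentiable at x" if x: "x ~= 0" for x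
 proof -
  have p: "(x, 0) : C2_star" "i (x, 0) ~= 0" using x eq by (auto simp: C2_star_def)
  obtain W \<alpha> \<beta> where W: "open W" "(x, 0) : W" "W <= C2_star" "holo2_on \<alpha> W" "holo2_on \<beta> W" "ALL q:W. \<beta> q ~= 0"
   "ALL q:W. ALL c. s q = c *s i q --> c = \<alpha> q / \<beta> q"
   by (rule ratio_local[OF E s i open_C2_star order_refl p])
  have O: "open ((%x. (x, 0)) -` W)" by (rule open_vimage[OF W(1)]) (intro continuous_intros)
  have "(%x. \<alpha> (x, 0) / \<beta> (x, 0)) holomorphic_on ((%x. (x, 0)) -` W)"
   by (rule holomorphic_on_divide; (rule holo2_on_slice_fst[OF W(4)] holo2_on_slice_fst[OF W(5)])?; use W(6) in simp)
  moreover have "\<alpha> (z, 0) / \<beta> (z, 0) = v z" if "z : (%x. (x, 0)) -` W" for z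
  proof -
   have "z ~= 0" using that W(3) by (auto simp: C2_star_def)
   thus ?thesis using W(7) eq[of z] that by (metis vimageD)
  qed
  ultimately have "v holomorphic_on ((%x. (x, 0)) -` W)" by (rule holomorphic_transform)
  thus ?thesis by (rule holomorphic_on_imp_differentiable_at[OF _ O]) (use W in simp)
 qed
 thus ?thesis by (auto simp: holomorphic_on_def intro: field_differentiable_at_within)
qed

text \<open>In rank two exactness is a dimension count: a nonzero column killed by a nonzero row
  spans the kernel of that row.\<close>

lemma extension_iff:
 "extension b r \<sigma> E \<tau> \<iota> \<rho> \<longleftrightarrow> \<sigma> ~= 0 & \<tau> ~= 0 & bundle_hom b r (L \<sigma>) E \<iota> & bundle_hom b r E (L \<tau>) \<rho> &
  (ALL p:C2_star. column 1 (\<iota> p) ~= 0 & \<rho> p ~= 0 & \<rho> p *v column 1 (\<iota> p) = 0)"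
proof -
 have "inj ((*v) u) & surj ((*v) \<eta>) & range ((*v) u) = {v. \<eta> *v v = 0} \<longleftrightarrow>
   column 1 u ~= 0 & \<eta> ~= 0 & \<eta> *v column 1 u = 0" for u :: "complex ^ 1 ^ 2" and \<eta> :: "complex ^ 2 ^ 1"
 proof
  assume *: "inj ((*v) u) & surj ((*v) \<eta>) & range ((*v) u) = {v. \<eta> *v v = 0}"
  have "u *v (vec 1) = u *v 0" if "column 1 u = 0" using that by (simp add: mult_vec_1)
  hence 1: "column 1 u ~= 0" using * injD[of "(*v) u" "vec 1" 0] by (auto simp: vec_eq_iff)
  have "\<eta> ~= 0"
  proof
   assume "\<eta> = 0"
   moreover obtain v where "\<eta> *v v = vec 1" using * unfolding surj_def by metis
   ultimately show False by (simp add: vec_eq_iff matrix_vector_mult_def)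
  qed
  moreover have "u *v (vec 1) : {v. \<eta> *v v = 0}" using * by blast
  ultimately show "column 1 u ~= 0 & \<eta> ~= 0 & \<eta> *v column 1 u = 0" using 1 by (simp add: mult_vec_1)
 next
  assume *: "column 1 u ~= 0 & \<eta> ~= 0 & \<eta> *v column 1 u = 0"
  have "inj ((*v) u)"
   using * by (auto simp: inj_def mult_vec_1 vec_eq_iff forall_1)
  moreover have "surj ((*v) \<eta>)"
  proof -
   obtain j where j: "\<eta> $ 1 $ j ~= 0" using * by (auto simp: vec_eq_iff forall_1)
   have "\<eta> *v ((w $ 1 / \<eta> $ 1 $ j) *s axis j 1) = w" for w
    using j exhaust_2[of j] by (auto simp: vec_eq_iff forall_1 mult_vec_2 axis_def)
   thus ?thesis unfolding surj_def by metis
  qed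
  moreover have "range ((*v) u) = {v. \<eta> *v v = 0}"
  proof (intro set_eqI iffI)
   fix v assume "v : {v. \<eta> *v v = 0}"
   then obtain c where "v = c *s column 1 u" using kernel_2[of \<eta> "column 1 u" v] * by blast
   hence "v = u *v vec c" by (simp add: mult_vec_1)
   thus "v : range ((*v) u)" by blast
  next
   fix v assume "v : range ((*v) u)"
   thus "v : {v. \<eta> *v v = 0}" using * by (auto simp: mult_vec_1 matrix_scale_vec)
  qed
  ultimately show "inj ((*v) u) & surj ((*v) \<eta>) & range ((*v) u) = {v. \<eta> *v v = 0}" by blast
 qed
 thus ?thesis unfolding extension_def by simp
qed

end

context hopf
begin

lemma F_axis: "F (x, 0) = (b ^ r * x, 0)"
 using r by (simp add: F_eq power_0_left)

lemma fst_F: "fst (F p) = b ^ r * (fst p + snd p ^ r / b ^ r)"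
 by (cases p) (simp add: F_eq field_simps)

lemma powi_b_inject: "b powi m = b powi n ==> m = n"
proof (rule ccontr)
 assume eq: "b powi m = b powi n" and "m ~= n"
 have c: "cmod b powi m = cmod b powi n" using eq by (simp flip: norm_power_int)
 show False
  using power_int_strict_decreasing[of m n "cmod b"] power_int_strict_decreasing[of n m "cmod b"] b c \<open>m ~= n\<close>
  by (cases "m < n") auto
qed

text \<open>For a < r every exponent of y is positive; for a = r the term with i = k - 1 would be
  free of y.\<close>

lemma cocycle_axis: "a < r ==> cocycle k a (x, 0) = 0"
proof -
 assume a: "a < r"
 have *: "a < r * (k - i)" if "i < k" for i
 proof -
  have "r * 1 <= r * (k - i)" using that by (intro mult_le_mono) auto
  thus ?thesis using a by linarith
 qed
 hence "snd (x, 0 :: complex) ^ (r * (k - i) - a) = 0" if "i < k" for i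
  using *[OF that] by (simp add: power_0_left)
 thus ?thesis unfolding cocycle_def by (intro sum.neutral) simp
qed

lemma local_section_subset: "local_section E U s ==> V <= U ==> local_section E V s"
 unfolding local_section_iff by blast

lemma esec_scale: "esec E \<sigma> s ==> esec E \<sigma> (%p. c *s s p)"
 unfolding esec_def using local_section_scale[of E C2_star s "%_. c"]
 by (simp add: matrix_scale_vec vector_smult_assoc mult.commute)

end

section \<open>Sections of a bundle given as an extension\<close>

locale hopf_extension = hopf +
 fixes E :: "2 hopf_bundle" and \<sigma> \<tau> :: complex
  and \<iota> :: "C2 => complex ^ 1 ^ 2" and \<rho> :: "C2 => complex ^ 2 ^ 1"
 assumes E: "holo_bundle b r E" and extension: "extension b r \<sigma> E \<tau> \<iota> \<rho>"
begin

abbreviation "A \<equiv> factor E"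
abbreviation "i p \<equiv> column 1 (\<iota> p)"
abbreviation "R p v \<equiv> (\<rho> p *v v) $ 1"

lemma \<sigma>0: "\<sigma> ~= 0" and \<tau>0: "\<tau> ~= 0" and esec_i: "esec E \<sigma> i" and hom_\<rho>: "bundle_hom b r E (L \<tau>) \<rho>"
 using extension unfolding extension_iff bundle_hom_L_iff by auto

lemma i0: "p : C2_star ==> i p ~= 0" and \<rho>0: "p : C2_star ==> \<rho> p ~= 0" and R_i: "p : C2_star ==> R p (i p) = 0"
 using extension unfolding extension_iff by auto

lemma i_local: "local_section E C2_star i" and i_F: "p : C2_star ==> A p *v i p = \<sigma> *s i (F p)"
 using esec_i unfolding esec_def by auto

lemma R_add: "R p (u + v) = R p u + R p v" and R_diff: "R p (u - v) = R p u - R p v" and R_scale: "R p (c *s v) = c * R p v"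
 by (simp_all add: matrix_vector_right_distrib matrix_scale_vec matrix_vector_mult_diff_distrib)

lemma R_ker:
 assumes "p : C2_star" "R p v = 0"
 obtains c where "v = c *s i p"
proof (rule kernel_2[OF \<rho>0[OF assms(1)] i0[OF assms(1)]])
 show "\<rho> p *v i p = 0" "\<rho> p *v v = 0"
  using R_i[OF assms(1)] assms(2) by (simp_all add: vec_eq_iff forall_1)
qed (rule that)

lemma R_surj:
 assumes "p : C2_star" obtains v where "R p v = 1"
proof -
 obtain v where v: "R p v ~= 0"
 proof -
  obtain j where "\<rho> p $ 1 $ j ~= 0" using \<rho>0[OF assms] by (auto simp: vec_eq_iff forall_1)
  thus ?thesis using exhaust_2[of j] by (intro that[of "axis j 1"]) (auto simp: mult_vec_2 axis_def)
 qed
 show ?thesis by (rule that[of "(1 / R p v) *s v"]) (use v in \<open>simp add: R_scale\<close>)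
qed

lemma R_F: "p : C2_star ==> R (F p) (A p *v v) = \<tau> * R p v"
 using bundle_homD(1)[OF hom_\<rho>, of p] by (simp add: matrix_vector_mul_assoc mat_mult_mult_vec)

lemma R_holo:
 assumes "local_section E U s" "U <= C2_star" "p : U"
 shows "holo2_at (%q. R q (s q)) p"
proof -
 have "local_section (L \<tau>) U (%q. \<rho> q *v s q)" by (rule local_section_hom[OF hom_\<rho> E assms(1,2)])
 thus ?thesis using assms by (simp add: local_section_trivial vec_at_def)
qed

text \<open>On y = 0 the values lie on the line of \<open>i\<close>. The ratio is holomorphic on the
  punctured line and an eigenfunction of x -> b^r x, so it is 0 or a monomial; in the latter case it
  has no zeros.\<close>

lemma axis_eigen:
 assumes s: "local_section E C2_star s" and \<mu>: "\<mu> ~= 0"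
  and R: "!!x. x ~= 0 ==> R (x, 0) (s (x, 0)) = 0"
  and eq: "!!x. x ~= 0 ==> A (x, 0) *v s (x, 0) = \<mu> *s s (F (x, 0))"
 shows "(ALL x. x ~= 0 --> s (x, 0) = 0) \<or>
  (EX m c. c ~= 0 & \<sigma> = b powi (int r * m) * \<mu> & (ALL x. x ~= 0 --> s (x, 0) = (c * x powi m) *s i (x, 0)))"
proof -
 have C: "(x, 0) : C2_star" if "x ~= 0" for x :: complex using that by (simp add: C2_star_def)
 have "EX v. ALL x. x ~= 0 --> s (x, 0) = v x *s i (x, 0)"
  by (rule choice) (metis R_ker[OF C R])
 then obtain v where v: "!!x. x ~= 0 ==> s (x, 0) = v x *s i (x, 0)" by blast
 have hol: "v holomorphic_on - {0}"
  by (rule holomorphic_on_axis_ratio[OF E s i_local]) (use v i0[OF C] in blast)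
 have "v (b ^ r * x) = \<sigma> / \<mu> * v x" if x: "x ~= 0" for x
 proof -
  have bx: "b ^ r * x ~= 0" using x by simp
  have "(\<mu> * v (b ^ r * x)) *s i (b ^ r * x, 0) = \<mu> *s s (F (x, 0))"
   by (simp add: F_axis v[OF bx] vector_smult_assoc)
  also have "\<dots> = v x *s (A (x, 0) *v i (x, 0))"
   using eq[OF x] v[OF x] by (simp add: matrix_scale_vec)
  also have "\<dots> = (v x * \<sigma>) *s i (b ^ r * x, 0)"
   by (simp add: i_F[OF C[OF x]] F_axis vector_smult_assoc)
  finally have "\<mu> * v (b ^ r * x) = v x * \<sigma>"
   using i0[OF C[OF bx]] unfolding vector_mul_rcancel by blast
  thus ?thesis using \<mu> by (simp add: field_simps)
 qed
 hence "(ALL x. x ~= 0 --> v x = 0) \<or> (EX m c. \<sigma> / \<mu> = (b ^ r) powi m & (ALL x. x ~= 0 --> v x = c * x powi m))"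
  by (intro punctured_eigenfunction[OF br hol])
 thus ?thesis
 proof (elim disjE exE conjE)
  assume "ALL x. x ~= 0 --> v x = 0"
  thus ?thesis using v by simp
 next
  fix m c assume *: "\<sigma> / \<mu> = (b ^ r) powi m" "ALL x. x ~= 0 --> v x = c * x powi m"
  have "b powi (int r * m) = (b ^ r) powi m" by (simp only: power_int_mult power_int_of_nat)
  hence "\<sigma> = b powi (int r * m) * \<mu>" using *(1) \<mu> by (simp add: field_simps)
  thus ?thesis using * v by (cases "c = 0") auto
 qed
qed

text \<open>If R(\<zeta>) = 0, then \<zeta> is a multiple of y^n i. Otherwise R(\<zeta>) is a
  nonzero multiple of y^n, so zeros occur only on y = 0, where \<zeta> vanishes identically or, for
  n > 0, is a monomial multiple of \<open>i\<close> without zeros. In the first case y divides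
  \<zeta>, which lowers n.\<close>

lemma saturation:
 assumes \<zeta>: "esec E \<mu> \<zeta>" "\<mu> ~= 0" and nz: "EX p:C2_star. \<zeta> p ~= 0"
 shows "EX n \<zeta>'. esec E (\<mu> * b ^ n) \<zeta>' & (ALL p:C2_star. \<zeta>' p ~= 0 & \<zeta> p = snd p ^ n *s \<zeta>' p)"
proof -
 have loc: "local_section E C2_star \<zeta>" and \<zeta>F: "!!p. p : C2_star ==> A p *v \<zeta> p = \<mu> *s \<zeta> (F p)"
  using \<zeta> unfolding esec_def by auto
 have ratio: "\<mu> * R (F p) (\<zeta> (F p)) = \<tau> * R p (\<zeta> p)" if "p : C2_star" for p
  using R_F[OF that, of "\<zeta> p"] by (simp add: \<zeta>F[OF that] R_scale)
 have "(ALL p:C2_star. R p (\<zeta> p) = 0) \<or>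
   (EX n c. c ~= 0 & \<tau> = \<mu> * b ^ n & (ALL p:C2_star. R p (\<zeta> p) = c * snd p ^ n))"
  by (rule section_ratio[OF R_holo[OF loc order_refl] \<zeta>(2) ratio])
 thus ?thesis
 proof
  assume "ALL p:C2_star. R p (\<zeta> p) = 0"
  hence "ALL p:C2_star. EX c. \<zeta> p = c *s i p" using R_ker by metis
  then obtain g where g: "!!p. p : C2_star ==> \<zeta> p = g p *s i p" by metis
  have hol: "holo2_at g p" if "p : C2_star" for p
   by (rule holo2_at_ratio[OF E loc i_local open_C2_star order_refl that]) (use i0 g in blast)
  have "\<mu> * g (F p) = \<sigma> * g p" if p: "p : C2_star" for p
  proof -
   have Fp: "F p : C2_star" using p by simp
   have "(\<mu> * g (F p)) *s i (F p) = A p *v \<zeta> p" by (simp add: \<zeta>F[OF p] g[OF Fp] vector_smult_assoc)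
   also have "\<dots> = (\<sigma> * g p) *s i (F p)"
    by (simp add: g[OF p] matrix_scale_vec i_F[OF p] vector_smult_assoc mult.commute)
   finally show ?thesis using i0[OF Fp] unfolding vector_mul_rcancel by blast
  qed
  from section_ratio[OF hol \<zeta>(2) this] nz g obtain n c where nc: "c ~= 0" "\<sigma> = \<mu> * b ^ n" "ALL p:C2_star. g p = c * snd p ^ n"
   by (metis vector_smult_lzero)
  show ?thesis
  proof (intro exI conjI ballI)
   show "esec E (\<mu> * b ^ n) (%p. c *s i p)" using esec_scale[OF esec_i] nc(2) by simp
   show "c *s i p ~= 0" if "p : C2_star" for p using i0[OF that] nc(1) by simp
   show "\<zeta> p = snd p ^ n *s (c *s i p)" if "p : C2_star" for p
    using g[OF that] nc(3) that by (simp add: vector_smult_assoc mult.commute)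
  qed
 next
  assume "EX n c. c ~= 0 & \<tau> = \<mu> * b ^ n & (ALL p:C2_star. R p (\<zeta> p) = c * snd p ^ n)"
  then obtain n c where c: "c ~= 0" and R\<zeta>: "ALL p:C2_star. R p (\<zeta> p) = c * snd p ^ n" by blast
  show ?thesis using \<zeta> R\<zeta>
  proof (induction n arbitrary: \<zeta> \<mu>)
   case 0
   show ?case
   proof (intro exI conjI ballI)
    show "esec E (\<mu> * b ^ 0) \<zeta>" using 0 by simp
    show "\<zeta> p ~= 0" if "p : C2_star" for p using 0(3) c that by force
    show "\<zeta> p = snd p ^ 0 *s \<zeta> p" for p by simp
   qed
  next
   case (Suc n)
   have loc: "local_section E C2_star \<zeta>" and \<zeta>F: "!!p. p : C2_star ==> A p *v \<zeta> p = \<mu> *s \<zeta> (F p)"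
    using Suc.prems(1) unfolding esec_def by auto
   have C: "(x, 0) : C2_star" if "x ~= 0" for x :: complex using that by (simp add: C2_star_def)
   show ?case
   proof (cases "ALL x. x ~= 0 --> \<zeta> (x, 0) = 0")
    case True
    then obtain \<zeta>1 where \<zeta>1: "esec E (\<mu> * b) \<zeta>1" "!!p. p : C2_star ==> \<zeta> p = snd p *s \<zeta>1 p"
     using esec_divide[OF E Suc.prems(1)] by blast
    have loc1: "local_section E C2_star \<zeta>1" using \<zeta>1(1) unfolding esec_def by blast
    have R1: "R p (\<zeta>1 p) = c * snd p ^ n" if "p : C2_star" "snd p ~= 0" for p
    proof -
     have "snd p * R p (\<zeta>1 p) = R p (\<zeta> p)" by (simp add: \<zeta>1(2)[OF that(1)] R_scale)
     hence "snd p * R p (\<zeta>1 p) = snd p * (c * snd p ^ n)" using Suc.prems(3) that(1) by (simp add: mult_ac)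
     thus ?thesis using that(2) by simp
    qed
    have cont: "isCont (%q. R q (\<zeta>1 q)) p" if "p : C2_star" for p
     by (rule holo2_at_continuous[OF R_holo[OF loc1 order_refl that]])
    have "R p (\<zeta>1 p) = c * snd p ^ n" if p: "p : C2_star" for p
    proof (cases "snd p = 0")
     case True
     then obtain x where px: "p = (x, 0)" by (cases p) auto
     have "R (x, 0) (\<zeta>1 (x, 0)) = c * snd (x, 0 :: complex) ^ n"
      by (rule eq_on_axis[where f = "%q. R q (\<zeta>1 q)" and g = "%q. c * snd q ^ n" and U = C2_star])
       (use cont p px R1 open_C2_star in \<open>auto intro!: continuous_intros\<close>)
     thus ?thesis by (simp add: px)
    qed (use R1 p in auto)
    then obtain m \<zeta>' where "esec E (\<mu> * b * b ^ m) \<zeta>'" "ALL p:C2_star. \<zeta>' p ~= 0 & \<zeta>1 p = snd p ^ m *s \<zeta>' p"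
     using Suc.IH[OF \<zeta>1(1)] Suc.prems(2) by auto
    thus ?thesis using \<zeta>1(2)
     by (intro exI[of _ "Suc m"] exI[of _ \<zeta>']) (auto simp: vector_smult_assoc mult.assoc)
   next
    case False
    have "\<zeta> p ~= 0" if p: "p : C2_star" for p
    proof (cases "snd p = 0")
     case True
     then obtain x where px: "p = (x, 0)" and x: "x ~= 0" using p by (cases p) (auto simp: C2_star_def)
     have "(ALL x. x ~= 0 --> \<zeta> (x, 0) = 0) \<or>
      (EX m c. c ~= 0 & \<sigma> = b powi (int r * m) * \<mu> & (ALL x. x ~= 0 --> \<zeta> (x, 0) = (c * x powi m) *s i (x, 0)))"
      by (rule axis_eigen[OF loc Suc.prems(2)]) (use Suc.prems(3) C \<zeta>F in auto)
     thus ?thesis using False px x i0[OF p] by auto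
    next
     case False
     thus ?thesis using Suc.prems(3) c p by force
    qed
    thus ?thesis using Suc.prems(1) by (intro exI[of _ 0] exI[of _ \<zeta>]) auto
   qed
  qed
 qed
qed

text \<open>On y = 0 the section is c x^k i. Subtracting this and dividing by y^a, which R(\<zeta>)
  = y^a permits, leaves a section complementary to i; it inherits the defect of x^k divided by y^a,
  which is the cocycle. For k < 0 the monomial has a pole at x = 0, and no frame is claimed.\<close>

lemma jet:
 assumes \<zeta>: "esec E \<mu> \<zeta>" and \<mu>: "\<mu> ~= 0" and nz: "!!p. p : C2_star ==> \<zeta> p ~= 0"
  and R\<zeta>: "!!p. p : C2_star ==> R p (\<zeta> p) = snd p ^ a" and a: "1 <= a" "a <= r"
 obtains k c where "\<sigma> = b powi (int r * k) * \<mu>" "c ~= 0"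
  "k >= 0 ==> EX e. local_section E C2_star e & (ALL p:C2_star. \<zeta> p = (c * fst p ^ nat k) *s i p + snd p ^ a *s e p &
   R p (e p) = 1 & A p *v e p = (\<mu> * b ^ a) *s e (F p) + (\<sigma> * c * cocycle (nat k) a p) *s i (F p))"
proof -
 have C: "(x, 0) : C2_star" if "x ~= 0" for x :: complex using that by (simp add: C2_star_def)
 have loc: "local_section E C2_star \<zeta>" and \<zeta>F: "!!p. p : C2_star ==> A p *v \<zeta> p = \<mu> *s \<zeta> (F p)"
  using \<zeta> unfolding esec_def by auto
 have "(ALL x. x ~= 0 --> \<zeta> (x, 0) = 0) \<or>
   (EX m c. c ~= 0 & \<sigma> = b powi (int r * m) * \<mu> & (ALL x. x ~= 0 --> \<zeta> (x, 0) = (c * x powi m) *s i (x, 0)))"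
  by (rule axis_eigen[OF loc \<mu>]) (use R\<zeta> C \<zeta>F a in auto)
 then obtain k c where k: "c ~= 0" "\<sigma> = b powi (int r * k) * \<mu>" "!!x. x ~= 0 ==> \<zeta> (x, 0) = (c * x powi k) *s i (x, 0)"
  using nz[OF C, of 1] by auto
 have "EX e. local_section E C2_star e & (ALL p:C2_star. \<zeta> p = (c * fst p ^ nat k) *s i p + snd p ^ a *s e p &
   R p (e p) = 1 & A p *v e p = (\<mu> * b ^ a) *s e (F p) + (\<sigma> * c * cocycle (nat k) a p) *s i (F p))" if "k >= 0"
 proof -
  define n where "n = nat k"
  have kn: "k = int n" using that by (simp add: n_def)
  have \<sigma>: "\<sigma> = (b ^ r) ^ n * \<mu>" unfolding k(2) kn of_nat_mult[symmetric] power_int_of_nat by (simp add: power_mult)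
  \<comment> \<open>\<open>P j s\<close> says that \<zeta> agrees with c x^n i up to order j in y,
    with remainder s.\<close>
  define P where "P j s \<longleftrightarrow> local_section E C2_star s & (ALL p:C2_star. \<zeta> p = (c * fst p ^ n) *s i p + snd p ^ j *s s p)" for j s
  have PR: "R p (s p) = snd p ^ (a - j)" if P: "P j s" and j: "j <= a" and p: "p : C2_star" for j s p
  proof -
   have off: "R q (s q) = snd q ^ (a - j)" if q: "q : C2_star" "snd q ~= 0" for q
   proof -
    have "snd q ^ a = snd q ^ j * R q (s q)"
     using P R\<zeta>[OF q(1)] q(1) R_i[OF q(1)] unfolding P_def by (metis R_add R_scale add_0 mult_zero_right)
    thus ?thesis using q(2) j by (simp add: power_diff)
   qed
   show ?thesis
   proof (cases "snd p = 0")
    case True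
    then obtain x where px: "p = (x, 0)" by (cases p) auto
    have cont: "isCont (%q. R q (s q)) (x, 0)"
     by (rule holo2_at_continuous[OF R_holo[of C2_star]]) (use P p px in \<open>auto simp: P_def\<close>)
    have "R (x, 0) (s (x, 0)) = snd (x, 0 :: complex) ^ (a - j)"
     by (rule eq_on_axis[where f = "%q. R q (s q)" and g = "%q. snd q ^ (a - j)" and U = C2_star])
      (use cont p px off open_C2_star in \<open>auto intro!: continuous_intros\<close>)
    thus ?thesis by (simp add: px)
   qed (use off p in auto)
  qed
  have PF: "A p *v s p = (\<mu> * b ^ j) *s s (F p) + (\<sigma> * c * cocycle n j p) *s i (F p)"
   if P: "P j s" and j: "j <= r" and p: "p : C2_star" for j s p
  proof -
   have s: "local_section E C2_star s" and \<zeta>s: "!!p. p : C2_star ==> \<zeta> p = (c * fst p ^ n) *s i p + snd p ^ j *s s p"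
    using P by (auto simp: P_def)
   define t where "t q = (\<mu> * b ^ j) *s s q + (\<sigma> * c * cocycle n j (F_inv q)) *s i q" for q
   have t: "local_section E C2_star t"
    unfolding t_def
    by (rule local_section_add[OF local_section_scale[OF s] local_section_scale[OF i_local]])
     (rule holo2_at_const holo2_at_mult[OF holo2_at_const holo2_at_F_inv[OF holo2_at_cocycle]])+
   have "A q *v s q = t (F q)" if q: "q : C2_star" "snd q ~= 0" for q
   proof -
    have Fq: "F q : C2_star" using q by simp
    have "snd q ^ j *s (A q *v s q) = A q *v (\<zeta> q - (c * fst q ^ n) *s i q)"
     using \<zeta>s[OF q(1)] by (simp add: matrix_scale_vec)
    also have "\<dots> = \<mu> *s \<zeta> (F q) - (c * fst q ^ n * \<sigma>) *s i (F q)"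
     by (simp add: matrix_vector_mult_diff_distrib \<zeta>F[OF q(1)] matrix_scale_vec i_F[OF q(1)] vector_smult_assoc)
    also have "\<dots> = (\<mu> * (b * snd q) ^ j) *s s (F q) + (c * (\<mu> * fst (F q) ^ n - \<sigma> * fst q ^ n)) *s i (F q)"
     by (simp add: \<zeta>s[OF Fq] vec_eq_iff algebra_simps)
    also have "\<mu> * fst (F q) ^ n - \<sigma> * fst q ^ n = \<sigma> * ((fst q + snd q ^ r / b ^ r) ^ n - fst q ^ n)"
     unfolding fst_F power_mult_distrib \<sigma> right_diff_distrib by (simp only: mult_ac)
    also have "\<dots> = \<sigma> * (snd q ^ j * cocycle n j q)" by (simp only: cocycle_eq[OF j])
    also have "(\<mu> * (b * snd q) ^ j) *s s (F q) + (c * (\<sigma> * (snd q ^ j * cocycle n j q))) *s i (F q) = snd q ^ j *s t (F q)"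
     by (simp add: t_def vec_eq_iff power_mult_distrib algebra_simps)
    finally show ?thesis using q(2) unfolding vector_mul_lcancel by simp
   qed
   from equivariant_on_axis[OF E s t this p] show ?thesis by (simp add: t_def)
  qed
  have "EX s. P j s" if "j <= a" for j
   using that
  proof (induction j)
   case 0
   have "local_section E C2_star (%p. \<zeta> p + (- c * fst p ^ n) *s i p)"
    by (rule local_section_add[OF loc local_section_scale[OF i_local]])
     (rule holo2_at_mult[OF holo2_at_const holo2_at_power[OF holo2_at_fst]])
   thus ?case
    by (intro exI[of _ "%p. \<zeta> p + (- c * fst p ^ n) *s i p"]) (simp add: P_def vec_eq_iff)
  next
   case (Suc j)
   then obtain s where P: "P j s" by auto
   have s: "local_section E C2_star s" and \<zeta>s: "!!p. p : C2_star ==> \<zeta> p = (c * fst p ^ n) *s i p + snd p ^ j *s s p"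
    using P by (auto simp: P_def)
   have j: "j < a" "j < r" "j <= r" "j <= a" using Suc.prems a by auto
   have "s (x, 0) = 0" if x: "x ~= 0" for x
   proof (cases "j = 0")
    case True
    thus ?thesis using \<zeta>s[OF C[OF x]] k(3)[OF x] by (simp add: kn)
   next
    case False
    have "(ALL x. x ~= 0 --> s (x, 0) = 0) \<or>
      (EX m c. c ~= 0 & \<sigma> = b powi (int r * m) * (\<mu> * b ^ j) & (ALL x. x ~= 0 --> s (x, 0) = (c * x powi m) *s i (x, 0)))"
    proof (rule axis_eigen[OF s])
     show "R (x, 0) (s (x, 0)) = 0" if "x ~= 0" for x using PR[OF P j(4) C[OF that]] j by simp
     show "A (x, 0) *v s (x, 0) = (\<mu> * b ^ j) *s s (F (x, 0))" if "x ~= 0" for x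
      using PF[OF P j(3) C[OF that]] cocycle_axis[OF j(2)] by simp
    qed (use \<mu> in auto)
    \<comment> \<open>A nonzero intermediate remainder would have the multiplier \<mu> b^j on y = 0,
      so r would divide j, which 0 < j < r excludes. Here a <= r enters.\<close>
    moreover have "\<sigma> ~= b powi (int r * m) * (\<mu> * b ^ j)" for m
    proof
     assume "\<sigma> = b powi (int r * m) * (\<mu> * b ^ j)"
     hence "b powi (int r * k) = b powi (int r * m + int j)"
      using k(2) \<mu> by (simp add: power_int_add)
     hence "int r * k = int r * m + int j" by (rule powi_b_inject)
     hence "int j = int r * (k - m)" by (simp add: algebra_simps)
     hence "int r dvd int j" by simp
     hence "r dvd j" by simp
     thus False using False j(2) dvd_imp_le[of r j] by auto
    qed
    ultimately show ?thesis using x by blast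
   qed
   then obtain s' where s': "local_section E C2_star s'" "!!p. p : C2_star ==> s p = snd p *s s' p"
    using local_section_divide[OF E s] by blast
   thus ?case using \<zeta>s
    by (intro exI[of _ s']) (auto simp: P_def vector_smult_assoc mult.commute)
  qed
  then obtain e where e: "P a e" by blast
  show ?thesis
   unfolding n_def[symmetric]
   by (intro exI[of _ e]) (use e PR[OF e] PF[OF e a(2)] in \<open>auto simp: P_def\<close>)
 qed
 thus ?thesis using k that by blast
qed

lemma local_lift:
 assumes p: "p : C2_star"
 obtains W e where "open W" "p : W" "W <= C2_star" "local_section E W e" "ALL q:W. R q (e q) = 1"
proof -
 obtain V f where V: "(V, f) : frames E" "p : V" "open V" "V <= C2_star" "!!q. q : V ==> invertible (f q)"
  using frame_at[OF E p] by metis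
 have col: "local_section E V (%q. column j (f q))" for j
 proof (rule local_sectionI)
  fix q W k assume "q : V" "(W, k) : frames E" "q : W"
  from transition_at(1)[OF E V(1) this(2,1,3)]
  show "vec_at (%q. matrix_inv (k q) *v column j (f q)) q"
   unfolding mat_at_columns column_mult by blast
 qed
 have "EX j. R p (column j (f p)) ~= 0"
 proof (rule ccontr)
  assume "\<nexists>j. R p (column j (f p)) ~= 0"
  hence "column j (\<rho> p ** f p) = 0" for j by (simp add: column_mult vec_eq_iff forall_1)
  hence "\<rho> p ** f p = 0" by (simp add: column_def vec_eq_iff)
  hence "(\<rho> p ** f p) ** matrix_inv (f p) = 0" by simp
  moreover have "(\<rho> p ** f p) ** matrix_inv (f p) = \<rho> p"
   using matrix_inv_right[OF V(5)[OF V(2)]] by (simp flip: matrix_mul_assoc)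
  ultimately show False using \<rho>0[OF p] by simp
 qed
 then obtain j where j: "R p (column j (f p)) ~= 0" by blast
 let ?g = "%q. R q (column j (f q))"
 have hg: "holo2_at ?g q" if "q : V" for q by (rule R_holo[OF col V(4) that])
 define W where "W = V Int ?g -` (- {0})"
 have W: "open W" "p : W" "W <= C2_star"
 proof -
  have "continuous_on V ?g" by (rule holo2_on_continuous_on) (use hg in \<open>simp add: holo2_on_iff\<close>)
  thus "open W" unfolding W_def by (rule continuous_open_preimage) (use V in auto)
 qed (use V j in \<open>auto simp: W_def\<close>)
 have gW: "?g q ~= 0" "q : V" if "q : W" for q using that by (auto simp: W_def)
 have loc: "local_section E W (%q. (1 / ?g q) *s column j (f q))"
  by (rule local_section_scale[OF local_section_subset[OF col]])
   (use gW in \<open>auto intro: holo2_at_divide[OF holo2_at_const hg]\<close>)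
 show ?thesis
  by (rule that[OF W loc]) (use gW(1) in \<open>simp add: R_scale\<close>)
qed

lemma splitting:
 assumes \<tau>: "\<tau> = \<sigma> * b powi l" and l: "l <= int r"
  and res: "l >= 1 \<or> 1 <= k & 1 <= a & a <= r & l = int a - int (r * k)"
 obtains e c where "local_section E C2_star e" "l >= 1 ==> c = 0" "!!p. p : C2_star ==> R p (e p) = 1"
  "!!p. p : C2_star ==> A p *v e p = \<tau> *s e (F p) + (\<sigma> * c * cocycle k a p) *s i (F p)"
proof -
 have "EX v. R p v = 1" if "p : C2_star" for p by (rule R_surj[OF that]) blast
 then obtain L0 where L0: "!!p. p : C2_star ==> R p (L0 p) = 1" by metis
 have "EX c. A p *v L0 p = \<tau> *s L0 (F p) + (\<sigma> * c) *s i (F p)" if p: "p : C2_star" for p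
 proof -
  have Fp: "F p : C2_star" using p by simp
  have "R (F p) (A p *v L0 p - \<tau> *s L0 (F p)) = 0"
   unfolding R_diff R_scale R_F[OF p] L0[OF p] L0[OF Fp] by simp
  then obtain c where c: "A p *v L0 p - \<tau> *s L0 (F p) = c *s i (F p)" by (rule R_ker[OF Fp])
  show ?thesis by (rule exI[of _ "c / \<sigma>"]) (use c \<sigma>0 in \<open>simp add: algebra_simps\<close>)
 qed
 then obtain \<kappa> where \<kappa>: "!!p. p : C2_star ==> A p *v L0 p = \<tau> *s L0 (F p) + (\<sigma> * \<kappa> p) *s i (F p)" by metis
 \<comment> \<open>All local corrections are taken at once, so no cover has to be chosen.\<close>
 define D where "D = {(V, v). open V & V <= C2_star & local_section E V (%p. L0 p + v p *s i p)}"
 have diff: "holo2_at (%p. v p - w p) p"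
  if "open U" "U <= C2_star" "local_section E U (%p. L0 p + v p *s i p)" "local_section E U (%p. L0 p + w p *s i p)" "p : U"
  for U v w p
 proof (rule holo2_at_ratio[OF E _ local_section_subset[OF i_local that(2)] that(1,2,5)])
  show "local_section E U (%p. (L0 p + v p *s i p) + (- 1) *s (L0 p + w p *s i p))"
   by (rule local_section_add[OF that(3) local_section_scale[OF that(4) holo2_at_const]])
  show "i q ~= 0 & L0 q + v q *s i q + - 1 *s (L0 q + w q *s i q) = (v q - w q) *s i q" if "q : U" for q
   using i0[of q] that \<open>U <= C2_star\<close> by (auto simp: vec_eq_iff algebra_simps)
 qed
 interpret cou: equivariant_cousin b r D "%p. - \<kappa> p" "b powi l"
 proof
  show "cousin_data D"
   unfolding cousin_data_def
  proof clarify
   fix V v assume Vv: "(V, v) : D"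
   have "fits D V v"
   proof (rule fits_atI)
    fix p W w assume p: "p : V" "(W, w) : D" "p : W"
    show "holo2_at (%p. v p - w p) p"
     by (rule diff[of "V Int W"]) (use p Vv in \<open>auto simp: D_def intro: local_section_subset\<close>)
   qed
   thus "open V & fits D V v" using Vv by (simp add: D_def)
  qed
  show "\<Union> (fst ` D) = C2_star"
  proof
   show "\<Union> (fst ` D) <= C2_star" by (auto simp: D_def)
   show "C2_star <= \<Union> (fst ` D)"
   proof
    fix p assume p: "p : C2_star"
    obtain W e where W: "open W" "p : W" "W <= C2_star" and loc: "local_section E W e" and Re: "ALL q:W. R q (e q) = 1"
     by (rule local_lift[OF p])
    have "EX v. e q = L0 q + v *s i q" if q: "q : W" for q
    proof -
     have qC: "q : C2_star" using q W by auto
     have "R q (e q - L0 q) = 0" using Re q unfolding R_diff L0[OF qC] by simp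
     then obtain c where "e q - L0 q = c *s i q" by (rule R_ker[OF qC])
     thus ?thesis by (intro exI[of _ c]) (simp add: algebra_simps)
    qed
    then obtain v where v: "!!q. q : W ==> e q = L0 q + v q *s i q" by metis
    have "local_section E W (%q. L0 q + v q *s i q)" by (rule local_section_cong[OF loc W(1) v])
    hence "(W, v) : D" using W by (simp add: D_def)
    thus "p : \<Union> (fst ` D)" using W(2) by force
   qed
  qed
  show "fits D {p. F p : V} (%p. - \<kappa> p + b powi l * v (F p))" if Vv: "(V, v) : D" for V v
  proof (rule fits_atI)
   fix p W w assume p: "p : {p. F p : V}" "(W, w) : D" "p : W"
   have V: "open V" "V <= C2_star" "local_section E V (%p. L0 p + v p *s i p)"
    and W: "open W" "W <= C2_star" "local_section E W (%p. L0 p + w p *s i p)"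
    using Vv p(2) by (auto simp: D_def)
   have "local_section E {p. F p : V} (%p. \<tau> *s (matrix_inv (A p) *v (L0 (F p) + v (F p) *s i (F p))))"
    by (rule local_section_scale[OF pullback_section[OF E V(3,2)] holo2_at_const])
   moreover have "\<tau> *s (matrix_inv (A q) *v (L0 (F q) + v (F q) *s i (F q))) = L0 q + (- \<kappa> q + b powi l * v (F q)) *s i q"
    if "q : {p. F p : V}" for q
   proof -
    have q: "q : C2_star" using that V(2) by auto
    have "A q *v (L0 q + (- \<kappa> q + b powi l * v (F q)) *s i q) = \<tau> *s (L0 (F q) + v (F q) *s i (F q))"
     unfolding matrix_vector_right_distrib matrix_scale_vec \<kappa>[OF q] i_F[OF q]
     by (simp add: vec_eq_iff \<tau> algebra_simps)
    hence "matrix_inv (A q) *v (A q *v (L0 q + (- \<kappa> q + b powi l * v (F q)) *s i q)) =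
      \<tau> *s (matrix_inv (A q) *v (L0 (F q) + v (F q) *s i (F q)))"
     by (simp only: matrix_scale_vec)
    thus ?thesis unfolding matrix_inv_cancel(5)[OF factor_invertible[OF E q]] ..
   qed
   ultimately have "local_section E {p. F p : V} (%q. L0 q + (- \<kappa> q + b powi l * v (F q)) *s i q)"
    by (rule local_section_cong[OF _ open_F_vimage[OF V(1)]])
   from local_section_subset[OF this, of "{p. F p : V} Int W"]
   have 1: "local_section E ({p. F p : V} Int W) (%q. L0 q + (- \<kappa> q + b powi l * v (F q)) *s i q)" by blast
   have 2: "local_section E ({p. F p : V} Int W) (%q. L0 q + w q *s i q)"
    by (rule local_section_subset[OF W(3)]) blast
   show "holo2_at (%q. - \<kappa> q + b powi l * v (F q) - w q) p"
    by (rule diff[OF _ _ 1 2]) (use open_F_vimage[OF V(1)] W p in auto)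
  qed
 qed simp
 obtain u c where u: "fits D C2_star u" "l >= 1 ==> c = 0"
  "!!p. p : C2_star ==> - \<kappa> p + b powi l * u (F p) - u p = c * cocycle k a p"
  using cou.global_splitting[OF refl l res] by blast
 show ?thesis
 proof (rule that[of "%p. L0 p + u p *s i p" "- c"])
  show "local_section E C2_star (%p. L0 p + u p *s i p)"
  proof (rule local_sectionI)
   fix p W f assume p: "p : C2_star" "(W, f) : frames E" "p : W"
   obtain V v where Vv: "(V, v) : D" "p : V" using cou.in_cover[OF p(1)] by blast
   have V: "open V" "V <= C2_star" "local_section E V (%p. L0 p + v p *s i p)" using Vv(1) by (auto simp: D_def)
   have h: "holo2_at (%q. u q - v q) q" if "q : V" for q
    by (rule fits_atD[OF u(1) _ Vv(1) that]) (use that V in auto)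
   have "local_section E V (%p. (L0 p + v p *s i p) + (u p - v p) *s i p)"
    by (rule local_section_add[OF V(3) local_section_scale[OF local_section_subset[OF i_local V(2)] h]])
   hence "local_section E V (%p. L0 p + u p *s i p)"
    by (rule local_section_cong[OF _ V(1)]) (simp add: vec_eq_iff algebra_simps)
   from local_sectionD[OF this Vv(2) p(2,3)]
   show "vec_at (%q. matrix_inv (f q) *v (L0 q + u q *s i q)) p" .
  qed
  show "R p (L0 p + u p *s i p) = 1" if "p : C2_star" for p
   unfolding R_add R_scale L0[OF that] R_i[OF that] by simp
  show "A p *v (L0 p + u p *s i p) = \<tau> *s (L0 (F p) + u (F p) *s i (F p)) + (\<sigma> * - c * cocycle k a p) *s i (F p)"
   if p: "p : C2_star" for p
  proof -
   have "\<sigma> * - c * cocycle k a p = \<sigma> * (\<kappa> p + u p) - \<tau> * u (F p)"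
    using u(3)[OF p] by (simp add: \<tau> algebra_simps)
   thus ?thesis
    unfolding matrix_vector_right_distrib matrix_scale_vec \<kappa>[OF p] i_F[OF p]
    by (simp only:) (simp add: vec_eq_iff algebra_simps)
  qed
 qed (use u(2) in auto)
qed

end

section \<open>Model bundles and invariant sub-line bundles\<close>

definition row2 :: "complex => complex => complex ^ 2 ^ 1" where
 "row2 x y = vector [vector [x, y]]"

lemma row2_nth [simp]: "row2 x y $ 1 $ 1 = x" "row2 x y $ 1 $ 2 = y"
 by (simp_all add: row2_def)

lemma incl_nth [simp]: "incl x y $ 1 $ 1 = x" "incl x y $ 2 $ 1 = y"
 by (simp_all add: incl_def)

lemma column_incl [simp]: "column 1 (incl x y) $ 1 = x" "column 1 (incl x y) $ 2 = y"
 by (simp_all add: column_def)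

lemma trace_2: "trace (A :: complex ^ 2 ^ 2) = A $ 1 $ 1 + A $ 2 $ 2"
 by (simp add: trace_def sum_2)

lemma mult_12: "((u :: complex ^ 1 ^ 'm) ** \<eta>) $ i $ j = u $ i $ 1 * \<eta> $ 1 $ j"
 by (simp add: matrix_matrix_mult_def)

lemma trace_product: "trace ((u :: complex ^ 1 ^ 2) ** \<eta>) = (\<eta> *v column 1 u) $ 1"
 by (simp add: trace_2 mult_12 mult_vec_2 column_def mult.commute)

lemma product_mult_vec: "((u :: complex ^ 1 ^ 2) ** \<eta>) *v v = (\<eta> *v v) $ 1 *s column 1 u"
 by (simp add: matrix_vector_mul_assoc[symmetric] mult_vec_1)

lemma mat_eqI_vec: "(!!v. A *v v = B *v v) ==> A = (B :: complex ^ 'n ^ 'm)"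
 using matrix_eq by blast

lemma trace_zero_neq_mat: "trace M = 0 ==> M ~= 0 ==> M ~= (mat c :: complex ^ 2 ^ 2)"
 by (auto simp: trace_2 vec_eq_iff forall_2)

text \<open>Cayley-Hamilton: for trace 0 the square of M is minus its determinant.\<close>

lemma trace_zero_mult:
 fixes M :: "complex ^ 2 ^ 2"
 assumes "trace M = 0"
 shows "M *v (M *v v) = ((M $ 1 $ 1)\<^sup>2 + M $ 1 $ 2 * M $ 2 $ 1) *s v"
proof -
 have "M $ 2 $ 2 = - (M $ 1 $ 1)" using assms by (simp add: trace_2 add_eq_0_iff)
 thus ?thesis by (simp add: vec_eq_iff forall_2 mult_vec_2 power2_eq_square algebra_simps)
qed

lemma trace_zero_square:
 fixes M :: "complex ^ 2 ^ 2"
 assumes "trace M = 0" "u ~= 0" "M *v u = c *s u"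
 shows "M *v (M *v v) = c\<^sup>2 *s v"
proof -
 have "((M $ 1 $ 1)\<^sup>2 + M $ 1 $ 2 * M $ 2 $ 1) *s u = c\<^sup>2 *s u"
  using trace_zero_mult[OF assms(1), of u] by (simp add: assms(3) matrix_scale_vec vector_smult_assoc power2_eq_square)
 thus ?thesis using assms(2) trace_zero_mult[OF assms(1), of v] unfolding vector_mul_rcancel by simp
qed

lemma connected_C2_star: "connected C2_star"
proof -
 have "DIM(C2) = 4" by simp
 hence "connected (- {0 :: C2})" by (intro connected_punctured_universe) simp
 moreover have "C2_star = - {0}" by (auto simp: C2_star_def zero_prod_def)
 ultimately show ?thesis by simp
qed

section \<open>Degrees, normalization and transport along isomorphisms\<close>

context hopf
begin

lemma bundle_hom_trivial:
 assumes "frames E = {(C2_star, %_. mat 1)}" "frames E' = {(C2_star, %_. mat 1)}"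
 shows "bundle_hom b r E E' h \<longleftrightarrow> (ALL p:C2_star. mat_at h p & h (F p) ** factor E p = factor E' p ** h p)"
 unfolding bundle_hom_def assms mat_holo_on_iff by auto

lemma esec_TB: "esec (TB B) \<sigma> s \<longleftrightarrow> (ALL p:C2_star. vec_at s p & B p *v s p = \<sigma> *s s (F p))"
 unfolding esec_def by (auto simp: local_section_trivial)

lemma holo_bundle_TB:
 assumes "!!p. p : C2_star ==> mat_at B p" "!!p. p : C2_star ==> invertible (B p)"
 shows "holo_bundle b r (TB B)"
 using assms by (auto simp: holo_bundle_def mat_holo_on_iff invertible_def intro!: exI[of _ "mat 1"])

lemma esec_hom:
 assumes h: "bundle_hom b r E E' h" and E: "holo_bundle b r E" and s: "esec E \<sigma> s"
 shows "esec E' \<sigma> (%p. h p *v s p)"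
 unfolding esec_def
proof (intro conjI ballI)
 show "local_section E' C2_star (%p. h p *v s p)"
  by (rule local_section_hom[OF h E]) (use s in \<open>auto simp: esec_def\<close>)
 fix p assume p: "p : C2_star"
 have "factor E' p *v (h p *v s p) = h (F p) *v (factor E p *v s p)"
  using bundle_homD(1)[OF h p] by (simp add: matrix_vector_mul_assoc)
 thus "factor E' p *v (h p *v s p) = \<sigma> *s (h (F p) *v s (F p))"
  using s p by (simp add: esec_def matrix_scale_vec)
qed

lemma esec_cong:
 assumes s: "esec E \<sigma> s" and eq: "!!p. p : C2_star ==> s p = t p"
 shows "esec E \<sigma> t"
 unfolding esec_def
proof (intro conjI ballI)
 show "local_section E C2_star t"
  by (rule local_section_cong[OF _ open_C2_star eq]) (use s in \<open>simp_all add: esec_def\<close>)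
 show "factor E p *v t p = \<sigma> *s t (F p)" if "p : C2_star" for p
  using s that by (simp add: esec_def eq[symmetric])
qed

lemma deg_powi: "deg_L b (b powi n) = real_of_int n"
proof -
 have "ln (cmod b) ~= 0" using b by simp
 thus ?thesis
  using b by (cases n rule: int_cases2)
   (simp_all add: deg_L_def norm_power norm_inverse power_int_minus ln_realpow ln_inverse)
qed

lemma deg_power: "deg_L b (b ^ n) = real n"
 using deg_powi[of "int n"] by simp

lemma deg_mult: "x ~= 0 ==> y ~= 0 ==> deg_L b (x * y) = deg_L b x + deg_L b y"
 by (simp add: deg_L_def norm_mult ln_mult add_divide_distrib)

lemma deg_inverse: "x ~= 0 ==> deg_L b (inverse x) = - deg_L b x"
 by (simp add: deg_L_def norm_inverse ln_inverse)

lemma deg_one: "deg_L b 1 = 0"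
 by (simp add: deg_L_def)

text \<open>Sections of E twisted by L \<mu> are equivariant sections of E with multiplier 1/\<mu>,
  so the degree condition becomes an upper bound on the degrees of multipliers.\<close>

lemma normalized_iff:
 "normalized_extension b r E \<longleftrightarrow> holo_bundle b r E & (EX \<sigma> \<tau> \<iota> \<rho>. extension b r \<sigma> E \<tau> \<iota> \<rho>) &
  (EX s. esec E 1 s & (EX p:C2_star. s p ~= 0)) &
  (ALL \<sigma> s. \<sigma> ~= 0 & esec E \<sigma> s & (EX p:C2_star. s p ~= 0) --> deg_L b \<sigma> <= 0)"
proof -
 have 1: "global_section b r E s \<longleftrightarrow> esec E 1 s" for s
  unfolding global_section_def esec_def by auto
 have 2: "global_section b r (twist \<mu> E) s \<longleftrightarrow> esec E (inverse \<mu>) s" if "\<mu> ~= 0" for \<mu> s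
 proof -
  have "s (F p) = (mat \<mu> ** factor E p) *v s p \<longleftrightarrow> factor E p *v s p = inverse \<mu> *s s (F p)" for p
   unfolding mat_mult_mult_vec using that by (auto simp: vector_smult_assoc)
  thus ?thesis unfolding global_section_def esec_def by simp
 qed
 have "(ALL \<mu>. \<mu> ~= 0 & deg_L b \<mu> < 0 --> (ALL s. global_section b r (twist \<mu> E) s --> (ALL p:C2_star. s p = 0))) \<longleftrightarrow>
  (ALL \<sigma> s. \<sigma> ~= 0 & esec E \<sigma> s & (EX p:C2_star. s p ~= 0) --> deg_L b \<sigma> <= 0)" (is "?l = ?r")
 proof
  assume l: ?l
  show ?r
  proof (intro allI impI; elim conjE)
   fix \<sigma> s assume *: "\<sigma> ~= 0" "esec E \<sigma> s" "EX p:C2_star. s p ~= 0"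
   show "deg_L b \<sigma> <= 0"
   proof (rule ccontr)
    assume "~ deg_L b \<sigma> <= 0"
    hence "inverse \<sigma> ~= 0 & deg_L b (inverse \<sigma>) < 0" using *(1) by (simp add: deg_inverse)
    moreover have "global_section b r (twist (inverse \<sigma>) E) s" using * 2[of "inverse \<sigma>"] by simp
    ultimately show False using l *(3) by blast
   qed
  qed
 next
  assume rr: ?r
  show ?l
  proof (intro allI impI)
   fix \<mu> s assume *: "\<mu> ~= 0 & deg_L b \<mu> < 0" "global_section b r (twist \<mu> E) s"
   have "inverse \<mu> ~= 0" "esec E (inverse \<mu>) s" "~ deg_L b (inverse \<mu>) <= 0"
    using * 2 by (auto simp: deg_inverse)
   thus "ALL p:C2_star. s p = 0" using rr by blast
  qed
 qed
 thus ?thesis unfolding normalized_extension_def 1 by simp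
qed

lemma bundle_iso_hom: "bundle_iso b r E E' g ==> bundle_hom b r E E' g"
 and bundle_iso_invertible: "bundle_iso b r E E' g ==> p : C2_star ==> invertible (g p)"
 by (auto simp: bundle_iso_def)

lemma bundle_hom_twist:
 fixes E E' :: "2 hopf_bundle"
 assumes "bundle_hom b r E E' h"
 shows "bundle_hom b r (twist l E) (twist l E') h"
proof (rule bundle_homI)
 fix p assume p: "p : C2_star"
 have "h (F p) ** (mat l ** factor E p) = mat l ** (h (F p) ** factor E p)"
  by (simp add: matrix_mul_assoc mat_mult_commute[of l "h (F p)"])
 thus "h (F p) ** factor (twist l E) p = factor (twist l E') p ** h p"
  using bundle_homD(1)[OF assms p] by (simp add: matrix_mul_assoc)
qed (use bundle_homD(2)[OF assms] in simp)

lemma extension_iso: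
 fixes E E' :: "2 hopf_bundle"
 assumes ext: "extension b r \<sigma> E \<tau> \<iota> \<rho>" and g: "bundle_iso b r E E' g" and E: "holo_bundle b r E" and E': "holo_bundle b r E'"
 shows "extension b r \<sigma> E' \<tau> (%p. g p ** \<iota> p) (%p. \<rho> p ** matrix_inv (g p))"
proof -
 note g' = bundle_iso_inverse[OF g E E']
 have x: "\<sigma> ~= 0" "\<tau> ~= 0" "esec E \<sigma> (%p. column 1 (\<iota> p))" "bundle_hom b r E (L \<tau>) \<rho>"
  "!!p. p : C2_star ==> column 1 (\<iota> p) ~= 0 & \<rho> p ~= 0 & \<rho> p *v column 1 (\<iota> p) = 0"
  using ext unfolding extension_iff bundle_hom_L_iff by auto
 have "esec E' \<sigma> (%p. column 1 (g p ** \<iota> p))"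
  unfolding column_mult by (rule esec_hom[OF bundle_iso_hom[OF g] E x(3)])
 moreover have "bundle_hom b r E' (L \<tau>) (%p. \<rho> p ** matrix_inv (g p))"
  by (rule bundle_hom_comp[OF bundle_iso_hom[OF g'] x(4) E' E])
 moreover have "column 1 (g p ** \<iota> p) ~= 0 & \<rho> p ** matrix_inv (g p) ~= 0 & (\<rho> p ** matrix_inv (g p)) *v column 1 (g p ** \<iota> p) = 0"
  if p: "p : C2_star" for p
 proof (intro conjI)
  note i = bundle_iso_invertible[OF g p]
  show "column 1 (g p ** \<iota> p) ~= 0" unfolding column_mult invertible_mult_vec_eq_0[OF i] using x(5)[OF p] by blast
  have "(\<rho> p ** matrix_inv (g p)) ** g p = \<rho> p" using matrix_inv_left[OF i] by (simp flip: matrix_mul_assoc)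
  thus "\<rho> p ** matrix_inv (g p) ~= 0" using x(5)[OF p] by auto
  show "(\<rho> p ** matrix_inv (g p)) *v column 1 (g p ** \<iota> p) = 0"
   unfolding column_mult matrix_vector_mul_assoc[symmetric] matrix_inv_cancel(5)[OF i] using x(5)[OF p] by blast
 qed
 ultimately show ?thesis using x(1,2) unfolding extension_iff bundle_hom_L_iff by blast
qed

lemma nonsplit_iso:
 fixes E E' :: "2 hopf_bundle"
 assumes ext: "nonsplit_extension b r \<sigma> E \<tau> \<iota> \<rho>" and g: "bundle_iso b r E E' g" and E: "holo_bundle b r E" and E': "holo_bundle b r E'"
 shows "nonsplit_extension b r \<sigma> E' \<tau> (%p. g p ** \<iota> p) (%p. \<rho> p ** matrix_inv (g p))"
 unfolding nonsplit_extension_def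
proof (intro conjI notI)
 show "extension b r \<sigma> E' \<tau> (%p. g p ** \<iota> p) (%p. \<rho> p ** matrix_inv (g p))"
  by (rule extension_iso[OF _ g E E']) (use ext in \<open>simp add: nonsplit_extension_def\<close>)
 assume "EX s. bundle_hom b r (L \<tau>) E' s & (ALL p:C2_star. (\<rho> p ** matrix_inv (g p)) ** s p = mat 1)"
 then obtain s where s: "bundle_hom b r (L \<tau>) E' s" "ALL p:C2_star. (\<rho> p ** matrix_inv (g p)) ** s p = mat 1" by blast
 have "bundle_hom b r (L \<tau>) E (%p. matrix_inv (g p) ** s p)"
  unfolding bundle_hom_L_iff column_mult
  by (rule esec_hom[OF bundle_iso_hom[OF bundle_iso_inverse[OF g E E']] E']) (use s(1) in \<open>simp add: bundle_hom_L_iff\<close>)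
 moreover have "ALL p:C2_star. \<rho> p ** (matrix_inv (g p) ** s p) = mat 1" using s(2) by (simp add: matrix_mul_assoc)
 ultimately show False using ext unfolding nonsplit_extension_def by blast
qed

lemma std_sequences_iso:
 fixes E E' :: "2 hopf_bundle"
 assumes std: "std_sequences b r j m E \<iota>1 \<rho>1 \<iota>2 \<rho>2" and g: "bundle_iso b r E E' g" and E: "holo_bundle b r E" and E': "holo_bundle b r E'"
 shows "std_sequences b r j m E' (%p. g p ** \<iota>1 p) (%p. \<rho>1 p ** matrix_inv (g p)) (%p. g p ** \<iota>2 p) (%p. \<rho>2 p ** matrix_inv (g p))"
proof -
 have "trace ((g p ** u) ** (\<eta> ** matrix_inv (g p))) = trace (u ** \<eta>)" if "p : C2_star" for p and u :: "complex ^ 1 ^ 2" and \<eta>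
  unfolding trace_product column_mult matrix_vector_mul_assoc[symmetric] matrix_inv_cancel(5)[OF bundle_iso_invertible[OF g that]] ..
 thus ?thesis
  using std unfolding std_sequences_def by (elim conjE) (intro conjI ballI nonsplit_iso[OF _ g E E'], simp_all)
qed

lemma normalized_iso:
 fixes E E' :: "2 hopf_bundle"
 assumes n: "normalized_extension b r E" and g: "bundle_iso b r E E' g" and E': "holo_bundle b r E'"
 shows "normalized_extension b r E'"
proof -
 have E: "holo_bundle b r E" using n by (simp add: normalized_iff)
 note g' = bundle_iso_inverse[OF g E E']
 obtain s p where s: "esec E 1 s" "p : C2_star" "s p ~= 0" using n unfolding normalized_iff by blast
 have 1: "EX s. esec E' 1 s & (EX p:C2_star. s p ~= 0)"
  using esec_hom[OF bundle_iso_hom[OF g] E s(1)] s(2,3) invertible_mult_vec_eq_0[OF bundle_iso_invertible[OF g s(2)]] by blast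
 have 2: "deg_L b \<sigma> <= 0" if s: "\<sigma> ~= 0" "esec E' \<sigma> s" "p : C2_star" "s p ~= 0" for \<sigma> s p
 proof -
  have "matrix_inv (g p) *v s p ~= 0"
   using s(4) invertible_mult_vec_eq_0[OF bundle_iso_invertible[OF g' s(3)]] by blast
  thus ?thesis using n esec_hom[OF bundle_iso_hom[OF g'] E' s(2)] s(1,3) unfolding normalized_iff by blast
 qed
 have 3: "EX \<sigma> \<tau> \<iota> \<rho>. extension b r \<sigma> E' \<tau> \<iota> \<rho>" using n extension_iso[OF _ g E E'] unfolding normalized_iff by blast
 show ?thesis unfolding normalized_iff using 1 2 3 E' by blast
qed

lemma higgs_field_iso:
 fixes E E' :: "2 hopf_bundle"
 assumes \<Phi>: "higgs_field b r l E \<Phi>" and l: "l ~= 0" and g: "bundle_iso b r E E' g" and E: "holo_bundle b r E" and E': "holo_bundle b r E'"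
  and eq: "!!p. p : C2_star ==> \<phi> p ** g p = g p ** \<Phi> p"
 shows "higgs_field b r l E' \<phi>"
proof -
 have conj: "g p ** (\<Phi> p ** matrix_inv (g p)) = \<phi> p" if "p : C2_star" for p
  unfolding matrix_mul_assoc eq[OF that, symmetric] by (rule matrix_inv_cancel(3)[OF bundle_iso_invertible[OF g that]])
 have "bundle_hom b r E (twist l E) \<Phi>" using \<Phi> by (simp add: higgs_field_def)
 from bundle_hom_comp[OF bundle_iso_hom[OF bundle_iso_inverse[OF g E E']] this E' E]
 have "bundle_hom b r E' (twist l E) (%p. \<Phi> p ** matrix_inv (g p))" .
 from bundle_hom_comp[OF this bundle_hom_twist[OF bundle_iso_hom[OF g]] E' holo_bundle_twist[OF l E]]
 have "bundle_hom b r E' (twist l E') (%p. g p ** (\<Phi> p ** matrix_inv (g p)))" .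
 hence "bundle_hom b r E' (twist l E') \<phi>" by (rule bundle_hom_cong[OF _ E' conj])
 moreover have "trace (\<phi> p) = 0" if p: "p : C2_star" for p
 proof -
  have "trace (\<phi> p) = trace ((\<Phi> p ** matrix_inv (g p)) ** g p)" using conj[OF p] trace_mul_sym by metis
  also have "\<dots> = trace (\<Phi> p)" by (simp add: matrix_inv_cancel(4)[OF bundle_iso_invertible[OF g p]])
  finally show ?thesis using \<Phi> p by (simp add: higgs_field_def)
 qed
 ultimately show ?thesis by (simp add: higgs_field_def)
qed

lemma higgs_iso_sym:
 assumes "higgs_iso b r E \<phi> E' \<phi>'" "holo_bundle b r E" "holo_bundle b r E'"
 shows "higgs_iso b r E' \<phi>' E \<phi>"
proof -
 obtain g where g: "bundle_iso b r E E' g" "!!p. p : C2_star ==> g p ** \<phi> p = \<phi>' p ** g p"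
  using assms(1) unfolding higgs_iso_def by blast
 have "matrix_inv (g p) ** \<phi>' p = \<phi> p ** matrix_inv (g p)" if p: "p : C2_star" for p
 proof -
  note i = bundle_iso_invertible[OF g(1) p]
  have "matrix_inv (g p) ** \<phi>' p = matrix_inv (g p) ** ((\<phi>' p ** g p) ** matrix_inv (g p))"
   by (simp add: matrix_inv_cancel(3)[OF i])
  also have "\<dots> = matrix_inv (g p) ** (g p ** (\<phi> p ** matrix_inv (g p)))" by (simp add: g(2)[OF p, symmetric] matrix_mul_assoc)
  also have "\<dots> = \<phi> p ** matrix_inv (g p)" by (rule matrix_inv_cancel(1)[OF i])
  finally show ?thesis .
 qed
 thus ?thesis unfolding higgs_iso_def using bundle_iso_inverse[OF g(1) assms(2,3)] by blast
qed

lemma higgs_iso_trans: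
 fixes E E' E'' :: "2 hopf_bundle"
 assumes "higgs_iso b r E \<phi> E' \<phi>'" "higgs_iso b r E' \<phi>' E'' \<phi>''" "holo_bundle b r E" "holo_bundle b r E'"
 shows "higgs_iso b r E \<phi> E'' \<phi>''"
proof -
 obtain g h where g: "bundle_iso b r E E' g" "!!p. p : C2_star ==> g p ** \<phi> p = \<phi>' p ** g p"
  and h: "bundle_iso b r E' E'' h" "!!p. p : C2_star ==> h p ** \<phi>' p = \<phi>'' p ** h p"
  using assms(1,2) unfolding higgs_iso_def by blast
 have "bundle_iso b r E E'' (%p. h p ** g p)"
  using bundle_hom_comp[OF bundle_iso_hom[OF g(1)] bundle_iso_hom[OF h(1)] assms(3,4)]
   bundle_iso_invertible[OF g(1)] bundle_iso_invertible[OF h(1)] invertible_mult unfolding bundle_iso_def by blast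
 moreover have "h p ** g p ** \<phi> p = \<phi>'' p ** (h p ** g p)" if "p : C2_star" for p
  using g(2)[OF that] h(2)[OF that] by (metis matrix_mul_assoc)
 ultimately show ?thesis unfolding higgs_iso_def by blast
qed

lemma same_subE:
 assumes "same_sub b r \<mu> h \<mu>' h'"
 obtains c where "!!p. p : C2_star ==> holo2_at c p & c p ~= 0 & c (F p) * \<mu> = \<mu>' * c p & column 1 (h p) = c p *s column 1 (h' p)"
proof -
 obtain u where u: "bundle_iso b r (L \<mu>) (L \<mu>') u" "!!p. p : C2_star ==> h p = h' p ** u p"
  using assms unfolding same_sub_def by blast
 have *: "mat_at u p & u (F p) ** mat \<mu> = mat \<mu>' ** u p" if "p : C2_star" for p
  using bundle_iso_hom[OF u(1)] that by (simp add: bundle_hom_trivial)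
 show ?thesis
 proof (rule that[of "%p. u p $ 1 $ 1"], intro conjI)
  fix p assume p: "p : C2_star"
  show "holo2_at (%p. u p $ 1 $ 1) p" using *[OF p] by (simp add: mat_at_def)
  have "u p *v vec 1 ~= 0"
   using invertible_mult_vec_eq_0[OF bundle_iso_invertible[OF u(1) p]] by (simp add: vec_eq_iff)
  thus "u p $ 1 $ 1 ~= 0" by (auto simp: mult_vec_1 vec_eq_iff column_def forall_1)
  have "(u (F p) ** mat \<mu>) $ 1 $ 1 = (mat \<mu>' ** u p) $ 1 $ 1" using *[OF p] by simp
  thus "u (F p) $ 1 $ 1 * \<mu> = \<mu>' * u p $ 1 $ 1" by (simp add: mult.commute)
  show "column 1 (h p) = u p $ 1 $ 1 *s column 1 (h' p)" by (simp add: u(2)[OF p] column_mult_1)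
 qed
qed

text \<open>The ratio of two proportional nowhere vanishing sections is holomorphic without zeros,
  hence an isomorphism of the line bundles.\<close>

lemma same_subI:
 fixes E :: "2 hopf_bundle"
 assumes E: "holo_bundle b r E" and h: "esec E \<mu> (%p. column 1 (h p))" "!!p. p : C2_star ==> column 1 (h p) ~= 0"
  and h': "esec E \<mu>' (%p. column 1 (h' p))" "!!p. p : C2_star ==> column 1 (h' p) ~= 0"
  and pr: "!!p. p : C2_star ==> EX c. column 1 (h p) = c *s column 1 (h' p)"
 shows "same_sub b r \<mu> h \<mu>' h'"
proof -
 obtain c where c: "!!p. p : C2_star ==> column 1 (h p) = c p *s column 1 (h' p)" using pr by metis
 have loc: "local_section E C2_star (%p. column 1 (h p))" "local_section E C2_star (%p. column 1 (h' p))"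
  using h(1) h'(1) by (auto simp: esec_def)
 have hol: "holo2_at c p" if "p : C2_star" for p
  by (rule holo2_at_ratio[OF E loc open_C2_star order_refl that]) (use c h' in blast)
 have c0: "c p ~= 0" if "p : C2_star" for p using c[OF that] h(2)[OF that] by auto
 have cF: "c (F p) * \<mu> = \<mu>' * c p" if p: "p : C2_star" for p
 proof -
  have Fp: "F p : C2_star" using p by simp
  have "(c (F p) * \<mu>) *s column 1 (h' (F p)) = factor E p *v column 1 (h p)"
   using h(1) p c[OF Fp] by (simp add: esec_def vector_smult_assoc mult.commute)
  also have "\<dots> = (\<mu>' * c p) *s column 1 (h' (F p))"
   using h'(1) p c[OF p] by (simp add: esec_def matrix_scale_vec vector_smult_assoc mult.commute)
  finally show ?thesis using h'(2)[OF Fp] unfolding vector_mul_rcancel by blast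
 qed
 have "bundle_iso b r (L \<mu>) (L \<mu>') (%p. mat (c p))"
  unfolding bundle_iso_def
 proof (intro conjI ballI)
  show "bundle_hom b r (L \<mu>) (L \<mu>') (%p. mat (c p))"
   unfolding bundle_hom_trivial[OF L_simps(2) L_simps(2)]
  proof (intro ballI conjI)
   fix p assume p: "p : C2_star"
   show "mat_at (%p. mat (c p) :: complex ^ 1 ^ 1) p" using hol[OF p] by (simp add: mat_at_def mat_def forall_1)
   have "(mat (c (F p)) ** factor (L \<mu>) p) $ 1 $ 1 = (factor (L \<mu>') p ** mat (c p)) $ 1 $ 1"
    unfolding L_simps mat_mult_nth using cF[OF p] by (simp add: mat_def)
   thus "mat (c (F p)) ** factor (L \<mu>) p = factor (L \<mu>') p ** mat (c p)" by (simp add: vec_eq_iff forall_1)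
  qed
  show "invertible (mat (c p) :: complex ^ 1 ^ 1)" if "p : C2_star" for p
   using c0[OF that] by (simp add: invertible_kernel mat_mult_vec)
 qed
 moreover have "h p = h' p ** mat (c p)" if "p : C2_star" for p
  unfolding column_1_eq_iff[symmetric] column_mult_1 using c[OF that] by (simp add: mat_def)
 ultimately show ?thesis unfolding same_sub_def by blast
qed

end

section \<open>Saturated and invariant sub-line bundles\<close>

context hopf_extension
begin

text \<open>A nonzero h is y^n times a nowhere vanishing section, and torsion-freeness allows y^n to
  be divided out, so h has no zeros. Conversely, if f s lies in the image of h, the determinant of h
  and s vanishes where f does not, hence everywhere by the identity theorem, and s is a holomorphic
  multiple of h.\<close>

lemma sub_line_bundle_iff:
 "sub_line_bundle b r E \<mu> h \<longleftrightarrow> \<mu> ~= 0 & esec E \<mu> (%p. column 1 (h p)) & (ALL p:C2_star. column 1 (h p) ~= 0)"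
proof (intro iffI conjI ballI; (elim conjE)?)
 assume s: "sub_line_bundle b r E \<mu> h"
 show \<mu>: "\<mu> ~= 0" and h: "esec E \<mu> (%p. column 1 (h p))"
  using s unfolding sub_line_bundle_def bundle_hom_L_iff by auto
 have "EX p:C2_star. column 1 (h p) ~= 0"
  using s unfolding sub_line_bundle_def by (metis column_1_eq_iff column_1_zero)
 from saturation[OF h \<mu> this] obtain n \<zeta> where \<zeta>: "esec E (\<mu> * b ^ n) \<zeta>"
  "!!p. p : C2_star ==> \<zeta> p ~= 0 & column 1 (h p) = snd p ^ n *s \<zeta> p" by blast
 have "EX m'. local_section (L \<mu>) C2_star m' & (ALL p:C2_star. \<zeta> p = h p *v m' p)"
 proof -
  \<comment> \<open>Torsion-freeness is applied on the whole punctured plane, which is connected,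
    with f = y^n and m = 1.\<close>
  have "open C2_star & connected C2_star & C2_star <= C2_star & holo2_on (%p. snd p ^ n) C2_star &
    (EX p:C2_star. snd p ^ n ~= 0) & local_section E C2_star \<zeta> & local_section (L \<mu>) C2_star (%_. vec 1) &
    (ALL p:C2_star. snd p ^ n *s \<zeta> p = h p *v vec 1)"
  proof (intro conjI)
   show "EX p:C2_star. snd p ^ n ~= 0" by (rule bexI[of _ "(0, 1)"]) (simp_all add: C2_star_def)
   show "holo2_on (%p. snd p ^ n) C2_star" unfolding holo2_on_iff by (intro ballI holo2_at_power holo2_at_snd)
   show "local_section (L \<mu>) C2_star (%_. vec 1)" by (simp add: local_section_trivial vec_at_def)
   show "ALL p:C2_star. snd p ^ n *s \<zeta> p = h p *v vec 1" using \<zeta>(2) by (simp add: mult_vec_1)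
  qed (use \<zeta>(1) open_C2_star connected_C2_star in \<open>auto simp: esec_def\<close>)
  thus ?thesis using s unfolding sub_line_bundle_def by blast
 qed
 hence "\<zeta> p = h p *v 0 \<or> column 1 (h p) ~= 0" if "p : C2_star" for p
  using that by (metis mult_vec_1 vector_smult_rzero matrix_vector_mult_0_right)
 thus "column 1 (h p) ~= 0" if "p : C2_star" for p
  using \<zeta>(2)[OF that] that by (metis matrix_vector_mult_0_right)
next
 assume \<mu>: "\<mu> ~= 0" and h: "esec E \<mu> (%p. column 1 (h p))" and nz: "ALL p:C2_star. column 1 (h p) ~= 0"
 have hloc: "local_section E C2_star (%p. column 1 (h p))" using h by (simp add: esec_def)
 show "sub_line_bundle b r E \<mu> h"
  unfolding sub_line_bundle_def
 proof (intro conjI allI impI; (elim conjE)?)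
  show "bundle_hom b r (L \<mu>) E h" using h by (simp add: bundle_hom_L_iff)
  have "(0, 1) : C2_star" by (simp add: C2_star_def)
  thus "EX p:C2_star. h p ~= 0" using nz column_1_zero by metis
 next
  fix U f s m
  assume U: "open U" "connected U" "U <= C2_star" and f: "holo2_on f U" "EX p:U. f p ~= 0"
   and s: "local_section E U s" and m: "local_section (L \<mu>) U m" and eq: "ALL p:U. f p *s s p = h p *v m p"
  have hU: "local_section E U (%p. column 1 (h p))" by (rule local_section_subset[OF hloc U(3)])
  have "EX c. s p = c *s column 1 (h p)" if p: "p : U" for p
  proof -
   have pC: "p : C2_star" using p U by auto
   obtain V k where V: "(V, k) : frames E" "p : V" "open V" "V <= C2_star" "!!q. q : V ==> invertible (k q)"
    using frame_at[OF E pC] by metis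
   have "open (U Int V)" "p : U Int V" using U V p by auto
   then obtain e where e: "e > 0" "ball p e <= U Int V" by (meson openE)
   define S where "S q = matrix_inv (k q) *v s q" for q
   define H where "H q = matrix_inv (k q) *v column 1 (h q)" for q
   define d where "d q = H q $ 1 * S q $ 2 - H q $ 2 * S q $ 1" for q
   have hol: "holo2_at (%q. S q $ j) q" "holo2_at (%q. H q $ j) q" if "q : U Int V" for q j
    using local_sectionD[OF s _ V(1), of q] local_sectionD[OF hU _ V(1), of q] that by (auto simp: vec_at_def S_def H_def)
   have d: "holo2_on d (ball p e)"
    unfolding holo2_on_iff d_def
   proof
    fix q assume "q : ball p e"
    hence q: "q : U Int V" using e by blast
    show "holo2_at (%q. H q $ 1 * S q $ 2 - H q $ 2 * S q $ 1) q"
     by (rule holo2_at_diff; rule holo2_at_mult; rule hol[OF q])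
   qed
   have "EX q:ball p e. f q ~= 0"
   proof (rule ccontr)
    assume "~ ?thesis"
    hence z: "f q = 0" if "q : ball p e" for q using that by blast
    have "f q = 0" if "q : U" for q
     by (rule holo2_identity[OF U(1,2) f(1), of "ball p e"]) (use e z that in auto)
    thus False using f(2) by blast
   qed
   then obtain q0 where q0: "q0 : ball p e" "f q0 ~= 0" by blast
   have fb: "holo2_on f (ball p e)" by (rule holo2_on_subset[OF f(1)]) (use e in blast)
   have op: "open (ball p e Int f -` (- {0}))"
    by (rule continuous_open_preimage[OF holo2_on_continuous_on[OF fb]]) auto
   have "d p = 0"
   proof (rule holo2_identity[OF _ _ d op])
    fix q assume q: "q : ball p e Int f -` (- {0})"
    hence qU: "q : U" using e by blast
    have fS: "f q *s S q = m q $ 1 *s H q"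
     using bspec[OF eq qU] unfolding S_def H_def matrix_scale_vec[symmetric] by (simp add: mult_vec_1)
    have c: "f q * S q $ j = m q $ 1 * H q $ j" for j
     using arg_cong[OF fS, of "%v. v $ j"] by simp
    have "f q * d q = H q $ 1 * (f q * S q $ 2) - H q $ 2 * (f q * S q $ 1)" by (simp add: d_def algebra_simps)
    also have "\<dots> = 0" unfolding c by simp
    finally show "d q = 0" using q by simp
   qed (use q0 e in auto)
   moreover have "H p ~= 0"
    unfolding H_def invertible_mult_vec_eq_0[OF invertible_matrix_inv[OF V(5)[OF V(2)]]] using nz pC by blast
   ultimately obtain c where c: "S p = c *s H p" using proportional_2[of "H p" "S p"] by (auto simp: d_def)
   have "s p = k p *v S p" "column 1 (h p) = k p *v H p"
    by (simp_all add: S_def H_def matrix_inv_cancel(6)[OF V(5)[OF V(2)]])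
   thus ?thesis unfolding c matrix_scale_vec by auto
  qed
  then obtain c where c: "!!p. p : U ==> s p = c p *s column 1 (h p)" by metis
  have "holo2_at c p" if "p : U" for p
   by (rule holo2_at_ratio[OF E s hU U(1,3) that]) (use c nz U(3) in blast)
  hence "local_section (L \<mu>) U (%p. vec (c p))" using U(3) by (simp add: local_section_trivial vec_at_def)
  thus "EX m'. local_section (L \<mu>) U m' & (ALL p:U. s p = h p *v m' p)"
   using c by (intro exI[of _ "%p. vec (c p)"]) (simp add: mult_vec_1)
 qed (use \<mu> in auto)
qed

lemma invariant_if_same_sub:
 assumes l: "l ~= 0" and P: "!!p. p : C2_star ==> holo2_at P p" "!!p. p : C2_star ==> P (F p) = l * P p"
  and h': "\<mu>' ~= 0" "esec E \<mu>' (%p. column 1 (h' p))" "!!p. p : C2_star ==> column 1 (h' p) ~= 0"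
   "!!p. p : C2_star ==> \<phi> p *v column 1 (h' p) = P p *s column 1 (h' p)"
  and s: "same_sub b r \<mu> h \<mu>' h'"
 shows "invariant_sub_line_bundle b r l E \<phi> \<mu> h"
proof -
 obtain c where c: "!!p. p : C2_star ==> holo2_at c p & c p ~= 0 & c (F p) * \<mu> = \<mu>' * c p & column 1 (h p) = c p *s column 1 (h' p)"
  using same_subE[OF s] by blast
 have p1: "(0, 1) : C2_star" by (simp add: C2_star_def)
 have \<mu>: "\<mu> ~= 0" using c[OF p1] h'(1) by auto
 have "local_section E C2_star (%p. c p *s column 1 (h' p))"
  by (rule local_section_scale) (use h'(2) c in \<open>auto simp: esec_def\<close>)
 moreover have "factor E p *v (c p *s column 1 (h' p)) = \<mu> *s (c (F p) *s column 1 (h' (F p)))" if "p : C2_star" for p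
  using h'(2) c[OF that] that by (simp add: esec_def matrix_scale_vec vector_smult_assoc mult.commute)
 ultimately have "esec E \<mu> (%p. c p *s column 1 (h' p))" by (simp add: esec_def)
 hence h: "esec E \<mu> (%p. column 1 (h p))" by (rule esec_cong) (use c in simp)
 have sub: "sub_line_bundle b r E \<mu> h"
  unfolding sub_line_bundle_iff using \<mu> h c h'(3) by (metis vector_mul_eq_0)
 have "bundle_hom b r (L \<mu>) (twist l (L \<mu>)) (%p. mat (P p))"
 proof -
  have fr: "frames (twist l (L \<mu>)) = {(C2_star, %_. mat 1)}" by simp
  show ?thesis
   unfolding bundle_hom_trivial[OF L_simps(2) fr]
  proof (intro ballI conjI)
   fix p assume p: "p : C2_star"
   show "mat_at (%p. mat (P p) :: complex ^ 1 ^ 1) p" using P(1)[OF p] by (simp add: mat_at_def mat_def forall_1)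
   have "(mat (P (F p)) ** factor (L \<mu>) p) $ 1 $ 1 = (factor (twist l (L \<mu>)) p ** mat (P p)) $ 1 $ 1"
    unfolding L_simps twist_simps mat_mult_nth mult_mat_nth P(2)[OF p] by (simp add: mat_def)
   thus "mat (P (F p)) ** factor (L \<mu>) p = factor (twist l (L \<mu>)) p ** mat (P p)" by (simp add: vec_eq_iff forall_1)
  qed
 qed
 moreover have "\<phi> p ** h p = h p ** mat (P p)" if "p : C2_star" for p
  unfolding column_1_eq_iff[symmetric] column_mult_1 column_mult[of 1 "\<phi> p"]
  using c[OF that] h'(4)[OF that] by (simp add: mat_def matrix_scale_vec vector_smult_assoc mult.commute)
 ultimately show ?thesis unfolding invariant_sub_line_bundle_def using sub by blast
qed

text \<open>An invariant h is an eigensection whose eigenvalue \<epsilon> satisfies \<epsilon>^2 =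
  P^2. When neither is 0, both are multiples of one power of y, so \<epsilon> is P or -P throughout.
  A nonzero trace-free matrix is not scalar, so its eigenspaces are lines. The case P = 0 with h1 =
  h2 covers nilpotent fields.\<close>

theorem invariant_iff:
 assumes l: "l ~= 0" and P: "!!p. p : C2_star ==> holo2_at P p" "!!p. p : C2_star ==> P (F p) = l * P p"
  and \<phi>: "!!p. p : C2_star ==> trace (\<phi> p) = 0" "!!p. p : C2_star ==> \<phi> p ~= 0"
  and h1: "\<mu>1 ~= 0" "esec E \<mu>1 (%p. column 1 (h1 p))" "!!p. p : C2_star ==> column 1 (h1 p) ~= 0"
   "!!p. p : C2_star ==> \<phi> p *v column 1 (h1 p) = P p *s column 1 (h1 p)"
  and h2: "\<mu>2 ~= 0" "esec E \<mu>2 (%p. column 1 (h2 p))" "!!p. p : C2_star ==> column 1 (h2 p) ~= 0"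
   "!!p. p : C2_star ==> \<phi> p *v column 1 (h2 p) = (- P p) *s column 1 (h2 p)"
 shows "invariant_sub_line_bundle b r l E \<phi> \<mu> h \<longleftrightarrow> same_sub b r \<mu> h \<mu>1 h1 \<or> same_sub b r \<mu> h \<mu>2 h2"
proof
 assume "same_sub b r \<mu> h \<mu>1 h1 \<or> same_sub b r \<mu> h \<mu>2 h2"
 thus "invariant_sub_line_bundle b r l E \<phi> \<mu> h"
 proof
  assume s: "same_sub b r \<mu> h \<mu>2 h2"
  have "- P (F p) = l * - P p" if "p : C2_star" for p using P(2)[OF that] by simp
  from invariant_if_same_sub[OF l holo2_at_minus[OF P(1)] this h2 s] show ?thesis .
 qed (rule invariant_if_same_sub[OF l P h1])
next
 assume "invariant_sub_line_bundle b r l E \<phi> \<mu> h"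
 then obtain e where \<mu>: "\<mu> ~= 0" and h: "esec E \<mu> (%p. column 1 (h p))" "!!p. p : C2_star ==> column 1 (h p) ~= 0"
  and e: "bundle_hom b r (L \<mu>) (twist l (L \<mu>)) e" "!!p. p : C2_star ==> \<phi> p ** h p = h p ** e p"
  unfolding invariant_sub_line_bundle_def sub_line_bundle_iff by blast
 have nz: "\<phi> p ~= mat c" if "p : C2_star" for p c
  by (rule trace_zero_neq_mat[OF \<phi>[OF that]])
 have sq: "\<phi> p *v (\<phi> p *v v) = (P p)\<^sup>2 *s v" if "p : C2_star" for p v
  by (rule trace_zero_square[OF \<phi>(1)[OF that] h1(3,4)[OF that]])
 define \<epsilon> where "\<epsilon> p = e p $ 1 $ 1" for p
 have fr: "frames (twist l (L \<mu>)) = {(C2_star, %_. mat 1)}" by simp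
 have *: "mat_at e p" "e (F p) ** factor (L \<mu>) p = factor (twist l (L \<mu>)) p ** e p" if "p : C2_star" for p
  using e(1) that unfolding bundle_hom_trivial[OF L_simps(2) fr] by auto
 have \<epsilon>h: "holo2_at \<epsilon> p" if "p : C2_star" for p using *(1)[OF that] by (simp add: mat_at_def \<epsilon>_def[abs_def])
 have \<epsilon>F: "1 * \<epsilon> (F p) = l * \<epsilon> p" if "p : C2_star" for p
 proof -
  have "(e (F p) ** factor (L \<mu>) p) $ 1 $ 1 = (factor (twist l (L \<mu>)) p ** e p) $ 1 $ 1" using *(2)[OF that] by simp
  hence "\<mu> * \<epsilon> (F p) = \<mu> * (l * \<epsilon> p)"
   by (simp add: \<epsilon>_def matrix_mul_assoc[symmetric])
  thus ?thesis using \<mu> by simp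
 qed
 have \<phi>h: "\<phi> p *v column 1 (h p) = \<epsilon> p *s column 1 (h p)" if "p : C2_star" for p
  using e(2)[OF that] unfolding column_1_eq_iff[symmetric] column_mult_1 column_mult[of 1 "\<phi> p"] \<epsilon>_def .
 have \<epsilon>P: "(\<epsilon> p)\<^sup>2 = (P p)\<^sup>2" if "p : C2_star" for p
 proof -
  have "(\<epsilon> p)\<^sup>2 *s column 1 (h p) = \<phi> p *v (\<phi> p *v column 1 (h p))"
   unfolding \<phi>h[OF that] matrix_scale_vec by (simp add: vector_smult_assoc power2_eq_square)
  thus ?thesis using h(2)[OF that] unfolding sq[OF that] vector_mul_rcancel by blast
 qed
 have P1: "1 * P (F p) = l * P p" if "p : C2_star" for p using P(2)[OF that] by simp
 have "(ALL p:C2_star. \<epsilon> p = P p) \<or> (ALL p:C2_star. \<epsilon> p = - P p)"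
 proof (cases "(ALL p:C2_star. \<epsilon> p = 0) \<or> (ALL p:C2_star. P p = 0)")
  case True
  thus ?thesis using \<epsilon>P by fastforce
 next
  case False
  obtain n c where n: "l = 1 * b ^ n" "ALL p:C2_star. \<epsilon> p = c * snd p ^ n"
   using section_ratio[OF \<epsilon>h _ \<epsilon>F] False by auto
  obtain m d where m: "l = 1 * b ^ m" "ALL p:C2_star. P p = d * snd p ^ m"
   using section_ratio[OF P(1) _ P1] False by auto
  have "n = m" using powi_b_inject[of "int n" "int m"] n(1) m(1) by simp
  moreover have "c\<^sup>2 = d\<^sup>2" using \<epsilon>P[of "(0, 1)"] n(2) m(2) by (simp add: C2_star_def)
  ultimately show ?thesis using n(2) m(2) unfolding power2_eq_iff by fastforce
 qed
 thus "same_sub b r \<mu> h \<mu>1 h1 \<or> same_sub b r \<mu> h \<mu>2 h2"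
 proof
  assume ep: "ALL p:C2_star. \<epsilon> p = P p"
  have "EX c. column 1 (h p) = c *s column 1 (h1 p)" if p: "p : C2_star" for p
   by (rule kernel_2[of "\<phi> p - mat (P p)" "column 1 (h1 p)" "column 1 (h p)"])
    (use nz[OF p] h1(3,4)[OF p] \<phi>h[OF p] ep p in \<open>auto simp: matrix_vector_mult_diff_rdistrib mat_mult_vec\<close>)
  thus ?thesis using same_subI[OF E h h1(2,3)] by blast
 next
  assume ep: "ALL p:C2_star. \<epsilon> p = - P p"
  have "EX c. column 1 (h p) = c *s column 1 (h2 p)" if p: "p : C2_star" for p
   by (rule kernel_2[of "\<phi> p - mat (- P p)" "column 1 (h2 p)" "column 1 (h p)"])
    (use nz[OF p] h2(3,4)[OF p] \<phi>h[OF p] ep p in \<open>auto simp: matrix_vector_mult_diff_rdistrib mat_mult_vec\<close>)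
  thus ?thesis using same_subI[OF E h h2(2,3)] by blast
 qed
qed

end

section \<open>Classification of nowhere vanishing Higgs fields\<close>

lemma cols_intertwine:
 assumes "\<phi> *v u = M $ 1 $ 1 *s u + M $ 2 $ 1 *s v" "\<phi> *v v = M $ 1 $ 2 *s u + M $ 2 $ 2 *s v"
 shows "cols u v ** M = \<phi> ** cols u v"
proof -
 have "column j (cols u v ** M) = column j (\<phi> ** cols u v)" for j
  using exhaust_2[of j] assms by (auto simp: column_mult cols_mult_vec) (simp_all add: column_def)
 thus ?thesis by (simp add: column_def vec_eq_iff)
qed

lemma column_incl_eta: "column 1 (incl (v $ 1) (v $ 2)) = v"
 by (simp add: vec_eq_iff forall_2)

context hopf
begin

text \<open>For k = 0 the cocycle is 0 and this is a direct sum, so the split case needs no separate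
  model.\<close>

definition MB :: "complex => nat => nat => C2 => complex ^ 2 ^ 2" where
 "MB \<sigma> k a p = mat2 \<sigma> (\<sigma> * cocycle k a p) 0 (\<sigma> * b powi (int a - int (r * k)))"

text \<open>The eigensections are (1, 0) with eigenvalue y^a and (x^k, y^a) with eigenvalue -y^a.
  For a >= 1 the two lines meet along y = 0, where the entry -2 x^k keeps the matrix
  nonzero.\<close>

definition model_higgs :: "nat => nat => C2 => complex ^ 2 ^ 2" where
 "model_higgs k a p = mat2 (snd p ^ a) (- 2 * fst p ^ k) 0 (- (snd p ^ a))"

lemma holo_bundle_upper:
 assumes "\<sigma> ~= 0" "\<tau> ~= 0" "!!p. p : C2_star ==> holo2_at g p"
 shows "holo_bundle b r (TB (%p. mat2 \<sigma> (g p) 0 \<tau>))"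
 by (rule holo_bundle_TB) (use assms in \<open>auto simp: mat_at_def forall_2 invertible_2_iff\<close>)

lemma holo_bundle_MB: "\<sigma> ~= 0 ==> holo_bundle b r (TB (MB \<sigma> k a))"
 unfolding MB_def[abs_def]
 by (rule holo_bundle_upper) (simp_all add: holo2_at_mult[OF holo2_at_const holo2_at_cocycle])

lemma tracefree_eq_line:
 fixes M :: "complex ^ 2 ^ 2"
 assumes "trace M = 0" "M ~= 0" "z ~= 0" "M *v z = c *s z" "M *v v = c *s v"
 obtains d where "v = d *s z"
 by (rule kernel_2[of "M - mat c" z v])
  (use trace_zero_neq_mat[OF assms(1,2)] assms in \<open>auto simp: matrix_vector_mult_diff_rdistrib mat_mult_vec\<close>)

end

context hopf_extension
begin

lemma jet_frame:
 assumes \<zeta>: "esec E \<mu> \<zeta>" and \<mu>: "\<mu> ~= 0" and nz: "!!p. p : C2_star ==> \<zeta> p ~= 0"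
  and R\<zeta>: "!!p. p : C2_star ==> R p (\<zeta> p) = snd p ^ a" and a: "1 <= a" "a <= r"
 obtains k c where "\<sigma> = b powi (int r * k) * \<mu>" "c ~= 0"
  "k >= 0 ==> EX e. local_section E C2_star e & bundle_iso b r (TB (MB \<sigma> (nat k) a)) E (%p. cols (c *s i p) (e p)) &
   (ALL p:C2_star. \<zeta> p = fst p ^ nat k *s (c *s i p) + snd p ^ a *s e p & R p (e p) = 1)"
proof -
 obtain k c where k: "\<sigma> = b powi (int r * k) * \<mu>" "c ~= 0"
  and ex: "k >= 0 ==> EX e. local_section E C2_star e & (ALL p:C2_star. \<zeta> p = (c * fst p ^ nat k) *s i p + snd p ^ a *s e p &
   R p (e p) = 1 & A p *v e p = (\<mu> * b ^ a) *s e (F p) + (\<sigma> * c * cocycle (nat k) a p) *s i (F p))"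
  using jet[OF assms] by blast
 have "EX e. local_section E C2_star e & bundle_iso b r (TB (MB \<sigma> (nat k) a)) E (%p. cols (c *s i p) (e p)) &
   (ALL p:C2_star. \<zeta> p = fst p ^ nat k *s (c *s i p) + snd p ^ a *s e p & R p (e p) = 1)" if k0: "k >= 0"
 proof -
  obtain e where e: "local_section E C2_star e" and e': "!!p. p : C2_star ==> \<zeta> p = (c * fst p ^ nat k) *s i p + snd p ^ a *s e p"
   "!!p. p : C2_star ==> R p (e p) = 1"
   "!!p. p : C2_star ==> A p *v e p = (\<mu> * b ^ a) *s e (F p) + (\<sigma> * c * cocycle (nat k) a p) *s i (F p)"
   using ex[OF k0] by blast
  have exp: "\<sigma> * b powi (int a - int (r * nat k)) = \<mu> * b ^ a"
   using k0 by (simp add: k(1) power_int_diff)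
  have "bundle_iso b r (TB (MB \<sigma> (nat k) a)) E (%p. cols (c *s i p) (e p))"
  proof (rule frame_iso[OF E local_section_scale[OF i_local holo2_at_const] e])
   fix p x y assume p: "p : C2_star" and z: "x *s (c *s i p) + y *s e p = 0"
   have "R p (x *s (c *s i p) + y *s e p) = y"
    unfolding R_add R_scale R_i[OF p] e'(2)[OF p] by simp
   hence "y = 0" unfolding z by simp
   thus "x = 0 & y = 0" using z k(2) i0[OF p] by (simp add: vector_smult_assoc)
  next
   fix p assume p: "p : C2_star"
   show "A p *v (c *s i p) = MB \<sigma> (nat k) a p $ 1 $ 1 *s (c *s i (F p)) + MB \<sigma> (nat k) a p $ 2 $ 1 *s e (F p)"
    by (simp add: MB_def matrix_scale_vec i_F[OF p] vector_smult_assoc mult.commute)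
   show "A p *v e p = MB \<sigma> (nat k) a p $ 1 $ 2 *s (c *s i (F p)) + MB \<sigma> (nat k) a p $ 2 $ 2 *s e (F p)"
    unfolding MB_def mat2_nth exp e'(3)[OF p] by (simp add: vec_eq_iff algebra_simps)
  qed
  thus ?thesis using e e' by (intro exI[of _ e]) (simp add: vector_smult_assoc mult.commute)
 qed
 thus ?thesis using that k by blast
qed

end

section \<open>Eigensections of a Higgs field and the normal forms\<close>

locale higgs_extension = hopf_extension +
 fixes l :: int and \<phi> :: "C2 => complex ^ 2 ^ 2"
 assumes higgs: "higgs_field b r (b powi l) E \<phi>" and \<phi>0: "!!p. p : C2_star ==> \<phi> p ~= 0" and l_le: "l <= int r"
begin

abbreviation "\<Lambda> \<equiv> b powi l"

lemma \<phi>_trace: "p : C2_star ==> trace (\<phi> p) = 0"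
 and \<phi>_hom: "bundle_hom b r E (twist \<Lambda> E) \<phi>"
 using higgs by (auto simp: higgs_field_def)

lemma \<phi>_F: "p : C2_star ==> \<phi> (F p) *v (A p *v v) = \<Lambda> *s (A p *v (\<phi> p *v v))"
 using bundle_homD(1)[OF \<phi>_hom, of p] by (simp add: matrix_vector_mul_assoc mat_mult_mult_vec[symmetric] matrix_mul_assoc)

lemma \<phi>_local: "local_section E U s ==> U <= C2_star ==> local_section E U (%p. \<phi> p *v s p)"
 using local_section_hom[OF \<phi>_hom E] by simp

lemma holo_monomial: "holo2_at (%p. \<delta> * snd p ^ n) p"
 by (rule holo2_at_mult[OF holo2_at_const holo2_at_power[OF holo2_at_snd]])

lemma eigen_eq_on_axis:
 assumes s: "local_section E C2_star s" and t: "local_section E C2_star t"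
  and eq: "!!p. p : C2_star ==> snd p ~= 0 ==> \<phi> p *v s p = t p" and p: "p : C2_star"
 shows "\<phi> p *v s p = t p"
 by (rule local_section_eq_on_axis[OF E \<phi>_local[OF s order_refl] t open_C2_star order_refl eq p])

lemma eigensection_saturation:
 assumes s: "esec E \<mu> s" "\<mu> ~= 0" "EX p:C2_star. s p ~= 0" and eig: "!!p. p : C2_star ==> \<phi> p *v s p = (\<delta> * snd p ^ n) *s s p"
 obtains \<mu>' \<zeta> where "\<mu>' ~= 0" "esec E \<mu>' \<zeta>" "!!p. p : C2_star ==> \<zeta> p ~= 0" "!!p. p : C2_star ==> \<phi> p *v \<zeta> p = (\<delta> * snd p ^ n) *s \<zeta> p"
proof -
 obtain m \<zeta> where \<zeta>: "esec E (\<mu> * b ^ m) \<zeta>" "!!p. p : C2_star ==> \<zeta> p ~= 0 & s p = snd p ^ m *s \<zeta> p"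
  using saturation[OF s] by blast
 have loc: "local_section E C2_star \<zeta>" using \<zeta>(1) by (simp add: esec_def)
 have "\<phi> p *v \<zeta> p = (\<delta> * snd p ^ n) *s \<zeta> p" if "p : C2_star" for p
 proof (rule eigen_eq_on_axis[OF loc local_section_scale[OF loc holo_monomial] _ that])
  fix p assume p: "p : C2_star" "snd p ~= 0"
  have "snd p ^ m *s (\<phi> p *v \<zeta> p) = \<phi> p *v s p" using \<zeta>(2)[OF p(1)] by (simp add: matrix_scale_vec)
  also have "\<dots> = snd p ^ m *s ((\<delta> * snd p ^ n) *s \<zeta> p)"
   unfolding eig[OF p(1)] using \<zeta>(2)[OF p(1)] by (simp add: vector_smult_assoc mult.commute)
  finally show "\<phi> p *v \<zeta> p = (\<delta> * snd p ^ n) *s \<zeta> p" using p(2) unfolding vector_mul_lcancel by simp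
 qed
 thus ?thesis using that[of "\<mu> * b ^ m" \<zeta>] \<zeta> s(2) by simp
qed

text \<open>The image of \<psi> lies on the line of z, so \<psi> is z times a row. This row is the
  quotient map in a new presentation of E, as an extension whose sub-line is the kernel of
  \<psi>.\<close>

lemma kernel_extension:
 assumes \<psi>F: "!!p v. p : C2_star ==> \<psi> (F p) *v (A p *v v) = \<Lambda> *s (A p *v (\<psi> p *v v))"
  and \<psi>_loc: "!!U s. U <= C2_star ==> local_section E U s ==> local_section E U (%p. \<psi> p *v s p)"
  and \<psi>0: "!!p. p : C2_star ==> \<psi> p ~= 0"
  and line: "!!p v. p : C2_star ==> EX c. \<psi> p *v v = c *s z p"
  and z: "\<mu>' ~= 0" "esec E \<mu>' z" "!!p. p : C2_star ==> z p ~= 0"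
  and u: "\<mu> ~= 0" "esec E \<mu> u" "!!p. p : C2_star ==> u p ~= 0 & \<psi> p *v u p = 0"
 obtains \<rho>' where "hopf_extension b r E \<mu> (\<Lambda> * \<mu>') (%p. incl (u p $ 1) (u p $ 2)) \<rho>'"
  "!!p v. p : C2_star ==> \<psi> p *v v = (\<rho>' p *v v) $ 1 *s z p"
proof -
 have "EX \<kappa> :: complex ^ 2 ^ 1. ALL v. \<psi> p *v v = (\<kappa> *v v) $ 1 *s z p" if "p : C2_star" for p
  using rank_one_2[OF line[OF that]] by metis
 then obtain \<kappa> :: "C2 => complex ^ 2 ^ 1" where \<kappa>: "!!p v. p : C2_star ==> \<psi> p *v v = (\<kappa> p *v v) $ 1 *s z p" by metis
 have zloc: "local_section E C2_star z" and zF: "!!p. p : C2_star ==> A p *v z p = \<mu>' *s z (F p)"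
  using z(2) by (auto simp: esec_def)
 have hom: "bundle_hom b r E (L (\<Lambda> * \<mu>')) \<kappa>"
 proof (rule bundle_hom_local[OF E])
  fix p assume p: "p : C2_star"
  have Fp: "F p : C2_star" using p by simp
  show "\<kappa> (F p) ** A p = factor (L (\<Lambda> * \<mu>')) p ** \<kappa> p"
  proof (rule mat_eqI_vec)
   fix v
   have "(\<kappa> (F p) *v (A p *v v)) $ 1 *s z (F p) = \<Lambda> *s (A p *v ((\<kappa> p *v v) $ 1 *s z p))"
    using \<psi>F[OF p, of v] unfolding \<kappa>[OF p] \<kappa>[OF Fp] .
   also have "\<dots> = (\<Lambda> * \<mu>' * (\<kappa> p *v v) $ 1) *s z (F p)"
    by (simp add: matrix_scale_vec zF[OF p] vector_smult_assoc mult_ac)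
   finally have "(\<kappa> (F p) *v (A p *v v)) $ 1 = \<Lambda> * \<mu>' * (\<kappa> p *v v) $ 1"
    using z(3)[OF Fp] unfolding vector_mul_rcancel by blast
   thus "(\<kappa> (F p) ** A p) *v v = (factor (L (\<Lambda> * \<mu>')) p ** \<kappa> p) *v v"
    unfolding L_simps mat_mult_mult_vec by (simp add: vec_eq_iff forall_1 matrix_vector_mul_assoc)
  qed
 next
  fix U s assume U: "open U" "U <= C2_star" "local_section E U s"
  have "holo2_at (%p. (\<kappa> p *v s p) $ 1) p" if "p : U" for p
   by (rule holo2_at_ratio[OF E \<psi>_loc[OF U(2,3)] local_section_subset[OF zloc U(2)] U(1,2) that]) (use z(3) \<kappa> U(2) in blast)
  thus "local_section (L (\<Lambda> * \<mu>')) U (%p. \<kappa> p *v s p)"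
   using U(2) by (simp add: local_section_trivial vec_at_def forall_1)
 qed
 have "extension b r \<mu> E (\<Lambda> * \<mu>') (%p. incl (u p $ 1) (u p $ 2)) \<kappa>"
  unfolding extension_iff bundle_hom_L_iff column_incl_eta
 proof (intro conjI ballI)
  fix p assume p: "p : C2_star"
  show "u p ~= 0" using u(3)[OF p] by blast
  show "\<kappa> p ~= 0"
  proof
   assume "\<kappa> p = 0"
   hence "\<psi> p *v v = 0 *v v" for v using \<kappa>[OF p, of v] by simp
   hence "\<psi> p = 0" by (intro mat_eqI_vec)
   thus False using \<psi>0[OF p] by blast
  qed
  have "(\<kappa> p *v u p) $ 1 *s z p = 0" using u(3)[OF p] \<kappa>[OF p, of "u p"] by simp
  thus "\<kappa> p *v u p = 0" using z(3)[OF p] by (simp add: vec_eq_iff[of "\<kappa> p *v u p"] forall_1)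
 qed (use u z hom in auto)
 hence "hopf_extension b r E \<mu> (\<Lambda> * \<mu>') (%p. incl (u p $ 1) (u p $ 2)) \<kappa>"
  by unfold_locales (rule E)
 thus ?thesis using \<kappa> that by blast
qed

text \<open>\<psi> = \<phi> + \<delta> y^n maps into the eigenspace for \<delta> y^n. Applied to i
  it yields an eigensection unless it is 0; then \<psi> factors through the quotient, and the image
  of a lift is one. Saturation removes the zeros.\<close>

lemma eigensection:
 assumes \<delta>: "\<delta> ~= 0" and ln: "l = int n" and sq: "!!p v. p : C2_star ==> \<phi> p *v (\<phi> p *v v) = (\<delta> * snd p ^ n)\<^sup>2 *s v"
 obtains \<mu> \<zeta> where "\<mu> ~= 0" "esec E \<mu> \<zeta>" "!!p. p : C2_star ==> \<zeta> p ~= 0" "!!p. p : C2_star ==> \<phi> p *v \<zeta> p = (\<delta> * snd p ^ n) *s \<zeta> p"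
proof -
 define \<psi> where "\<psi> p = \<phi> p + mat (\<delta> * snd p ^ n)" for p
 have \<psi>: "\<psi> p *v v = \<phi> p *v v + (\<delta> * snd p ^ n) *s v" for p v
  by (simp add: \<psi>_def matrix_vector_mult_add_rdistrib mat_mult_vec)
 have \<phi>\<psi>: "\<phi> p *v (\<psi> p *v v) = (\<delta> * snd p ^ n) *s (\<psi> p *v v)" if "p : C2_star" for p v
  unfolding \<psi> matrix_vector_right_distrib sq[OF that] matrix_scale_vec by (simp add: vec_eq_iff power2_eq_square algebra_simps)
 have \<psi>F: "\<psi> (F p) *v (A p *v v) = \<Lambda> *s (A p *v (\<psi> p *v v))" if "p : C2_star" for p v
  unfolding \<psi> \<phi>_F[OF that] matrix_vector_right_distrib matrix_scale_vec
  by (simp add: ln vec_eq_iff power_mult_distrib algebra_simps)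
 have \<psi>loc: "local_section E U (%p. \<psi> p *v s p)" if "local_section E U s" "U <= C2_star" for U s
  unfolding \<psi> by (rule local_section_add[OF \<phi>_local[OF that] local_section_scale[OF that(1) holo_monomial]])
 have \<Lambda>0: "\<Lambda> ~= 0" by simp
 have "EX \<mu> s. \<mu> ~= 0 & esec E \<mu> s & (EX p:C2_star. s p ~= 0) & (ALL p:C2_star. \<phi> p *v s p = (\<delta> * snd p ^ n) *s s p)"
 proof (cases "EX p:C2_star. \<psi> p *v i p ~= 0")
  case True
  have "A p *v (\<psi> p *v i p) = (\<sigma> / \<Lambda>) *s (\<psi> (F p) *v i (F p))" if p: "p : C2_star" for p
  proof -
   have "\<Lambda> *s (A p *v (\<psi> p *v i p)) = \<Lambda> *s ((\<sigma> / \<Lambda>) *s (\<psi> (F p) *v i (F p)))"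
    using \<psi>F[OF p, of "i p"] by (simp add: i_F[OF p] matrix_scale_vec vector_smult_assoc)
   thus ?thesis unfolding vector_mul_lcancel by simp
  qed
  hence "esec E (\<sigma> / \<Lambda>) (%p. \<psi> p *v i p)" using \<psi>loc[OF i_local] by (simp add: esec_def)
  thus ?thesis using True \<phi>\<psi> \<sigma>0 by (intro exI[of _ "\<sigma> / \<Lambda>"] exI[of _ "%p. \<psi> p *v i p"]) simp
 next
  case False
  have "EX v. R p v = 1" if "p : C2_star" for p by (rule R_surj[OF that]) blast
  then obtain e where e: "!!p. p : C2_star ==> R p (e p) = 1" by metis
  \<comment> \<open>Independent of the lift, because \<psi> kills i; comparison with local
    holomorphic lifts shows that it is holomorphic although e is arbitrary.\<close>
  define \<xi> where "\<xi> p = \<psi> p *v e p" for p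
  have \<xi>: "\<psi> p *v v = R p v *s \<xi> p" if p: "p : C2_star" for p v
  proof -
   have "R p (v - R p v *s e p) = 0" unfolding R_diff R_scale e[OF p] by simp
   then obtain c where "v - R p v *s e p = c *s i p" by (rule R_ker[OF p])
   hence "v = R p v *s e p + c *s i p" by (simp add: algebra_simps)
   hence "\<psi> p *v v = R p v *s \<xi> p + c *s (\<psi> p *v i p)"
    by (metis \<xi>_def matrix_vector_right_distrib matrix_scale_vec)
   thus ?thesis using False p by simp
  qed
  have loc: "local_section E C2_star \<xi>"
  proof (rule local_sectionI)
   fix p V f assume p: "p : C2_star" "(V, f) : frames E" "p : V"
   obtain W e' where W: "open W" "p : W" "W <= C2_star" "local_section E W e'" "ALL q:W. R q (e' q) = 1"
    by (rule local_lift[OF p(1)])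
   have "local_section E W \<xi>"
    by (rule local_section_cong[OF \<psi>loc[OF W(4,3)] W(1)]) (use \<xi> W(3,5) in auto)
   from local_sectionD[OF this W(2) p(2,3)] show "vec_at (%q. matrix_inv (f q) *v \<xi> q) p" .
  qed
  have "A p *v \<xi> p = (\<tau> / \<Lambda>) *s \<xi> (F p)" if p: "p : C2_star" for p
  proof -
   have Fp: "F p : C2_star" using p by simp
   have "\<Lambda> *s (A p *v \<xi> p) = \<psi> (F p) *v (A p *v e p)" unfolding \<xi>_def \<psi>F[OF p] ..
   also have "\<dots> = \<tau> *s \<xi> (F p)" unfolding \<xi>[OF Fp] R_F[OF p] e[OF p] by simp
   finally have "\<Lambda> *s (A p *v \<xi> p) = \<Lambda> *s ((\<tau> / \<Lambda>) *s \<xi> (F p))" by (simp add: vector_smult_assoc)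
   thus ?thesis unfolding vector_mul_lcancel by simp
  qed
  hence "esec E (\<tau> / \<Lambda>) \<xi>" using loc by (simp add: esec_def)
  moreover have "EX p:C2_star. \<xi> p ~= 0"
  proof (rule ccontr)
   assume "~ ?thesis"
   moreover have p: "(0, 1) : C2_star" by (simp add: C2_star_def)
   ultimately have "\<psi> (0, 1) *v v = 0 *v v" for v using \<xi>[OF p, of v] by simp
   hence "\<psi> (0, 1) = 0" by (rule mat_eqI_vec)
   hence "\<phi> (0, 1) = mat (- \<delta>)" by (simp add: \<psi>_def vec_eq_iff forall_2 eq_neg_iff_add_eq_0)
   thus False using trace_zero_neq_mat[OF \<phi>_trace[OF p] \<phi>0[OF p]] by blast
  qed
  moreover have "\<phi> p *v \<xi> p = (\<delta> * snd p ^ n) *s \<xi> p" if "p : C2_star" for p unfolding \<xi>_def by (rule \<phi>\<psi>[OF that])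
  ultimately show ?thesis using \<tau>0 by (intro exI[of _ "\<tau> / \<Lambda>"] exI[of _ \<xi>]) simp
 qed
 then obtain \<mu> s where s: "esec E \<mu> s" "\<mu> ~= 0" "EX p:C2_star. s p ~= 0" "!!p. p : C2_star ==> \<phi> p *v s p = (\<delta> * snd p ^ n) *s s p" by blast
 show ?thesis using eigensection_saturation[OF s] that by blast
qed

lemma higgs_isoI:
 assumes "bundle_iso b r (TB B) E (%p. cols (u p) (v p))"
  "!!p. p : C2_star ==> \<phi> p *v u p = \<Phi> p $ 1 $ 1 *s u p + \<Phi> p $ 2 $ 1 *s v p"
  "!!p. p : C2_star ==> \<phi> p *v v p = \<Phi> p $ 1 $ 2 *s u p + \<Phi> p $ 2 $ 2 *s v p"
 shows "higgs_iso b r (TB B) \<Phi> E \<phi>"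
 unfolding higgs_iso_def using assms(1) cols_intertwine[OF assms(2,3)] by blast

text \<open>E is presented with sub-line u, the kernel of \<phi> - \<delta> y^n. The other
  eigensection z projects to y^n in the quotient, so its jet along y = 0 yields the model frame. The
  exponent k may come out negative; then the roles of u and z have to be exchanged.\<close>

lemma distinct_eigenvalues:
 assumes \<delta>: "\<delta> ~= 0" and n: "l = int n" "1 <= n" "n <= r"
  and u: "\<mu> ~= 0" "esec E \<mu> u" "!!p. p : C2_star ==> u p ~= 0" "!!p. p : C2_star ==> \<phi> p *v u p = (\<delta> * snd p ^ n) *s u p"
  and z: "\<mu>' ~= 0" "esec E \<mu>' z" "!!p. p : C2_star ==> z p ~= 0" "!!p. p : C2_star ==> \<phi> p *v z p = (- \<delta> * snd p ^ n) *s z p"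
 obtains k where "\<mu> = b powi (int r * k) * \<mu>'" "k >= 0 ==> higgs_iso b r (TB (MB \<mu> (nat k) n)) (%p. mat \<delta> ** model_higgs (nat k) n p) E \<phi>"
proof -
 let ?P = "%p. \<delta> * snd p ^ n"
 have sq: "\<phi> p *v (\<phi> p *v v) = (?P p)\<^sup>2 *s v" if "p : C2_star" for p v
  by (rule trace_zero_square[OF \<phi>_trace[OF that] u(3,4)[OF that]])
 define \<psi> where "\<psi> p = \<phi> p - mat (?P p)" for p
 have \<psi>: "\<psi> p *v v = \<phi> p *v v + (- ?P p) *s v" for p v
  unfolding \<psi>_def matrix_vector_mult_diff_rdistrib mat_mult_vec by (simp add: vec_eq_iff)
 \<comment> \<open>\<psi> z = -2 \<delta> y^n z; this factor makes z project to exactly y^n.\<close>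
 define w where "w p = (- 2 * \<delta>) *s z p" for p
 obtain \<kappa> where ext: "hopf_extension b r E \<mu> (\<Lambda> * \<mu>') (%p. incl (u p $ 1) (u p $ 2)) \<kappa>"
  and \<kappa>: "!!p v. p : C2_star ==> \<psi> p *v v = (\<kappa> p *v v) $ 1 *s w p"
 proof (rule kernel_extension[of \<psi> w \<mu>' \<mu> u])
  show "\<psi> (F p) *v (A p *v v) = \<Lambda> *s (A p *v (\<psi> p *v v))" if "p : C2_star" for p v
   unfolding \<psi> \<phi>_F[OF that] matrix_vector_right_distrib matrix_scale_vec
   by (simp add: n(1) vec_eq_iff power_mult_distrib algebra_simps)
  show "local_section E U (%p. \<psi> p *v s p)" if "U <= C2_star" "local_section E U s" for U s
   unfolding \<psi> by (rule local_section_add[OF \<phi>_local[OF that(2,1)] local_section_scale[OF that(2) holo2_at_minus[OF holo_monomial]]])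
  show "\<psi> p ~= 0" if "p : C2_star" for p
   using trace_zero_neq_mat[OF \<phi>_trace[OF that] \<phi>0[OF that]] by (simp add: \<psi>_def)
  show "EX c. \<psi> p *v v = c *s w p" if p: "p : C2_star" for p v
  proof -
   have "\<phi> p *v (\<psi> p *v v) = (- \<delta> * snd p ^ n) *s (\<psi> p *v v)"
    unfolding \<psi> matrix_vector_right_distrib sq[OF p] matrix_scale_vec by (simp add: vec_eq_iff power2_eq_square algebra_simps)
   from tracefree_eq_line[OF \<phi>_trace[OF p] \<phi>0[OF p] z(3,4)[OF p] this]
   obtain d where "\<psi> p *v v = d *s z p" .
   thus ?thesis using \<delta> by (intro exI[of _ "d / (- 2 * \<delta>)"]) (simp add: w_def vector_smult_assoc)
  qed
  show "esec E \<mu>' w" unfolding w_def by (rule esec_scale[OF z(2)])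
  show "w p ~= 0" if "p : C2_star" for p using z(3)[OF that] \<delta> by (simp add: w_def)
  show "u p ~= 0 & \<psi> p *v u p = 0" if "p : C2_star" for p using u(3,4)[OF that] by (simp add: \<psi> vec_eq_iff)
 qed (use u z in blast)+
 interpret K: hopf_extension b r E \<mu> "\<Lambda> * \<mu>'" "%p. incl (u p $ 1) (u p $ 2)" \<kappa> by (rule ext)
 have Kz: "K.R p (z p) = snd p ^ n" if p: "p : C2_star" for p
 proof -
  have "(K.R p (z p) * (- 2 * \<delta>)) *s z p = \<psi> p *v z p" unfolding \<kappa>[OF p] w_def vector_smult_assoc ..
  also have "\<dots> = (snd p ^ n * (- 2 * \<delta>)) *s z p" unfolding \<psi> z(4)[OF p] by (simp add: vec_eq_iff algebra_simps)
  finally show ?thesis using z(3)[OF p] \<delta> unfolding vector_mul_rcancel by simp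
 qed
 obtain k c where k: "\<mu> = b powi (int r * k) * \<mu>'" "c ~= 0"
  and ex: "k >= 0 ==> EX e. local_section E C2_star e & bundle_iso b r (TB (MB \<mu> (nat k) n)) E (%p. cols (c *s K.i p) (e p)) &
   (ALL p:C2_star. z p = fst p ^ nat k *s (c *s K.i p) + snd p ^ n *s e p & K.R p (e p) = 1)"
  using K.jet_frame[OF z(2,1,3) Kz n(2,3)] by blast
 have "higgs_iso b r (TB (MB \<mu> (nat k) n)) (%p. mat \<delta> ** model_higgs (nat k) n p) E \<phi>" if k0: "k >= 0"
 proof -
  obtain e where e: "local_section E C2_star e" "bundle_iso b r (TB (MB \<mu> (nat k) n)) E (%p. cols (c *s u p) (e p))"
   and ze: "!!p. p : C2_star ==> z p = fst p ^ nat k *s (c *s u p) + snd p ^ n *s e p"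
   using ex[OF k0] unfolding column_incl_eta by blast
  have uloc: "local_section E C2_star u" using u(2) by (simp add: esec_def)
  show ?thesis
  proof (rule higgs_isoI[OF e(2)])
   fix p assume p: "p : C2_star"
   show "\<phi> p *v (c *s u p) = (mat \<delta> ** model_higgs (nat k) n p) $ 1 $ 1 *s (c *s u p) + (mat \<delta> ** model_higgs (nat k) n p) $ 2 $ 1 *s e p"
    by (simp add: model_higgs_def matrix_scale_vec u(4)[OF p] vector_smult_assoc mult.commute)
   have "\<phi> p *v e p = (- 2 * \<delta> * fst p ^ nat k) *s (c *s u p) + (- ?P p) *s e p"
   proof (rule eigen_eq_on_axis[OF e(1) _ _ p])
    show "local_section E C2_star (%p. (- 2 * \<delta> * fst p ^ nat k) *s (c *s u p) + (- ?P p) *s e p)"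
     by (rule local_section_add[OF local_section_scale[OF local_section_scale[OF uloc holo2_at_const] holo2_at_mult[OF holo2_at_const holo2_at_power[OF holo2_at_fst]]]
        local_section_scale[OF e(1) holo2_at_minus[OF holo_monomial]]])
    fix q assume q: "q : C2_star" "snd q ~= 0"
    have "snd q ^ n *s (\<phi> q *v e q) = \<phi> q *v (z q - fst q ^ nat k *s (c *s u q))"
     unfolding ze[OF q(1)] by (simp add: matrix_scale_vec)
    also have "\<dots> = (- \<delta> * snd q ^ n) *s z q - fst q ^ nat k *s (c *s (?P q *s u q))"
     unfolding matrix_vector_mult_diff_distrib matrix_scale_vec z(4)[OF q(1)] u(4)[OF q(1)] ..
    also have "\<dots> = snd q ^ n *s ((- 2 * \<delta> * fst q ^ nat k) *s (c *s u q) + (- ?P q) *s e q)"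
     unfolding ze[OF q(1)] by (simp add: vec_eq_iff algebra_simps)
    finally show "\<phi> q *v e q = (- 2 * \<delta> * fst q ^ nat k) *s (c *s u q) + (- ?P q) *s e q"
     using q(2) unfolding vector_mul_lcancel by simp
   qed
   thus "\<phi> p *v e p = (mat \<delta> ** model_higgs (nat k) n p) $ 1 $ 2 *s (c *s u p) + (mat \<delta> ** model_higgs (nat k) n p) $ 2 $ 2 *s e p"
    by (simp add: model_higgs_def vec_eq_iff algebra_simps)
  qed
 qed
 thus ?thesis using that k(1) by blast
qed

text \<open>Minus the determinant of \<phi> is 0 or a nonzero multiple of y^(2l). If it is nonzero
  there are two eigensections: for l = 0 they split E, for l >= 1 their jets give the model. If it
  is 0, the image of \<phi> is its kernel line L \<mu>, so E is an extension of L(\<Lambda> \<mu>)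
  by L \<mu> and the splitting theorem applies.\<close>

theorem higgs_normal_form:
 "(l = 0 & (EX \<sigma> \<tau> \<delta>. \<sigma> ~= 0 & \<tau> ~= 0 & \<delta> ~= 0 & higgs_iso b r (TB (%_. mat2 \<sigma> 0 0 \<tau>)) (%_. mat2 \<delta> 0 0 (- \<delta>)) E \<phi>)) \<or>
 (1 <= l & (EX \<sigma> k \<delta>. \<sigma> ~= 0 & \<delta> ~= 0 & higgs_iso b r (TB (MB \<sigma> k (nat l))) (%p. mat \<delta> ** model_higgs k (nat l) p) E \<phi>)) \<or>
 (EX \<sigma>. \<sigma> ~= 0 & higgs_iso b r (TB (%_. mat2 \<sigma> 0 0 (\<sigma> * b powi l))) (%_. mat2 0 1 0 0) E \<phi>) \<or>
 (EX \<sigma> k a \<beta>. \<sigma> ~= 0 & \<beta> ~= 0 & 1 <= k & 1 <= a & a <= r & l = int a - int (r * k) &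
   higgs_iso b r (TB (MB \<sigma> k a)) (%_. mat2 0 \<beta> 0 0) E \<phi>)"
proof -
 define q where "q p = (\<phi> p $ 1 $ 1)\<^sup>2 + \<phi> p $ 1 $ 2 * \<phi> p $ 2 $ 1" for p
 have sq: "\<phi> p *v (\<phi> p *v v) = q p *s v" if "p : C2_star" for p v
  unfolding q_def by (rule trace_zero_mult[OF \<phi>_trace[OF that]])
 have holq: "holo2_at q p" if "p : C2_star" for p
  by (rule holo2_at_ratio[OF E \<phi>_local[OF \<phi>_local[OF i_local order_refl] order_refl] i_local open_C2_star order_refl that])
   (use sq i0 in blast)
 have qF: "1 * q (F p) = \<Lambda>\<^sup>2 * q p" if p: "p : C2_star" for p
 proof -
  have Fp: "F p : C2_star" using p by simp
  have "q (F p) *s (A p *v i p) = \<phi> (F p) *v (\<phi> (F p) *v (A p *v i p))" by (simp only: sq[OF Fp])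
  also have "\<dots> = \<Lambda> *s (\<Lambda> *s (A p *v (q p *s i p)))" by (simp only: \<phi>_F[OF p] matrix_scale_vec sq[OF p])
  also have "\<dots> = (\<Lambda>\<^sup>2 * q p) *s (A p *v i p)"
   by (simp only: matrix_scale_vec vector_smult_assoc power2_eq_square mult_ac)
  finally have "q (F p) *s (A p *v i p) = (\<Lambda>\<^sup>2 * q p) *s (A p *v i p)" .
  moreover have "A p *v i p ~= 0" using invertible_mult_vec_eq_0[OF factor_invertible[OF E p]] i0[OF p] by blast
  ultimately show ?thesis unfolding vector_mul_rcancel by simp
 qed
 have \<Lambda>2: "\<Lambda>\<^sup>2 = b powi (2 * l)" by (simp only: power2_eq_square mult_2 power_int_add[OF disjI1[OF b0]])
 have "(ALL p:C2_star. q p = 0) \<or> (EX n c. c ~= 0 & \<Lambda>\<^sup>2 = 1 * b ^ n & (ALL p:C2_star. q p = c * snd p ^ n))"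
  by (rule section_ratio[OF holq one_neq_zero qF])
 thus ?thesis
 proof (elim disjE exE conjE)
  fix N c assume c: "c ~= 0" "\<Lambda>\<^sup>2 = 1 * b ^ N" "ALL p:C2_star. q p = c * snd p ^ N"
  have "b powi (2 * l) = b powi (int N)" using c(2) \<Lambda>2 by simp
  hence N: "2 * l = int N" by (rule powi_b_inject)
  define n where "n = nat l"
  have n: "l = int n" "N = 2 * n" "n <= r" using N l_le by (auto simp: n_def)
  define \<delta> where "\<delta> = csqrt c"
  have \<delta>: "\<delta> ~= 0" "\<delta>\<^sup>2 = c" using c(1) by (auto simp: \<delta>_def)
  have sq1: "\<phi> p *v (\<phi> p *v v) = (\<delta> * snd p ^ n)\<^sup>2 *s v" and sq2: "\<phi> p *v (\<phi> p *v v) = (- \<delta> * snd p ^ n)\<^sup>2 *s v"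
   if "p : C2_star" for p v
   using sq[OF that] c(3) that by (simp_all add: power_mult_distrib \<delta>(2) n(2) power_mult[symmetric] mult.commute)
  obtain \<mu> u where u: "\<mu> ~= 0" "esec E \<mu> u" "!!p. p : C2_star ==> u p ~= 0" "!!p. p : C2_star ==> \<phi> p *v u p = (\<delta> * snd p ^ n) *s u p"
   using eigensection[OF \<delta>(1) n(1) sq1] by blast
  have md: "- \<delta> ~= 0" using \<delta> by simp
  obtain \<mu>' z where z: "\<mu>' ~= 0" "esec E \<mu>' z" "!!p. p : C2_star ==> z p ~= 0" "!!p. p : C2_star ==> \<phi> p *v z p = (- \<delta> * snd p ^ n) *s z p"
   using eigensection[OF md n(1) sq2] by blast
  show ?thesis
  proof (cases "n = 0")
   case True
   have loc: "local_section E C2_star u" "local_section E C2_star z" using u(2) z(2) by (auto simp: esec_def)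
   have "bundle_iso b r (TB (%_. mat2 \<mu> 0 0 \<mu>')) E (%p. cols (u p) (z p))"
   proof (rule frame_iso[OF E loc])
    fix p x y assume p: "p : C2_star" and e: "x *s u p + y *s z p = 0"
    have "\<phi> p *v (x *s u p + y *s z p) = \<delta> *s (x *s u p - y *s z p)"
     unfolding matrix_vector_right_distrib matrix_scale_vec u(4)[OF p] z(4)[OF p] True by (simp add: vec_eq_iff algebra_simps)
    hence "\<delta> *s (x *s u p - y *s z p) = 0" unfolding e matrix_vector_mult_0_right by (rule sym)
    hence "x *s u p - y *s z p = 0" using \<delta>(1) unfolding vector_mul_eq_0 by blast
    hence "x *s u p = y *s z p" by simp
    hence "x *s u p = 0" "y *s z p = 0" using e by (simp_all add: vec_eq_iff)
    thus "x = 0 & y = 0" using u(3)[OF p] z(3)[OF p] by simp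
   qed (use u(2) z(2) in \<open>auto simp: esec_def\<close>)
   hence "higgs_iso b r (TB (%_. mat2 \<mu> 0 0 \<mu>')) (%_. mat2 \<delta> 0 0 (- \<delta>)) E \<phi>"
    by (rule higgs_isoI) (use u(4) z(4) True in auto)
   thus ?thesis using u(1) z(1) \<delta>(1) n(1) True by auto
  next
   case False
   hence n1: "1 <= n" by simp
   have u': "\<phi> p *v u p = (- (- \<delta>) * snd p ^ n) *s u p" if "p : C2_star" for p using u(4)[OF that] by simp
   obtain k where k: "\<mu> = b powi (int r * k) * \<mu>'" "k >= 0 ==> higgs_iso b r (TB (MB \<mu> (nat k) n)) (%p. mat \<delta> ** model_higgs (nat k) n p) E \<phi>"
    using distinct_eigenvalues[OF \<delta>(1) n(1) n1 n(3) u z] by blast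
   obtain k' where k': "\<mu>' = b powi (int r * k') * \<mu>" "k' >= 0 ==> higgs_iso b r (TB (MB \<mu>' (nat k') n)) (%p. mat (- \<delta>) ** model_higgs (nat k') n p) E \<phi>"
    using distinct_eigenvalues[OF md n(1) n1 n(3) z u(1,2,3) u'] by blast
   \<comment> \<open>The jets of z along u and of u along z have opposite exponents, so one of the
     two is nonnegative.\<close>
   have "b powi (int r * k + int r * k') = b powi 0"
    using k(1) k'(1) u(1) by (simp add: power_int_add)
   hence "int r * k + int r * k' = 0" by (rule powi_b_inject)
   hence "int r * (k + k') = 0" by (simp add: algebra_simps)
   hence "k' = - k" using r by auto
   then consider "k >= 0" | "k' >= 0" by linarith
   thus ?thesis
   proof cases
    case 1
    hence "1 <= l & \<mu> ~= 0 & \<delta> ~= 0 &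
      higgs_iso b r (TB (MB \<mu> (nat k) (nat l))) (%p. mat \<delta> ** model_higgs (nat k) (nat l) p) E \<phi>"
     using k(2) u(1) \<delta>(1) n1 by (simp add: n(1))
    thus ?thesis by blast
   next
    case 2
    hence "1 <= l & \<mu>' ~= 0 & - \<delta> ~= 0 &
      higgs_iso b r (TB (MB \<mu>' (nat k') (nat l))) (%p. mat (- \<delta>) ** model_higgs (nat k') (nat l) p) E \<phi>"
     using k'(2) z(1) md n1 by (simp add: n(1))
    thus ?thesis by blast
   qed
  qed
 next
  assume q0: "ALL p:C2_star. q p = 0"
  have \<phi>\<phi>: "\<phi> p *v (\<phi> p *v v) = 0" if "p : C2_star" for p v using sq[OF that] q0 that by simp
  obtain \<mu> z where z: "\<mu> ~= 0" "esec E \<mu> z" "!!p. p : C2_star ==> z p ~= 0" "!!p. p : C2_star ==> \<phi> p *v z p = 0"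
  proof (cases "EX p:C2_star. \<phi> p *v i p ~= 0")
   case True
   have "A p *v (\<phi> p *v i p) = (\<sigma> / \<Lambda>) *s (\<phi> (F p) *v i (F p))" if p: "p : C2_star" for p
   proof -
    have "\<Lambda> *s (A p *v (\<phi> p *v i p)) = \<Lambda> *s ((\<sigma> / \<Lambda>) *s (\<phi> (F p) *v i (F p)))"
     using \<phi>_F[OF p, of "i p"] by (simp add: i_F[OF p] matrix_scale_vec vector_smult_assoc)
    thus ?thesis unfolding vector_mul_lcancel by simp
   qed
   hence "esec E (\<sigma> / \<Lambda>) (%p. \<phi> p *v i p)" using \<phi>_local[OF i_local] by (simp add: esec_def)
   moreover have "\<sigma> / \<Lambda> ~= 0" using \<sigma>0 by simp
   ultimately obtain \<mu> \<zeta> where "\<mu> ~= 0" "esec E \<mu> \<zeta>" "!!p. p : C2_star ==> \<zeta> p ~= 0" "!!p. p : C2_star ==> \<phi> p *v \<zeta> p = (0 * snd p ^ 0) *s \<zeta> p"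
    using eigensection_saturation[of "\<sigma> / \<Lambda>" "%p. \<phi> p *v i p" 0 0] True \<phi>\<phi> by auto
   thus ?thesis using that[of \<mu> \<zeta>] by simp
  next
   case False
   thus ?thesis using that[of \<sigma> i] \<sigma>0 esec_i i0 by blast
  qed
  have zloc: "local_section E C2_star z" using z(2) by (simp add: esec_def)
  obtain \<kappa> where ext: "hopf_extension b r E \<mu> (\<Lambda> * \<mu>) (%p. incl (z p $ 1) (z p $ 2)) \<kappa>"
   and \<kappa>: "!!p v. p : C2_star ==> \<phi> p *v v = (\<kappa> p *v v) $ 1 *s z p"
  proof (rule kernel_extension[of \<phi> z \<mu> \<mu> z])
   show "EX c. \<phi> p *v v = c *s z p" if p: "p : C2_star" for p v
    using kernel_2[OF \<phi>0[OF p] z(3,4)[OF p] \<phi>\<phi>[OF p]] by metis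
  qed (use \<phi>_F \<phi>_local \<phi>0 z in blast)+
  interpret K: hopf_extension b r E \<mu> "\<Lambda> * \<mu>" "%p. incl (z p $ 1) (z p $ 2)" \<kappa> by (rule ext)
  \<comment> \<open>Euclidean division of l - 1 by r writes l <= 0 as a - r k with 1 <= a <= r and k
    >= 1.\<close>
  obtain k a where ka: "l >= 1 \<or> 1 <= k & 1 <= a & a <= r & l = int a - int (r * k)"
  proof (cases "l >= 1")
   case False
   define m where "m = (l - 1) mod int r"
   define d where "d = (l - 1) div int r"
   have m: "0 <= m" "m < int r" "l - 1 = int r * d + m" using r by (simp_all add: m_def d_def)
   have "d < 0" using False r by (simp add: d_def neg_imp_zdiv_neg_iff[symmetric] pos_imp_zdiv_neg_iff)
   thus ?thesis using m by (intro that[of "nat (- d)" "nat (m + 1)"]) auto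
  qed (use that in blast)
  \<comment> \<open>\<open>c\<close> is the coefficient of the cocycle: for c = 0 the bundle splits,
    otherwise replacing z by c z gives the model extension, and the Higgs field acquires the entry 1
    / c.\<close>
  obtain e c where e: "local_section E C2_star e" "l >= 1 ==> c = 0" and Re: "!!p. p : C2_star ==> K.R p (e p) = 1"
   and eF: "!!p. p : C2_star ==> A p *v e p = (\<Lambda> * \<mu>) *s e (F p) + (\<mu> * c * cocycle k a p) *s z (F p)"
   using K.splitting[OF mult.commute l_le ka] unfolding column_incl_eta by blast
  have \<phi>e: "\<phi> p *v e p = z p" if "p : C2_star" for p using \<kappa>[OF that, of "e p"] Re[OF that] by simp
  have indep: "x = 0 & y = 0" if p: "p : C2_star" and d: "d ~= 0" and s: "x *s (d *s z p) + y *s e p = 0" for p x y d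
  proof -
   have "\<phi> p *v (x *s (d *s z p) + y *s e p) = y *s z p"
    unfolding matrix_vector_right_distrib matrix_scale_vec z(4)[OF p] \<phi>e[OF p] by simp
   hence "y = 0" using z(3)[OF p] unfolding s by simp
   thus ?thesis using s z(3)[OF p] d by (simp add: vector_smult_assoc)
  qed
  show ?thesis
  proof (cases "c = 0")
   case True
   have "bundle_iso b r (TB (%_. mat2 \<mu> 0 0 (\<mu> * b powi l))) E (%p. cols (z p) (e p))"
    by (rule frame_iso[OF E zloc e(1)])
     (use indep[of _ 1] z(2) eF True in \<open>auto simp: esec_def mult.commute\<close>)
   hence "higgs_iso b r (TB (%_. mat2 \<mu> 0 0 (\<mu> * b powi l))) (%_. mat2 0 1 0 0) E \<phi>"
    by (rule higgs_isoI) (use z(4) \<phi>e in auto)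
   thus ?thesis using z(1) by blast
  next
   case False
   hence ka': "1 <= k" "1 <= a" "a <= r" "l = int a - int (r * k)" using e(2) ka by auto
   have "bundle_iso b r (TB (MB \<mu> k a)) E (%p. cols (c *s z p) (e p))"
   proof (rule frame_iso[OF E local_section_scale[OF zloc holo2_at_const] e(1)])
    show "x = 0 & y = 0" if "p : C2_star" "x *s (c *s z p) + y *s e p = 0" for p x y
     using indep[OF that(1) False that(2)] .
    fix p assume p: "p : C2_star"
    show "A p *v (c *s z p) = MB \<mu> k a p $ 1 $ 1 *s (c *s z (F p)) + MB \<mu> k a p $ 2 $ 1 *s e (F p)"
     using z(2) p by (simp add: MB_def matrix_scale_vec esec_def vector_smult_assoc mult.commute)
    show "A p *v e p = MB \<mu> k a p $ 1 $ 2 *s (c *s z (F p)) + MB \<mu> k a p $ 2 $ 2 *s e (F p)"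
     unfolding eF[OF p] MB_def mat2_nth ka'(4)[symmetric] by (simp add: vec_eq_iff algebra_simps)
   qed
   hence "higgs_iso b r (TB (MB \<mu> k a)) (%_. mat2 0 (1 / c) 0 0) E \<phi>"
    by (rule higgs_isoI) (use z(4) \<phi>e False in \<open>auto simp: matrix_scale_vec vector_smult_assoc\<close>)
   hence "\<mu> ~= 0 & 1 / c ~= 0 & 1 <= k & 1 <= a & a <= r & l = int a - int (r * k) &
     higgs_iso b r (TB (MB \<mu> k a)) (%_. mat2 0 (1 / c) 0 0) E \<phi>"
    using z(1) False ka' by simp
   thus ?thesis by blast
  qed
 qed
qed

end

section \<open>Normalized bundles and the final classification\<close>

context hopf
begin

section \<open>Multipliers allowed by normalization\<close>

lemma vec_at_incl: "vec_at (%p. column 1 (incl (f p) (g p))) p \<longleftrightarrow> holo2_at f p & holo2_at g p"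
 by (simp add: vec_at_def forall_2)

lemma extension_upper:
 assumes "\<sigma> ~= 0" "\<tau> ~= 0" "!!p. p : C2_star ==> holo2_at g p"
 shows "extension b r \<sigma> (TB (%p. mat2 \<sigma> (g p) 0 \<tau>)) \<tau> (%_. incl 1 0) (%_. row2 0 1)"
 unfolding extension_iff bundle_hom_L_iff esec_TB bundle_hom_trivial[OF TB_simps(2) L_simps(2)]
 using assms
 by (auto simp: vec_at_incl vec_eq_iff forall_1 forall_2 mult_vec_2 mat_at_def matrix_matrix_mult_def sum_2 mat_def)

text \<open>A nonzero second component is a section relating \<mu> to \<tau>; if it vanishes, the
  first component relates \<mu> to \<sigma>.\<close>

lemma esec_upper:
 assumes g: "!!p. p : C2_star ==> holo2_at g p" and s: "esec (TB (%p. mat2 \<sigma> (g p) 0 \<tau>)) \<mu> s" "\<mu> ~= 0" "EX p:C2_star. s p ~= 0"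
 obtains n where "\<sigma> = \<mu> * b ^ n \<or> \<tau> = \<mu> * b ^ n"
proof -
 have h: "holo2_at (%p. s p $ j) p" if "p : C2_star" for p j using s(1) that by (auto simp: esec_TB vec_at_def)
 have e: "\<mu> * s (F p) $ 2 = \<tau> * s p $ 2" "\<mu> * s (F p) $ 1 = \<sigma> * s p $ 1 + g p * s p $ 2" if "p : C2_star" for p
  using s(1) that by (auto simp: esec_TB vec_eq_iff forall_2 mult_vec_2)
 have "(ALL p:C2_star. s p $ 2 = 0) \<or> (EX n c. c ~= 0 & \<tau> = \<mu> * b ^ n & (ALL p:C2_star. s p $ 2 = c * snd p ^ n))"
  by (rule section_ratio[OF h s(2) e(1)])
 thus ?thesis
 proof
  assume z: "ALL p:C2_star. s p $ 2 = 0"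
  have e1: "\<mu> * s (F p) $ 1 = \<sigma> * s p $ 1" if "p : C2_star" for p using e(2)[OF that] z that by simp
  have "~ (ALL p:C2_star. s p $ 1 = 0)" using s(3) z by (auto simp: vec_eq_iff forall_2)
  thus ?thesis using section_ratio[OF h s(2) e1] that by blast
 qed (use that in blast)
qed

lemma normalized_upper:
 assumes g: "!!p. p : C2_star ==> holo2_at g p" and \<eta>: "\<eta> ~= 0" "deg_L b \<eta> <= 0"
 shows "normalized_extension b r (TB (%p. mat2 1 (g p) 0 \<eta>))"
 unfolding normalized_iff
proof (intro conjI allI impI; (elim conjE)?)
 show "holo_bundle b r (TB (%p. mat2 1 (g p) 0 \<eta>))" by (rule holo_bundle_upper) (use \<eta> g in auto)
 have ext: "extension b r 1 (TB (%p. mat2 1 (g p) 0 \<eta>)) \<eta> (%_. incl 1 0) (%_. row2 0 1)"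
  by (rule extension_upper) (use \<eta> g in auto)
 thus "EX \<sigma> \<tau> \<iota> \<rho>. extension b r \<sigma> (TB (%p. mat2 1 (g p) 0 \<eta>)) \<tau> \<iota> \<rho>" by blast
 have "(1, 0) : C2_star" by (simp add: C2_star_def)
 thus "EX s. esec (TB (%p. mat2 1 (g p) 0 \<eta>)) 1 s & (EX p:C2_star. s p ~= 0)"
  using ext unfolding extension_iff bundle_hom_L_iff by blast
 fix \<mu> s assume "\<mu> ~= 0" "esec (TB (%p. mat2 1 (g p) 0 \<eta>)) \<mu> s" "EX p:C2_star. s p ~= 0"
 then obtain n where "1 = \<mu> * b ^ n \<or> \<eta> = \<mu> * b ^ n" using esec_upper[OF g] by blast
 hence "deg_L b 1 = deg_L b \<mu> + n \<or> deg_L b \<eta> = deg_L b \<mu> + n"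
  using deg_mult[OF \<open>\<mu> ~= 0\<close>, of "b ^ n"] by (auto simp: deg_power)
 thus "deg_L b \<mu> <= 0" using \<eta>(2) by (auto simp: deg_one)
qed

lemma normalized_upper_necessary:
 assumes n: "normalized_extension b r (TB (%p. mat2 \<sigma> (g p) 0 \<tau>))" and g: "!!p. p : C2_star ==> holo2_at g p"
  and \<sigma>: "\<sigma> ~= 0" "\<tau> ~= 0"
 shows "deg_L b \<sigma> <= 0" "(ALL p:C2_star. g p = 0) ==> deg_L b \<tau> <= 0" "EX n. \<sigma> = b ^ n \<or> \<tau> = b ^ n"
proof -
 let ?B = "TB (%p. mat2 \<sigma> (g p) 0 \<tau>)"
 have deg: "deg_L b \<mu> <= 0" if "\<mu> ~= 0" "esec ?B \<mu> (%_. column 1 (incl x y))" "x ~= 0 \<or> y ~= 0" for \<mu> x y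
 proof -
  have "(1, 0) : C2_star" by (simp add: C2_star_def)
  moreover have "column 1 (incl x y) ~= 0" using that(3) by (auto simp: vec_eq_iff forall_2)
  ultimately show ?thesis using n that(1,2) unfolding normalized_iff by blast
 qed
 show "deg_L b \<sigma> <= 0"
  by (rule deg[of _ 1 0]) (use \<sigma> in \<open>auto simp: esec_TB vec_at_incl vec_eq_iff forall_2 mult_vec_2\<close>)
 show "deg_L b \<tau> <= 0" if "ALL p:C2_star. g p = 0"
  by (rule deg[of _ 0 1]) (use \<sigma> that in \<open>auto simp: esec_TB vec_at_incl vec_eq_iff forall_2 mult_vec_2\<close>)
 obtain s where s: "esec ?B 1 s" "EX p:C2_star. s p ~= 0" using n unfolding normalized_iff by blast
 show "EX n. \<sigma> = b ^ n \<or> \<tau> = b ^ n" by (rule esec_upper[OF g s(1) _ s(2)]) auto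
qed

lemma normalized_diag:
 assumes "normalized_extension b r (TB (%_. mat2 \<sigma> 0 0 \<tau>))" "\<sigma> ~= 0" "\<tau> ~= 0"
 shows "deg_L b \<sigma> <= 0" "deg_L b \<tau> <= 0" "\<sigma> = 1 \<or> \<tau> = 1"
proof -
 note * = normalized_upper_necessary[OF assms(1) _ assms(2,3), simplified]
 show d: "deg_L b \<sigma> <= 0" "deg_L b \<tau> <= 0" using * by auto
 obtain n where "\<sigma> = b ^ n \<or> \<tau> = b ^ n" using * by blast
 thus "\<sigma> = 1 \<or> \<tau> = 1" using d by (auto simp: deg_power)
qed

lemma deg_twist: "\<sigma> ~= 0 ==> deg_L b (\<sigma> * b powi l) = deg_L b \<sigma> + l"
 by (simp add: deg_mult deg_powi)

text \<open>A section with multiplier 1 makes \<sigma> or \<sigma> b^(a-rk) a nonnegative power of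
  b. Since a - rk <= 0, the degree bound on \<sigma> leaves only \<sigma> = 1.\<close>

lemma normalized_MB:
 assumes n: "normalized_extension b r (TB (MB \<sigma> k a))" and "\<sigma> ~= 0" "1 <= k" "a <= r"
 shows "\<sigma> = 1"
proof -
 let ?l = "int a - int (r * k)"
 have l: "?l <= 0"
 proof -
  have "r * 1 <= r * k" using assms(3) by (intro mult_le_mono) auto
  thus ?thesis using assms(4) by linarith
 qed
 have t: "\<sigma> * b powi ?l ~= 0" using assms(2) by simp
 note * = normalized_upper_necessary[OF n[unfolded MB_def[abs_def]] holo2_at_mult[OF holo2_at_const holo2_at_cocycle] assms(2) t]
 obtain m where m: "\<sigma> = b ^ m \<or> \<sigma> * b powi ?l = b ^ m" using *(3) by blast
 have d: "deg_L b \<sigma> <= 0" by (rule *(1))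
 from m show ?thesis
 proof
  assume "\<sigma> = b ^ m" thus ?thesis using d by (simp add: deg_power)
 next
  assume e: "\<sigma> * b powi ?l = b ^ m"
  hence "deg_L b \<sigma> + ?l = m" using deg_twist[OF assms(2), of ?l] by (simp add: deg_power)
  hence "real_of_int ?l >= 0" "real m <= 0" using d l by linarith+
  hence "?l >= 0" "m = 0" unfolding of_int_0_le_iff by simp_all
  hence "?l = 0" "m = 0" using l by linarith+
  thus ?thesis using e by simp
 qed
qed

lemma higgs_iso_TB:
 assumes "!!p. p : C2_star ==> mat_at h p" "!!p. p : C2_star ==> invertible (h p)"
  "!!p. p : C2_star ==> h (F p) ** B p = B' p ** h p" "!!p. p : C2_star ==> h p ** \<Phi> p = \<Phi>' p ** h p"
 shows "higgs_iso b r (TB B) \<Phi> (TB B') \<Phi>'"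
 unfolding higgs_iso_def bundle_iso_def bundle_hom_trivial[OF TB_simps(2) TB_simps(2)] TB_simps(1)
 using assms by blast

lemma higgs_field_TB:
 assumes "!!p. p : C2_star ==> mat_at \<Phi> p" "!!p. p : C2_star ==> \<Phi> (F p) ** B p = mat l ** (B p ** \<Phi> p)"
  "!!p. p : C2_star ==> trace (\<Phi> p) = 0"
 shows "higgs_field b r l (TB B) \<Phi>"
proof -
 have fr: "frames (twist l (TB B)) = {(C2_star, %_. mat 1)}" by simp
 show ?thesis
  unfolding higgs_field_def bundle_hom_trivial[OF TB_simps(2) fr] using assms by (simp add: matrix_mul_assoc)
qed

lemma normalized_nv_higgs_iso:
 fixes E E' :: "2 hopf_bundle"
 assumes n: "normalized_nv_higgs b r l E \<Phi>" and l: "l ~= 0" and g: "bundle_iso b r E E' g" and E': "holo_bundle b r E'"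
  and eq: "!!p. p : C2_star ==> \<phi> p ** g p = g p ** \<Phi> p"
 shows "normalized_nv_higgs b r l E' \<phi>"
 unfolding normalized_nv_higgs_def
proof (intro conjI ballI)
 have E: "holo_bundle b r E" using n by (simp add: normalized_nv_higgs_def normalized_iff)
 show "normalized_extension b r E'" using normalized_iso[OF _ g E'] n by (simp add: normalized_nv_higgs_def)
 show "higgs_field b r l E' \<phi>" using higgs_field_iso[OF _ l g E E' eq] n by (simp add: normalized_nv_higgs_def)
 show "\<phi> p ~= 0" if p: "p : C2_star" for p
 proof
  assume "\<phi> p = 0"
  hence "g p ** \<Phi> p = 0" using eq[OF p] by simp
  hence "\<Phi> p = 0" using matrix_inv_cancel(1)[OF bundle_iso_invertible[OF g p], of "\<Phi> p"] by simp
  thus False using n p by (simp add: normalized_nv_higgs_def)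
 qed
qed

section \<open>The standard sequences on the model\<close>

text \<open>Under F the function x^k picks up y^a times the cocycle; this is what makes (x^k, y^a)
  equivariant for the model factor.\<close>

lemma cocycle_F: "a <= r ==> fst (F p) ^ k = b ^ (r * k) * (fst p ^ k + snd p ^ a * cocycle k a p)"
 by (simp add: cocycle_eq fst_F power_mult_distrib power_mult)

lemma twist_power: "b ^ (r * k) * b powi (int a - int (r * k)) = b ^ a"
proof -
 have "b powi int (r * k) * b powi (int a - int (r * k)) = b powi int a"
  by (subst power_int_add[symmetric]) simp_all
 thus ?thesis by (simp only: power_int_of_nat)
qed

lemma holo2_at_fst_power: "holo2_at (%p. c * fst p ^ n) p" and holo2_at_snd_power: "holo2_at (%p. c * snd p ^ n) p"
 by (rule holo2_at_mult[OF holo2_at_const holo2_at_power[OF holo2_at_fst]] holo2_at_mult[OF holo2_at_const holo2_at_power[OF holo2_at_snd]])+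

text \<open>Dictionary between the exponents k, a of the model and the indices j = k - 1, m = r - a
  of the standard sequences.\<close>

lemma std_index:
 assumes "1 <= k" "a <= r"
 shows "int (r * (k - 1) + (r - a)) = int (r * k) - int a"
 using assms by (cases k) (auto simp: algebra_simps)

text \<open>The second sequence consists of the equivariant vector (x^k, y^a) and the row
  annihilating it. Both nonsplit claims follow by evaluating a hypothetical splitting at y =
  0.\<close>

lemma std_sequences_MB:
 assumes k: "1 <= k" and a: "1 <= a" "a <= r"
 shows "std_sequences b r (k - 1) (r - a) (TB (MB 1 k a)) (%_. incl 1 0) (%_. row2 0 1)
  (%p. incl (fst p ^ k) (snd p ^ a)) (%p. row2 (snd p ^ a) (- (fst p ^ k)))"
proof -
 define t where "t = b powi (int a - int (r * k))"
 have t0: "t ~= 0" by (simp add: t_def)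
 have B: "MB 1 k a = (%p. mat2 1 (cocycle k a p) 0 t)" by (simp add: MB_def[abs_def] t_def)
 have tb: "b ^ (r * k) * t = b ^ a" unfolding t_def by (rule twist_power)
 define w where "w = b powi (- int (r * k))"
 have w: "b ^ (r * k) * w = 1" "w ~= 0" "t = b ^ a * w"
  unfolding w_def t_def power_int_minus power_int_of_nat power_int_diff[OF disjI1[OF b0]] divide_inverse by simp_all
 have E: "holo_bundle b r (TB (MB 1 k a))" by (rule holo_bundle_MB) simp
 have ext1: "extension b r 1 (TB (MB 1 k a)) t (%_. incl 1 0) (%_. row2 0 1)"
  unfolding B by (rule extension_upper) (use t0 holo2_at_cocycle in auto)
 have F': "fst (F p) ^ k = b ^ (r * k) * (fst p ^ k + snd p ^ a * cocycle k a p)" for p by (rule cocycle_F[OF a(2)])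
 have ext2: "extension b r w (TB (MB 1 k a)) (b ^ a) (%p. incl (fst p ^ k) (snd p ^ a)) (%p. row2 (snd p ^ a) (- (fst p ^ k)))"
  unfolding extension_iff bundle_hom_L_iff esec_TB bundle_hom_trivial[OF TB_simps(2) L_simps(2)]
 proof (intro conjI ballI)
  fix p assume p: "p : C2_star"
  have nz: "fst p ^ k ~= 0 \<or> snd p ^ a ~= 0" using p by (cases p) (auto simp: C2_star_def)
  show "vec_at (%p. column 1 (incl (fst p ^ k) (snd p ^ a))) p" unfolding vec_at_incl
   using holo2_at_fst_power[of 1 k p] holo2_at_snd_power[of 1 a p] by simp
  show "MB 1 k a p *v column 1 (incl (fst p ^ k) (snd p ^ a)) = w *s column 1 (incl (fst (F p) ^ k) (snd (F p) ^ a))"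
  proof -
   have "w * fst (F p) ^ k = (b ^ (r * k) * w) * (fst p ^ k + snd p ^ a * cocycle k a p)" by (simp add: F' mult_ac)
   thus ?thesis using w(1) by (simp add: B w(3) vec_eq_iff forall_2 mult_vec_2 power_mult_distrib)
  qed
  show "mat_at (%p. row2 (snd p ^ a) (- (fst p ^ k))) p"
   using holo2_at_fst_power[of "-1" k p] holo2_at_snd_power[of 1 a p] by (simp add: mat_at_def forall_1 forall_2)
  show "row2 (snd (F p) ^ a) (- (fst (F p) ^ k)) ** factor (TB (MB 1 k a)) p = factor (L (b ^ a)) p ** row2 (snd p ^ a) (- (fst p ^ k))"
  proof -
   have "fst (F p) ^ k * t = (b ^ (r * k) * t) * (fst p ^ k + snd p ^ a * cocycle k a p)" by (simp add: F' mult_ac)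
   thus ?thesis unfolding tb
    by (simp add: B vec_eq_iff forall_1 forall_2 matrix_matrix_mult_def sum_2 mat_def power_mult_distrib algebra_simps)
  qed
  show "column 1 (incl (fst p ^ k) (snd p ^ a)) ~= 0" using nz by (auto simp: vec_eq_iff forall_2)
  show "row2 (snd p ^ a) (- (fst p ^ k)) ~= 0" using nz by (auto simp: vec_eq_iff forall_1 forall_2)
  show "row2 (snd p ^ a) (- (fst p ^ k)) *v column 1 (incl (fst p ^ k) (snd p ^ a)) = 0"
   by (simp add: vec_eq_iff forall_1 mult_vec_2)
 qed (use w in auto)
 have p1: "(1, 0) : C2_star" by (simp add: C2_star_def)
 have ns1: "~ (EX s. bundle_hom b r (L t) (TB (MB 1 k a)) s & (ALL p:C2_star. row2 0 1 ** s p = mat 1))"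
 proof (intro notI, elim exE conjE)
  fix s assume s: "bundle_hom b r (L t) (TB (MB 1 k a)) s" "ALL p:C2_star. row2 0 1 ** s p = mat 1"
  define u where "u p = s p $ 1 $ 1" for p
  have s2: "s p $ 2 $ 1 = 1" if "p : C2_star" for p
  proof -
   have "(row2 0 1 ** s p) $ 1 $ 1 = (mat 1 :: complex ^ 1 ^ 1) $ 1 $ 1" using s(2) that by simp
   thus ?thesis by (simp add: matrix_matrix_mult_def sum_2 mat_def)
  qed
  have uh: "holo2_at u p" and uF: "t * u (F p) = u p + cocycle k a p" if p: "p : C2_star" for p
   using s(1) p s2[OF p] unfolding bundle_hom_L_iff esec_TB B
   by (auto simp: vec_at_def vec_eq_iff forall_2 mult_vec_2 column_def u_def[abs_def])
  \<comment> \<open>A splitting u of the first sequence would make y^a u - x^k an eigenfunction of F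
    with multiplier b^(rk), hence 0 or a multiple of y^(rk); at y = 0 this reads x^k = 0.\<close>
  have eq: "1 * (snd (F p) ^ a * u (F p) + (- 1) * fst (F p) ^ k) = b ^ (r * k) * (snd p ^ a * u p + (- 1) * fst p ^ k)" if p: "p : C2_star" for p
  proof -
   have "snd (F p) ^ a * u (F p) = b ^ a * (snd p ^ a * u (F p))" by (simp add: power_mult_distrib)
   also have "\<dots> = b ^ (r * k) * (snd p ^ a * (t * u (F p)))" unfolding tb[symmetric] by (simp add: mult_ac)
   finally show ?thesis unfolding uF[OF p] F' by (simp add: algebra_simps)
  qed
  have hol: "holo2_at (%p. snd p ^ a * u p + (- 1) * fst p ^ k) p" if "p : C2_star" for p
   by (rule holo2_at_add[OF holo2_at_mult[OF holo2_at_power[OF holo2_at_snd] uh[OF that]] holo2_at_fst_power])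
  have "(ALL p:C2_star. snd p ^ a * u p + (- 1) * fst p ^ k = 0) \<or>
    (EX n c. c ~= 0 & b ^ (r * k) = 1 * b ^ n & (ALL p:C2_star. snd p ^ a * u p + (- 1) * fst p ^ k = c * snd p ^ n))"
   by (rule section_ratio[OF hol one_neq_zero eq])
  thus False
  proof (elim disjE exE conjE)
   assume "ALL p:C2_star. snd p ^ a * u p + (- 1) * fst p ^ k = 0"
   from bspec[OF this p1] show False using a by (simp add: power_0_left)
  next
   fix n c assume n: "b ^ (r * k) = 1 * b ^ n" "ALL p:C2_star. snd p ^ a * u p + (- 1) * fst p ^ k = c * snd p ^ n"
   have "int (r * k) = int n" using n(1) by (intro powi_b_inject) (simp only: power_int_of_nat mult_1)
   moreover have "0 < r * k" using r k by simp
   ultimately have "n > 0" by linarith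
   thus False using bspec[OF n(2) p1] a by (simp add: power_0_left)
  qed
 qed
 have ns2: "~ (EX s. bundle_hom b r (L (b ^ a)) (TB (MB 1 k a)) s & (ALL p:C2_star. row2 (snd p ^ a) (- (fst p ^ k)) ** s p = mat 1))"
 proof (intro notI, elim exE conjE)
  fix s assume s: "bundle_hom b r (L (b ^ a)) (TB (MB 1 k a)) s" "ALL p:C2_star. row2 (snd p ^ a) (- (fst p ^ k)) ** s p = mat 1"
  have e: "snd p ^ a * s p $ 1 $ 1 - fst p ^ k * s p $ 2 $ 1 = 1" if "p : C2_star" for p
  proof -
   have "(row2 (snd p ^ a) (- (fst p ^ k)) ** s p) $ 1 $ 1 = (mat 1 :: complex ^ 1 ^ 1) $ 1 $ 1" using s(2) that by simp
   thus ?thesis by (simp add: matrix_matrix_mult_def sum_2 mat_def)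
  qed
  have h: "holo2_at (%p. s p $ 2 $ 1) p" and hF: "b ^ a * s (F p) $ 2 $ 1 = t * s p $ 2 $ 1" if p: "p : C2_star" for p
   using s(1) p unfolding bundle_hom_L_iff esec_TB B
   by (auto simp: vec_at_def vec_eq_iff forall_2 mult_vec_2 column_def)
  have ba: "b ^ a ~= 0" by simp
  \<comment> \<open>The second component of a splitting has multiplier b^(-rk), of modulus above 1,
    so it is 0; then y^a would be invertible.\<close>
  have "(ALL p:C2_star. s p $ 2 $ 1 = 0) \<or> (EX n c. c ~= 0 & t = b ^ a * b ^ n & (ALL p:C2_star. s p $ 2 $ 1 = c * snd p ^ n))"
   by (rule section_ratio[OF h ba hF])
  thus False
  proof (elim disjE exE conjE)
   assume z: "ALL p:C2_star. s p $ 2 $ 1 = 0"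
   show False using e[OF p1] bspec[OF z p1] a by (simp add: power_0_left)
  next
   fix n assume "t = b ^ a * b ^ n"
   hence "w = b ^ n" using w(3) by simp
   hence "b powi (- int (r * k)) = b powi int n" by (simp only: w_def power_int_of_nat)
   hence "- int (r * k) = int n" by (rule powi_b_inject)
   moreover have "0 < r * k" using r k by simp
   ultimately show False by linarith
  qed
 qed
 have j: "r * (k - 1 + 1) = r * k" "r - (r - a) = a" "r - a < r" using k a by auto
 have t': "b powi (- int (r * (k - 1) + (r - a))) = t" unfolding std_index[OF k a(2)] t_def by simp
 show ?thesis
  unfolding std_sequences_def nonsplit_extension_def t' j power_int_of_nat
  using ext1 ext2 ns1 ns2 j(3) unfolding w_def
  by (simp add: trace_product mult_vec_2)
qed

text \<open>By the trace normalization \<open>\<iota>2\<close> projects to y^a in the first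
  sequence, so its jet gives the model frame, and comparing multipliers fixes the exponent to k.
  Every choice of standard sequences is thus conjugate to the model, up to the constant c in
  \<open>phi_12\<close>.\<close>

lemma std_sequences_frame:
 fixes E :: "2 hopf_bundle"
 assumes E: "holo_bundle b r E" and std: "std_sequences b r (k - 1) (r - a) E \<iota>1 \<rho>1 \<iota>2 \<rho>2"
  and k: "1 <= k" and a: "1 <= a" "a <= r"
 obtains G c where "c ~= 0" "bundle_iso b r (TB (MB 1 k a)) E G"
  "!!p. p : C2_star ==> phi_11_minus_22 \<iota>1 \<rho>1 \<iota>2 \<rho>2 p ** G p = G p ** model_higgs k a p"
  "!!p. p : C2_star ==> phi_12 \<iota>1 \<rho>1 p ** G p = G p ** mat2 0 (1 / c) 0 0"
proof -
 have j: "r * (k - 1 + 1) = r * k" "r - (r - a) = a" using k a by auto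
 define t where "t = b powi (- int (r * (k - 1) + (r - a)))"
 have ex: "extension b r 1 E t \<iota>1 \<rho>1" "extension b r (b powi (- int (r * k))) E (b powi int a) \<iota>2 \<rho>2"
  and tr: "!!p. p : C2_star ==> (\<rho>2 p *v column 1 (\<iota>1 p)) $ 1 = snd p ^ a" "!!p. p : C2_star ==> (\<rho>1 p *v column 1 (\<iota>2 p)) $ 1 = snd p ^ a"
  using std unfolding std_sequences_def nonsplit_extension_def j t_def[symmetric] trace_product by auto
 interpret X: hopf_extension b r E 1 t \<iota>1 \<rho>1 by unfold_locales (use E ex in auto)
 interpret Y: hopf_extension b r E "b powi (- int (r * k))" "b powi int a" \<iota>2 \<rho>2 by unfold_locales (use E ex in auto)
 obtain k' c where k': "1 = b powi (int r * k') * b powi (- int (r * k))" "c ~= 0"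
  and e0: "k' >= 0 ==> EX e. local_section E C2_star e & bundle_iso b r (TB (MB 1 (nat k') a)) E (%p. cols (c *s X.i p) (e p)) &
   (ALL p:C2_star. Y.i p = fst p ^ nat k' *s (c *s X.i p) + snd p ^ a *s e p & X.R p (e p) = 1)"
  using X.jet_frame[OF Y.esec_i Y.\<sigma>0 Y.i0 tr(2) a] by blast
 have "b powi (int r * k' + - int (r * k)) = b powi 0"
  by (simp only: power_int_add[OF disjI1[OF b0]] power_int_0_right k'(1)[symmetric])
 hence "int r * k' + - int (r * k) = 0" by (rule powi_b_inject)
 hence "int r * (k' - int k) = 0" by (simp add: algebra_simps)
 hence kk: "k' = int k" using r by simp
 obtain e where e: "local_section E C2_star e" "bundle_iso b r (TB (MB 1 k a)) E (%p. cols (c *s X.i p) (e p))"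
  and Ye: "!!p. p : C2_star ==> Y.i p = fst p ^ k *s (c *s X.i p) + snd p ^ a *s e p" and Re: "!!p. p : C2_star ==> X.R p (e p) = 1"
  using e0 kk by auto
 \<comment> \<open>\<open>\<rho>2\<close> kills \<open>\<iota>2\<close> and takes
   \<open>\<iota>1\<close> to y^a; expanding \<open>\<iota>2\<close> in the frame and cancelling y^a
   gives its value on e.\<close>
 have Y2: "Y.R p (e p) = - c * fst p ^ k" if p: "p : C2_star" for p
 proof -
  have off: "Y.R q (e q) = - c * fst q ^ k" if q: "q : C2_star" "snd q ~= 0" for q
  proof -
   have "0 = Y.R q (fst q ^ k *s (c *s X.i q) + snd q ^ a *s e q)" using Y.R_i[OF q(1)] Ye[OF q(1)] by simp
   also have "\<dots> = snd q ^ a * (c * fst q ^ k + Y.R q (e q))"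
    unfolding Y.R_add Y.R_scale tr(1)[OF q(1)] by (simp add: algebra_simps)
   finally show ?thesis using q(2) by (simp add: add_eq_0_iff)
  qed
  show ?thesis
  proof (cases "snd p = 0")
   case True
   then obtain x where px: "p = (x, 0)" by (cases p) auto
   have cont: "isCont (%q. Y.R q (e q)) (x, 0)"
    by (rule holo2_at_continuous[OF Y.R_holo[OF e(1) order_refl]]) (use p px in simp)
   have "Y.R (x, 0) (e (x, 0)) = - c * fst (x, 0 :: complex) ^ k"
    by (rule eq_on_axis[where f = "%q. Y.R q (e q)" and g = "%q. - c * fst q ^ k" and U = C2_star])
     (use cont p px off open_C2_star in \<open>auto intro!: continuous_intros\<close>)
   thus ?thesis by (simp add: px)
  qed (use off p in auto)
 qed
 have d: "phi_11_minus_22 \<iota>1 \<rho>1 \<iota>2 \<rho>2 p *v v = Y.R p v *s X.i p - X.R p v *s Y.i p" for p v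
  by (simp add: phi_11_minus_22_def matrix_vector_mult_diff_rdistrib product_mult_vec)
 show ?thesis
 proof (rule that[OF k'(2) e(2)])
  fix p assume p: "p : C2_star"
  show "phi_11_minus_22 \<iota>1 \<rho>1 \<iota>2 \<rho>2 p ** cols (c *s X.i p) (e p) = cols (c *s X.i p) (e p) ** model_higgs k a p"
  proof (rule cols_intertwine[symmetric])
   show "phi_11_minus_22 \<iota>1 \<rho>1 \<iota>2 \<rho>2 p *v (c *s X.i p) = model_higgs k a p $ 1 $ 1 *s (c *s X.i p) + model_higgs k a p $ 2 $ 1 *s e p"
    unfolding d X.R_scale Y.R_scale tr(1)[OF p] X.R_i[OF p] by (simp add: model_higgs_def vec_eq_iff)
   show "phi_11_minus_22 \<iota>1 \<rho>1 \<iota>2 \<rho>2 p *v e p = model_higgs k a p $ 1 $ 2 *s (c *s X.i p) + model_higgs k a p $ 2 $ 2 *s e p"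
    unfolding d Y2[OF p] Re[OF p] Ye[OF p] by (simp add: model_higgs_def vec_eq_iff algebra_simps)
  qed
  show "phi_12 \<iota>1 \<rho>1 p ** cols (c *s X.i p) (e p) = cols (c *s X.i p) (e p) ** mat2 0 (1 / c) 0 0"
   by (rule cols_intertwine[symmetric])
    (use k'(2) X.R_i[OF p] Re[OF p] in \<open>simp_all add: phi_12_def product_mult_vec X.R_scale vector_smult_assoc\<close>)
 qed
qed

lemma MB_normalized_nv_higgs:
 assumes k: "1 <= k" and a: "1 <= a" "a <= r" and c: "c ~= 0"
 shows "normalized_nv_higgs b r (b ^ a) (TB (MB 1 k a)) (%p. mat c ** model_higgs k a p)"
  "normalized_nv_higgs b r (b powi (int a - int (r * k))) (TB (MB 1 k a)) (%p. mat2 0 c 0 0)"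
proof -
 define t where "t = b powi (int a - int (r * k))"
 have t0: "t ~= 0" by (simp add: t_def)
 have B: "MB 1 k a = (%p. mat2 1 (cocycle k a p) 0 t)" by (simp add: MB_def[abs_def] t_def)
 have tb: "b ^ (r * k) * t = b ^ a" unfolding t_def by (rule twist_power)
 have "r * 1 <= r * k" using k by (intro mult_le_mono) auto
 hence "deg_L b t <= 0" using a unfolding t_def deg_powi by linarith
 hence n: "normalized_extension b r (TB (MB 1 k a))"
  unfolding B by (intro normalized_upper holo2_at_cocycle t0)
 have F': "fst (F p) ^ k = b ^ (r * k) * (fst p ^ k + snd p ^ a * cocycle k a p)" for p by (rule cocycle_F[OF a(2)])
 show "normalized_nv_higgs b r (b ^ a) (TB (MB 1 k a)) (%p. mat c ** model_higgs k a p)"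
  unfolding normalized_nv_higgs_def
 proof (intro conjI ballI n higgs_field_TB)
  fix p assume p: "p : C2_star"
  show "mat_at (%p. mat c ** model_higgs k a p) p"
   using holo2_at_minus[OF holo2_at_mult[OF holo2_at_const[of c] holo2_at_fst_power[of 2 k p]]]
    holo2_at_snd_power[of c a p] holo2_at_snd_power[of "-c" a p]
   by (simp add: mat_at_def forall_2 model_higgs_def)
  show "(mat c ** model_higgs k a (F p)) ** MB 1 k a p = mat (b ^ a) ** (MB 1 k a p ** (mat c ** model_higgs k a p))"
  proof (rule mat_2_eqI)
   have "fst (F p) ^ k * t = (b ^ (r * k) * t) * (fst p ^ k + snd p ^ a * cocycle k a p)" by (simp add: F' mult_ac)
   hence e: "fst (F p) ^ k * t = b ^ a * (fst p ^ k + snd p ^ a * cocycle k a p)" by (simp only: tb)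
   have "((mat c ** model_higgs k a (F p)) ** MB 1 k a p) $ 1 $ 2 =
     c * (b ^ a * snd p ^ a * cocycle k a p) - 2 * c * (fst (F p) ^ k * t)"
    by (simp add: mult_22 model_higgs_def B power_mult_distrib)
   also have "\<dots> = (mat (b ^ a) ** (MB 1 k a p ** (mat c ** model_higgs k a p))) $ 1 $ 2"
    unfolding e by (simp add: mult_22 model_higgs_def B algebra_simps)
   finally show "((mat c ** model_higgs k a (F p)) ** MB 1 k a p) $ 1 $ 2 = (mat (b ^ a) ** (MB 1 k a p ** (mat c ** model_higgs k a p))) $ 1 $ 2" .
  qed (simp_all add: mult_22 model_higgs_def B power_mult_distrib)
  show "trace (mat c ** model_higgs k a p) = 0" by (simp add: trace_2 model_higgs_def)
  show "mat c ** model_higgs k a p ~= 0"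
   using c p by (cases p) (auto simp: C2_star_def vec_eq_iff forall_2 model_higgs_def)
 qed
 have "normalized_nv_higgs b r t (TB (MB 1 k a)) (%p. mat2 0 c 0 0)"
  unfolding normalized_nv_higgs_def
 proof (intro conjI ballI n higgs_field_TB)
  fix p assume p: "p : C2_star"
  show "mat_at (%p. mat2 0 c 0 0) p" by simp
  show "mat2 0 c 0 0 ** MB 1 k a p = mat t ** (MB 1 k a p ** mat2 0 c 0 0)"
   by (rule mat_2_eqI) (simp_all add: mult_22 B)
  show "trace (mat2 0 c 0 0) = 0" by (simp add: trace_2)
  show "mat2 0 c 0 0 ~= 0" using c by (auto simp: vec_eq_iff forall_2)
 qed
 thus "normalized_nv_higgs b r (b powi (int a - int (r * k))) (TB (MB 1 k a)) (%p. mat2 0 c 0 0)"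
  by (simp add: t_def)
qed

end

section \<open>The listed Higgs fields and their invariant sub-line bundles\<close>

context hopf
begin

lemma normalized_source:
 assumes "higgs_iso b r (TB B) \<Phi> E \<phi>" "normalized_extension b r E" "holo_bundle b r (TB B)"
 shows "normalized_extension b r (TB B)"
proof -
 obtain g where g: "bundle_iso b r (TB B) E g" using assms(1) unfolding higgs_iso_def by blast
 have E: "holo_bundle b r E" using assms(2) by (simp add: normalized_iff)
 show ?thesis by (rule normalized_iso[OF assms(2) bundle_iso_inverse[OF g assms(3) E] assms(3)])
qed

lemma holo_bundle_diag: "\<sigma> ~= 0 ==> \<tau> ~= 0 ==> holo_bundle b r (TB (%_. mat2 \<sigma> 0 0 \<tau>))"
 by (rule holo_bundle_upper) simp_all

lemma std_sequences_exist:
 assumes hi: "higgs_iso b r (TB (MB 1 k a)) \<Phi> E \<phi>" and E: "holo_bundle b r E" and k: "1 <= k" and a: "1 <= a" "a <= r"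
 shows "EX \<iota> \<rho>. nonsplit_extension b r 1 E (b powi (int a - int (r * k))) \<iota> \<rho>"
  "EX \<iota>1 \<rho>1 \<iota>2 \<rho>2. std_sequences b r (k - 1) (r - a) E \<iota>1 \<rho>1 \<iota>2 \<rho>2"
proof -
 obtain g where g: "bundle_iso b r (TB (MB 1 k a)) E g" using hi unfolding higgs_iso_def by blast
 show s: "EX \<iota>1 \<rho>1 \<iota>2 \<rho>2. std_sequences b r (k - 1) (r - a) E \<iota>1 \<rho>1 \<iota>2 \<rho>2"
  using std_sequences_iso[OF std_sequences_MB[OF k a] g holo_bundle_MB[OF one_neq_zero] E] by blast
 have "- int (r * (k - 1) + (r - a)) = int a - int (r * k)" using std_index[OF k a(2)] by linarith
 thus "EX \<iota> \<rho>. nonsplit_extension b r 1 E (b powi (int a - int (r * k))) \<iota> \<rho>"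
  using s unfolding std_sequences_def by metis
qed

text \<open>Both fields are conjugate to \<delta> times the model field, so the constant does not
  depend on the choice of sequences.\<close>

lemma phi_11_minus_22_unique:
 assumes hi: "higgs_iso b r (TB (MB 1 k a)) (%p. mat \<delta> ** model_higgs k a p) E \<phi>" and E: "holo_bundle b r E"
  and k: "1 <= k" and a: "1 <= a" "a <= r" and std: "std_sequences b r (k - 1) (r - a) E \<iota>1 \<rho>1 \<iota>2 \<rho>2"
 shows "higgs_iso b r E \<phi> E (%p. mat \<delta> ** phi_11_minus_22 \<iota>1 \<rho>1 \<iota>2 \<rho>2 p)"
proof -
 have M: "holo_bundle b r (TB (MB 1 k a))" by (rule holo_bundle_MB) simp
 obtain G c where G: "bundle_iso b r (TB (MB 1 k a)) E G"
  and GM: "!!p. p : C2_star ==> phi_11_minus_22 \<iota>1 \<rho>1 \<iota>2 \<rho>2 p ** G p = G p ** model_higgs k a p"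
  using std_sequences_frame[OF E std k a] by metis
 have "G p ** (mat \<delta> ** model_higgs k a p) = (mat \<delta> ** phi_11_minus_22 \<iota>1 \<rho>1 \<iota>2 \<rho>2 p) ** G p" if "p : C2_star" for p
 proof -
  have "G p ** (mat \<delta> ** model_higgs k a p) = mat \<delta> ** (G p ** model_higgs k a p)"
   by (simp add: matrix_mul_assoc mat_mult_commute[of \<delta> "G p"])
  thus ?thesis by (simp add: GM[OF that, symmetric] matrix_mul_assoc)
 qed
 hence "higgs_iso b r (TB (MB 1 k a)) (%p. mat \<delta> ** model_higgs k a p) E (%p. mat \<delta> ** phi_11_minus_22 \<iota>1 \<rho>1 \<iota>2 \<rho>2 p)"
  using G unfolding higgs_iso_def by blast
 from higgs_iso_trans[OF higgs_iso_sym[OF hi M E] this E M] show ?thesis .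
qed

lemma phi_12_unique:
 assumes hi: "higgs_iso b r (TB (MB 1 k a)) (%_. mat2 0 \<beta> 0 0) E \<phi>" and \<beta>: "\<beta> ~= 0" and E: "holo_bundle b r E"
  and k: "1 <= k" and a: "1 <= a" "a <= r" and std: "std_sequences b r (k - 1) (r - a) E \<iota>1 \<rho>1 \<iota>2 \<rho>2"
 shows "EX \<beta>. \<beta> ~= 0 & higgs_iso b r E \<phi> E (%p. mat \<beta> ** phi_12 \<iota>1 \<rho>1 p)"
proof -
 have M: "holo_bundle b r (TB (MB 1 k a))" by (rule holo_bundle_MB) simp
 obtain G c where c: "c ~= 0" and G: "bundle_iso b r (TB (MB 1 k a)) E G"
  and GM: "!!p. p : C2_star ==> phi_12 \<iota>1 \<rho>1 p ** G p = G p ** mat2 0 (1 / c) 0 0"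
  using std_sequences_frame[OF E std k a] by metis
 have "G p ** mat2 0 \<beta> 0 0 = (mat (\<beta> * c) ** phi_12 \<iota>1 \<rho>1 p) ** G p" if "p : C2_star" for p
 proof -
  have "mat2 0 \<beta> 0 0 = mat (\<beta> * c) ** mat2 0 (1 / c) 0 0" using c by (simp add: vec_eq_iff forall_2)
  hence "G p ** mat2 0 \<beta> 0 0 = mat (\<beta> * c) ** (G p ** mat2 0 (1 / c) 0 0)"
   by (simp add: matrix_mul_assoc mat_mult_commute[of "\<beta> * c" "G p"])
  thus ?thesis by (simp add: GM[OF that, symmetric] matrix_mul_assoc)
 qed
 hence "higgs_iso b r (TB (MB 1 k a)) (%_. mat2 0 \<beta> 0 0) E (%p. mat (\<beta> * c) ** phi_12 \<iota>1 \<rho>1 p)"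
  using G unfolding higgs_iso_def by blast
 from higgs_iso_trans[OF higgs_iso_sym[OF hi M E] this E M] show ?thesis using \<beta> c by (intro exI[of _ "\<beta> * c"]) simp
qed

text \<open>By the trace normalization \<open>\<iota>1\<close> and \<open>\<iota>2\<close> are
  eigensections of the first field, with eigenvalues \<alpha> y^a and -\<alpha> y^a. The second
  field is nilpotent with kernel \<open>\<iota>1\<close>.\<close>

lemma std_higgs_fields:
 assumes E: "holo_bundle b r E" and std: "std_sequences b r (k - 1) (r - a) E \<iota>1 \<rho>1 \<iota>2 \<rho>2"
  and k: "1 <= k" and a: "1 <= a" "a <= r" and \<alpha>: "\<alpha> ~= 0"
 shows "normalized_nv_higgs b r (b ^ a) E (%p. mat \<alpha> ** phi_11_minus_22 \<iota>1 \<rho>1 \<iota>2 \<rho>2 p)"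
  "invariant_sub_line_bundle b r (b ^ a) E (%p. mat \<alpha> ** phi_11_minus_22 \<iota>1 \<rho>1 \<iota>2 \<rho>2 p) \<mu> h \<longleftrightarrow>
   same_sub b r \<mu> h 1 \<iota>1 \<or> same_sub b r \<mu> h (b powi (- int (r * k))) \<iota>2"
  "normalized_nv_higgs b r (b powi (int a - int (r * k))) E (%p. mat \<alpha> ** phi_12 \<iota>1 \<rho>1 p)"
  "invariant_sub_line_bundle b r (b powi (int a - int (r * k))) E (%p. mat \<alpha> ** phi_12 \<iota>1 \<rho>1 p) \<mu> h \<longleftrightarrow> same_sub b r \<mu> h 1 \<iota>1"
proof -
 let ?f = "%p. mat \<alpha> ** phi_11_minus_22 \<iota>1 \<rho>1 \<iota>2 \<rho>2 p" and ?g = "%p. mat \<alpha> ** phi_12 \<iota>1 \<rho>1 p"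
 have M: "holo_bundle b r (TB (MB 1 k a))" by (rule holo_bundle_MB) simp
 obtain G c where c: "c ~= 0" and G: "bundle_iso b r (TB (MB 1 k a)) E G"
  and G1: "!!p. p : C2_star ==> phi_11_minus_22 \<iota>1 \<rho>1 \<iota>2 \<rho>2 p ** G p = G p ** model_higgs k a p"
  and G2: "!!p. p : C2_star ==> phi_12 \<iota>1 \<rho>1 p ** G p = G p ** mat2 0 (1 / c) 0 0"
  using std_sequences_frame[OF E std k a] by metis
 have f: "?f p ** G p = G p ** (mat \<alpha> ** model_higgs k a p)" if "p : C2_star" for p
 proof -
  have "?f p ** G p = (mat \<alpha> ** G p) ** model_higgs k a p"
   by (simp add: matrix_mul_assoc[symmetric] G1[OF that])
  thus ?thesis unfolding mat_mult_commute[of \<alpha> "G p"] by (simp add: matrix_mul_assoc)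
 qed
 have g: "?g p ** G p = G p ** mat2 0 (\<alpha> / c) 0 0" if "p : C2_star" for p
 proof -
  have "mat2 0 (\<alpha> / c) 0 0 = mat2 0 (1 / c) 0 0 ** mat \<alpha>" by (simp add: vec_eq_iff forall_2)
  moreover have "?g p ** G p = (G p ** mat2 0 (1 / c) 0 0) ** mat \<alpha>"
   by (simp add: matrix_mul_assoc[symmetric] G2[OF that, symmetric] mat_mult_commute)
  ultimately show ?thesis by (simp add: matrix_mul_assoc)
 qed
 show n1: "normalized_nv_higgs b r (b ^ a) E ?f"
  by (rule normalized_nv_higgs_iso[OF MB_normalized_nv_higgs(1)[OF k a \<alpha>] _ G E f]) simp_all
 have \<alpha>c: "\<alpha> / c ~= 0" using \<alpha> c by simp
 show n2: "normalized_nv_higgs b r (b powi (int a - int (r * k))) E ?g"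
  by (rule normalized_nv_higgs_iso[OF MB_normalized_nv_higgs(2)[OF k a \<alpha>c] _ G E g]) simp_all
 have j: "r * (k - 1 + 1) = r * k" "r - (r - a) = a" using k a by auto
 define t where "t = b powi (- int (r * (k - 1) + (r - a)))"
 have ex: "extension b r 1 E t \<iota>1 \<rho>1" "extension b r (b powi (- int (r * k))) E (b powi int a) \<iota>2 \<rho>2"
  and tr: "!!p. p : C2_star ==> (\<rho>2 p *v column 1 (\<iota>1 p)) $ 1 = snd p ^ a" "!!p. p : C2_star ==> (\<rho>1 p *v column 1 (\<iota>2 p)) $ 1 = snd p ^ a"
  using std unfolding std_sequences_def nonsplit_extension_def j t_def[symmetric] trace_product by auto
 interpret X: hopf_extension b r E 1 t \<iota>1 \<rho>1 by unfold_locales (use E ex in auto)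
 interpret Y: hopf_extension b r E "b powi (- int (r * k))" "b powi int a" \<iota>2 \<rho>2 by unfold_locales (use E ex in auto)
 have d: "?f p *v v = \<alpha> *s (Y.R p v *s X.i p - X.R p v *s Y.i p)" and d2: "?g p *v v = \<alpha> *s (X.R p v *s X.i p)" for p v
  by (simp_all add: mat_mult_mult_vec phi_11_minus_22_def phi_12_def matrix_vector_mult_diff_rdistrib product_mult_vec)
 show "invariant_sub_line_bundle b r (b ^ a) E ?f \<mu> h \<longleftrightarrow> same_sub b r \<mu> h 1 \<iota>1 \<or> same_sub b r \<mu> h (b powi (- int (r * k))) \<iota>2"
 proof (rule X.invariant_iff[where P = "%p. \<alpha> * snd p ^ a"])
  show "?f p *v X.i p = (\<alpha> * snd p ^ a) *s X.i p" if "p : C2_star" for p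
   unfolding d tr(1)[OF that] X.R_i[OF that] by (simp add: vector_smult_assoc)
  show "?f p *v Y.i p = - (\<alpha> * snd p ^ a) *s Y.i p" if "p : C2_star" for p
   unfolding d tr(2)[OF that] Y.R_i[OF that] by (simp add: vec_eq_iff)
  show "trace (?f p) = 0" "?f p ~= 0" if "p : C2_star" for p
   using n1 that by (auto simp: normalized_nv_higgs_def higgs_field_def)
 qed (use holo2_at_snd_power X.esec_i X.i0 Y.esec_i Y.i0 in \<open>simp_all add: power_mult_distrib\<close>)
 have "invariant_sub_line_bundle b r (b powi (int a - int (r * k))) E ?g \<mu> h \<longleftrightarrow> same_sub b r \<mu> h 1 \<iota>1 \<or> same_sub b r \<mu> h 1 \<iota>1"
 proof (rule X.invariant_iff[where P = "%p. 0"])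
  show "?g p *v X.i p = 0 *s X.i p" "?g p *v X.i p = - 0 *s X.i p" if "p : C2_star" for p
   unfolding d2 X.R_i[OF that] by simp_all
  show "trace (?g p) = 0" "?g p ~= 0" if "p : C2_star" for p
   using n2 that by (auto simp: normalized_nv_higgs_def higgs_field_def)
 qed (use X.esec_i X.i0 in simp_all)
 thus "invariant_sub_line_bundle b r (b powi (int a - int (r * k))) E ?g \<mu> h \<longleftrightarrow> same_sub b r \<mu> h 1 \<iota>1" by simp
qed

lemma L_sum_nilpotent:
 assumes \<eta>: "\<eta> ~= 0" "deg_L b \<eta> <= 0"
 shows "normalized_nv_higgs b r \<eta> (L_sum 1 \<eta>) (%_. mat2 0 1 0 0)"
  "invariant_sub_line_bundle b r \<eta> (L_sum 1 \<eta>) (%_. mat2 0 1 0 0) \<mu> h \<longleftrightarrow> same_sub b r \<mu> h 1 (%_. incl 1 0)"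
proof -
 have ext: "extension b r 1 (L_sum 1 \<eta>) \<eta> (%_. incl 1 0) (%_. row2 0 1)"
  unfolding L_sum_eq_TB by (rule extension_upper) (use \<eta> in auto)
 have nz: "mat2 0 1 0 0 ~= 0" by (auto simp: vec_eq_iff forall_2)
 show n: "normalized_nv_higgs b r \<eta> (L_sum 1 \<eta>) (%_. mat2 0 1 0 0)"
  unfolding normalized_nv_higgs_def L_sum_eq_TB
 proof (intro conjI ballI nz higgs_field_TB)
  show "normalized_extension b r (TB (%_. mat2 1 0 0 \<eta>))" by (rule normalized_upper) (use \<eta> in auto)
  show "mat2 0 1 0 0 ** mat2 1 0 0 \<eta> = mat \<eta> ** (mat2 1 0 0 \<eta> ** mat2 0 1 0 0)"
   by (rule mat_2_eqI) (simp_all add: mult_22)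
  show "trace (mat2 0 1 0 0) = 0" by (simp add: trace_2)
 qed simp
 interpret X: hopf_extension b r "L_sum 1 \<eta>" 1 \<eta> "%_. incl 1 0" "%_. row2 0 1"
  by unfold_locales (use n ext in \<open>auto simp: normalized_nv_higgs_def normalized_iff\<close>)
 have z: "mat2 0 1 0 0 *v column 1 (incl 1 0) = 0" by (simp add: vec_eq_iff forall_2 mult_vec_2)
 have "invariant_sub_line_bundle b r \<eta> (L_sum 1 \<eta>) (%_. mat2 0 1 0 0) \<mu> h \<longleftrightarrow>
   same_sub b r \<mu> h 1 (%_. incl 1 0) \<or> same_sub b r \<mu> h 1 (%_. incl 1 0)"
  by (rule X.invariant_iff[where P = "%p. 0"]) (use X.esec_i X.i0 \<eta> z nz in \<open>simp_all add: trace_2\<close>)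
 thus "invariant_sub_line_bundle b r \<eta> (L_sum 1 \<eta>) (%_. mat2 0 1 0 0) \<mu> h \<longleftrightarrow> same_sub b r \<mu> h 1 (%_. incl 1 0)" by simp
qed

lemma L_sum_diagonal:
 assumes \<eta>: "\<eta> ~= 0" "deg_L b \<eta> <= 0" and c: "c ~= 0"
 shows "normalized_nv_higgs b r 1 (L_sum 1 \<eta>) (%_. mat2 c 0 0 (- c))"
  "invariant_sub_line_bundle b r 1 (L_sum 1 \<eta>) (%_. mat2 c 0 0 (- c)) 1 (%_. incl 1 0)"
  "invariant_sub_line_bundle b r 1 (L_sum 1 \<eta>) (%_. mat2 c 0 0 (- c)) \<eta> (%_. incl 0 1)"
proof -
 have ext: "extension b r 1 (L_sum 1 \<eta>) \<eta> (%_. incl 1 0) (%_. row2 0 1)"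
  unfolding L_sum_eq_TB by (rule extension_upper) (use \<eta> in auto)
 show n: "normalized_nv_higgs b r 1 (L_sum 1 \<eta>) (%_. mat2 c 0 0 (- c))"
  unfolding normalized_nv_higgs_def L_sum_eq_TB
 proof (intro conjI ballI higgs_field_TB)
  show "normalized_extension b r (TB (%_. mat2 1 0 0 \<eta>))" by (rule normalized_upper) (use \<eta> in auto)
  show "mat2 c 0 0 (- c) ** mat2 1 0 0 \<eta> = mat 1 ** (mat2 1 0 0 \<eta> ** mat2 c 0 0 (- c))"
   by (rule mat_2_eqI) (simp_all add: mult_22)
  show "trace (mat2 c 0 0 (- c)) = 0" by (simp add: trace_2)
  show "mat2 c 0 0 (- c) ~= 0" using c by (auto simp: vec_eq_iff forall_2)
  show "mat_at (%_. mat2 c 0 0 (- c)) p" for p by simp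
 qed
 interpret X: hopf_extension b r "L_sum 1 \<eta>" 1 \<eta> "%_. incl 1 0" "%_. row2 0 1"
  by unfold_locales (use n ext in \<open>auto simp: normalized_nv_higgs_def normalized_iff\<close>)
 have e2: "esec (L_sum 1 \<eta>) \<eta> (%p. column 1 (incl 0 1))"
  unfolding L_sum_eq_TB by (auto simp: esec_TB vec_at_incl vec_eq_iff forall_2 mult_vec_2)
 have nz: "column 1 (incl 0 1) ~= 0" "column 1 (incl 1 0) ~= 0" by (auto simp: vec_eq_iff forall_2)
 have refl1: "same_sub b r 1 (%_. incl 1 0) 1 (%_. incl 1 0)"
  by (rule same_subI[OF X.E X.esec_i X.i0 X.esec_i X.i0]) (auto intro: exI[of _ 1])
 have refl2: "same_sub b r \<eta> (%_. incl 0 1) \<eta> (%_. incl 0 1)"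
  by (rule same_subI[OF X.E e2 nz(1) e2 nz(1)]) (auto intro: exI[of _ 1])
 have v: "mat2 c 0 0 (- c) *v column 1 (incl 1 0) = c *s column 1 (incl 1 0)"
  "mat2 c 0 0 (- c) *v column 1 (incl 0 1) = (- c) *s column 1 (incl 0 1)"
  by (simp_all add: vec_eq_iff forall_2 mult_vec_2)
 show "invariant_sub_line_bundle b r 1 (L_sum 1 \<eta>) (%_. mat2 c 0 0 (- c)) 1 (%_. incl 1 0)"
  by (rule X.invariant_if_same_sub[where P = "%_. c", OF _ _ _ _ X.esec_i X.i0 _ refl1]) (use v in simp_all)
 show "invariant_sub_line_bundle b r 1 (L_sum 1 \<eta>) (%_. mat2 c 0 0 (- c)) \<eta> (%_. incl 0 1)"
  by (rule X.invariant_if_same_sub[where P = "%_. - c", OF _ _ _ _ e2 nz(1) _ refl2]) (use v \<eta> in simp_all)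
qed

text \<open>The two inclusions are eigensections with eigenvalues plus and minus y^n times the root
  of t; for t = 0 they coincide.\<close>

lemma L_sum_companion:
 fixes t :: complex and n :: nat
 defines "\<eta> \<equiv> inverse (b ^ n)"
 shows "normalized_nv_higgs b r (b ^ n) (L_sum 1 \<eta>) (%p. mat2 0 (t * snd p ^ (2 * n)) 1 0)"
  "invariant_sub_line_bundle b r (b ^ n) (L_sum 1 \<eta>) (%p. mat2 0 (t * snd p ^ (2 * n)) 1 0) \<mu> h \<longleftrightarrow>
   same_sub b r \<mu> h \<eta> (%p. incl (1 * snd p ^ n * csqrt t) 1) \<or> same_sub b r \<mu> h \<eta> (%p. incl (- 1 * snd p ^ n * csqrt t) 1)"
proof -
 have \<eta>: "\<eta> ~= 0" "deg_L b \<eta> <= 0" "b ^ n * \<eta> = 1" by (simp_all add: \<eta>_def deg_inverse deg_power)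
 have ext: "extension b r 1 (L_sum 1 \<eta>) \<eta> (%_. incl 1 0) (%_. row2 0 1)"
  unfolding L_sum_eq_TB by (rule extension_upper) (use \<eta> in auto)
 have nz: "mat2 0 x 1 0 ~= 0" for x by (auto simp: vec_eq_iff forall_2)
 show N: "normalized_nv_higgs b r (b ^ n) (L_sum 1 \<eta>) (%p. mat2 0 (t * snd p ^ (2 * n)) 1 0)"
  unfolding normalized_nv_higgs_def L_sum_eq_TB
 proof (intro conjI ballI nz higgs_field_TB)
  show "normalized_extension b r (TB (%_. mat2 1 0 0 \<eta>))" by (rule normalized_upper) (use \<eta> in auto)
  fix p
  show "mat_at (%p. mat2 0 (t * snd p ^ (2 * n)) 1 0) p" using holo2_at_snd_power[of t "2 * n" p] by (simp add: mat_at_def forall_2)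
  have e: "b ^ (2 * n) * \<eta> = b ^ n" using \<eta>(3) by (simp add: mult_2 power_add mult.assoc)
  have "t * snd (F p) ^ (2 * n) * \<eta> = t * snd p ^ (2 * n) * (b ^ (2 * n) * \<eta>)" by (simp add: power_mult_distrib mult_ac)
  thus "mat2 0 (t * snd (F p) ^ (2 * n)) 1 0 ** mat2 1 0 0 \<eta> = mat (b ^ n) ** (mat2 1 0 0 \<eta> ** mat2 0 (t * snd p ^ (2 * n)) 1 0)"
   unfolding e by (intro mat_2_eqI) (simp_all add: mult_22 \<eta>(3), simp add: mult.commute)
  show "trace (mat2 0 (t * snd p ^ (2 * n)) 1 0) = 0" by (simp add: trace_2)
 qed
 interpret X: hopf_extension b r "L_sum 1 \<eta>" 1 \<eta> "%_. incl 1 0" "%_. row2 0 1"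
  by unfold_locales (use N ext in \<open>auto simp: normalized_nv_higgs_def normalized_iff\<close>)
 have es: "esec (L_sum 1 \<eta>) \<eta> (%p. column 1 (incl (\<epsilon> * snd p ^ n * csqrt t) 1))" for \<epsilon>
 proof -
  have "\<eta> * (\<epsilon> * snd (F p) ^ n * csqrt t) = (b ^ n * \<eta>) * (\<epsilon> * snd p ^ n * csqrt t)" for p :: C2 by (simp add: power_mult_distrib mult_ac)
  thus ?thesis
   unfolding L_sum_eq_TB esec_TB vec_at_incl \<eta>(3) using holo2_at_mult[OF holo2_at_snd_power holo2_at_const]
   by (auto simp: vec_eq_iff forall_2 mult_vec_2)
 qed
 have nzc: "column 1 (incl x 1) ~= 0" for x by (auto simp: vec_eq_iff forall_2)
 have v: "mat2 0 (t * y ^ (2 * n)) 1 0 *v column 1 (incl (\<epsilon> * y ^ n * csqrt t) 1) = (\<epsilon> * (csqrt t * y ^ n)) *s column 1 (incl (\<epsilon> * y ^ n * csqrt t) 1)"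
  if "\<epsilon> * \<epsilon> = 1" for \<epsilon> y
 proof -
  have "(csqrt t)\<^sup>2 = t" by simp
  hence "t * y ^ (2 * n) = (\<epsilon> * \<epsilon>) * ((csqrt t)\<^sup>2 * (y ^ n)\<^sup>2)" using that by (simp add: power_mult mult.commute)
  thus ?thesis by (simp add: vec_eq_iff forall_2 mult_vec_2 power2_eq_square mult_ac)
 qed
 show "invariant_sub_line_bundle b r (b ^ n) (L_sum 1 \<eta>) (%p. mat2 0 (t * snd p ^ (2 * n)) 1 0) \<mu> h \<longleftrightarrow>
   same_sub b r \<mu> h \<eta> (%p. incl (1 * snd p ^ n * csqrt t) 1) \<or> same_sub b r \<mu> h \<eta> (%p. incl (- 1 * snd p ^ n * csqrt t) 1)"
 proof (rule X.invariant_iff[where P = "%p. csqrt t * snd p ^ n"])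
  show "mat2 0 (t * snd p ^ (2 * n)) 1 0 *v column 1 (incl (1 * snd p ^ n * csqrt t) 1) = (csqrt t * snd p ^ n) *s column 1 (incl (1 * snd p ^ n * csqrt t) 1)" for p :: C2
   using v[of 1 "snd p"] by simp
  show "mat2 0 (t * snd p ^ (2 * n)) 1 0 *v column 1 (incl (- 1 * snd p ^ n * csqrt t) 1) = (- (csqrt t * snd p ^ n)) *s column 1 (incl (- 1 * snd p ^ n * csqrt t) 1)" for p :: C2
   using v[of "-1" "snd p"] by simp
  show "esec (L_sum 1 \<eta>) \<eta> (%p. column 1 (incl (1 * snd p ^ n * csqrt t) 1))"
   "esec (L_sum 1 \<eta>) \<eta> (%p. column 1 (incl (- 1 * snd p ^ n * csqrt t) 1))" by (rule es)+
 qed (use \<eta>(1) nz nzc holo2_at_snd_power in \<open>simp_all add: trace_2 power_mult_distrib\<close>)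
qed

text \<open>Each normal form still carries a free multiplier \<sigma>. A normalized bundle has a
  nonzero section and only multipliers of degree at most 0; this forces one diagonal factor to be 1,
  and exchanging the summands brings it to the first place.\<close>

lemma higgs_normal_form:
 assumes nv: "normalized_nv_higgs b r (b powi l) E \<phi>" and l: "l <= int r"
 shows "(l = 0 & (EX \<eta> c. \<eta> ~= 0 & deg_L b \<eta> <= 0 & c ~= 0 & higgs_iso b r E \<phi> (L_sum 1 \<eta>) (%_. mat2 c 0 0 (- c)))) \<or>
  (1 <= l & (EX t. higgs_iso b r E \<phi> (L_sum 1 (inverse (b powi l))) (%p. mat2 0 (t * snd p ^ (2 * nat l)) 1 0))) \<or>
  (1 <= l & (EX k \<delta>. 1 <= k & \<delta> ~= 0 & higgs_iso b r (TB (MB 1 k (nat l))) (%p. mat \<delta> ** model_higgs k (nat l) p) E \<phi>)) \<or>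
  (l <= 0 & higgs_iso b r E \<phi> (L_sum 1 (b powi l)) (%_. mat2 0 1 0 0)) \<or>
  (EX k a \<beta>. \<beta> ~= 0 & 1 <= k & 1 <= a & a <= r & l = int a - int (r * k) &
   higgs_iso b r (TB (MB 1 k a)) (%_. mat2 0 \<beta> 0 0) E \<phi>)"
proof -
 have N: "normalized_extension b r E" and E: "holo_bundle b r E"
  using nv by (auto simp: normalized_nv_higgs_def normalized_iff)
 obtain \<sigma> \<tau> \<iota> \<rho> where ext: "extension b r \<sigma> E \<tau> \<iota> \<rho>" using N unfolding normalized_iff by blast
 interpret H: higgs_extension b r E \<sigma> \<tau> \<iota> \<rho> l \<phi>
  by unfold_locales (use nv E ext l in \<open>auto simp: normalized_nv_higgs_def\<close>)
 have sw: "mat2 0 1 1 0 ** mat2 x 0 0 y = mat2 y 0 0 x ** mat2 0 1 1 0" for x y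
  by (rule mat_2_eqI) (simp_all add: mult_22)
 have swi: "invertible (mat2 0 1 1 0)" by (simp add: invertible_2_iff)
 \<comment> \<open>For l >= 1 the summand \<sigma> b^l has larger degree than \<sigma>, so it must
   be the one equal to 1.\<close>
 have top: "\<sigma> = inverse (b powi l)" if n: "normalized_extension b r (TB (%_. mat2 \<sigma> 0 0 (\<sigma> * b powi l)))" "\<sigma> ~= 0" "1 <= l" for \<sigma>
 proof -
  note d = normalized_diag[OF n(1,2)]
  have "\<sigma> ~= 1" using d(2) n(3) deg_powi[of l] n(2) by auto
  hence "\<sigma> * b powi l = 1" using d(3) n(2) by simp
  thus ?thesis by (simp add: field_simps)
 qed
 from H.higgs_normal_form show ?thesis
 proof (elim disjE exE conjE)
  fix \<sigma> \<tau> \<delta> assume *: "l = 0" "\<sigma> ~= 0" "\<tau> ~= 0" "\<delta> ~= 0" and hi: "higgs_iso b r (TB (%_. mat2 \<sigma> 0 0 \<tau>)) (%_. mat2 \<delta> 0 0 (- \<delta>)) E \<phi>"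
  have B: "holo_bundle b r (TB (%_. mat2 \<sigma> 0 0 \<tau>))" by (rule holo_bundle_diag) (use * in auto)
  note d = normalized_diag[OF normalized_source[OF hi N B] *(2,3)]
  note hi' = higgs_iso_sym[OF hi B E]
  from d(3) show ?thesis
  proof
   assume "\<sigma> = 1"
   hence "\<tau> ~= 0 & deg_L b \<tau> <= 0 & \<delta> ~= 0 & higgs_iso b r E \<phi> (L_sum 1 \<tau>) (%_. mat2 \<delta> 0 0 (- \<delta>))"
    using hi' d * by (simp add: L_sum_eq_TB)
   thus ?thesis using *(1) by blast
  next
   assume t1: "\<tau> = 1"
   have "higgs_iso b r (TB (%_. mat2 \<sigma> 0 0 \<tau>)) (%_. mat2 \<delta> 0 0 (- \<delta>)) (TB (%_. mat2 \<tau> 0 0 \<sigma>)) (%_. mat2 (- \<delta>) 0 0 \<delta>)"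
    by (rule higgs_iso_TB[of "%_. mat2 0 1 1 0"]) (use sw swi in simp_all)
   from higgs_iso_trans[OF hi' this E B]
   have "\<sigma> ~= 0 & deg_L b \<sigma> <= 0 & - \<delta> ~= 0 & higgs_iso b r E \<phi> (L_sum 1 \<sigma>) (%_. mat2 (- \<delta>) 0 0 (- (- \<delta>)))"
    using d * t1 by (simp add: L_sum_eq_TB)
   thus ?thesis using *(1) by blast
  qed
 next
  fix \<sigma> k \<delta> assume *: "1 <= l" "\<sigma> ~= 0" "\<delta> ~= 0" and hi: "higgs_iso b r (TB (MB \<sigma> k (nat l))) (%p. mat \<delta> ** model_higgs k (nat l) p) E \<phi>"
  define n where "n = nat l"
  have n: "l = int n" "n <= r" using * l by (auto simp: n_def)
  have B: "holo_bundle b r (TB (MB \<sigma> k n))" by (rule holo_bundle_MB[OF *(2)])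
  note hi = hi[folded n_def]
  note NB = normalized_source[OF hi N B]
  show ?thesis
  proof (cases "k = 0")
   case True
   have MB: "MB \<sigma> k n = (%_. mat2 \<sigma> 0 0 (\<sigma> * b powi l))" by (simp add: MB_def[abs_def] True cocycle_def n)
   have \<sigma>: "\<sigma> = inverse (b ^ n)" using top[OF NB[unfolded MB] *(2,1)] by (simp add: n)
   have MB': "MB \<sigma> k n = (%_. mat2 (inverse (b ^ n)) 0 0 1)" unfolding MB by (simp add: \<sigma> n)
   have pw: "\<delta>\<^sup>2 * y ^ (2 * n) = (\<delta> * y ^ n) * (\<delta> * y ^ n)" for y by (simp only: power2_eq_square mult_2 power_add) (simp only: mult_ac)
   have "higgs_iso b r (TB (%_. mat2 1 0 0 (inverse (b ^ n)))) (%p. mat2 0 (\<delta>\<^sup>2 * snd p ^ (2 * n)) 1 0) (TB (MB \<sigma> k n)) (%p. mat \<delta> ** model_higgs k n p)"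
   \<comment> \<open>The columns are the section (0, 1) and its image under \<delta> times the model
     field. This section is cyclic for k = 0, and in its basis the field takes companion form with t
     = \<delta>^2.\<close>
   proof (rule higgs_iso_TB[of "%p. mat2 0 (- 2 * \<delta>) 1 (- \<delta> * snd p ^ n)"])
    fix p :: C2
    show "mat_at (%p. mat2 0 (- 2 * \<delta>) 1 (- \<delta> * snd p ^ n)) p" using holo2_at_snd_power[of "- \<delta>" n p] by (simp add: mat_at_def forall_2)
    show "invertible (mat2 0 (- 2 * \<delta>) 1 (- \<delta> * snd p ^ n))" using * by (simp add: invertible_2_iff)
    show "mat2 0 (- 2 * \<delta>) 1 (- \<delta> * snd (F p) ^ n) ** mat2 1 0 0 (inverse (b ^ n)) = MB \<sigma> k n p ** mat2 0 (- 2 * \<delta>) 1 (- \<delta> * snd p ^ n)"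
     unfolding MB' by (rule mat_2_eqI) (simp_all add: mult_22 power_mult_distrib field_simps)
    show "mat2 0 (- 2 * \<delta>) 1 (- \<delta> * snd p ^ n) ** mat2 0 (\<delta>\<^sup>2 * snd p ^ (2 * n)) 1 0 = (mat \<delta> ** model_higgs k n p) ** mat2 0 (- 2 * \<delta>) 1 (- \<delta> * snd p ^ n)"
     unfolding pw by (rule mat_2_eqI) (simp_all add: mult_22 model_higgs_def True algebra_simps)
   qed
   moreover have L: "holo_bundle b r (TB (%_. mat2 1 0 0 (inverse (b ^ n))))" by (rule holo_bundle_diag) simp_all
   ultimately have "higgs_iso b r (TB (MB \<sigma> k n)) (%p. mat \<delta> ** model_higgs k n p) (TB (%_. mat2 1 0 0 (inverse (b ^ n)))) (%p. mat2 0 (\<delta>\<^sup>2 * snd p ^ (2 * n)) 1 0)"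
    using higgs_iso_sym[OF _ L B] by blast
   from higgs_iso_trans[OF higgs_iso_sym[OF hi B E] this E B]
   have "higgs_iso b r E \<phi> (L_sum 1 (inverse (b powi l))) (%p. mat2 0 (\<delta>\<^sup>2 * snd p ^ (2 * nat l)) 1 0)"
    by (simp only: L_sum_eq_TB n power_int_of_nat nat_int)
   thus ?thesis using *(1) by blast
  next
   case False
   hence k: "1 <= k" by simp
   have "\<sigma> = 1" by (rule normalized_MB[OF NB *(2) k n(2)])
   hence "1 <= k & \<delta> ~= 0 & higgs_iso b r (TB (MB 1 k (nat l))) (%p. mat \<delta> ** model_higgs k (nat l) p) E \<phi>"
    using hi *(3) k by (simp add: n_def)
   thus ?thesis using *(1) by blast
  qed
 next
  fix \<sigma> assume \<sigma>: "\<sigma> ~= 0" and hi: "higgs_iso b r (TB (%_. mat2 \<sigma> 0 0 (\<sigma> * b powi l))) (%_. mat2 0 1 0 0) E \<phi>"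
  have s: "\<sigma> * b powi l ~= 0" using \<sigma> by simp
  have B: "holo_bundle b r (TB (%_. mat2 \<sigma> 0 0 (\<sigma> * b powi l)))" by (rule holo_bundle_diag[OF \<sigma> s])
  note NB = normalized_source[OF hi N B]
  note hi' = higgs_iso_sym[OF hi B E]
  show ?thesis
  proof (cases "1 <= l")
   case True
   have "\<sigma> = inverse (b powi l)" by (rule top[OF NB \<sigma> True])
   hence \<sigma>': "\<sigma> * b powi l = 1" by simp
   \<comment> \<open>For l >= 1 the trivial summand is the second one; after the exchange the
     nilpotent field is the companion form with t = 0.\<close>
   have "higgs_iso b r (TB (%_. mat2 \<sigma> 0 0 (\<sigma> * b powi l))) (%_. mat2 0 1 0 0) (TB (%_. mat2 (\<sigma> * b powi l) 0 0 \<sigma>)) (%p. mat2 0 (0 * snd p ^ (2 * nat l)) 1 0)"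
   proof (rule higgs_iso_TB[of "%_. mat2 0 1 1 0"])
    show "mat2 0 1 1 0 ** mat2 0 1 0 0 = mat2 0 (0 * snd p ^ (2 * nat l)) 1 0 ** mat2 0 1 1 0" for p :: C2
     by (rule mat_2_eqI) (simp_all add: mult_22)
   qed (use sw swi in simp_all)
   from higgs_iso_trans[OF hi' this E B, unfolded \<sigma>']
   have "higgs_iso b r E \<phi> (L_sum 1 (inverse (b powi l))) (%p. mat2 0 (0 * snd p ^ (2 * nat l)) 1 0)"
    unfolding L_sum_eq_TB using \<open>\<sigma> = inverse (b powi l)\<close> by simp
   thus ?thesis using True by blast
  next
   case False
   note d = normalized_diag[OF NB \<sigma> s]
   have "\<sigma> = 1"
   proof (rule ccontr)
    assume "\<sigma> ~= 1"
    hence "deg_L b \<sigma> + l = 0" using d(3) deg_twist[OF \<sigma>, of l] by (simp add: deg_one)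
    hence "l = 0" using d(1) False by linarith
    thus False using d(3) \<open>\<sigma> ~= 1\<close> by simp
   qed
   hence "l <= 0 & higgs_iso b r E \<phi> (L_sum 1 (b powi l)) (%_. mat2 0 1 0 0)"
    using hi' False by (simp add: L_sum_eq_TB)
   thus ?thesis by blast
  qed
 next
  fix \<sigma> k a \<beta> assume *: "\<sigma> ~= 0" "\<beta> ~= 0" "1 <= k" "1 <= a" "a <= r" "l = int a - int (r * k)"
   and hi: "higgs_iso b r (TB (MB \<sigma> k a)) (%_. mat2 0 \<beta> 0 0) E \<phi>"
  have "\<sigma> = 1"
   by (rule normalized_MB[OF normalized_source[OF hi N holo_bundle_MB[OF *(1)]] *(1,3,5)])
  thus ?thesis using hi * by blast
 qed
qed

end

section \<open>The three ranges of l\<close>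

context hopf
begin

lemma positive_classification:
 assumes l: "1 <= l" "l <= int r"
 shows "ALL E \<phi>. normalized_nv_higgs b r (b powi l) E \<phi> -->
    (EX t. higgs_iso b r E \<phi>
       (L_sum 1 (inverse (b powi l))) (%(x, y). mat2 0 (t * y ^ (2 * nat l)) 1 0)) \<or>
    (EX k::nat. 1 <= k &
     (EX \<iota> \<rho>. nonsplit_extension b r 1 E (b powi (l - int (r * k))) \<iota> \<rho>) &
     (EX \<iota>1 \<rho>1 \<iota>2 \<rho>2. std_sequences b r (k - 1) (r - nat l) E \<iota>1 \<rho>1 \<iota>2 \<rho>2) &
     (ALL \<iota>1 \<rho>1 \<iota>2 \<rho>2. std_sequences b r (k - 1) (r - nat l) E \<iota>1 \<rho>1 \<iota>2 \<rho>2 -->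
       (EX \<alpha>. \<alpha> ~= 0 &
        higgs_iso b r E \<phi> E (%p. mat \<alpha> ** phi_11_minus_22 \<iota>1 \<rho>1 \<iota>2 \<rho>2 p))))"
  (is "ALL E \<phi>. _ --> ?A E \<phi> \<or> ?B E \<phi>")
proof (intro allI impI)
 fix E \<phi> assume nv: "normalized_nv_higgs b r (b powi l) E \<phi>"
 have E: "holo_bundle b r E" using nv by (simp add: normalized_nv_higgs_def normalized_iff)
 have a: "1 <= nat l" "nat l <= r" "int (nat l) = l" using l by auto
 from higgs_normal_form[OF nv l(2)] show "?A E \<phi> \<or> ?B E \<phi>"
 proof (elim disjE exE conjE)
  fix t assume "higgs_iso b r E \<phi> (L_sum 1 (inverse (b powi l))) (%p. mat2 0 (t * snd p ^ (2 * nat l)) 1 0)"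
  thus ?thesis unfolding case_prod_unfold by blast
 next
  fix k \<delta> assume k: "1 <= k" and \<delta>: "\<delta> ~= 0"
   and hi: "higgs_iso b r (TB (MB 1 k (nat l))) (%p. mat \<delta> ** model_higgs k (nat l) p) E \<phi>"
  have "EX \<alpha>. \<alpha> ~= 0 & higgs_iso b r E \<phi> E (%p. mat \<alpha> ** phi_11_minus_22 \<iota>1 \<rho>1 \<iota>2 \<rho>2 p)"
   if "std_sequences b r (k - 1) (r - nat l) E \<iota>1 \<rho>1 \<iota>2 \<rho>2" for \<iota>1 \<rho>1 \<iota>2 \<rho>2
   using phi_11_minus_22_unique[OF hi E k a(1,2) that] \<delta> by blast
  hence "?B E \<phi>" using k std_sequences_exist[OF hi E k a(1,2), unfolded a(3)] by blast
  thus ?thesis ..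
 next
  fix k a assume *: "1 <= k" "a <= r" "l = int a - int (r * k)"
  \<comment> \<open>The nonsplit nilpotent form has l = a - rk <= 0, so it does not occur
    here.\<close>
  have "r * 1 <= r * k" using *(1) by (intro mult_le_mono) auto
  thus ?thesis using * l(1) by linarith
 qed (use l in auto)
qed

lemma positive_companion:
 assumes l: "1 <= l"
 shows "ALL t. let E = L_sum 1 (inverse (b powi l));
       \<phi> = (%(x, y). mat2 0 (t * y ^ (2 * nat l)) 1 0)
     in normalized_nv_higgs b r (b powi l) E \<phi> &
       (ALL \<mu> h. invariant_sub_line_bundle b r (b powi l) E \<phi> \<mu> h \<longleftrightarrow>
        (EX \<epsilon>:{1, -1}. same_sub b r \<mu> h
          (inverse (b powi l)) (%(x, y). incl (\<epsilon> * y ^ nat l * csqrt t) 1)))"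
proof -
 have n: "b powi l = b ^ nat l" using l by (simp add: power_int_def)
 have B: "(EX \<epsilon>:{1, -1}. Q \<epsilon>) \<longleftrightarrow> Q 1 \<or> Q (-1)" for Q :: "complex => bool" by blast
 show ?thesis unfolding Let_def case_prod_unfold n B using L_sum_companion by blast
qed

lemma positive_std:
 assumes l: "1 <= l" "l <= int r"
 shows "ALL (k::nat) E \<iota>1 \<rho>1 \<iota>2 \<rho>2 \<alpha>.
    1 <= k & holo_bundle b r E &
    std_sequences b r (k - 1) (r - nat l) E \<iota>1 \<rho>1 \<iota>2 \<rho>2 & \<alpha> ~= 0 -->
    (let \<phi> = (%p. mat \<alpha> ** phi_11_minus_22 \<iota>1 \<rho>1 \<iota>2 \<rho>2 p)
     in normalized_nv_higgs b r (b powi l) E \<phi> &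
      (ALL \<mu> h. invariant_sub_line_bundle b r (b powi l) E \<phi> \<mu> h \<longleftrightarrow>
        same_sub b r \<mu> h 1 \<iota>1 \<or>
        same_sub b r \<mu> h (b powi (- int (r * k))) \<iota>2))"
proof -
 have n: "b powi l = b ^ nat l" and a: "1 <= nat l" "nat l <= r" using l by (auto simp: power_int_def)
 show ?thesis unfolding Let_def n using std_higgs_fields(1,2)[OF _ _ _ a] by blast
qed

lemma degree_zero_classification:
 assumes l: "l = 0"
 shows "ALL E \<phi>. normalized_nv_higgs b r (b powi l) E \<phi> -->
    higgs_iso b r E \<phi> (L_sum 1 1) (%_. mat2 0 1 0 0) \<or>
    (EX \<eta> c. \<eta> ~= 0 & deg_L b \<eta> <= 0 & c ~= 0 &
     higgs_iso b r E \<phi> (L_sum 1 \<eta>) (%_. mat2 c 0 0 (- c))) \<or>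
    ((EX \<iota> \<rho>. nonsplit_extension b r 1 E 1 \<iota> \<rho>) &
    (EX \<iota>1 \<rho>1 \<iota>2 \<rho>2. std_sequences b r 0 0 E \<iota>1 \<rho>1 \<iota>2 \<rho>2) &
    (ALL \<iota>1 \<rho>1 \<iota>2 \<rho>2. std_sequences b r 0 0 E \<iota>1 \<rho>1 \<iota>2 \<rho>2 -->
      (EX \<beta>. \<beta> ~= 0 & higgs_iso b r E \<phi> E (%p. mat \<beta> ** phi_12 \<iota>1 \<rho>1 p))))"
  (is "ALL E \<phi>. _ --> ?A E \<phi> \<or> ?B E \<phi> \<or> ?C E \<phi>")
proof (intro allI impI)
 fix E \<phi> assume nv: "normalized_nv_higgs b r (b powi l) E \<phi>"
 have E: "holo_bundle b r E" using nv by (simp add: normalized_nv_higgs_def normalized_iff)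
 have lr: "l <= int r" using l by simp
 from higgs_normal_form[OF nv lr] show "?A E \<phi> \<or> ?B E \<phi> \<or> ?C E \<phi>"
 proof (elim disjE exE conjE)
  fix k a \<beta> assume *: "\<beta> ~= 0" "1 <= k" "1 <= a" "a <= r" "l = int a - int (r * k)"
   and hi: "higgs_iso b r (TB (MB 1 k a)) (%_. mat2 0 \<beta> 0 0) E \<phi>"
  \<comment> \<open>With a <= r and k >= 1 this leaves k = 1 and a = r, that is, j = m = 0.\<close>
  have "a = r * k" using *(5) l by linarith
  hence ka: "k = 1" "a = r" using *(2,4) r by (auto simp: antisym)
  have hi: "higgs_iso b r (TB (MB 1 1 r)) (%_. mat2 0 \<beta> 0 0) E \<phi>" using hi ka by simp
  have "EX \<beta>. \<beta> ~= 0 & higgs_iso b r E \<phi> E (%p. mat \<beta> ** phi_12 \<iota>1 \<rho>1 p)"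
   if "std_sequences b r 0 0 E \<iota>1 \<rho>1 \<iota>2 \<rho>2" for \<iota>1 \<rho>1 \<iota>2 \<rho>2
   by (rule phi_12_unique[OF hi *(1) E order_refl r order_refl]) (use that in simp)
  hence "?C E \<phi>" using std_sequences_exist[OF hi E order_refl r order_refl] by simp
  thus ?thesis by blast
 qed (use l in auto)
qed

lemma degree_zero_std:
 assumes l: "l = 0"
 shows "ALL E \<iota>1 \<rho>1 \<iota>2 \<rho>2 \<beta>.
    holo_bundle b r E & std_sequences b r 0 0 E \<iota>1 \<rho>1 \<iota>2 \<rho>2 & \<beta> ~= 0 -->
    (let \<phi> = (%p. mat \<beta> ** phi_12 \<iota>1 \<rho>1 p)
     in normalized_nv_higgs b r (b powi l) E \<phi> &
      (ALL \<mu> h. invariant_sub_line_bundle b r (b powi l) E \<phi> \<mu> h \<longleftrightarrow>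
        same_sub b r \<mu> h 1 \<iota>1))"
proof -
 have n: "l = int r - int (r * 1)" "0 = (1::nat) - 1" "0 = r - r" using l by auto
 show ?thesis unfolding Let_def n(1)
  using std_higgs_fields(3,4)[of _ 1 r, OF _ _ order_refl r order_refl, unfolded n(2,3)[symmetric]] by blast
qed

lemma negative_classification:
 assumes l: "l < 0"
 shows "ALL E \<phi>. normalized_nv_higgs b r (b powi l) E \<phi> -->
    higgs_iso b r E \<phi> (L_sum 1 (b powi l)) (%_. mat2 0 1 0 0) \<or>
    (EX j m. m < r & - int (r * j + m) = l &
    (EX \<iota> \<rho>. nonsplit_extension b r 1 E (b powi l) \<iota> \<rho>) &
    (EX \<iota>1 \<rho>1 \<iota>2 \<rho>2. std_sequences b r j m E \<iota>1 \<rho>1 \<iota>2 \<rho>2) &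
    (ALL \<iota>1 \<rho>1 \<iota>2 \<rho>2. std_sequences b r j m E \<iota>1 \<rho>1 \<iota>2 \<rho>2 -->
      (EX \<beta>. \<beta> ~= 0 & higgs_iso b r E \<phi> E (%p. mat \<beta> ** phi_12 \<iota>1 \<rho>1 p))))"
  (is "ALL E \<phi>. _ --> ?A E \<phi> \<or> (EX j m. ?B E \<phi> j m)")
proof (intro allI impI)
 fix E \<phi> assume nv: "normalized_nv_higgs b r (b powi l) E \<phi>"
 have E: "holo_bundle b r E" using nv by (simp add: normalized_nv_higgs_def normalized_iff)
 have lr: "l <= int r" using l by simp
 from higgs_normal_form[OF nv lr] show "?A E \<phi> \<or> (EX j m. ?B E \<phi> j m)"
 proof (elim disjE exE conjE)
  fix k a \<beta> assume *: "\<beta> ~= 0" "1 <= k" "1 <= a" "a <= r" "l = int a - int (r * k)"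
   and hi: "higgs_iso b r (TB (MB 1 k a)) (%_. mat2 0 \<beta> 0 0) E \<phi>"
  have "EX \<beta>. \<beta> ~= 0 & higgs_iso b r E \<phi> E (%p. mat \<beta> ** phi_12 \<iota>1 \<rho>1 p)"
   if "std_sequences b r (k - 1) (r - a) E \<iota>1 \<rho>1 \<iota>2 \<rho>2" for \<iota>1 \<rho>1 \<iota>2 \<rho>2
   by (rule phi_12_unique[OF hi *(1) E *(2,3,4) that])
  moreover have "r - a < r" "- int (r * (k - 1) + (r - a)) = l" using std_index[OF *(2,4)] *(3,4,5) r by linarith+
  ultimately have "?B E \<phi> (k - 1) (r - a)"
   using std_sequences_exist[OF hi E *(2,3,4), folded *(5)] by blast
  thus ?thesis by blast
 qed (use l in auto)
qed

lemma negative_std: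
 "ALL j m E \<iota>1 \<rho>1 \<iota>2 \<rho>2 \<beta>.
    m < r & - int (r * j + m) = l & holo_bundle b r E &
    std_sequences b r j m E \<iota>1 \<rho>1 \<iota>2 \<rho>2 & \<beta> ~= 0 -->
    (let \<phi> = (%p. mat \<beta> ** phi_12 \<iota>1 \<rho>1 p)
     in normalized_nv_higgs b r (b powi l) E \<phi> &
      (ALL \<mu> h. invariant_sub_line_bundle b r (b powi l) E \<phi> \<mu> h \<longleftrightarrow>
        same_sub b r \<mu> h 1 \<iota>1))"
proof (intro allI impI, elim conjE)
 fix j m E \<iota>1 \<rho>1 \<iota>2 \<rho>2 and \<beta> :: complex
 assume m: "m < r" "- int (r * j + m) = l" and E: "holo_bundle b r E"
  and std: "std_sequences b r j m E \<iota>1 \<rho>1 \<iota>2 \<rho>2" and \<beta>: "\<beta> ~= 0"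
 have k: "1 <= Suc j" "1 <= r - m" "r - m <= r" using m(1) by auto
 have n: "int (r - m) - int (r * Suc j) = l" using m by (simp add: of_nat_diff algebra_simps)
 have std': "std_sequences b r (Suc j - 1) (r - (r - m)) E \<iota>1 \<rho>1 \<iota>2 \<rho>2" using std m(1) by simp
 show "let \<phi> = (%p. mat \<beta> ** phi_12 \<iota>1 \<rho>1 p)
     in normalized_nv_higgs b r (b powi l) E \<phi> &
      (ALL \<mu> h. invariant_sub_line_bundle b r (b powi l) E \<phi> \<mu> h \<longleftrightarrow>
        same_sub b r \<mu> h 1 \<iota>1)"
  unfolding Let_def using std_higgs_fields(3,4)[OF E std' k \<beta>, unfolded n] by blast
qed

end

theorem proposition5p12:
  fixes b :: complex and r :: nat and l :: int and lam :: complex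
  assumes b: "0 < cmod b" "cmod b < 1"
    and r: "1 \<le> r"
    and l: "l \<le> int r"
    and lam: "lam = b powi l"
  shows
   "(1 \<le> l \<longrightarrow>
      (\<forall>E \<phi>. normalized_nv_higgs b r lam E \<phi> \<longrightarrow>
        (\<exists>t. higgs_iso b r E \<phi>
               (L_sum 1 (inverse lam)) (\<lambda>(x, y). mat2 0 (t * y ^ (2 * nat l)) 1 0)) \<or>
        (\<exists>k::nat. 1 \<le> k \<and>
           (\<exists>\<iota> \<rho>. nonsplit_extension b r 1 E (b powi (l - int (r * k))) \<iota> \<rho>) \<and>
           (\<exists>\<iota>1 \<rho>1 \<iota>2 \<rho>2. std_sequences b r (k - 1) (r - nat l) E \<iota>1 \<rho>1 \<iota>2 \<rho>2) \<and>
           (\<forall>\<iota>1 \<rho>1 \<iota>2 \<rho>2. std_sequences b r (k - 1) (r - nat l) E \<iota>1 \<rho>1 \<iota>2 \<rho>2 \<longrightarrow>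
              (\<exists>\<alpha>. \<alpha> \<noteq> 0 \<and>
                 higgs_iso b r E \<phi> E (\<lambda>p. mat \<alpha> ** phi_11_minus_22 \<iota>1 \<rho>1 \<iota>2 \<rho>2 p))))) \<and>
      (\<forall>t. let E = L_sum 1 (inverse lam);
               \<phi> = (\<lambda>(x, y). mat2 0 (t * y ^ (2 * nat l)) 1 0)
           in normalized_nv_higgs b r lam E \<phi> \<and>
              (\<forall>\<mu> h. invariant_sub_line_bundle b r lam E \<phi> \<mu> h \<longleftrightarrow>
                 (\<exists>\<epsilon>\<in>{1, -1}. same_sub b r \<mu> h
                    (inverse lam) (\<lambda>(x, y). incl (\<epsilon> * y ^ nat l * csqrt t) 1)))) \<and>
      (\<forall>(k::nat) E \<iota>1 \<rho>1 \<iota>2 \<rho>2 \<alpha>.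
         1 \<le> k \<and> holo_bundle b r E \<and>
         std_sequences b r (k - 1) (r - nat l) E \<iota>1 \<rho>1 \<iota>2 \<rho>2 \<and> \<alpha> \<noteq> 0 \<longrightarrow>
         (let \<phi> = (\<lambda>p. mat \<alpha> ** phi_11_minus_22 \<iota>1 \<rho>1 \<iota>2 \<rho>2 p)
          in normalized_nv_higgs b r lam E \<phi> \<and>
             (\<forall>\<mu> h. invariant_sub_line_bundle b r lam E \<phi> \<mu> h \<longleftrightarrow>
                same_sub b r \<mu> h 1 \<iota>1 \<or>
                same_sub b r \<mu> h (b powi (- int (r * k))) \<iota>2)))) \<and>
    (l = 0 \<longrightarrow>
      (\<forall>E \<phi>. normalized_nv_higgs b r lam E \<phi> \<longrightarrow>
        higgs_iso b r E \<phi> (L_sum 1 1) (\<lambda>_. mat2 0 1 0 0) \<or>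
        (\<exists>\<eta> c. \<eta> \<noteq> 0 \<and> deg_L b \<eta> \<le> 0 \<and> c \<noteq> 0 \<and>
           higgs_iso b r E \<phi> (L_sum 1 \<eta>) (\<lambda>_. mat2 c 0 0 (- c))) \<or>
        ((\<exists>\<iota> \<rho>. nonsplit_extension b r 1 E 1 \<iota> \<rho>) \<and>
         (\<exists>\<iota>1 \<rho>1 \<iota>2 \<rho>2. std_sequences b r 0 0 E \<iota>1 \<rho>1 \<iota>2 \<rho>2) \<and>
         (\<forall>\<iota>1 \<rho>1 \<iota>2 \<rho>2. std_sequences b r 0 0 E \<iota>1 \<rho>1 \<iota>2 \<rho>2 \<longrightarrow>
            (\<exists>\<beta>. \<beta> \<noteq> 0 \<and> higgs_iso b r E \<phi> E (\<lambda>p. mat \<beta> ** phi_12 \<iota>1 \<rho>1 p))))) \<and>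
      normalized_nv_higgs b r lam (L_sum 1 1) (\<lambda>_. mat2 0 1 0 0) \<and>
      (\<forall>\<mu> h. invariant_sub_line_bundle b r lam (L_sum 1 1) (\<lambda>_. mat2 0 1 0 0) \<mu> h \<longleftrightarrow>
         same_sub b r \<mu> h 1 (\<lambda>_. incl 1 0)) \<and>
      (\<forall>\<eta> c. \<eta> \<noteq> 0 \<and> deg_L b \<eta> \<le> 0 \<and> c \<noteq> 0 \<longrightarrow>
         (let E = L_sum 1 \<eta>; \<phi> = (\<lambda>_. mat2 c 0 0 (- c))
          in normalized_nv_higgs b r lam E \<phi> \<and>
             invariant_sub_line_bundle b r lam E \<phi> 1 (\<lambda>_. incl 1 0) \<and>
             invariant_sub_line_bundle b r lam E \<phi> \<eta> (\<lambda>_. incl 0 1))) \<and>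
      (\<forall>E \<iota>1 \<rho>1 \<iota>2 \<rho>2 \<beta>.
         holo_bundle b r E \<and> std_sequences b r 0 0 E \<iota>1 \<rho>1 \<iota>2 \<rho>2 \<and> \<beta> \<noteq> 0 \<longrightarrow>
         (let \<phi> = (\<lambda>p. mat \<beta> ** phi_12 \<iota>1 \<rho>1 p)
          in normalized_nv_higgs b r lam E \<phi> \<and>
             (\<forall>\<mu> h. invariant_sub_line_bundle b r lam E \<phi> \<mu> h \<longleftrightarrow>
                same_sub b r \<mu> h 1 \<iota>1)))) \<and>
    (l < 0 \<longrightarrow>
      (\<forall>E \<phi>. normalized_nv_higgs b r lam E \<phi> \<longrightarrow>
        higgs_iso b r E \<phi> (L_sum 1 lam) (\<lambda>_. mat2 0 1 0 0) \<or>
        (\<exists>j m. m < r \<and> - int (r * j + m) = l \<and>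
         (\<exists>\<iota> \<rho>. nonsplit_extension b r 1 E lam \<iota> \<rho>) \<and>
         (\<exists>\<iota>1 \<rho>1 \<iota>2 \<rho>2. std_sequences b r j m E \<iota>1 \<rho>1 \<iota>2 \<rho>2) \<and>
         (\<forall>\<iota>1 \<rho>1 \<iota>2 \<rho>2. std_sequences b r j m E \<iota>1 \<rho>1 \<iota>2 \<rho>2 \<longrightarrow>
            (\<exists>\<beta>. \<beta> \<noteq> 0 \<and> higgs_iso b r E \<phi> E (\<lambda>p. mat \<beta> ** phi_12 \<iota>1 \<rho>1 p))))) \<and>
      normalized_nv_higgs b r lam (L_sum 1 lam) (\<lambda>_. mat2 0 1 0 0) \<and>
      (\<forall>\<mu> h. invariant_sub_line_bundle b r lam (L_sum 1 lam) (\<lambda>_. mat2 0 1 0 0) \<mu> h \<longleftrightarrow>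
         same_sub b r \<mu> h 1 (\<lambda>_. incl 1 0)) \<and>
      (\<forall>j m E \<iota>1 \<rho>1 \<iota>2 \<rho>2 \<beta>.
         m < r \<and> - int (r * j + m) = l \<and> holo_bundle b r E \<and>
         std_sequences b r j m E \<iota>1 \<rho>1 \<iota>2 \<rho>2 \<and> \<beta> \<noteq> 0 \<longrightarrow>
         (let \<phi> = (\<lambda>p. mat \<beta> ** phi_12 \<iota>1 \<rho>1 p)
          in normalized_nv_higgs b r lam E \<phi> \<and>
             (\<forall>\<mu> h. invariant_sub_line_bundle b r lam E \<phi> \<mu> h \<longleftrightarrow>
                same_sub b r \<mu> h 1 \<iota>1))))"
proof -
 interpret hopf b r by unfold_locales (use b r in auto)
 have neg: "b powi l ~= 0" "l <= 0 ==> deg_L b (b powi l) <= 0" by (simp_all add: deg_powi)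
 have zero: "b powi l = 1" if "l = 0" using that by simp
 show ?thesis
  unfolding lam
 proof (intro conjI impI)
  assume l0: "l = 0"
  show "normalized_nv_higgs b r (b powi l) (L_sum 1 1) (%_. mat2 0 1 0 0)"
   "ALL \<mu> h. invariant_sub_line_bundle b r (b powi l) (L_sum 1 1) (%_. mat2 0 1 0 0) \<mu> h \<longleftrightarrow>
    same_sub b r \<mu> h 1 (%_. incl 1 0)"
   "ALL \<eta> c. \<eta> ~= 0 & deg_L b \<eta> <= 0 & c ~= 0 -->
    (let E = L_sum 1 \<eta>; \<phi> = (%_. mat2 c 0 0 (- c))
     in normalized_nv_higgs b r (b powi l) E \<phi> &
      invariant_sub_line_bundle b r (b powi l) E \<phi> 1 (%_. incl 1 0) &
      invariant_sub_line_bundle b r (b powi l) E \<phi> \<eta> (%_. incl 0 1))"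
   unfolding zero[OF l0] Let_def
   using L_sum_nilpotent[OF one_neq_zero] L_sum_diagonal by (simp_all add: deg_one)
 next
  assume "l < 0"
  hence d: "deg_L b (b powi l) <= 0" using neg by simp
  show "normalized_nv_higgs b r (b powi l) (L_sum 1 (b powi l)) (%_. mat2 0 1 0 0)"
   "ALL \<mu> h. invariant_sub_line_bundle b r (b powi l) (L_sum 1 (b powi l)) (%_. mat2 0 1 0 0) \<mu> h \<longleftrightarrow>
    same_sub b r \<mu> h 1 (%_. incl 1 0)"
   using L_sum_nilpotent[OF neg(1) d] by blast+
 qed (rule positive_classification positive_companion positive_std degree_zero_classification degree_zero_std
   negative_classification negative_std; (assumption | rule l)?)+
qed

end
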